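(* Let $u_0\in\mathcal{H}^{1}(\mathbb{T}^2)\cap W^{1,\infty}(\mathbb{T}^2)$, let $T>0$, and for every $\varepsilon>0$ let $u_\varepsilon$ be the mild solution on $[0,T]$ of $$\partial_t u_\varepsilon=-\Delta^2u_\varepsilon-\nabla\cdot\frac{\nabla u_\varepsilon}{1+|\nabla u_\varepsilon|^2}+\partial_tW_\varepsilon,\qquad u_\varepsilon(0)=u_0 .$$ Then, for each $p\ge 1$, $u_\varepsilon$ converges to $u$ in $L^p(\Omega,C^0([0,T]\times\mathbb{T}^2))$ as $\varepsilon\to0$, where $u$ is a mild solution of $$\partial_tu=-\Delta^2u+\partial_tW,\qquad u(0)=u_0,$$ that is, $u(t)=e^{tA}u_0+Z(t)$ for $t\in[0,T]$.
   Context: Fix $L>0$ and let $\mathbb{T}^2=[0,L]^2$ with periodic boundary conditions. All functions have zero spatial mean. Let $\mathcal{Z}=\mathbb{Z}^2\setminus\{0\}$ and $e_k(x)=\omega_{k_1}(x_1)\omega_{k_2}(x_2)$ for $k=(k_1,k_2)\in\mathbb Z^2$, where $\omega_j(z)=\sqrt{2/L}\,\sin(2\pi jz/L)$ for $j>0$, $\omega_0(z)=1/\sqrt L$, and $\omega_j(z)=\sqrt{2/L}\,\cos(2\pi jz/L)$ for $j<0$; this is an orthonormal basis of $L^2([0,L]^2)$. Let $\mu_k=(2\pi|k|/L)^2$, so $-\Delta e_k=\mu_ke_k$. For $\alpha\in\mathbb R$, $\mathcal{H}^\alpha=\mathcal H^\alpha(\mathbb T^2)$ is the space of (formal) series $u=\sum_{k\in\mathcal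 Z}u_ke_k$ with $\|u\|_{\mathcal H^\alpha}^2=\sum_{k\in\mathcal Z}\mu_k^\alpha u_k^2<\infty$. Let $A=-\Delta^2$ and $e^{tA}\sum_{k\in\mathcal Z}u_ke_k=\sum_{k\in\mathcal Z}e^{-t\mu_k^2}u_ke_k$. Noise: $(\beta_k)_{k\in\mathcal Z}$ are i.i.d. real-valued Wiener processes on a probability space $(\Omega,\mathbb P)$, and $W(t)=\sum_{k\in\mathcal Z}\beta_k(t)e_k$ (cylindrical Wiener process). The regularization coefficients $(\alpha_k^{(\varepsilon)})_{k\in\mathcal Z}$, $\varepsilon>0$, are real and satisfy: (i) $\sup_{\varepsilon>0}\sup_{k\in\mathcal Z}|\alpha_k^{(\varepsilon)}|<\infty$; (ii) for every $\varepsilon>0$ there are $\delta(\varepsilon)>0$, $C_\varepsilon>0$ with $|\alpha_k^{(\varepsilon)}|\le C_\varepsilon|k|^{-\delta(\varepsilon)}$ for all $k\in\mathcal Z$; (iii) $\alpha_k^{(\varepsilon)}\to1$ as $\varepsilon\to0$ for each fixed $k$; (iv) for every $\varepsilon>0$ there is $a_\varepsilon:[0,\infty)\to\mathbb R$ with $\alpha_k^{(\varepsilon)}=a_\varepsilon(|k|)$ for all $k\in\mathcal Z$. Set $W_\varepsilon(t)=\sum_{k\in\mathcal Z}\alpha_k^{(\varepsilon)}\beta_k(t)e_k$. Stochastic convolutions: $Z(t,x)=\sum_{k\in\mathcal Z}\int_0^te^{-(t-s)\mu_k^2}\,d\beta_k(s)\,e_k(x)$ and $Z_\varepsilon(t,x)=\sum_{k\in\mathcal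 Z}\alpha_k^{(\varepsilon)}\int_0^te^{-(t-s)\mu_k^2}\,d\beta_k(s)\,e_k(x)$. Mild solution of the regularized equation with $u_0\in\mathcal H^1$: a process $(u_\varepsilon(t))_{t\in[0,T]}$ with continuous paths in $\mathcal H^1$ such that for all $t\in[0,T]$, $u_\varepsilon(t)=e^{tA}u_0+\int_0^te^{(t-s)A}\mathfrak F(u_\varepsilon(s))\,ds+Z_\varepsilon(t)$, where $\mathfrak F(u)=-\nabla\cdot f(\nabla u)$ and $f(y)=\frac{y}{1+|y|^2}$ for $y\in\mathbb R^2$. *)

theory Defs
  imports "HOL-Probability.Probability"
begin

section \<open>Functions and formal Fourier series on the torus\<close>

text \<open>
  A function on the torus is an \<open>L\<close>-periodic function on the plane; for almost-everywhere
  classes only the values on the fundamental square matter.  A formal series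
  \<open>\<Sum>k. u\<^sub>k e\<^sub>k\<close> is its coefficient family, the vanishing mean being the condition
  \<open>u (0, 0) = 0\<close>.
\<close>

type_synonym idx = "int \<times> int"
type_synonym plane = "real \<times> real"
type_synonym series = "idx \<Rightarrow> real"

definition torus :: "real \<Rightarrow> plane set" where
  "torus L = cbox (0, 0) (L, L)"

definition periodic :: "real \<Rightarrow> (plane \<Rightarrow> 'b) \<Rightarrow> bool" where
  "periodic L g \<longleftrightarrow> (\<forall>x y. g (x + L, y) = g (x, y) \<and> g (x, y + L) = g (x, y))"

definition modes :: "idx set" where
  "modes = UNIV - {(0, 0)}"

definition mode_norm :: "idx \<Rightarrow> real" where
  "mode_norm k = sqrt ((real_of_int (fst k))\<^sup>2 + (real_of_int (snd k))\<^sup>2)"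

definition trig :: "real \<Rightarrow> int \<Rightarrow> real \<Rightarrow> real" where
  "trig L j z =
     (if j > 0 then sqrt (2 / L) * sin (2 * pi * real_of_int j * z / L)
      else if j = 0 then 1 / sqrt L
      else sqrt (2 / L) * cos (2 * pi * real_of_int j * z / L))"

definition basis_fun :: "real \<Rightarrow> idx \<Rightarrow> plane \<Rightarrow> real" where
  "basis_fun L k x = trig L (fst k) (fst x) * trig L (snd k) (snd x)"

definition eigval :: "real \<Rightarrow> idx \<Rightarrow> real" where
  "eigval L k = (2 * pi * mode_norm k / L)\<^sup>2"

definition Hspace :: "real \<Rightarrow> real \<Rightarrow> series set" where
  "Hspace L \<gamma> =
     {u. u (0, 0) = 0 \<and> (\<lambda>k. eigval L k powr \<gamma> * (u k)\<^sup>2) summable_on modes}"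

definition Hnorm :: "real \<Rightarrow> real \<Rightarrow> series \<Rightarrow> real" where
  "Hnorm L \<gamma> u = sqrt (\<Sum>\<^sub>\<infinity>k\<in>modes. eigval L k powr \<gamma> * (u k)\<^sup>2)"

definition continuous_path_H :: "real \<Rightarrow> real \<Rightarrow> real \<Rightarrow> (real \<Rightarrow> series) \<Rightarrow> bool" where
  "continuous_path_H L \<gamma> T u \<longleftrightarrow>
     (\<forall>t\<in>{0..T}. u t \<in> Hspace L \<gamma>) \<and>
     (\<forall>t\<in>{0..T}. ((\<lambda>s. Hnorm L \<gamma> (\<lambda>k. u s k - u t k)) \<longlongrightarrow> 0) (at t within {0..T}))"

text \<open>\<open>g\<close> is the sum of the series \<open>u\<close>, with unconditional convergence in \<open>L\<^sup>2\<close> of the torus.\<close>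

definition represents :: "real \<Rightarrow> series \<Rightarrow> (plane \<Rightarrow> real) \<Rightarrow> bool" where
  "represents L u g \<longleftrightarrow>
     set_borel_measurable lborel (torus L) g \<and>
     ((\<lambda>F. \<integral>\<^sup>+x\<in>torus L. ennreal ((g x - (\<Sum>k\<in>F. u k * basis_fun L k x))\<^sup>2) \<partial>lborel)
        \<longlongrightarrow> 0) (finite_subsets_at_top modes)"

section \<open>Weak gradients\<close>

definition grad :: "(plane \<Rightarrow> real) \<Rightarrow> plane \<Rightarrow> plane" where
  "grad \<phi> x = (THE D. GDERIV \<phi> x :> D)"

definition C1_periodic :: "real \<Rightarrow> (plane \<Rightarrow> real) \<Rightarrow> bool" where
  "C1_periodic L \<phi> \<longleftrightarrow>
     periodic L \<phi> \<and> (\<forall>x. \<phi> differentiable (at x)) \<and> continuous_on UNIV (grad \<phi>)"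

text \<open>
  The test functions are periodic and not compactly supported in the open square, so
  this is the weak gradient on the torus: a jump across the boundary of the square is seen.
\<close>

definition weak_gradient :: "real \<Rightarrow> (plane \<Rightarrow> real) \<Rightarrow> (plane \<Rightarrow> plane) \<Rightarrow> bool" where
  "weak_gradient L g G \<longleftrightarrow>
     set_integrable lborel (torus L) g \<and> set_integrable lborel (torus L) G \<and>
     (\<forall>\<phi>. C1_periodic L \<phi> \<longrightarrow>
        (LINT x:torus L|lborel. g x *\<^sub>R grad \<phi> x) = - (LINT x:torus L|lborel. \<phi> x *\<^sub>R G x))"

definition ess_bounded :: "real \<Rightarrow> (plane \<Rightarrow> 'b::{real_normed_vector}) \<Rightarrow> bool" where
  "ess_bounded L g \<longleftrightarrow>
     set_borel_measurable lborel (torus L) g \<and>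
     (\<exists>C. AE x in lborel. x \<in> torus L \<longrightarrow> norm (g x) \<le> C)"

definition W1inf :: "real \<Rightarrow> (plane \<Rightarrow> real) set" where
  "W1inf L = {g. ess_bounded L g \<and> (\<exists>G. weak_gradient L g G \<and> ess_bounded L G)}"

definition series_in_W1inf :: "real \<Rightarrow> series \<Rightarrow> bool" where
  "series_in_W1inf L u \<longleftrightarrow> (\<exists>g \<in> W1inf L. represents L u g)"

text \<open>Determined only up to a null set, which is harmless under the integral below.\<close>

definition series_grad :: "real \<Rightarrow> series \<Rightarrow> plane \<Rightarrow> plane" where
  "series_grad L u = (SOME G. \<exists>g. represents L u g \<and> weak_gradient L g G)"

section \<open>The deterministic part of the equation\<close>

definition semigroup_A :: "real \<Rightarrow> real \<Rightarrow> series \<Rightarrow> series" where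
  "semigroup_A L t u = (\<lambda>k. exp (- t * (eigval L k)\<^sup>2) * u k)"

text \<open>Distributional divergence of a vector field, tested against the basis functions.\<close>

definition div_series :: "real \<Rightarrow> (plane \<Rightarrow> plane) \<Rightarrow> series" where
  "div_series L V = (\<lambda>k. - (LINT x:torus L|lborel. V x \<bullet> grad (basis_fun L k) x))"

definition flux :: "plane \<Rightarrow> plane" where
  "flux y = y /\<^sub>R (1 + (norm y)\<^sup>2)"

definition nonlinearity :: "real \<Rightarrow> series \<Rightarrow> series" where
  "nonlinearity L u = (\<lambda>k. - div_series L (\<lambda>x. flux (series_grad L u x)) k)"

section \<open>Wiener processes and Wiener integrals\<close>

definition wiener_process :: "'w measure \<Rightarrow> (real \<Rightarrow> 'w \<Rightarrow> real) \<Rightarrow> bool" where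
  "wiener_process M B \<longleftrightarrow>
     (\<forall>t\<ge>0. B t \<in> borel_measurable M) \<and>
     (AE \<omega> in M. B 0 \<omega> = 0) \<and>
     (\<forall>s t. 0 \<le> s \<and> s < t \<longrightarrow>
        distributed M lborel (\<lambda>\<omega>. B t \<omega> - B s \<omega>) (normal_density 0 (sqrt (t - s)))) \<and>
     (\<forall>n (s :: nat \<Rightarrow> real). 0 \<le> s 0 \<and> (\<forall>i<n. s i \<le> s (Suc i)) \<longrightarrow>
        prob_space.indep_vars M (\<lambda>_. borel) (\<lambda>i \<omega>. B (s (Suc i)) \<omega> - B (s i) \<omega>) {..<n}) \<and>
     (AE \<omega> in M. continuous_on {0..} (\<lambda>t. B t \<omega>))"

definition iid_wiener :: "'w measure \<Rightarrow> (idx \<Rightarrow> real \<Rightarrow> 'w \<Rightarrow> real) \<Rightarrow> bool" where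
  "iid_wiener M \<beta> \<longleftrightarrow>
     (\<forall>k\<in>modes. wiener_process M (\<beta> k)) \<and>
     prob_space.indep_vars M (\<lambda>_. Pi\<^sub>M {0..} (\<lambda>_. borel))
       (\<lambda>k \<omega>. \<lambda>t\<in>{0..}. \<beta> k t \<omega>) modes"

definition partition_of :: "real \<Rightarrow> real \<Rightarrow> nat \<Rightarrow> (nat \<Rightarrow> real) \<Rightarrow> bool" where
  "partition_of a b n s \<longleftrightarrow> s 0 = a \<and> s n = b \<and> (\<forall>i<n. s i \<le> s (Suc i))"

definition step_fun :: "nat \<Rightarrow> (nat \<Rightarrow> real) \<Rightarrow> (nat \<Rightarrow> real) \<Rightarrow> real \<Rightarrow> real" where
  "step_fun n s c r = (\<Sum>i<n. c i * indicator {s i <.. s (Suc i)} r)"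

definition step_integral ::
    "(real \<Rightarrow> 'w \<Rightarrow> real) \<Rightarrow> nat \<Rightarrow> (nat \<Rightarrow> real) \<Rightarrow> (nat \<Rightarrow> real) \<Rightarrow> 'w \<Rightarrow> real" where
  "step_integral B n s c \<omega> = (\<Sum>i<n. c i * (B (s (Suc i)) \<omega> - B (s i) \<omega>))"

text \<open>
  The integral of a deterministic square integrable \<open>f\<close> over \<open>[a, b]\<close> against \<open>B\<close>: the
  mean-square limit of the integrals of step functions that converge to \<open>f\<close> in \<open>L\<^sup>2\<close>.
  By the isometry it does not depend on the approximating sequence, up to a null set.
\<close>

definition has_wiener_integral ::
    "'w measure \<Rightarrow> (real \<Rightarrow> 'w \<Rightarrow> real) \<Rightarrow> (real \<Rightarrow> real) \<Rightarrow> real \<Rightarrow> real \<Rightarrow> ('w \<Rightarrow> real) \<Rightarrow> bool"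
  where
  "has_wiener_integral M B f a b I \<longleftrightarrow>
     I \<in> borel_measurable M \<and>
     (\<exists>n s c. (\<forall>j. partition_of a b (n j) (s j)) \<and>
        (\<lambda>j. \<integral>\<^sup>+r\<in>{a..b}. ennreal ((f r - step_fun (n j) (s j) (c j) r)\<^sup>2) \<partial>lborel)
           \<longlonglongrightarrow> 0 \<and>
        (\<lambda>j. \<integral>\<^sup>+\<omega>. ennreal ((I \<omega> - step_integral B (n j) (s j) (c j) \<omega>)\<^sup>2) \<partial>M)
           \<longlonglongrightarrow> 0)"

definition wiener_integral ::
    "'w measure \<Rightarrow> (real \<Rightarrow> 'w \<Rightarrow> real) \<Rightarrow> (real \<Rightarrow> real) \<Rightarrow> real \<Rightarrow> real \<Rightarrow> 'w \<Rightarrow> real" where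
  "wiener_integral M B f a b = (SOME I. has_wiener_integral M B f a b I)"

definition stoch_conv ::
    "'w measure \<Rightarrow> real \<Rightarrow> (idx \<Rightarrow> real \<Rightarrow> 'w \<Rightarrow> real) \<Rightarrow> series \<Rightarrow> real \<Rightarrow> 'w \<Rightarrow> series" where
  "stoch_conv M L \<beta> a t \<omega> =
     (\<lambda>k. if k \<in> modes
          then a k * wiener_integral M (\<beta> k) (\<lambda>s. exp (- (t - s) * (eigval L k)\<^sup>2)) 0 t \<omega>
          else 0)"

definition admissible_regularization :: "(real \<Rightarrow> series) \<Rightarrow> bool" where
  "admissible_regularization \<alpha> \<longleftrightarrow>
     (\<exists>C. \<forall>\<epsilon>>0. \<forall>k\<in>modes. \<bar>\<alpha> \<epsilon> k\<bar> \<le> C) \<and>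
     (\<forall>\<epsilon>>0. \<exists>\<delta>>0. \<exists>C>0. \<forall>k\<in>modes. \<bar>\<alpha> \<epsilon> k\<bar> \<le> C * mode_norm k powr (- \<delta>)) \<and>
     (\<forall>k\<in>modes. ((\<lambda>\<epsilon>. \<alpha> \<epsilon> k) \<longlongrightarrow> 1) (at_right 0)) \<and>
     (\<forall>\<epsilon>>0. \<exists>a :: real \<Rightarrow> real. \<forall>k\<in>modes. \<alpha> \<epsilon> k = a (mode_norm k))"

section \<open>Mild solutions\<close>

text \<open>
  A process is a family \<open>u t \<omega>\<close> of series.  The integral of the series-valued integrand is
  taken coefficientwise, which for a Bochner integral in some \<open>H\<^sup>\<gamma>\<close> is the same.
\<close>

definition series_process :: "'w measure \<Rightarrow> real \<Rightarrow> (real \<Rightarrow> 'w \<Rightarrow> series) \<Rightarrow> bool" where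
  "series_process M T u \<longleftrightarrow> (\<forall>t\<in>{0..T}. \<forall>k. (\<lambda>\<omega>. u t \<omega> k) \<in> borel_measurable M)"

definition mild_solution ::
    "'w measure \<Rightarrow> real \<Rightarrow> (idx \<Rightarrow> real \<Rightarrow> 'w \<Rightarrow> real) \<Rightarrow> series \<Rightarrow> real \<Rightarrow> series
       \<Rightarrow> (real \<Rightarrow> 'w \<Rightarrow> series) \<Rightarrow> bool" where
  "mild_solution M L \<beta> a T u0 u \<longleftrightarrow>
     series_process M T u \<and>
     (AE \<omega> in M. continuous_path_H L 1 T (\<lambda>t. u t \<omega>)) \<and>
     (\<forall>t\<in>{0..T}. AE \<omega> in M. \<forall>k.
        u t \<omega> k = semigroup_A L t u0 k
          + (LINT s:{0..t}|lborel. semigroup_A L (t - s) (nonlinearity L (u s \<omega>)) k)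
          + stoch_conv M L \<beta> a t \<omega> k)"

definition linear_mild_solution ::
    "'w measure \<Rightarrow> real \<Rightarrow> (idx \<Rightarrow> real \<Rightarrow> 'w \<Rightarrow> real) \<Rightarrow> real \<Rightarrow> series
       \<Rightarrow> (real \<Rightarrow> 'w \<Rightarrow> series) \<Rightarrow> bool" where
  "linear_mild_solution M L \<beta> T u0 u \<longleftrightarrow>
     series_process M T u \<and>
     (\<forall>t\<in>{0..T}. AE \<omega> in M. \<forall>k.
        u t \<omega> k = semigroup_A L t u0 k + stoch_conv M L \<beta> (\<lambda>_. 1) t \<omega> k)"

section \<open>Convergence of random continuous functions\<close>

definition C0 :: "real \<Rightarrow> real \<Rightarrow> (real \<Rightarrow> plane \<Rightarrow> real) set" where
  "C0 L T = {v. continuous_on ({0..T} \<times> UNIV) (\<lambda>(t, x). v t x) \<and> (\<forall>t\<in>{0..T}. periodic L (v t))}"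

definition C0_norm :: "real \<Rightarrow> real \<Rightarrow> (real \<Rightarrow> plane \<Rightarrow> real) \<Rightarrow> real" where
  "C0_norm L T v = (SUP (t, x)\<in>{0..T} \<times> torus L. \<bar>v t x\<bar>)"

text \<open>Measurability of all evaluations is Borel measurability, as \<open>C\<^sup>0\<close> is separable.\<close>

definition Lp_C0 ::
    "'w measure \<Rightarrow> real \<Rightarrow> real \<Rightarrow> real \<Rightarrow> ('w \<Rightarrow> real \<Rightarrow> plane \<Rightarrow> real) set" where
  "Lp_C0 M L T p =
     {v. (\<forall>\<omega>\<in>space M. v \<omega> \<in> C0 L T) \<and>
         (\<forall>t\<in>{0..T}. \<forall>x. (\<lambda>\<omega>. v \<omega> t x) \<in> borel_measurable M) \<and>
         integrable M (\<lambda>\<omega>. C0_norm L T (v \<omega>) powr p)}"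

definition Lp_C0_norm ::
    "'w measure \<Rightarrow> real \<Rightarrow> real \<Rightarrow> real \<Rightarrow> ('w \<Rightarrow> real \<Rightarrow> plane \<Rightarrow> real) \<Rightarrow> real" where
  "Lp_C0_norm M L T p v = (LINT \<omega>|M. C0_norm L T (v \<omega>) powr p) powr (1 / p)"

text \<open>\<open>v\<close> consists of continuous functions of space and time with, almost surely, the
  Fourier series prescribed by \<open>u\<close> at all times.\<close>

definition realizes ::
    "'w measure \<Rightarrow> real \<Rightarrow> real \<Rightarrow> (real \<Rightarrow> 'w \<Rightarrow> series) \<Rightarrow> ('w \<Rightarrow> real \<Rightarrow> plane \<Rightarrow> real) \<Rightarrow> bool"
  where
  "realizes M L T u v \<longleftrightarrow>
     (\<forall>\<omega>\<in>space M. v \<omega> \<in> C0 L T) \<and>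
     (AE \<omega> in M. \<forall>t\<in>{0..T}. u t \<omega> (0, 0) = 0 \<and> represents L (u t \<omega>) (v \<omega> t))"

definition converges_Lp_C0 ::
    "'w measure \<Rightarrow> real \<Rightarrow> real \<Rightarrow> real \<Rightarrow> (real \<Rightarrow> real \<Rightarrow> 'w \<Rightarrow> series)
       \<Rightarrow> (real \<Rightarrow> 'w \<Rightarrow> series) \<Rightarrow> bool" where
  "converges_Lp_C0 M L T p u\<epsilon> u \<longleftrightarrow>
     (\<exists>v\<epsilon> v.
        (\<forall>\<epsilon>>0. realizes M L T (u\<epsilon> \<epsilon>) (v\<epsilon> \<epsilon>) \<and> v\<epsilon> \<epsilon> \<in> Lp_C0 M L T p) \<and>
        realizes M L T u v \<and> v \<in> Lp_C0 M L T p \<and>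
        ((\<lambda>\<epsilon>. Lp_C0_norm M L T p (\<lambda>\<omega> t x. v\<epsilon> \<epsilon> \<omega> t x - v \<omega> t x)) \<longlongrightarrow> 0) (at_right 0))"

end

theory Submission
 imports Defs
begin

text \<open>
 Both solutions contain the linear evolution of the initial value, so the difference of \<open>u\<epsilon>\<close> and
 \<open>u\<close> is the stochastic convolution with coefficients \<open>\<alpha> - 1\<close> plus the Duhamel integral of the
 nonlinearity. Both tend to zero, for different reasons.

 The nonlinearity vanishes because the limiting noise is rough. In dimension two the variance of the
 gradient of the stochastic convolution diverges logarithmically (\<open>gradient_variance\<close>). As soon as
 many coefficients are at least one half, the gradient is therefore large at most points, by the
 boundedness of the Gaussian density, while the rest of the gradient of the solution has bounded energy
 (\<open>energy_bound\<close>). Since the flux decays at infinity (\<open>flux_split\<close>), its mean is small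
 (\<open>flux_le_slow\<close>, \<open>small_mass\<close>), and so is every coefficient of the Duhamel integral. Smoothing by
 the semigroup bounds the high modes of this integral independently of the noise, which makes it small
 uniformly in space and time (\<open>rest_bounds\<close>, \<open>suminf_rb_small\<close>).

 For the noise, the supremum over space and time is estimated on each shell of wave numbers by moments
 of Gaussian variables, by chaining in time and by a grid in space (\<open>shell_majorant\<close>). High moments
 give a summable bound that is homogeneous in the coefficients (\<open>convolution_majorant\<close>), and the
 coefficients of the first shells are close to one.

 Two inputs are needed in advance. The stochastic convolution has continuous Gaussian coefficient paths
 (\<open>ou_version\<close>, \<open>ou_gauss\<close>). The linear evolution of an initial value with bounded weak gradient is
 continuous up to time zero; the biharmonic kernel being not positive, this is obtained by comparison
 with Fejer means (\<open>fejer_gradient_bound\<close>, \<open>semigroup_version\<close>).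
\<close>

section \<open>The trigonometric basis on the line\<close>

abbreviation LIMSEQ_ascii :: "(nat => 'a::topological_space) => 'a => bool" (infixr "---->" 60) where
 "X ----> l == X \<longlonglongrightarrow> l"

abbreviation tendsto_ascii :: "('a => 'b::topological_space) => 'b => 'a filter => bool" (infixr "--->" 55) where
 "f ---> l == f \<longlongrightarrow> l"

locale flat_torus = fixes L :: real assumes L_pos: "L > 0"
begin

definition kp :: real where "kp = 2 * pi / L"
text \<open>Integrals over the square use the restricted measure, so that the finite-measure library applies.\<close>

definition tor :: "plane measure" where "tor = restrict_space lborel (torus L)"

lemma kp_pos: "kp > 0" using L_pos by (simp add: kp_def)

lemma trig_alt: "trig L j z = (if j > 0 then sqrt (2 / L) * sin (kp * j * z)
   else if j = 0 then 1 / sqrt L else sqrt (2 / L) * cos (kp * j * z))"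
 by (simp add: trig_def kp_def)

lemma trig_deriv: "(trig L j has_real_derivative kp * j * trig L (- j) z) (at z)"
proof -
 consider "j > 0" | "j = 0" | "j < 0" by linarith
 then show ?thesis
 proof cases
  case 1
  have e: "trig L j = (%z. sqrt (2 / L) * sin (kp * j * z))" using 1 by (auto simp: trig_alt)
  have "((%z. sqrt (2 / L) * sin (kp * j * z)) has_real_derivative
     sqrt (2 / L) * (cos (kp * j * z) * (kp * j))) (at z)"
   by (auto intro!: derivative_eq_intros)
  then show ?thesis using 1 by (simp add: e trig_alt mult_ac)
 next
  case 2
  have "trig L j = (%z. 1 / sqrt L)" using 2 by (auto simp: trig_alt)
  then show ?thesis using 2 by simp
 next
  case 3
  have e: "trig L j = (%z. sqrt (2 / L) * cos (kp * j * z))" using 3 by (auto simp: trig_alt)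
  have "((%z. sqrt (2 / L) * cos (kp * j * z)) has_real_derivative
     sqrt (2 / L) * (- sin (kp * j * z) * (kp * j))) (at z)"
   by (auto intro!: derivative_eq_intros)
  then show ?thesis using 3 by (simp add: e trig_alt mult_ac)
 qed
qed

lemma trig_continuous [continuous_intros]:
 "continuous_on A f ==> continuous_on A (%x. trig L j (f x))"
proof -
 assume f: "continuous_on A f"
 have "continuous_on UNIV (trig L j)" by (meson DERIV_continuous_on trig_deriv)
 from continuous_on_compose2[OF this f] show ?thesis by auto
qed

lemma trig_measurable [measurable]: "trig L j : borel_measurable borel" by (intro borel_measurable_continuous_onI trig_continuous continuous_on_id)

lemma trig_bound: "abs (trig L j z) <= sqrt (2 / L)"
proof -
 have "1 / sqrt L <= sqrt (2 / L)" using L_pos by (simp add: real_sqrt_divide divide_right_mono)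
 then show ?thesis using L_pos by (auto simp: trig_alt abs_mult mult_left_le)
qed

lemma trig_periodic: "trig L j (z + L) = trig L j z"
proof -
 have "kp * j * (z + L) = kp * j * z + 2 * pi * j" using L_pos by (simp add: kp_def field_simps)
 then show ?thesis using sin_int_2pin[of j] cos_int_2pin[of j] by (simp only: trig_alt sin_add cos_add) (simp add: mult_ac)
qed

lemma trig_sq_sum: "j ~= 0 ==> (trig L j z)^2 + (trig L (- j) z)^2 = 2 / L"
proof -
 assume j: "j ~= 0"
 have "sqrt (2 / L) ^ 2 = 2 / L" using L_pos by simp
 moreover have "(sin (kp * j * z))^2 + (cos (kp * j * z))^2 = 1" by simp
 ultimately have "(sqrt (2 / L) * sin (kp * j * z))^2 + (sqrt (2 / L) * cos (kp * j * z))^2 = 2 / L" by (simp only: power_mult_distrib flip: distrib_left)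
 then show ?thesis using j by (auto simp: trig_alt)
qed

definition int1 :: "(real => real) => real" where
 "int1 f = (\<integral>x. f x * indicator {0..L} x \<partial>lborel)"

lemma int1_FTC:
 assumes "!!x. (F has_real_derivative f x) (at x)" "continuous_on UNIV f"
 shows "int1 f = F L - F 0" unfolding int1_def using assms L_pos by (intro integral_FTC_Icc_real) (auto simp: continuous_on_eq_continuous_at)

lemma int1_integrable:
 fixes f :: "real => real"
 assumes "continuous_on UNIV f" shows "integrable lborel (%x. f x * indicator {0..L} x)" using borel_integrable_atLeastAtMost'[OF continuous_on_subset[OF assms]]
 by (simp add: set_integrable_def mult.commute)

lemma int1_add: "continuous_on UNIV f ==> continuous_on UNIV g ==> int1 (%x. f x + g x) = int1 f + int1 g" unfolding int1_def by (simp add: distrib_right int1_integrable)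

lemma int1_cmult: "int1 (%x. c * f x) = c * int1 f" unfolding int1_def by (simp add: mult.assoc)

lemma trig_eq_L: "trig L j L = trig L j 0" using trig_periodic[of j 0] by simp

text \<open>Comes from integrating the derivative of a product of two basis functions over a period; iterating it gives orthogonality without product formulas.\<close>

lemma int1_trig_rel: "real_of_int i * int1 (%z. trig L i z * trig L j z)
  = j * int1 (%z. trig L (- i) z * trig L (- j) z)"
proof -
 have "int1 (%z. (- kp * i) * (trig L i z * trig L j z) + (kp * j) * (trig L (- i) z * trig L (- j) z))
   = trig L (- i) L * trig L j L - trig L (- i) 0 * trig L j 0"
  by (rule int1_FTC, (auto intro!: derivative_eq_intros trig_deriv continuous_intros)[2])
 also have "... = 0" by (simp add: trig_eq_L)
 finally have "(- kp * i) * int1 (%z. trig L i z * trig L j z)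
   + (kp * j) * int1 (%z. trig L (- i) z * trig L (- j) z) = 0"
  by (subst (asm) int1_add) (auto intro!: continuous_intros simp only: int1_cmult)
 then have "kp * (j * int1 (%z. trig L (- i) z * trig L (- j) z) - i * int1 (%z. trig L i z * trig L j z)) = 0" by (simp add: algebra_simps)
 then show ?thesis using kp_pos by simp
qed

lemma int1_const: "int1 (%z. c) = c * L" using L_pos by (simp add: int1_def)

lemma trig_orthonormal: "int1 (%z. trig L i z * trig L j z) = (if i = j then 1 else 0)"
proof -
 define A where "A i j = int1 (%z. trig L i z * trig L j z)" for i j
 have r1: "real_of_int i * A i j = j * A (-i) (-j)" for i j using int1_trig_rel by (simp add: A_def)
 have r2: "real_of_int i * A (-i) (-j) = j * A i j" for i j using r1[of "-i" "-j"] by simp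
 consider "i^2 ~= j^2" | "i = j" "j = 0" | "i = j" "j ~= 0" | "i = - j" "j ~= 0" by (metis power2_eq_iff neg_equal_zero add.inverse_inverse)
 then show ?thesis
 proof cases
  case 1
  have "(real_of_int i)^2 * A i j = (real_of_int j)^2 * A i j" using r1[of i j] r2[of i j] unfolding power2_eq_square mult.assoc by (metis mult.left_commute)
  moreover have "(real_of_int i)^2 ~= (real_of_int j)^2" using 1 by (metis of_int_eq_iff of_int_power)
  ultimately have "A i j = 0" by simp
  then show ?thesis using 1 by (auto simp: A_def)
 next
  case 2
  then have "(%z. trig L i z * trig L j z) = (%z. 1 / L)" using L_pos by (auto simp: trig_alt)
  then have "int1 (%z. trig L i z * trig L j z) = 1 / L * L" by (simp only: int1_const)
  then show ?thesis using 2 L_pos by simp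
 next
  case 3
  have "A j j + A (-j) (-j) = int1 (%z. trig L j z * trig L j z + trig L (-j) z * trig L (-j) z)"
   unfolding A_def by (rule int1_add[symmetric]) (auto intro!: continuous_intros)
  also have "(%z. trig L j z * trig L j z + trig L (-j) z * trig L (-j) z) = (%z. 2 / L)" using trig_sq_sum[OF 3(2)] by (simp add: power2_eq_square fun_eq_iff)
  also have "int1 (%z. 2 / L) = 2" using L_pos by (simp add: int1_const)
  finally have "A j j + A (-j) (-j) = 2" .
  moreover have "A j j = A (-j) (-j)" using r1[of j j] 3 by simp
  ultimately show ?thesis using 3 by (simp add: A_def)
 next
  case 4
  have "int1 (%z. (2 * kp * j) * (trig L j z * trig L (-j) z)) = trig L j L * trig L j L - trig L j 0 * trig L j 0"
   by (rule int1_FTC) ((auto intro!: derivative_eq_intros trig_deriv continuous_intros)[2])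
  then have "(2 * kp * j) * A j (-j) = 0" by (simp only: int1_cmult A_def trig_eq_L)
  then have "A j (-j) = 0" using 4 kp_pos by simp
  then have "A (-j) j = 0" by (simp add: A_def mult.commute)
  then show ?thesis using 4 by (auto simp: A_def)
 qed
qed

section \<open>The measure on the torus\<close>

lemma torus_closed: "closed (torus L)" unfolding torus_def by (rule closed_cbox)
lemma torus_compact: "compact (torus L)" unfolding torus_def by (rule compact_cbox)
lemma torus_sets [measurable]: "torus L : sets borel" using torus_closed by simp
lemma torus_Times: "torus L = {0..L} \<times> {0..L}" by (auto simp: torus_def cbox_def Basis_prod_def)

lemma space_tor [simp]: "space tor = torus L" by (simp add: tor_def space_restrict_space)

lemma borel_measurable_tor [measurable (raw)]: "f : borel_measurable borel ==> f : borel_measurable tor" by (simp add: tor_def measurable_restrict_space1)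

lemma emeasure_tor: "emeasure tor (torus L) = ennreal (L^2)" using L_pos by (simp add: tor_def emeasure_restrict_space torus_def emeasure_lborel_cbox_eq
   Basis_prod_def prod.union_disjoint inner_prod_def power2_eq_square)

lemma finite_measure_tor: "finite_measure tor" by standard (simp add: emeasure_tor)

sublocale finT: finite_measure tor by (rule finite_measure_tor)

lemma bounded_integrable_tor:
 fixes f :: "plane => 'b::{banach, second_countable_topology}"
 assumes "f : borel_measurable tor" "!!x. x : torus L ==> norm (f x) <= B"
 shows "integrable tor f" using assms by (intro finT.integrable_const_bound[of _ B]) auto

lemma continuous_integrable_tor:
 fixes f :: "plane => 'b::{banach, second_countable_topology}"
 assumes "continuous_on UNIV f" shows "integrable tor f"
proof -
 have "compact (f ` torus L)" using assms by (intro compact_continuous_image torus_compact) (auto intro: continuous_on_subset)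
 then obtain B where "!!x. x : torus L ==> norm (f x) <= B" by (meson bounded_iff compact_imp_bounded image_eqI)
 moreover have "f : borel_measurable borel" using assms by (rule borel_measurable_continuous_onI)
 ultimately show ?thesis by (intro bounded_integrable_tor) auto
qed

lemma set_integral_tor:
 fixes f :: "plane => 'b::{banach, second_countable_topology}"
 shows "(LINT x:torus L|lborel. f x) = (\<integral>x. f x \<partial>tor)" by (simp add: set_lebesgue_integral_def tor_def integral_restrict_space)

lemma set_integrable_tor:
 fixes f :: "plane => 'b::{banach, second_countable_topology}"
 shows "set_integrable lborel (torus L) f \<longleftrightarrow> integrable tor f" by (simp add: set_integrable_def tor_def integrable_restrict_space)

lemma set_borel_measurable_tor:
 fixes f :: "plane => 'b::real_normed_vector"
 shows "set_borel_measurable lborel (torus L) f \<longleftrightarrow> f : borel_measurable tor"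
 by (simp add: set_borel_measurable_def tor_def borel_measurable_restrict_space_iff)

lemma nn_integral_tor: "(\<integral>\<^sup>+x\<in>torus L. f x \<partial>lborel) = (\<integral>\<^sup>+x. f x \<partial>tor)"
 by (simp add: tor_def nn_integral_restrict_space)

lemma AE_tor: "(AE x in tor. P x) \<longleftrightarrow> (AE x in lborel. x : torus L --> P x)" unfolding tor_def by (subst AE_restrict_space_iff) auto

lemma integral_tor_Fubini:
 fixes f :: "plane => real"
 assumes f: "continuous_on UNIV f"
 shows "(\<integral>x. f x \<partial>tor) = int1 (%x. int1 (%y. f (x, y)))"
  and "(\<integral>x. f x \<partial>tor) = int1 (%y. int1 (%x. f (x, y)))"
proof -
 have i: "integrable lborel (%z. indicator (torus L) z * f z)" using continuous_integrable_tor[OF f] by (simp add: tor_def integrable_restrict_space)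
 have i': "integrable (lborel \<Otimes>\<^sub>M lborel) (%(x, y). indicator (torus L) (x, y) * f (x, y))" using i unfolding lborel_prod by (simp add: case_prod_beta')
 have e: "(\<integral>x. f x \<partial>tor) = (\<integral>z. (%(x, y). indicator (torus L) (x, y) * f (x, y)) z \<partial>(lborel \<Otimes>\<^sub>M lborel))"
  by (simp add: tor_def integral_restrict_space lborel_prod case_prod_beta')
 show "(\<integral>x. f x \<partial>tor) = int1 (%x. int1 (%y. f (x, y)))" unfolding e by (subst lborel_pair.integral_fst'[OF i', symmetric])
    (auto simp: int1_def torus_Times indicator_times mult_ac intro!: Bochner_Integration.integral_cong
     simp flip: integral_mult_right_zero)
 show "(\<integral>x. f x \<partial>tor) = int1 (%y. int1 (%x. f (x, y)))" unfolding e by (subst lborel_pair.integral_snd[OF i', symmetric])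
    (auto simp: int1_def torus_Times indicator_times mult_ac intro!: Bochner_Integration.integral_cong
     simp flip: integral_mult_right_zero)
qed

section \<open>The basis on the torus\<close>

abbreviation bf :: "idx => plane => real" where "bf \<equiv> basis_fun L"

lemma e_continuous: "continuous_on UNIV (bf k)" unfolding basis_fun_def by (intro continuous_intros)

lemma e_continuous' [continuous_intros]: "continuous_on A f ==> continuous_on A (%x. bf k (f x))" using continuous_on_compose2[OF e_continuous] by blast

lemma e_measurable [measurable]: "bf k : borel_measurable borel" by (rule borel_measurable_continuous_onI[OF e_continuous])

lemma e_bound: "abs (bf k x) <= 2 / L"
proof -
 have "abs (bf k x) <= sqrt (2 / L) * sqrt (2 / L)" unfolding basis_fun_def abs_mult using L_pos by (intro mult_mono trig_bound) auto
 then show ?thesis using L_pos by simp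
qed

lemma e_periodic: "periodic L (bf k)" by (simp add: periodic_def basis_fun_def trig_periodic)

lemma e_orthonormal: "(\<integral>x. bf k x * bf l x \<partial>tor) = (if k = l then 1 else 0)"
proof -
 have "(\<integral>x. bf k x * bf l x \<partial>tor) = int1 (%x. int1 (%y. bf k (x, y) * bf l (x, y)))" by (rule integral_tor_Fubini) (intro continuous_intros)
 also have "... = int1 (%x. (trig L (fst k) x * trig L (fst l) x) * int1 (%y. trig L (snd k) y * trig L (snd l) y))" by (simp add: basis_fun_def mult_ac flip: int1_cmult)
 also have "... = int1 (%y. trig L (snd k) y * trig L (snd l) y) * int1 (%x. trig L (fst k) x * trig L (fst l) x)" by (subst int1_cmult[symmetric]) (simp add: mult_ac)
 finally show ?thesis by (auto simp: trig_orthonormal prod_eq_iff)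
qed

lemma e_sum_sq:
 assumes "finite F"
 shows "(\<integral>x. (SUM k:F. c k * bf k x)^2 \<partial>tor) = (SUM k:F. (c k)^2)"
proof -
 have "(\<integral>x. (SUM k:F. c k * bf k x)^2 \<partial>tor) = (\<integral>x. (SUM k:F. SUM l:F. c k * c l * (bf k x * bf l x)) \<partial>tor)"
  by (simp add: power2_eq_square sum_product mult_ac)
 also have "... = (SUM k:F. SUM l:F. c k * c l * (\<integral>x. bf k x * bf l x \<partial>tor))"
  by (subst Bochner_Integration.integral_sum, (intro continuous_integrable_tor continuous_intros)[1],
    intro sum.cong refl, subst Bochner_Integration.integral_sum)
    (auto intro!: continuous_integrable_tor continuous_intros)
 also have "... = (SUM k:F. (c k)^2)" using assms by (simp add: e_orthonormal if_distrib sum.delta power2_eq_square cong: if_cong)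
 finally show ?thesis .
qed

lemma e_sum_sq_nn:
 assumes "finite F"
 shows "(\<integral>\<^sup>+x. ennreal ((SUM k:F. c k * bf k x)^2) \<partial>tor) = ennreal (SUM k:F. (c k)^2)" by (subst nn_integral_eq_integral)
   (auto intro!: continuous_integrable_tor continuous_intros simp: e_sum_sq assms)

definition d1 :: "idx => plane => real" where "d1 k x = kp * fst k * bf (- fst k, snd k) x"
definition d2 :: "idx => plane => real" where "d2 k x = kp * snd k * bf (fst k, - snd k) x"

lemma grad_eqI: "GDERIV f x :> D ==> grad f x = D" unfolding grad_def
proof (rule the_equality)
 fix D' assume a: "GDERIV f x :> D" "GDERIV f x :> D'"
 then have "(%h. h \<bullet> D) = (%h. h \<bullet> D')" unfolding gderiv_def by (rule has_derivative_unique)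
 then have "h \<bullet> D = h \<bullet> D'" for h by metis
 then have "h \<bullet> (D' - D) = 0" for h by (metis inner_diff_right right_minus_eq)
 from this[of "D' - D"] show "D' = D" by simp
qed

lemma e_gderiv: "GDERIV (bf k) x :> (d1 k x, d2 k x)"
proof -
 have 1: "((%x. trig L (fst k) (fst x)) has_derivative (%h. kp * fst k * trig L (- fst k) (fst x) * fst h)) (at x)"
  by (rule has_derivative_compose[OF has_derivative_fst[OF has_derivative_ident] trig_deriv[unfolded has_field_derivative_def]])
 have 2: "((%x. trig L (snd k) (snd x)) has_derivative (%h. kp * snd k * trig L (- snd k) (snd x) * snd h)) (at x)"
  by (rule has_derivative_compose[OF has_derivative_snd[OF has_derivative_ident] trig_deriv[unfolded has_field_derivative_def]])
 show ?thesis unfolding gderiv_def basis_fun_def[abs_def] using has_derivative_mult[OF 1 2]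
  by (rule has_derivative_eq_rhs) (auto simp: d1_def d2_def basis_fun_def inner_prod_def algebra_simps)
qed

lemma grad_e: "grad (bf k) x = (d1 k x, d2 k x)" by (rule grad_eqI[OF e_gderiv])

lemma d1_continuous [continuous_intros]: "continuous_on A f ==> continuous_on A (%x. d1 k (f x))" unfolding d1_def by (intro continuous_intros)
lemma d2_continuous [continuous_intros]: "continuous_on A f ==> continuous_on A (%x. d2 k (f x))" unfolding d2_def by (intro continuous_intros)

lemma gderiv_sum:
 assumes "!!k. k : F ==> GDERIV (f k) x :> D k"
 shows "GDERIV (%x. SUM k:F. f k x) x :> (SUM k:F. D k)" using assms unfolding gderiv_def inner_sum_right by (intro has_derivative_sum) auto

lemma gderiv_cmult: "GDERIV f x :> D ==> GDERIV (%x. (c::real) * f x) x :> c *\<^sub>R D" unfolding gderiv_def by (drule has_derivative_mult_right[of _ _ _ c]) simp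

lemma trig_poly_gderiv: "GDERIV (%x. SUM k:F. c k * bf k x) x :> (SUM k:F. c k * d1 k x, SUM k:F. c k * d2 k x)"
proof -
 have "GDERIV (%x. SUM k:F. c k * bf k x) x :> (SUM k:F. c k *\<^sub>R (d1 k x, d2 k x))" by (intro gderiv_sum gderiv_cmult e_gderiv)
 also have "(SUM k:F. c k *\<^sub>R (d1 k x, d2 k x)) = (SUM k:F. c k * d1 k x, SUM k:F. c k * d2 k x)" by (simp add: sum_prod)
 finally show ?thesis .
qed

lemma trig_poly_C1: "C1_periodic L (%x. SUM k:F. c k * bf k x)"
proof -
 have g: "grad (%x. SUM k:F. c k * bf k x) = (%x. (SUM k:F. c k * d1 k x, SUM k:F. c k * d2 k x))" by (rule ext) (rule grad_eqI[OF trig_poly_gderiv])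
 have "(%x. SUM k:F. c k * bf k x) differentiable (at x)" for x using trig_poly_gderiv[where F=F and c=c and x=x] unfolding gderiv_def differentiable_def by blast
 then show ?thesis using e_periodic by (auto simp: C1_periodic_def g periodic_def intro!: continuous_intros)
qed

end

section \<open>Shells of modes\<close>

text \<open>The shells of the maximum norm have about \<open>n\<close> points each and are invariant under sign changes of the components.\<close>

definition cnorm :: "idx => nat" where "cnorm k = nat (max (abs (fst k)) (abs (snd k)))"
definition square :: "nat => idx set" where "square n = {k \<in> modes. cnorm k <= n}"
definition shell :: "nat => idx set" where "shell n = {k \<in> modes. cnorm k = n}"

lemma cnorm_le_iff: "cnorm k <= n \<longleftrightarrow> abs (fst k) <= int n & abs (snd k) <= int n" by (auto simp: cnorm_def)

lemma square_subset: "square n <= {- int n..int n} \<times> {- int n..int n}" by (auto simp: square_def cnorm_le_iff)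

lemma finite_square [simp]: "finite (square n)" by (rule finite_subset[OF square_subset]) auto

lemma square_modes: "square n <= modes" by (auto simp: square_def)
lemma shell_modes: "shell n <= modes" by (auto simp: shell_def)
lemma square_mono: "m <= n ==> square m <= square n" by (auto simp: square_def)
lemma shell_square: "shell n <= square n" by (auto simp: square_def shell_def)
lemma finite_shell [simp]: "finite (shell n)" by (rule finite_subset[OF shell_square]) simp

lemma cnorm_pos: "k : modes ==> cnorm k >= 1" by (cases k) (auto simp: modes_def cnorm_def)

lemma square_0 [simp]: "square 0 = {}" using cnorm_pos by (force simp: square_def)

lemma square_Suc: "square (Suc n) = square n \<union> shell (Suc n)" "square n \<inter> shell (Suc n) = {}" by (auto simp: square_def shell_def)

lemma sum_square: "(SUM k:square N. f k) = (SUM n<N. SUM k:shell (Suc n). f k)" by (induction N) (simp_all add: square_Suc sum.union_disjoint)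

lemma finite_in_square:
 assumes "finite F" "F <= modes" obtains n where "F <= square n"
proof
 show "F <= square (SUM k:F. cnorm k)" using assms by (auto simp: square_def intro: member_le_sum)
qed

lemma filterlim_square: "filterlim square (finite_subsets_at_top modes) sequentially" unfolding filterlim_iff eventually_finite_subsets_at_top
proof safe
 fix P X assume *: "finite X" "X <= modes" "ALL Y. finite Y & X <= Y & Y <= modes --> P Y"
 obtain n where "X <= square n" by (rule finite_in_square[OF *(1,2)])
 then have "P (square m)" if "m >= n" for m using * square_mono[OF that] square_modes by (metis finite_square order_trans)
 then show "eventually (%x. P (square x)) sequentially" by (auto simp: eventually_sequentially)
qed

lemma card_shell: "real (card (shell n)) <= 12 * real n"
proof (cases "n = 0")
 case True
 then have "shell n = {}" using cnorm_pos by (force simp: shell_def)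
 then show ?thesis by simp
next
 case False
 let ?I = "{- int n..int n}" and ?E = "{int n, - int n}"
 have "shell n <= ?E \<times> ?I \<union> ?I \<times> ?E"
 proof
  fix k assume "k : shell n"
  then have k: "cnorm k = n" by (simp add: shell_def)
  then have "abs (fst k) <= int n" "abs (snd k) <= int n" using cnorm_le_iff[of k n] by auto
  moreover have "abs (fst k) = int n \<or> abs (snd k) = int n" using k by (auto simp: cnorm_def)
  ultimately show "k : ?E \<times> ?I \<union> ?I \<times> ?E" by (cases k) (simp, linarith)
 qed
 then have "card (shell n) <= card (?E \<times> ?I \<union> ?I \<times> ?E)" by (intro card_mono) auto
 also have "... <= card (?E \<times> ?I) + card (?I \<times> ?E)" by (rule card_Un_le)
 also have "... = 4 * (2 * n + 1)" using False by (simp add: card_cartesian_product card_insert_if)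
 also have "... <= 12 * n" using False by simp
 finally show ?thesis by linarith
qed

lemma sum_square_le:
 fixes f :: "idx => real" and h :: "nat => real"
 assumes "!!k. k : modes ==> f k <= h (cnorm k)" "!!n. n >= 1 ==> h n >= 0"
 shows "(SUM k:square N. f k) <= 12 * (SUM n<N. Suc n * h (Suc n))"
proof -
 have "(SUM k:shell (Suc n). f k) <= 12 * (Suc n * h (Suc n))" for n
 proof -
  have "(SUM k:shell (Suc n). f k) <= real (card (shell (Suc n))) * h (Suc n)"
   using assms(1) by (intro sum_bounded_above) (metis (mono_tags, lifting) mem_Collect_eq shell_def)
  also have "... <= 12 * Suc n * h (Suc n)" using card_shell[of "Suc n"] assms by (intro mult_right_mono) auto
  finally show ?thesis by (simp add: mult_ac)
 qed
 then show ?thesis unfolding sum_square sum_distrib_left by (intro sum_mono) auto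
qed

lemma summable_on_modes:
 fixes f :: "idx => real" and h :: "nat => real"
 assumes "!!k. k : modes ==> 0 <= f k" "!!k. k : modes ==> f k <= h (cnorm k)" "!!n. n >= 1 ==> h n >= 0"
  and "summable (%n. Suc n * h (Suc n))"
 shows "f summable_on modes" "infsum f modes <= 12 * (\<Sum>n. Suc n * h (Suc n))"
proof -
 have b: "sum f F <= 12 * (\<Sum>n. Suc n * h (Suc n))" if F: "finite F" "F <= modes" for F
 proof -
  obtain N where N: "F <= square N" by (rule finite_in_square[OF F])
  have "sum f F <= sum f (square N)" using N assms(1) square_modes[of N] finite_square[of N] by (intro sum_mono2) blast+
  also have "... <= 12 * (SUM n<N. Suc n * h (Suc n))" using assms by (intro sum_square_le) auto
  also have "(SUM n<N. Suc n * h (Suc n)) <= (\<Sum>n. Suc n * h (Suc n))" using assms by (intro sum_le_suminf) auto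
  finally show ?thesis by simp
 qed
 show s: "f summable_on modes" using assms b by (intro nonneg_bdd_above_summable_on bdd_aboveI2[where M="12 * (\<Sum>n. Suc n * h (Suc n))"]) auto
 show "infsum f modes <= 12 * (\<Sum>n. Suc n * h (Suc n))" using b by (intro infsum_le_finite_sums s) auto
qed

lemma tail_small:
 fixes f :: "idx => real"
 assumes "!!k. k : modes ==> 0 <= f k" "f summable_on modes" "d > 0"
 obtains n where "!!F. finite F ==> F <= modes ==> F \<inter> square n = {} ==> sum f F < d"
proof -
 have "(%n. sum f (square n)) ----> infsum f modes" using infsum_tendsto[OF assms(2)] filterlim_square by (rule filterlim_compose)
 then have "eventually (%n. sum f (square n) > infsum f modes - d) sequentially" using assms(3) by (intro order_tendstoD) auto
 then obtain n where n: "sum f (square n) > infsum f modes - d" by (auto simp: eventually_sequentially)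
 show thesis
 proof (rule that)
  fix F assume F: "finite F" "F <= modes" "F \<inter> square n = {}"
  have "sum f F + sum f (square n) = sum f (F \<union> square n)" using F by (simp add: sum.union_disjoint)
  also have "... <= infsum f modes" using F assms square_modes by (intro finite_sum_le_infsum) auto
  finally show "sum f F < d" using n by simp
 qed
qed

lemma summable_square_limit:
 fixes f :: "idx => real"
 assumes "f summable_on modes" shows "(%n. sum f (square n)) ----> infsum f modes" using infsum_tendsto[OF assms] filterlim_square by (rule filterlim_compose)

lemma mode_norm_sq: "(mode_norm k)^2 = (real_of_int (fst k))^2 + (real_of_int (snd k))^2" by (simp add: mode_norm_def)

lemma cnorm_sq: "(real (cnorm k))^2 = max ((real_of_int (fst k))^2) ((real_of_int (snd k))^2)"
proof -
 have "real (cnorm k) = max (abs (real_of_int (fst k))) (abs (real_of_int (snd k)))" by (auto simp: cnorm_def max_def)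
 then show ?thesis by (auto simp: max_def abs_le_square_iff)
qed

lemma mode_norm_bounds: "(real (cnorm k))^2 <= (mode_norm k)^2" "(mode_norm k)^2 <= 2 * (real (cnorm k))^2" unfolding mode_norm_sq cnorm_sq by (auto simp: max_def)

lemma tendsto_0_ennreal_iff: "(f ---> (0::ennreal)) F \<longleftrightarrow> (ALL d>0. eventually (%x. f x <= ennreal d) F)"
proof
 assume "(f ---> 0) F"
 then show "ALL d>0. eventually (%x. f x <= ennreal d) F" by (auto dest!: order_tendstoD(2)[where a = "ennreal _"] elim: eventually_mono)
next
 assume *: "ALL d>0. eventually (%x. f x <= ennreal d) F"
 show "(f ---> 0) F"
 proof (rule order_tendstoI)
  fix a :: ennreal assume "0 < a"
  then obtain r where r: "0 < ennreal r" "ennreal r < a" using dense by (metis ennreal_cases less_le_trans not_less_iff_gr_or_eq top_greatest not_top_less)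
  then have "r > 0" by simp
  with * have "eventually (%x. f x <= ennreal r) F" by blast
  then show "eventually (%x. f x < a) F" by eventually_elim (use r in auto)
 qed simp
qed

lemma tendsto_0_le_ennreal:
 fixes f g :: "'b => ennreal"
 assumes "(g ---> 0) F" "!!x. f x <= g x" shows "(f ---> 0) F"
 by (rule tendsto_sandwich[OF always_eventually always_eventually tendsto_const assms(1)]) (auto simp: assms(2))

context flat_torus begin

lemma eigval_eq: "eigval L k = kp^2 * (mode_norm k)^2" by (simp add: eigval_def kp_def power_mult_distrib power_divide)

lemma eigval_bounds: "kp^2 * (real (cnorm k))^2 <= eigval L k" "eigval L k <= 2 * kp^2 * (real (cnorm k))^2" using mode_norm_bounds[of k] kp_pos by (auto simp: eigval_eq)

lemma eigval_pos: "k : modes ==> eigval L k > 0" using cnorm_pos[of k] kp_pos eigval_bounds(1)[of k] by (intro less_le_trans[OF _ eigval_bounds(1)]) auto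

lemma eigval_nonneg: "eigval L k >= 0" by (simp add: eigval_def)

section \<open>Representation in mean square\<close>

definition dist2 :: "(plane => real) => (plane => real) => ennreal" where
 "dist2 f g = (\<integral>\<^sup>+x. ennreal ((f x - g x)^2) \<partial>tor)"

abbreviation PS :: "idx set => series => plane => real" where
 "PS F u \<equiv> %x. SUM k:F. u k * bf k x"

lemma PS_measurable [measurable]: "PS F u : borel_measurable borel" by measurable

lemma dist2_triangle:
 assumes [measurable]: "f : borel_measurable tor" "g : borel_measurable tor" "h : borel_measurable tor"
 shows "dist2 f h <= 2 * dist2 f g + 2 * dist2 g h"
proof -
 have "(a - c)^2 <= 2 * (a - b)^2 + 2 * (b - c)^2" for a b c :: real using zero_le_power2[of "a - 2 * b + c"] by (simp add: power2_eq_square algebra_simps)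
 then have "dist2 f h <= (\<integral>\<^sup>+x. 2 * ennreal ((f x - g x)^2) + 2 * ennreal ((g x - h x)^2) \<partial>tor)" unfolding dist2_def
  by (intro nn_integral_mono) (simp flip: ennreal_plus ennreal_mult ennreal_numeral)
 also have "... = 2 * dist2 f g + 2 * dist2 g h" by (simp add: dist2_def nn_integral_add nn_integral_cmult)
 finally show ?thesis .
qed

lemma dist2_commute: "dist2 f g = dist2 g f" by (simp add: dist2_def power2_commute)

lemma dist2_PS:
 assumes "finite G" "F <= G" shows "dist2 (PS G u) (PS F u) = ennreal (SUM k:G - F. (u k)^2)"
proof -
 have "PS G u x - PS F u x = PS (G - F) u x" for x using assms by (simp add: sum_diff)
 then show ?thesis using assms by (simp add: dist2_def e_sum_sq_nn)
qed

lemma dist2_PS_coeff: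
 assumes "finite F" shows "dist2 (PS F u) (PS F v) = ennreal (SUM k:F. (u k - v k)^2)"
proof -
 have "PS F u x - PS F v x = PS F (%k. u k - v k) x" for x by (simp add: sum_subtractf left_diff_distrib)
 then show ?thesis using assms by (simp add: dist2_def e_sum_sq_nn)
qed

lemma represents_iff:
 "represents L u g \<longleftrightarrow> g : borel_measurable tor & ((%F. dist2 g (PS F u)) ---> 0) (finite_subsets_at_top modes)"
 by (simp add: represents_def set_borel_measurable_tor nn_integral_tor dist2_def)

lemma represents_measurable: "represents L u g ==> g : borel_measurable tor" by (simp add: represents_iff)

lemma represents_iff2:
 "represents L u g \<longleftrightarrow> g : borel_measurable tor &
   (ALL d>0. EX n. ALL F. finite F & square n <= F & F <= modes --> dist2 g (PS F u) <= ennreal d)"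
proof -
 have "(EX X. finite X & X <= modes & (ALL Y. finite Y & X <= Y & Y <= modes --> P Y))
   \<longleftrightarrow> (EX n. ALL F. finite F & square n <= F & F <= modes --> P F)" for P
  by (meson finite_in_square finite_square order_trans square_modes)
 then show ?thesis by (simp add: represents_iff tendsto_0_ennreal_iff eventually_finite_subsets_at_top)
qed

lemma represents_square_limit: "represents L u g ==> (%n. dist2 g (PS (square n) u)) ----> 0"
 unfolding represents_iff by (drule conjunct2, drule filterlim_compose[OF _ filterlim_square])

text \<open>Squares suffice: by orthogonality the mean-square error of a partial sum over a larger set only decreases.\<close>

lemma represents_subseqI:
 assumes g [measurable]: "g : borel_measurable tor" and l2: "(%k. (u k)^2) summable_on modes"
  and lim: "!!d m. d > 0 ==> EX n>=m. dist2 g (PS (square n) u) <= ennreal d"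
 shows "represents L u g" unfolding represents_iff2
proof (intro conjI allI impI g)
 fix d :: real assume d: "d > 0"
 obtain m where m: "!!F. finite F ==> F <= modes ==> F \<inter> square m = {} ==> (SUM k:F. (u k)^2) < d / 4" by (rule tail_small[OF _ l2, of "d / 4"]) (use d in auto)
 obtain n where n: "n >= m" "dist2 g (PS (square n) u) <= ennreal (d / 4)" using lim[of "d / 4" m] d by auto
 show "EX n. ALL F. finite F & square n <= F & F <= modes --> dist2 g (PS F u) <= ennreal d"
 proof (intro exI[of _ n] allI impI)
  fix F assume F: "finite F & square n <= F & F <= modes"
  have "dist2 g (PS F u) <= 2 * dist2 g (PS (square n) u) + 2 * dist2 (PS (square n) u) (PS F u)" by (rule dist2_triangle) auto
  also have "... <= 2 * ennreal (d / 4) + 2 * ennreal (d / 4)"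
  proof (intro add_mono mult_left_mono n)
   have "(SUM k:F - square n. (u k)^2) < d / 4" using F square_mono[OF n(1)] by (intro m) auto
   then show "dist2 (PS (square n) u) (PS F u) <= ennreal (d / 4)" using F by (subst dist2_commute) (simp add: dist2_PS ennreal_leI)
  qed auto
  also have "... = ennreal d" using d by (simp flip: ennreal_plus ennreal_mult ennreal_numeral)
  finally show "dist2 g (PS F u) <= ennreal d" .
 qed
qed

lemma represents_add:
 assumes "represents L u f" "represents L v g"
 shows "represents L (%k. u k + v k) (%x. f x + g x)"
proof -
 note [measurable] = assms[THEN represents_measurable]
 have le: "dist2 (%x. f x + g x) (PS F (%k. u k + v k)) <= 2 * dist2 f (PS F u) + 2 * dist2 g (PS F v)" for F
 proof -
  have "dist2 (%x. f x + g x) (PS F (%k. u k + v k))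
    <= 2 * dist2 (%x. f x + g x) (%x. PS F u x + g x) + 2 * dist2 (%x. PS F u x + g x) (PS F (%k. u k + v k))"
   by (rule dist2_triangle) measurable
  also have "dist2 (%x. f x + g x) (%x. PS F u x + g x) = dist2 f (PS F u)" by (simp add: dist2_def)
  also have "dist2 (%x. PS F u x + g x) (PS F (%k. u k + v k)) = dist2 g (PS F v)" by (simp add: dist2_def distrib_right sum.distrib)
  finally show ?thesis .
 qed
 have "((%F. 2 * dist2 f (PS F u) + 2 * dist2 g (PS F v)) ---> 2 * 0 + 2 * 0) (finite_subsets_at_top modes)"
  using assms by (intro tendsto_add ennreal_tendsto_cmult) (auto simp: represents_iff)
 then have "((%F. 2 * dist2 f (PS F u) + 2 * dist2 g (PS F v)) ---> 0) (finite_subsets_at_top modes)" by simp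
 from tendsto_0_le_ennreal[OF this le] show ?thesis by (simp add: represents_iff)
qed

lemma represents_uniform_limit:
 assumes g [measurable]: "g : borel_measurable tor"
  and ap: "!!\<delta>. \<delta> > 0 ==> EX c h. represents L c h & (ALL x:torus L. (g x - h x)^2 <= \<delta>) &
    (ALL F. finite F --> F <= modes --> (SUM k:F. (u k - c k)^2) <= \<delta>)"
 shows "represents L u g" unfolding represents_iff2
proof (intro conjI allI impI g)
 fix \<delta> :: real assume \<delta>: "\<delta> > 0"
 define \<delta>' where "\<delta>' = \<delta> / (2 * L^2 + 8)"
 have \<delta>': "\<delta>' > 0" using \<delta> L_pos by (simp add: \<delta>'_def add_pos_pos)
 obtain c h where ch: "represents L c h" "!!x. x\<in>torus L ==> (g x - h x)^2 <= \<delta>'"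
  "!!F. finite F ==> F <= modes ==> (SUM k:F. (u k - c k)^2) <= \<delta>'" using ap[OF \<delta>'] by auto
 note [measurable] = represents_measurable[OF ch(1)]
 obtain n where n: "!!F. finite F & square n <= F & F <= modes ==> dist2 h (PS F c) <= ennreal \<delta>'" using ch(1) \<delta>' unfolding represents_iff2 by meson
 have gh: "dist2 g h <= ennreal (\<delta>' * L^2)"
 proof -
  have "dist2 g h <= (\<integral>\<^sup>+x. ennreal \<delta>' \<partial>tor)" unfolding dist2_def using ch(2) by (intro nn_integral_mono) (auto intro!: ennreal_leI)
  also have "... = ennreal \<delta>' * ennreal (L^2)" by (simp add: emeasure_tor)
  finally show ?thesis using \<delta>' by (simp add: ennreal_mult)
 qed
 show "EX n. ALL F. finite F & square n <= F & F <= modes --> dist2 g (PS F u) <= ennreal \<delta>"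
 proof (intro exI[of _ n] allI impI)
  fix F assume F: "finite F & square n <= F & F <= modes"
  have "dist2 g (PS F u) <= 2 * dist2 g h + 2 * dist2 h (PS F u)" by (rule dist2_triangle) auto
  also have "dist2 h (PS F u) <= 2 * dist2 h (PS F c) + 2 * dist2 (PS F c) (PS F u)" by (rule dist2_triangle) auto
  also have "2 * dist2 g h + 2 * (2 * dist2 h (PS F c) + 2 * dist2 (PS F c) (PS F u))
   <= 2 * ennreal (\<delta>' * L^2) + 2 * (2 * ennreal \<delta>' + 2 * ennreal \<delta>')"
  proof (intro add_mono mult_left_mono gh n F)
   have "dist2 (PS F c) (PS F u) = ennreal (SUM k:F. (u k - c k)^2)" using F by (subst dist2_commute) (simp add: dist2_PS_coeff)
   then show "dist2 (PS F c) (PS F u) <= ennreal \<delta>'" using ch(3) F by (simp add: ennreal_leI)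
  qed auto
  also have "... = ennreal (2 * (\<delta>' * L^2) + 2 * (2 * \<delta>' + 2 * \<delta>'))" using \<delta>' by (simp flip: ennreal_plus ennreal_mult ennreal_numeral)
  also have "2 * (\<delta>' * L^2) + 2 * (2 * \<delta>' + 2 * \<delta>') = \<delta>' * (2 * L^2 + 8)" by (simp add: algebra_simps)
  also have "... = \<delta>" using L_pos by (simp add: \<delta>'_def add_pos_pos less_imp_neq[symmetric])
  finally show "dist2 g (PS F u) <= ennreal \<delta>" by (simp add: mult_left_mono add_left_mono)
 qed
qed

lemma represents_finite:
 assumes "finite F" "F <= modes" shows "represents L (%k. if k : F then c k else 0) (PS F c)" unfolding represents_iff2
proof (intro conjI allI impI)
 obtain n where n: "F <= square n" by (rule finite_in_square[OF assms])
 have "PS G (%k. if k : F then c k else 0) = PS F c" if "finite G" "F <= G" for G using that by (intro ext sum.mono_neutral_cong_right) auto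
 then show "EX n. ALL G. finite G & square n <= G & G <= modes -->
    dist2 (PS F c) (PS G (%k. if k : F then c k else 0)) <= ennreal d" for d
  using n by (intro exI[of _ n]) (simp add: order_trans[of F "square n"], simp add: dist2_def)
qed auto

lemma abs_summable_PS:
 assumes "(%k. abs (c k)) summable_on modes"
 shows "(%k. c k * bf k x) summable_on modes"
  "abs (\<Sum>\<^sub>\<infinity>k\<in>modes. c k * bf k x) <= 2 / L * (\<Sum>\<^sub>\<infinity>k\<in>modes. abs (c k))"
proof -
 have le: "norm (c k * bf k x) <= 2 / L * abs (c k)" for k using mult_left_mono[OF e_bound, of "abs (c k)" k x] by (simp add: abs_mult mult.commute)
 have s: "(%k. 2 / L * abs (c k)) summable_on modes" using assms by (rule summable_on_cmult_right)
 have a: "(%k. norm (c k * bf k x)) summable_on modes" using le by (intro summable_on_comparison_test[OF s]) auto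
 then show s': "(%k. c k * bf k x) summable_on modes" by (rule abs_summable_summable)
 have "norm (\<Sum>\<^sub>\<infinity>k\<in>modes. c k * bf k x) <= (\<Sum>\<^sub>\<infinity>k\<in>modes. norm (c k * bf k x))" using a by (rule norm_infsum_bound)
 also have "... <= (\<Sum>\<^sub>\<infinity>k\<in>modes. 2 / L * abs (c k))" by (intro infsum_mono a s le)
 also have "... = 2 / L * (\<Sum>\<^sub>\<infinity>k\<in>modes. abs (c k))" using assms by (subst infsum_cmult_right) auto
 finally show "abs (\<Sum>\<^sub>\<infinity>k\<in>modes. c k * bf k x) <= 2 / L * (\<Sum>\<^sub>\<infinity>k\<in>modes. abs (c k))" by simp
qed

text \<open>A subsequence of square partial sums with summable distances converges almost everywhere, and its limit is the mean-square limit.\<close>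

lemma riesz_fischer:
 assumes l2: "(%k. (c k)^2) summable_on modes"
 obtains g where "represents L c g" "g : borel_measurable tor"
proof -
 have "EX n. ALL F. finite F & F <= modes & F \<inter> square n = {} --> (SUM k:F. (c k)^2) < 1 / 4 ^ j" for j :: nat
 proof -
  obtain n where "!!F. finite F ==> F <= modes ==> F \<inter> square n = {} ==> (SUM k:F. (c k)^2) < 1 / 4 ^ j" by (rule tail_small[OF _ l2, of "1 / 4 ^ j"]) auto
  then show ?thesis by blast
 qed
 then obtain r where r: "!!j F. finite F ==> F <= modes ==> F \<inter> square (r j) = {} ==> (SUM k:F. (c k)^2) < 1 / 4 ^ j" by metis
 define R where "R j = j + (\<Sum>i\<le>j. r i)" for j
 have R_mono: "i <= j ==> R i <= R j" for i j unfolding R_def by (intro add_mono sum_mono2) auto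
 have R_ge: "R j >= j" "R j >= r j" for j using member_le_sum[of j "{..j}" r] by (auto simp: R_def)
 define P where "P j = PS (square (R j)) c" for j
 have Pm [measurable]: "P j : borel_measurable borel" for j unfolding P_def by measurable
 have dP: "dist2 (P i) (P j) <= ennreal (1 / 4 ^ j)" if "i >= j" for i j
 proof -
  have "(SUM k:square (R i) - square (R j). (c k)^2) < 1 / 4 ^ j" using square_mono[OF R_ge(2)[of j]] square_modes by (intro r) auto
  then show ?thesis unfolding P_def using square_mono[OF R_mono[OF that]] by (simp add: dist2_PS ennreal_leI)
 qed
 have d: "(\<integral>\<^sup>+x. ennreal (abs (P (Suc j) x - P j x)) \<partial>tor) <= ennreal ((L^2 + 1) * (1/2) ^ j)" for j
 proof -
  have am: "abs y <= (1/2)^j + 2^j * y^2" for y :: real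
  proof (cases "abs y <= (1/2)^j")
   case False
   then have "1 <= 2^j * abs y" by (simp add: field_simps)
   then have "abs y * 1 <= abs y * (2^j * abs y)" by (intro mult_left_mono) auto
   then show ?thesis by (simp add: power2_eq_square mult_ac add_increasing)
  qed (simp add: add_increasing2)
  have "(\<integral>\<^sup>+x. ennreal (abs (P (Suc j) x - P j x)) \<partial>tor) <=
    (\<integral>\<^sup>+x. ennreal ((1/2)^j) + ennreal (2^j) * ennreal ((P (Suc j) x - P j x)^2) \<partial>tor)"
   using am by (intro nn_integral_mono) (simp flip: ennreal_plus ennreal_mult)
  also have "... = ennreal ((1/2)^j) * ennreal (L^2) + ennreal (2^j) * dist2 (P (Suc j)) (P j)" by (simp add: nn_integral_add nn_integral_cmult dist2_def emeasure_tor)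
  also have "... <= ennreal ((1/2)^j) * ennreal (L^2) + ennreal (2^j) * ennreal (1/4^j)" by (intro add_mono mult_left_mono dP) auto
  also have "... = ennreal ((1/2)^j * L^2 + 2^j * (1/4^j))" by (simp flip: ennreal_plus ennreal_mult)
  also have "(1/2)^j * L^2 + 2^j * (1/4^j) = (L^2 + 1) * (1/2::real) ^ j"
  proof -
   have "(4::real) ^ j = 2 ^ j * 2 ^ j" by (simp flip: power_mult_distrib)
   then show ?thesis by (simp add: field_simps)
  qed
  finally show ?thesis .
 qed
 have "(\<integral>\<^sup>+x. (\<Sum>j. ennreal (abs (P (Suc j) x - P j x))) \<partial>tor) = (\<Sum>j. \<integral>\<^sup>+x. ennreal (abs (P (Suc j) x - P j x)) \<partial>tor)"
  by (rule nn_integral_suminf) measurable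
 also have "... <= (\<Sum>j. ennreal ((L^2 + 1) * (1/2) ^ j))" by (intro suminf_le d) auto
 also have "... = ennreal (\<Sum>j. (L^2 + 1) * (1/2) ^ j)" by (intro suminf_ennreal2) (auto intro!: summable_mult summable_geometric)
 finally have "(\<integral>\<^sup>+x. (\<Sum>j. ennreal (abs (P (Suc j) x - P j x))) \<partial>tor) ~= \<infinity>" by (auto simp: top_unique)
 then have "AE x in tor. (\<Sum>j. ennreal (abs (P (Suc j) x - P j x))) ~= \<infinity>" by (intro nn_integral_PInf_AE) measurable
 then have conv: "AE x in tor. (%j. P j x) ----> lim (%j. P j x)"
 proof eventually_elim
  case (elim x)
  then have "summable (%j. abs (P (Suc j) x - P j x))" unfolding infinity_ennreal_def by (rule summable_suminf_not_top[OF abs_ge_zero])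
  then have "summable (%j. P (Suc j) x - P j x)" by (rule summable_rabs_cancel)
  then have "(%j. (SUM i<j. P (Suc i) x - P i x) + P 0 x) ----> (\<Sum>i. P (Suc i) x - P i x) + P 0 x" by (intro tendsto_intros summable_LIMSEQ)
  then have "(%j. P j x) ----> (\<Sum>i. P (Suc i) x - P i x) + P 0 x" by (simp add: sum_lessThan_telescope[of "%i. P i x"])
  then show ?case by (metis limI)
 qed
 define g where "g x = lim (%j. P j x)" for x
 have gm [measurable]: "g : borel_measurable tor" unfolding g_def by measurable
 have dg: "dist2 g (P j) <= ennreal (1 / 4 ^ j)" for j
 proof -
  have "dist2 g (P j) = (\<integral>\<^sup>+x. liminf (%i. ennreal ((P i x - P j x)^2)) \<partial>tor)" unfolding dist2_def
  proof (rule nn_integral_cong_AE, use conv in eventually_elim)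
   case (elim x)
   have "(%i. ennreal ((P i x - P j x)^2)) ----> ennreal ((g x - P j x)^2)" using elim unfolding g_def by (intro tendsto_intros tendsto_ennrealI) auto
   then show ?case by (rule lim_imp_Liminf[OF trivial_limit_sequentially, symmetric])
  qed
  also have "... <= liminf (%i. dist2 (P i) (P j))" unfolding dist2_def by (rule nn_integral_liminf) measurable
  also have "... <= ennreal (1 / 4 ^ j)" by (rule Liminf_le) (auto simp: eventually_sequentially intro!: exI[of _ j] dP)
  finally show ?thesis .
 qed
 have "represents L c g"
 proof (rule represents_subseqI[OF gm l2])
  fix h :: real and m :: nat assume "h > 0"
  then obtain j0 where j0: "(1/4) ^ j0 < h" by (metis real_arch_pow_inv divide_less_eq_1_pos one_less_numeral_iff semiring_norm(76) zero_less_numeral)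
  define j where "j = max j0 m"
  have "(1/4::real) ^ j <= (1/4) ^ j0" by (intro power_decreasing) (auto simp: j_def)
  then have "dist2 g (PS (square (R j)) c) <= ennreal h"
   using dg[of j] j0 by (intro order_trans[OF dg[of j, unfolded P_def]]) (auto intro!: ennreal_leI simp: power_one_over)
  moreover have "R j >= m" using R_ge(1)[of j] by (simp add: j_def)
  ultimately show "EX n>=m. dist2 g (PS (square n) c) <= ennreal h" by blast
 qed
 then show thesis using that gm by blast
qed

lemma dist2_L1:
 assumes [measurable]: "f : borel_measurable tor" "g : borel_measurable tor" and "h > 0"
 shows "(\<integral>\<^sup>+x. ennreal (abs (f x - g x)) \<partial>tor) <= ennreal (h * L^2) + ennreal (1 / h) * dist2 f g"
proof -
 have am: "abs y <= h + (1 / h) * y^2" for y :: real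
 proof (cases "abs y <= h")
  case False
  then have "1 <= (1 / h) * abs y" using \<open>h > 0\<close> by (simp add: field_simps)
  then have "abs y * 1 <= abs y * ((1 / h) * abs y)" by (intro mult_left_mono) auto
  then show ?thesis using \<open>h > 0\<close> by (simp add: power2_eq_square mult_ac add_increasing)
 qed (use \<open>h > 0\<close> in \<open>simp add: add_increasing2\<close>)
 have "(\<integral>\<^sup>+x. ennreal (abs (f x - g x)) \<partial>tor) <= (\<integral>\<^sup>+x. ennreal h + ennreal (1/h) * ennreal ((f x - g x)^2) \<partial>tor)"
  using am \<open>h > 0\<close> by (intro nn_integral_mono) (simp flip: ennreal_plus ennreal_mult)
 also have "... = ennreal (h * L^2) + ennreal (1 / h) * dist2 f g"
  using \<open>h > 0\<close> by (simp add: nn_integral_add nn_integral_cmult dist2_def emeasure_tor ennreal_mult)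
 finally show ?thesis .
qed

lemma dist2_L1_tendsto:
 assumes [measurable]: "g : borel_measurable tor" "!!n. h n : borel_measurable tor"
  and lim: "(%n. dist2 g (h n)) ----> 0"
 shows "(%n. \<integral>\<^sup>+x. ennreal (abs (g x - h n x)) \<partial>tor) ----> 0" unfolding tendsto_0_ennreal_iff
proof (intro allI impI)
 fix d :: real assume d: "d > 0"
 define \<eta> where "\<eta> = d / (2 * L^2)"
 have \<eta>: "\<eta> > 0" "\<eta> * L^2 = d / 2" using d L_pos by (auto simp: \<eta>_def)
 have "eventually (%n. dist2 g (h n) <= ennreal (\<eta> * (d / 2))) sequentially" using lim \<eta> d by (simp add: tendsto_0_ennreal_iff)
 then show "eventually (%n. (\<integral>\<^sup>+x. ennreal (abs (g x - h n x)) \<partial>tor) <= ennreal d) sequentially"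
 proof eventually_elim
  case (elim n)
  have "(\<integral>\<^sup>+x. ennreal (abs (g x - h n x)) \<partial>tor) <= ennreal (\<eta> * L^2) + ennreal (1 / \<eta>) * dist2 g (h n)"
   by (rule dist2_L1) (use \<eta> in auto)
  also have "... <= ennreal (\<eta> * L^2) + ennreal (1 / \<eta>) * ennreal (\<eta> * (d / 2))" by (intro add_mono mult_left_mono elim) auto
  also have "... = ennreal d" using \<eta> d by (simp flip: ennreal_plus ennreal_mult)
  finally show ?case .
 qed
qed

lemma represents_integrable:
 assumes "represents L u g" shows "integrable tor g"
proof -
 note [measurable] = represents_measurable[OF assms]
 have "(%n. \<integral>\<^sup>+x. ennreal (abs (g x - PS (square n) u x)) \<partial>tor) ----> 0" by (intro dist2_L1_tendsto represents_square_limit assms) auto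
 then have "eventually (%n. (\<integral>\<^sup>+x. ennreal (abs (g x - PS (square n) u x)) \<partial>tor) < \<infinity>) sequentially" by (intro order_tendstoD) auto
 then obtain n where "(\<integral>\<^sup>+x. ennreal (abs (g x - PS (square n) u x)) \<partial>tor) < \<infinity>" by (auto simp: eventually_sequentially)
 then have "integrable tor (%x. g x - PS (square n) u x)" by (intro integrableI_bounded) auto
 moreover have "integrable tor (PS (square n) u)" by (intro continuous_integrable_tor continuous_intros)
 ultimately have "integrable tor (%x. (g x - PS (square n) u x) + PS (square n) u x)" by (rule Bochner_Integration.integrable_add)
 then show ?thesis by simp
qed

lemma L1_tendsto_integral:
 assumes g: "integrable tor g" and h: "!!n. integrable tor (h n)"
  and lim: "(%n. \<integral>\<^sup>+x. ennreal (abs (g x - h n x)) \<partial>tor) ----> 0"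
  and f [measurable]: "f : borel_measurable tor" and B: "!!x. x : torus L ==> abs (f x) <= B"
 shows "(%n. \<integral>x. h n x * f x \<partial>tor) ----> (\<integral>x. g x * f x \<partial>(tor::plane measure) :: real)"
proof (rule tendsto_L1_int)
 have [measurable]: "g : borel_measurable tor" "h n : borel_measurable tor" for n using g h by auto
 have i: "integrable tor (%x. k x * f x)" if "integrable tor k" for k
 proof (rule Bochner_Integration.integrable_bound[of _ "%x. abs B * k x"])
  show "AE x in tor. norm (k x * f x) <= norm (abs B * k x)"
  proof (rule AE_I2)
   fix x assume "x : space tor"
   then have "abs (f x) <= abs B" using B[of x] unfolding space_tor by linarith
   then have "abs (f x) * abs (k x) <= abs B * abs (k x)" by (intro mult_right_mono) auto
   then show "norm (k x * f x) <= norm (abs B * k x)" by (simp only: real_norm_def abs_mult abs_abs mult.commute)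
  qed
  show "(%x. k x * f x) : borel_measurable tor" using that by measurable
 qed (use that in simp)
 show "integrable tor (%x. h n x * f x)" "integrable tor (%x. g x * f x)" for n by (intro i g h)+
 have "(%n. ennreal (abs B) * (\<integral>\<^sup>+x. ennreal (abs (g x - h n x)) \<partial>tor)) ----> ennreal (abs B) * 0"
  using lim by (intro ennreal_tendsto_cmult) auto
 then have lim0: "(%n. ennreal (abs B) * (\<integral>\<^sup>+x. ennreal (abs (g x - h n x)) \<partial>tor)) ----> 0" by simp
 have le: "(\<integral>\<^sup>+x. ennreal (norm (h n x * f x - g x * f x)) \<partial>tor) <= ennreal (abs B) * (\<integral>\<^sup>+x. ennreal (abs (g x - h n x)) \<partial>tor)" for n
 proof -
  have "(\<integral>\<^sup>+x. ennreal (norm (h n x * f x - g x * f x)) \<partial>tor) <= (\<integral>\<^sup>+x. ennreal (abs B) * ennreal (abs (g x - h n x)) \<partial>tor)"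
  proof (rule nn_integral_mono)
   fix x assume "x : space tor"
   then have "abs (f x) <= abs B" using B[of x] unfolding space_tor by linarith
   then have "abs (f x) * abs (g x - h n x) <= abs B * abs (g x - h n x)" by (intro mult_right_mono) auto
   moreover have "norm (h n x * f x - g x * f x) = abs (f x) * abs (g x - h n x)"
    by (simp add: abs_mult mult.commute[of _ "f x"] abs_minus_commute flip: right_diff_distrib)
   ultimately show "ennreal (norm (h n x * f x - g x * f x)) <= ennreal (abs B) * ennreal (abs (g x - h n x))" by (simp flip: ennreal_mult)
  qed
  also have "... = ennreal (abs B) * (\<integral>\<^sup>+x. ennreal (abs (g x - h n x)) \<partial>tor)" by (rule nn_integral_cmult) measurable
  finally show ?thesis .
 qed
 show "(%n. \<integral>\<^sup>+x. ennreal (norm (h n x * f x - g x * f x)) \<partial>tor) ----> 0" by (rule tendsto_0_le_ennreal[OF lim0 le])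
qed

lemma represents_inner:
 assumes "represents L u g" and f [measurable]: "f : borel_measurable tor" and B: "!!x. x : torus L ==> abs (f x) <= B"
 shows "(%n. \<integral>x. PS (square n) u x * f x \<partial>tor) ----> (\<integral>x. g x * f x \<partial>tor)"
proof (rule L1_tendsto_integral[OF represents_integrable[OF assms(1)] _ _ f B])
 note [measurable] = represents_measurable[OF assms(1)]
 show "integrable tor (PS (square n) u)" for n by (intro continuous_integrable_tor continuous_intros)
 show "(%n. \<integral>\<^sup>+x. ennreal (abs (g x - PS (square n) u x)) \<partial>tor) ----> 0" by (intro dist2_L1_tendsto represents_square_limit assms) auto
qed

lemma represents_coeff:
 assumes "represents L u g"
 shows "(\<integral>x. g x * bf k x \<partial>tor) = (if k : modes then u k else 0)"
proof (rule LIMSEQ_unique[OF represents_inner[OF assms _ e_bound]])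
 have "(\<integral>x. PS (square n) u x * bf k x \<partial>tor) = (if k : square n then u k else 0)" for n
 proof -
  have "(\<integral>x. PS (square n) u x * bf k x \<partial>tor) = (SUM l:square n. u l * (\<integral>x. bf l x * bf k x \<partial>tor))"
   unfolding sum_distrib_right mult.assoc by (subst Bochner_Integration.integral_sum) (auto intro!: continuous_integrable_tor continuous_intros)
  then show ?thesis by (simp add: e_orthonormal if_distrib sum.delta' cong: if_cong)
 qed
 then show "(%n. \<integral>x. PS (square n) u x * bf k x \<partial>tor) ----> (if k : modes then u k else 0)"
  by (intro tendsto_eventually eventually_sequentiallyI[of "cnorm k"]) (auto simp: square_def)
qed measurable

lemma represents_unique_AE:
 assumes "represents L u g" "represents L u h" shows "AE x in tor. g x = h x"
proof -
 note [measurable] = assms[THEN represents_measurable]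
 have "(%n. 2 * dist2 g (PS (square n) u) + 2 * dist2 (PS (square n) u) h) ----> 2 * 0 + 2 * 0"
  using represents_square_limit[OF assms(1)] represents_square_limit[OF assms(2)] by (intro tendsto_add ennreal_tendsto_cmult) (auto simp: dist2_commute[of _ h])
 then have "dist2 g h <= 2 * 0 + 2 * 0" by (rule LIMSEQ_le_const) (auto intro!: exI[of _ 0] dist2_triangle)
 then have "dist2 g h = 0" by simp
 then show ?thesis unfolding dist2_def by (subst (asm) nn_integral_0_iff_AE) auto
qed

end

section \<open>Gradients and the flux\<close>

lemma norm_flux: "norm (flux y) = norm y / (1 + (norm y)^2)" by (simp add: flux_def divide_inverse mult.commute add_nonneg_nonneg)

lemma norm_flux_le_half: "norm (flux y) <= 1 / 2"
proof -
 have "2 * norm y <= 1 + (norm y)^2" using zero_le_power2[of "norm y - 1"] by (simp add: power2_eq_square algebra_simps)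
 moreover have "0 < 1 + (norm y)^2" by (simp add: add_pos_nonneg)
 ultimately show ?thesis by (simp add: norm_flux divide_simps)
qed

lemma norm_flux_lipschitz: "abs (norm (flux a) - norm (flux b)) <= norm (a - b)"
proof -
 define r s where "r = norm a" and "s = norm b"
 have rs: "r >= 0" "s >= 0" by (auto simp: r_def s_def)
 have p: "0 < 1 + r^2" "0 < 1 + s^2" by (auto simp: add_pos_nonneg)
 have "r / (1 + r^2) - s / (1 + s^2) = (r - s) * ((1 - r * s) / ((1 + r^2) * (1 + s^2)))" using p by (simp add: divide_simps) (simp add: power2_eq_square algebra_simps)
 moreover have "abs ((1 - r * s) / ((1 + r^2) * (1 + s^2))) <= 1"
 proof -
  have "abs (1 - r * s) <= 1 + r * s" using rs by (simp add: abs_le_iff)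
  also have "... <= (1 + r^2) * (1 + s^2)"
  proof -
   have "r * s <= r^2 + s^2" using zero_le_power2[of "r - s"] mult_nonneg_nonneg[OF rs] by (simp add: power2_diff)
   moreover have "(1 + r^2) * (1 + s^2) = 1 + r^2 + s^2 + (r * s)^2" by (simp add: algebra_simps power_mult_distrib)
   ultimately show ?thesis using zero_le_power2[of "r * s"] by linarith
  qed
  finally show ?thesis using p by (simp add: abs_mult)
 qed
 ultimately have "abs (r / (1 + r^2) - s / (1 + s^2)) <= abs (r - s) * 1" by (simp only: abs_mult) (intro mult_left_mono, auto)
 also have "... <= norm (a - b)" by (simp add: r_def s_def norm_triangle_ineq3)
 finally show ?thesis by (simp add: norm_flux r_def s_def)
qed

lemma flux_measurable [measurable]: "flux : borel_measurable borel" unfolding flux_def[abs_def] by measurable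

lemma gderiv_partials:
 fixes f :: "plane => real"
 assumes "GDERIV f (x, y) :> D"
 shows "((%s. f (s, y)) has_real_derivative fst D) (at x)"
  and "((%s. f (x, s)) has_real_derivative snd D) (at y)"
proof -
 have f: "(f has_derivative (%h. h \<bullet> D)) (at (x, y))" using assms by (simp add: gderiv_def)
 have "((%s. (s, y)) has_derivative (%h. (h, 0))) (at x)" by (auto intro!: derivative_eq_intros)
 from has_derivative_compose[OF this f] show "((%s. f (s, y)) has_real_derivative fst D) (at x)" by (simp add: has_field_derivative_def inner_prod_def mult_commute_abs)
 have "((%s. (x, s)) has_derivative (%h. (0, h))) (at y)" by (auto intro!: derivative_eq_intros)
 from has_derivative_compose[OF this f] show "((%s. f (x, s)) has_real_derivative snd D) (at y)" by (simp add: has_field_derivative_def inner_prod_def mult_commute_abs)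
qed

lemma differentiable_gderiv:
 fixes f :: "plane => real"
 assumes "f differentiable (at x)" obtains D where "GDERIV f x :> D"
proof -
 from assms obtain f' where f': "(f has_derivative f') (at x)" by (auto simp: differentiable_def)
 interpret bounded_linear f' using f' by (rule has_derivative_bounded_linear)
 have "f' h = h \<bullet> (f' (1, 0), f' (0, 1))" for h
 proof -
  have "f' h = f' (fst h *\<^sub>R (1, 0) + snd h *\<^sub>R (0, 1))" by simp
  also have "... = fst h * f' (1, 0) + snd h * f' (0, 1)" unfolding add scaleR by simp
  finally show ?thesis by (simp add: inner_prod_def)
 qed
 then have "f' = (%h. h \<bullet> (f' (1, 0), f' (0, 1)))" by blast
 with f' have "GDERIV f x :> (f' (1, 0), f' (0, 1))" unfolding gderiv_def by simp
 then show thesis by (rule that)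
qed

context flat_torus begin

lemma C1_gderiv: "C1_periodic L f ==> GDERIV f x :> grad f x"
proof -
 assume "C1_periodic L f"
 then have "f differentiable (at x)" unfolding C1_periodic_def by blast
 then obtain D where "GDERIV f x :> D" by (rule differentiable_gderiv)
 then show ?thesis using grad_eqI by metis
qed

lemma C1_continuous: "C1_periodic L f ==> continuous_on UNIV f" by (simp add: C1_periodic_def differentiable_imp_continuous_within continuous_at_imp_continuous_on)

lemma integral_gradient_zero:
 assumes F: "!!x. GDERIV F x :> D x" and D: "continuous_on UNIV D" and per: "periodic L F"
 shows "(\<integral>x. fst (D x) \<partial>tor) = 0" "(\<integral>x. snd (D x) \<partial>tor) = 0"
proof -
 have c: "continuous_on UNIV (%x. fst (D x))" "continuous_on UNIV (%x. snd (D x))" using D by (auto intro!: continuous_intros)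
 have cc: "continuous_on UNIV (%s. fst (D (s, y)))" "continuous_on UNIV (%s. snd (D (y, s)))" for y by (auto intro!: continuous_intros continuous_on_compose2[OF D])
 have "int1 (%x. fst (D (x, y))) = F (L, y) - F (0, y)" for y by (rule int1_FTC[where F="%s. F (s, y)"]) (auto intro: gderiv_partials F cc)
 also have "F (L, y) - F (0, y) = 0" for y using per[unfolded periodic_def, rule_format, of 0 y] by simp
 finally show "(\<integral>x. fst (D x) \<partial>tor) = 0" unfolding integral_tor_Fubini(2)[OF c(1)] by (simp add: int1_const)
 have "int1 (%y. snd (D (x, y))) = F (x, L) - F (x, 0)" for x by (rule int1_FTC[where F="%s. F (x, s)"]) (auto intro: gderiv_partials F cc)
 also have "F (x, L) - F (x, 0) = 0" for x using per[unfolded periodic_def, rule_format, of x 0] by simp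
 finally show "(\<integral>x. snd (D x) \<partial>tor) = 0" unfolding integral_tor_Fubini(1)[OF c(2)] by (simp add: int1_const)
qed

text \<open>The product of two periodic functions has a gradient of mean zero, which is integration by parts.\<close>

lemma parts_trig_poly:
 assumes f: "C1_periodic L f"
 shows "(\<integral>x. PS F u x * fst (grad f x) \<partial>tor) = - (\<integral>x. (SUM k:F. u k * d1 k x) * f x \<partial>tor)"
  "(\<integral>x. PS F u x * snd (grad f x) \<partial>tor) = - (\<integral>x. (SUM k:F. u k * d2 k x) * f x \<partial>tor)"
proof -
 let ?D = "%x. PS F u x *\<^sub>R grad f x + f x *\<^sub>R (SUM k:F. u k * d1 k x, SUM k:F. u k * d2 k x)"
 have g: "GDERIV (%x. PS F u x * f x) x :> ?D x" for x by (rule GDERIV_mult[OF trig_poly_gderiv C1_gderiv[OF f]])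
 have gc: "continuous_on UNIV (grad f)" using f by (simp add: C1_periodic_def)
 have gc': "continuous_on UNIV (%x. fst (grad f x))" "continuous_on UNIV (%x. snd (grad f x))" using gc by (auto intro!: continuous_intros)
 have c: "continuous_on UNIV ?D" by (intro continuous_intros gc C1_continuous[OF f])
 have p: "periodic L (%x. PS F u x * f x)" using f e_periodic by (simp add: periodic_def C1_periodic_def)
 note z = integral_gradient_zero[OF g c p]
 note ci = continuous_integrable_tor
 have i: "integrable tor (%x. PS F u x * fst (grad f x))" "integrable tor (%x. (SUM k:F. u k * d1 k x) * f x)"
   "integrable tor (%x. PS F u x * snd (grad f x))" "integrable tor (%x. (SUM k:F. u k * d2 k x) * f x)" by (intro ci continuous_intros gc' C1_continuous[OF f])+
 have "0 = (\<integral>x. PS F u x * fst (grad f x) + (SUM k:F. u k * d1 k x) * f x \<partial>tor)" using z(1) by (simp add: mult.commute)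
 then show "(\<integral>x. PS F u x * fst (grad f x) \<partial>tor) = - (\<integral>x. (SUM k:F. u k * d1 k x) * f x \<partial>tor)"
  by (subst (asm) Bochner_Integration.integral_add[OF i(1,2)]) simp
 have "0 = (\<integral>x. PS F u x * snd (grad f x) + (SUM k:F. u k * d2 k x) * f x \<partial>tor)" using z(2) by (simp add: mult.commute)
 then show "(\<integral>x. PS F u x * snd (grad f x) \<partial>tor) = - (\<integral>x. (SUM k:F. u k * d2 k x) * f x \<partial>tor)"
  by (subst (asm) Bochner_Integration.integral_add[OF i(3,4)]) simp
qed

definition flip1 :: "idx => idx" where "flip1 k = (- fst k, snd k)"
definition flip2 :: "idx => idx" where "flip2 k = (fst k, - snd k)"
text \<open>Differentiation exchanges sine and cosine, so the coefficients of the partial derivatives are those of \<open>u\<close> at the index with one sign flipped.\<close>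

definition dc1 :: "series => series" where "dc1 u l = - kp * fst l * u (flip1 l)"
definition dc2 :: "series => series" where "dc2 u l = - kp * snd l * u (flip2 l)"

lemma flip_simps [simp]: "flip1 (flip1 k) = k" "flip2 (flip2 k) = k"
 "fst (flip1 k) = - fst k" "snd (flip1 k) = snd k" "fst (flip2 k) = fst k" "snd (flip2 k) = - snd k" by (auto simp: flip1_def flip2_def)

lemma flip_modes [simp]: "flip1 k : modes \<longleftrightarrow> k : modes" "flip2 k : modes \<longleftrightarrow> k : modes"
 by (cases k; auto simp: modes_def flip1_def flip2_def)+

lemma flip_cnorm [simp]: "cnorm (flip1 k) = cnorm k" "cnorm (flip2 k) = cnorm k" by (auto simp: cnorm_def flip1_def flip2_def)

lemma flip_eigval [simp]: "eigval L (flip1 k) = eigval L k" "eigval L (flip2 k) = eigval L k" by (auto simp: eigval_eq mode_norm_sq)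

lemma flip_bij: "bij_betw flip1 modes modes" "bij_betw flip2 modes modes"
 "bij_betw flip1 (square n) (square n)" "bij_betw flip2 (square n) (square n)"
 by (rule bij_betw_byWitness[where f'=flip1] bij_betw_byWitness[where f'=flip2]; auto simp: square_def)+

lemma d1_flip: "d1 k x = kp * fst k * bf (flip1 k) x" by (simp add: d1_def flip1_def)
lemma d2_flip: "d2 k x = kp * snd k * bf (flip2 k) x" by (simp add: d2_def flip2_def)

lemma PS_dc1: "(SUM k:square n. u k * d1 k x) = PS (square n) (dc1 u) x" by (rule sum.reindex_bij_betw[OF flip_bij(3), symmetric, THEN trans])
   (simp add: d1_flip dc1_def mult_ac)

lemma PS_dc2: "(SUM k:square n. u k * d2 k x) = PS (square n) (dc2 u) x" by (rule sum.reindex_bij_betw[OF flip_bij(4), symmetric, THEN trans])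
   (simp add: d2_flip dc2_def mult_ac)

lemma dc_le: "(dc1 u k)^2 <= eigval L (flip1 k) * (u (flip1 k))^2" "(dc2 u k)^2 <= eigval L (flip2 k) * (u (flip2 k))^2"
 by (auto simp: dc1_def dc2_def eigval_eq mode_norm_sq power_mult_distrib intro!: mult_right_mono mult_left_mono)

lemma dc_l2:
 assumes "(%k. eigval L k * (u k)^2) summable_on modes"
 shows "(%k. (dc1 u k)^2) summable_on modes" "(%k. (dc2 u k)^2) summable_on modes"
proof -
 have "(%k. eigval L (flip1 k) * (u (flip1 k))^2) summable_on modes"
  "(%k. eigval L (flip2 k) * (u (flip2 k))^2) summable_on modes"
  using assms by (simp_all only: summable_on_reindex_bij_betw[OF flip_bij(1), of "%k. eigval L k * (u k)^2"]
    summable_on_reindex_bij_betw[OF flip_bij(2), of "%k. eigval L k * (u k)^2"])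
 then show "(%k. (dc1 u k)^2) summable_on modes" "(%k. (dc2 u k)^2) summable_on modes" using dc_le by (auto intro: summable_on_comparison_test)
qed

lemma Hspace_1: "u : Hspace L 1 \<longleftrightarrow> u (0, 0) = 0 & (%k. eigval L k * (u k)^2) summable_on modes" using eigval_nonneg by (simp add: Hspace_def)

lemma Hspace_1_l2:
 assumes "(%k. eigval L k * (u k)^2) summable_on modes" shows "(%k. (u k)^2) summable_on modes"
proof (rule summable_on_comparison_test[OF summable_on_cmult_right[OF assms, of "1 / kp^2"]])
 fix k assume k: "k : modes"
 have "kp^2 * 1 <= kp^2 * (real (cnorm k))^2" using cnorm_pos[OF k] by (intro mult_left_mono) auto
 then have "kp^2 <= eigval L k" using eigval_bounds(1)[of k] by simp
 then have "kp^2 * (u k)^2 <= eigval L k * (u k)^2" by (intro mult_right_mono) auto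
 then show "(u k)^2 <= 1 / kp^2 * (eigval L k * (u k)^2)" using kp_pos by (simp add: field_simps)
qed auto

lemma integral_tor_fst_snd:
 assumes "integrable tor (G :: plane => plane)"
 shows "fst (\<integral>x. G x \<partial>tor) = (\<integral>x. fst (G x) \<partial>tor)" "snd (\<integral>x. G x \<partial>tor) = (\<integral>x. snd (G x) \<partial>tor)"
 using integral_bounded_linear[OF bounded_linear_fst assms] integral_bounded_linear[OF bounded_linear_snd assms] by auto

lemma integrable_tor_pair:
 "integrable tor (G :: plane => plane) \<longleftrightarrow> integrable tor (%x. fst (G x)) & integrable tor (%x. snd (G x))"
proof safe
 assume G: "integrable tor G"
 show "integrable tor (%x. fst (G x))" "integrable tor (%x. snd (G x))"
  using integrable_bounded_linear[OF bounded_linear_fst G] integrable_bounded_linear[OF bounded_linear_snd G] by auto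
next
 assume a: "integrable tor (%x. fst (G x))" "integrable tor (%x. snd (G x))"
 have "bounded_linear (%r::real. (r, 0::real))" "bounded_linear (%r::real. (0::real, r))" by (auto intro!: bounded_linear_Pair bounded_linear_ident bounded_linear_zero)
 from integrable_bounded_linear[OF this(1) a(1)] integrable_bounded_linear[OF this(2) a(2)]
 have "integrable tor (%x. (fst (G x), 0) + (0, snd (G x)))" by (rule Bochner_Integration.integrable_add)
 then show "integrable tor G" by simp
qed

lemma integrable_mult_continuous:
 assumes "integrable tor (g :: plane => real)" "continuous_on UNIV f"
 shows "integrable tor (%x. g x * f x)"
proof -
 have "compact (f ` torus L)" using assms by (intro compact_continuous_image torus_compact) (auto intro: continuous_on_subset)
 then obtain B where B: "!!x. x : torus L ==> abs (f x) <= B" by (metis bounded_iff compact_imp_bounded image_eqI real_norm_def)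
 have [measurable]: "f : borel_measurable borel" using assms(2) by (rule borel_measurable_continuous_onI)
 show ?thesis
 proof (rule Bochner_Integration.integrable_bound[of _ "%x. abs B * g x"])
  show "AE x in tor. norm (g x * f x) <= norm (abs B * g x)"
  proof (rule AE_I2)
   fix x assume "x : space tor"
   then have "abs (f x) <= abs B" using B[of x] unfolding space_tor by linarith
   then have "abs (f x) * abs (g x) <= abs B * abs (g x)" by (intro mult_right_mono) auto
   then show "norm (g x * f x) <= norm (abs B * g x)" by (simp only: real_norm_def abs_mult abs_abs mult.commute)
  qed
 qed (use assms in simp_all)
qed

lemma weak_gradient_iff:
 "weak_gradient L g G \<longleftrightarrow> integrable tor g & integrable tor G &
   (ALL f. C1_periodic L f --> (\<integral>x. g x * fst (grad f x) \<partial>tor) = - (\<integral>x. fst (G x) * f x \<partial>tor) &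
    (\<integral>x. g x * snd (grad f x) \<partial>tor) = - (\<integral>x. snd (G x) * f x \<partial>tor))"
proof -
 have "(\<integral>x. g x *\<^sub>R grad f x \<partial>tor) = - (\<integral>x. f x *\<^sub>R G x \<partial>tor) \<longleftrightarrow>
   (\<integral>x. g x * fst (grad f x) \<partial>tor) = - (\<integral>x. fst (G x) * f x \<partial>tor) &
    (\<integral>x. g x * snd (grad f x) \<partial>tor) = - (\<integral>x. snd (G x) * f x \<partial>tor)"
  if g: "integrable tor g" and G: "integrable tor G" and f: "C1_periodic L f" for f
 proof -
  have gc: "continuous_on UNIV (grad f)" using f by (simp add: C1_periodic_def)
  have c: "f x * fst (G x) = fst (G x) * f x" "f x * snd (G x) = snd (G x) * f x" for x by (rule mult.commute)+
  have gc': "continuous_on UNIV (%x. fst (grad f x))" "continuous_on UNIV (%x. snd (grad f x))" using continuous_on_fst[OF gc] continuous_on_snd[OF gc] by auto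
  have "integrable tor (%x. g x *\<^sub>R grad f x)" unfolding integrable_tor_pair fst_scaleR snd_scaleR real_scaleR_def by (intro conjI integrable_mult_continuous g gc')
  moreover have "integrable tor (%x. f x *\<^sub>R G x)" unfolding integrable_tor_pair fst_scaleR snd_scaleR real_scaleR_def c
   using G[unfolded integrable_tor_pair] by (intro conjI integrable_mult_continuous C1_continuous[OF f]) auto
  ultimately have ii: "integrable tor (%x. g x *\<^sub>R grad f x)" "integrable tor (%x. f x *\<^sub>R G x)" .
  note i = ii[THEN integral_tor_fst_snd(1)] ii[THEN integral_tor_fst_snd(2)]
  show ?thesis unfolding prod_eq_iff fst_uminus snd_uminus i fst_scaleR snd_scaleR real_scaleR_def c ..
 qed
 then show ?thesis unfolding weak_gradient_def set_integrable_tor set_integral_tor by blast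
qed

text \<open>Integration by parts holds for the partial sums and passes to the mean-square limit on both sides.\<close>

lemma H1_weak_gradient:
 assumes H1: "(%k. eigval L k * (u k)^2) summable_on modes" and g: "represents L u g"
 obtains G1 G2 where "represents L (dc1 u) G1" "represents L (dc2 u) G2" "weak_gradient L g (%x. (G1 x, G2 x))"
proof -
 obtain G1 where G1: "represents L (dc1 u) G1" using riesz_fischer[OF dc_l2(1)[OF H1]] by metis
 obtain G2 where G2: "represents L (dc2 u) G2" using riesz_fischer[OF dc_l2(2)[OF H1]] by metis
 have bnd: "EX B. ALL x:torus L. abs (f x) <= B" if "continuous_on UNIV f" for f :: "plane => real"
 proof -
  have "compact (f ` torus L)" using that by (intro compact_continuous_image torus_compact) (auto intro: continuous_on_subset)
  then show ?thesis by (metis bounded_iff compact_imp_bounded image_eqI real_norm_def)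
 qed
 have lim: "(%n. \<integral>x. PS (square n) v x * f x \<partial>tor) ----> (\<integral>x. h x * f x \<partial>tor)"
  if h: "represents L v h" and f: "continuous_on UNIV f" for v h f
 proof -
  obtain B where "!!x. x : torus L ==> abs (f x) <= B" using bnd[OF f] by auto
  then show ?thesis using f by (intro represents_inner[OF h, of f B]) (auto intro!: borel_measurable_tor borel_measurable_continuous_onI)
 qed
 have "(\<integral>x. g x * fst (grad \<phi> x) \<partial>tor) = - (\<integral>x. G1 x * \<phi> x \<partial>tor)"
    "(\<integral>x. g x * snd (grad \<phi> x) \<partial>tor) = - (\<integral>x. G2 x * \<phi> x \<partial>tor)" if \<phi>: "C1_periodic L \<phi>" for \<phi>
 proof -
  have gc: "continuous_on UNIV (%x. fst (grad \<phi> x))" "continuous_on UNIV (%x. snd (grad \<phi> x))"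
   using \<phi> by (auto simp: C1_periodic_def intro!: continuous_intros)
  note \<phi>c = C1_continuous[OF \<phi>]
  show "(\<integral>x. g x * fst (grad \<phi> x) \<partial>tor) = - (\<integral>x. G1 x * \<phi> x \<partial>tor)"
   using lim[OF g gc(1)] tendsto_minus[OF lim[OF G1 \<phi>c]] unfolding parts_trig_poly(1)[OF \<phi>] PS_dc1 by (rule LIMSEQ_unique)
  show "(\<integral>x. g x * snd (grad \<phi> x) \<partial>tor) = - (\<integral>x. G2 x * \<phi> x \<partial>tor)"
   using lim[OF g gc(2)] tendsto_minus[OF lim[OF G2 \<phi>c]] unfolding parts_trig_poly(2)[OF \<phi>] PS_dc2 by (rule LIMSEQ_unique)
 qed
 then have "weak_gradient L g (%x. (G1 x, G2 x))" by (simp add: weak_gradient_iff represents_integrable[OF g] integrable_tor_pair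
    represents_integrable[OF G1] represents_integrable[OF G2])
 with G1 G2 show thesis by (rule that)
qed

end

lemma pos_part_sq_deriv: "((%y::real. (max 0 y)^2) has_real_derivative 2 * max 0 y) (at y)"
proof -
 consider "y > 0" | "y < 0" | "y = 0" by linarith
 then show ?thesis
 proof cases
  case 1
  have "((%y. y^2) has_real_derivative 2 * max 0 y) (at y)" using 1 by (auto intro!: derivative_eq_intros)
  then show ?thesis by (rule has_field_derivative_transform_within_open[where S="{0<..}"]) (use 1 in auto)
 next
  case 2
  have "((%y. 0) has_real_derivative 2 * max 0 y) (at y)" using 2 by (auto intro!: derivative_eq_intros)
  then show ?thesis by (rule has_field_derivative_transform_within_open[where S="{..<0}"]) (use 2 in auto)
 next
  case 3
  have "((%h::real. ((max 0 h)^2) / h) ---> 0) (at 0)"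
  proof (rule Lim_null_comparison[where g="%h::real. abs h"])
   show "eventually (%h::real. norm ((max 0 h)^2 / h) <= abs h) (at 0)" by (intro always_eventually allI) (auto simp: max_def power2_eq_square)
   show "((%h::real. abs h) ---> 0) (at 0)" by (intro tendsto_eq_intros) auto
  qed
  then show ?thesis using 3 by (simp add: has_field_derivative_iff)
 qed
qed

context flat_torus begin

text \<open>A periodic continuously differentiable function that increases with \<open>n\<close> to the indicator of \<open>(a, b)\<close> modulo the period: the inner positive part is positive exactly there.\<close>

definition bump :: "real => real => nat => real => real" where
 "bump a b n z = 1 - 1 / (1 + real n * (max 0 (cos (kp * (z - (a + b) / 2)) - cos (kp * ((b - a) / 2))))^2)"

lemma bump_deriv: "EX f'. continuous_on UNIV f' & (ALL z. (bump a b n has_real_derivative f' z) (at z))"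
proof -
 define c where "c z = cos (kp * (z - (a + b) / 2)) - cos (kp * ((b - a) / 2))" for z
 define q where "q z = 1 + real n * (max 0 (c z))^2" for z
 have q: "q z > 0" for z unfolding q_def by (intro add_pos_nonneg) auto
 have c': "(c has_real_derivative - sin (kp * (z - (a + b) / 2)) * kp) (at z)" for z unfolding c_def by (auto intro!: derivative_eq_intros)
 have cc: "continuous_on UNIV c" by (rule DERIV_continuous_on[OF c'])
 have qc: "continuous_on UNIV q" unfolding q_def by (intro continuous_intros cc)
 have "(q has_real_derivative real n * (2 * max 0 (c z) * (- sin (kp * (z - (a + b) / 2)) * kp))) (at z)" for z
  unfolding q_def using DERIV_add[OF DERIV_const[of 1] DERIV_cmult[OF DERIV_chain2[OF pos_part_sq_deriv c'], of "real n"]] by simp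
 note dq = this
 have "((%z. 1 - 1 / q z) has_real_derivative (real n * (2 * max 0 (c z) * (- sin (kp * (z - (a + b) / 2)) * kp))) / (q z * q z)) (at z)" for z
  using q[of z] by (auto intro!: derivative_eq_intros dq)
 moreover have "bump a b n = (%z. 1 - 1 / q z)" by (simp add: bump_def[abs_def] q_def c_def)
 moreover have "continuous_on UNIV (%z. (real n * (2 * max 0 (c z) * (- sin (kp * (z - (a + b) / 2)) * kp))) / (q z * q z))"
  using q by (intro continuous_intros cc qc) (metis less_irrefl mult_eq_0_iff)
 ultimately show ?thesis by auto
qed

lemma bump_periodic: "bump a b n (z + L) = bump a b n z"
proof -
 have "kp * (z + L - (a + b) / 2) = kp * (z - (a + b) / 2) + 2 * pi" using L_pos by (simp add: kp_def field_simps)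
 then show ?thesis by (simp add: bump_def)
qed

lemma bump_bound: "abs (bump a b n z) <= 1"
proof -
 define q where "q = 1 + real n * (max 0 (cos (kp * (z - (a + b) / 2)) - cos (kp * ((b - a) / 2))))^2"
 have "1 <= q" by (simp add: q_def)
 then have "0 <= 1 / q" "1 / q <= 1" by auto
 then show ?thesis unfolding bump_def q_def[symmetric] by linarith
qed

lemma bump_limit:
 assumes ab: "0 <= a" "a < b" "b <= L" and z: "0 < z" "z < L"
 shows "(%n. bump a b n z) ----> indicator {a<..<b} z"
proof -
 define m r where "m = (a + b) / 2" and "r = (b - a) / 2"
 have L2: "kp * (L / 2) = pi" using L_pos by (simp add: kp_def)
 have r: "0 < r" "r <= L / 2" using ab by (auto simp: r_def)
 have kr: "kp * r <= pi" "0 <= kp * r" using r kp_pos L2 by (metis mult_le_cancel_left_pos) (use r kp_pos in auto)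
 show ?thesis
 proof (cases "z : {a<..<b}")
  case True
  then have "abs (z - m) < r" by (auto simp: m_def r_def abs_less_iff field_simps)
  then have "kp * abs (z - m) < kp * r" using kp_pos by simp
  then have "cos (kp * r) < cos (kp * abs (z - m))" using kr kp_pos by (intro cos_monotone_0_pi) auto
  also have "cos (kp * abs (z - m)) = cos (kp * (z - m))" by (metis abs_minus_commute abs_of_nonneg abs_of_nonpos cos_minus linear minus_mult_right abs_minus_cancel)
  finally have p: "max 0 (cos (kp * (z - m)) - cos (kp * r)) > 0" by simp
  define s where "s = (max 0 (cos (kp * (z - m)) - cos (kp * r)))^2"
  have s: "s > 0" using p by (simp add: s_def)
  have "filterlim (%n. 1 + real n * s) at_top sequentially"
   by (intro filterlim_tendsto_add_at_top[OF tendsto_const] filterlim_at_top_mult_tendsto_pos[OF tendsto_const s] filterlim_real_sequentially)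
  then have "(%n. 1 / (1 + real n * s)) ----> 0" by (intro tendsto_divide_0[OF tendsto_const] filterlim_at_top_imp_at_infinity)
  then have "(%n. 1 - 1 / (1 + real n * s)) ----> 1 - 0" by (intro tendsto_intros)
  then show ?thesis using True by (simp add: bump_def m_def r_def s_def)
 next
  case False
  then have ge: "abs (z - m) >= r" by (auto simp: m_def r_def field_simps abs_if)
  have le: "abs (z - m) <= L - r" using z ab by (auto simp: m_def r_def field_simps abs_if)
  have "cos (kp * abs (z - m)) <= cos (kp * r)"
  proof (cases "abs (z - m) <= L / 2")
   case True
   then have "kp * abs (z - m) <= pi" using kp_pos L2 by (metis mult_le_cancel_left_pos)
   then show ?thesis using ge kr kp_pos by (intro cos_monotone_0_pi_le) auto
  next
   case False
   have "cos (kp * abs (z - m)) = cos (kp * (L - abs (z - m)))"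
   proof -
    have "kp * (L - abs (z - m)) = 2 * pi - kp * abs (z - m)" using L2 by (simp add: field_simps)
    then show ?thesis by (simp add: cos_diff)
   qed
   also have "... <= cos (kp * r)"
   proof (intro cos_monotone_0_pi_le)
    have "L - abs (z - m) <= L / 2" using False by simp
    then show "kp * (L - abs (z - m)) <= pi" using kp_pos L2 by (metis mult_le_cancel_left_pos)
   qed (use le kr kp_pos in auto)
   finally show ?thesis .
  qed
  also have "cos (kp * abs (z - m)) = cos (kp * (z - m))" by (metis abs_minus_commute abs_of_nonneg abs_of_nonpos cos_minus linear minus_mult_right abs_minus_cancel)
  finally have "max 0 (cos (kp * (z - m)) - cos (kp * r)) = 0" by simp
  then show ?thesis using False by (simp add: bump_def m_def r_def)
 qed
qed

lemma C1_product:
 assumes "continuous_on UNIV f'" "!!z. (f has_real_derivative f' z) (at z)"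
  "continuous_on UNIV g'" "!!z. (g has_real_derivative g' z) (at z)"
  "!!z. f (z + L) = f z" "!!z. g (z + L) = g z"
 shows "C1_periodic L (%x. f (fst x) * g (snd x))"
proof -
 have fc: "continuous_on UNIV f" by (rule DERIV_continuous_on[OF assms(2)])
 have gc: "continuous_on UNIV g" by (rule DERIV_continuous_on[OF assms(4)])
 have g: "GDERIV (%x. f (fst x) * g (snd x)) x :> (f' (fst x) * g (snd x), f (fst x) * g' (snd x))" for x
 proof -
  have 1: "((%x. f (fst x)) has_derivative (%h. f' (fst x) * fst h)) (at x)"
   by (rule has_derivative_compose[OF has_derivative_fst[OF has_derivative_ident] assms(2)[unfolded has_field_derivative_def]])
  have 2: "((%x. g (snd x)) has_derivative (%h. g' (snd x) * snd h)) (at x)"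
   by (rule has_derivative_compose[OF has_derivative_snd[OF has_derivative_ident] assms(4)[unfolded has_field_derivative_def]])
  show ?thesis unfolding gderiv_def using has_derivative_mult[OF 1 2] by (rule has_derivative_eq_rhs) (auto simp: inner_prod_def algebra_simps)
 qed
 have e: "grad (%x. f (fst x) * g (snd x)) = (%x. (f' (fst x) * g (snd x), f (fst x) * g' (snd x)))" by (rule ext) (rule grad_eqI[OF g])
 have "(%x. f (fst x) * g (snd x)) differentiable (at x)" for x using g[of x] unfolding gderiv_def differentiable_def by blast
 moreover have "continuous_on UNIV (grad (%x. f (fst x) * g (snd x)))"
  unfolding e by (intro continuous_intros continuous_on_compose2[OF assms(1)] continuous_on_compose2[OF assms(3)]
    continuous_on_compose2[OF fc] continuous_on_compose2[OF gc]) auto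
 ultimately show ?thesis using assms(5,6) by (simp add: C1_periodic_def periodic_def)
qed

lemma AE_tor_interior: "AE x in tor. x : {0<..<L} \<times> {0<..<L}"
proof -
 have box: "box (0, 0) (L, L) = {0<..<L} \<times> {0<..<L}" by (auto simp: box_def Basis_prod_def)
 have sub: "box (0, 0) (L, L) <= torus L" by (auto simp: box torus_Times)
 have m: "box (0, 0) (L, L) : sets tor" using sub by (simp add: tor_def sets_restrict_space_iff)
 have "emeasure tor (box (0, 0) (L, L)) = ennreal (L^2)" using sub L_pos by (simp add: tor_def emeasure_restrict_space emeasure_lborel_box_eq
   Basis_prod_def prod.union_disjoint inner_prod_def power2_eq_square)
 then have "emeasure tor (space tor - box (0, 0) (L, L)) = 0" using m sub sets.top[of tor] by (subst emeasure_Diff) (auto simp: emeasure_tor)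
 then have "AE x in tor. x : box (0, 0) (L, L)" using m by (intro AE_I[of _ _ "space tor - box (0, 0) (L, L)"] sets.compl_sets) auto
 then show ?thesis by (simp add: box)
qed

lemma orthogonal_test_box:
 assumes H: "integrable tor H" and ort: "!!\<phi>. C1_periodic L \<phi> ==> (\<integral>x. H x * \<phi> x \<partial>tor) = (0::real)"
  and ab: "0 <= a" "a < b" "b <= L" and cd: "0 <= c" "c < d" "d <= L"
 shows "(\<integral>x. H x * indicator ({a<..<b} \<times> {c<..<d}) x \<partial>tor) = 0"
proof -
 define \<phi> where "\<phi> n x = bump a b n (fst x) * bump c d n (snd x)" for n x
 have C1: "C1_periodic L (\<phi> n)" for n
 proof -
  obtain f' g' where "continuous_on UNIV f'" "!!z. (bump a b n has_real_derivative f' z) (at z)"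
   "continuous_on UNIV g'" "!!z. (bump c d n has_real_derivative g' z) (at z)" using bump_deriv by metis
  from C1_product[OF this bump_periodic bump_periodic] show ?thesis by (simp add: \<phi>_def[abs_def])
 qed
 note [measurable] = borel_measurable_integrable[OF H]
 have [measurable]: "\<phi> n : borel_measurable borel" for n by (rule borel_measurable_continuous_onI[OF C1_continuous[OF C1]])
 have [measurable]: "{a<..<b} \<times> {c<..<d} \<in> sets (borel :: plane measure)" unfolding borel_prod[symmetric] by measurable
 have ind: "indicator ({a<..<b} \<times> {c<..<d}) \<in> borel_measurable tor" by (intro borel_measurable_tor) measurable
 have "(%n. \<integral>x. H x * \<phi> n x \<partial>tor) ----> (\<integral>x. H x * indicator ({a<..<b} \<times> {c<..<d}) x \<partial>tor)"
 proof (rule integral_dominated_convergence[where w="%x. norm (H x)"])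
  show "AE x in tor. (%n. H x * \<phi> n x) ----> H x * indicator ({a<..<b} \<times> {c<..<d}) x" using AE_tor_interior
  proof eventually_elim
   case (elim x)
   then have "(%n. H x * \<phi> n x) ----> H x * (indicator {a<..<b} (fst x) * indicator {c<..<d} (snd x))"
    unfolding \<phi>_def by (intro tendsto_intros bump_limit ab cd) auto
   then show ?case by (simp add: indicator_times)
  qed
  have "abs (\<phi> n x) <= 1 * 1" for n x unfolding \<phi>_def abs_mult by (intro mult_mono bump_bound) auto
  then show "AE x in tor. norm (H x * \<phi> n x) <= norm (H x)" for n by (intro AE_I2) (simp add: abs_mult mult_left_le)
 qed (use H ind in \<open>auto intro!: borel_measurable_times borel_measurable_tor\<close>)
 then have "(%n. 0) ----> (\<integral>x. H x * indicator ({a<..<b} \<times> {c<..<d}) x \<partial>tor)" by (simp only: ort[OF C1])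
 then show ?thesis by (simp add: LIMSEQ_const_iff)
qed

text \<open>Products of bumps recover the integrals over all boxes, and boxes generate the Borel sets.\<close>

lemma orthogonal_test_zero:
 assumes H: "integrable tor H" and ort: "!!h. C1_periodic L h ==> (\<integral>x. H x * h x \<partial>tor) = (0::real)"
 shows "AE x in tor. H x = 0"
proof -
 define K where "K x = indicator (torus L) x * H x" for x
 have K: "integrable lborel K" using H by (simp add: K_def[abs_def] tor_def integrable_restrict_space)
 note [measurable] = borel_measurable_integrable[OF K, simplified]
 have box0: "(\<integral>x. K x * indicator (box p q) x \<partial>lborel) = 0" for p q :: plane
 proof -
  define a b c d where "a = max 0 (fst p)" "b = min L (fst q)" "c = max 0 (snd p)" "d = min L (snd q)"
  note abcd = this
  have "(\<integral>x. K x * indicator (box p q) x \<partial>lborel) = (\<integral>x. H x * indicator (box p q) x \<partial>tor)"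
   by (simp add: K_def tor_def integral_restrict_space mult_ac)
  also have "... = (\<integral>x. H x * indicator ({a<..<b} \<times> {c<..<d}) x \<partial>tor)"
  proof (rule integral_cong_AE)
   note [measurable] = borel_measurable_integrable[OF H]
   have "{a<..<b} \<times> {c<..<d} \<in> sets (borel :: plane measure)" unfolding borel_prod[symmetric] by measurable
   then show "(%x. H x * indicator ({a<..<b} \<times> {c<..<d}) x) : borel_measurable tor"
    "(%x. H x * indicator (box p q) x) : borel_measurable tor" by (auto intro!: borel_measurable_times borel_measurable_tor borel_measurable_indicator)
   show "AE x in tor. H x * indicator (box p q) x = H x * indicator ({a<..<b} \<times> {c<..<d}) x" using AE_tor_interior
    by eventually_elim (auto simp: indicator_def box_def Basis_prod_def abcd inner_prod_def)
  qed
  also have "... = 0"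
  proof (cases "a < b & c < d")
   case True
   then show ?thesis by (intro orthogonal_test_box H ort) (auto simp: abcd)
  next
   case False
   then have e: "{a<..<b} \<times> {c<..<d} = {}" by auto
   show ?thesis unfolding e by simp
  qed
  finally show ?thesis .
 qed
 define N where "N s = density lborel (%x. ennreal (s * K x))" for s
 have sN: "sets (N s) = sets borel" for s by (simp add: N_def)
 have em: "emeasure (N s) (box p q) = (\<integral>\<^sup>+x. ennreal (s * (K x * indicator (box p q) x)) \<partial>lborel)" for s p q
  unfolding N_def by (subst emeasure_density) (auto intro!: nn_integral_cong simp: indicator_def)
 have iK: "integrable lborel (%x. K x * indicator (box p q) x)" for p q using K by (intro integrable_real_mult_indicator) auto
 have "N 1 = N (- 1)"
 proof (rule measure_eqI_generator_eq[where \<Omega>=UNIV and E="range (%(a, b). box a b)" and A="%n. box (- real n, - real n) (real n, real n)"])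
  show "Int_stable (range (%(a, b). box a b :: plane set))" by (auto simp: Int_stable_def box_Int_box)
  show "sets (N 1) = sigma_sets UNIV (range (%(a, b). box a b))"
   "sets (N (- 1)) = sigma_sets UNIV (range (%(a, b). box a b))" unfolding sN by (simp_all add: borel_eq_box)
  fix X assume "X : range (%(a, b). box a b :: plane set)"
  then obtain p q where X: "X = box p q" by auto
  have "(\<integral>\<^sup>+x. ennreal (1 * (K x * indicator (box p q) x)) \<partial>lborel) = (\<integral>\<^sup>+x. ennreal (- 1 * (K x * indicator (box p q) x)) \<partial>lborel)"
  proof -
   let ?f = "%x. K x * indicator (box p q) x"
   have fin: "(\<integral>\<^sup>+x. ennreal (?f x) \<partial>lborel) < top" "(\<integral>\<^sup>+x. ennreal (- ?f x) \<partial>lborel) < top"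
    using iK[of p q] unfolding real_integrable_def by (auto simp: less_top)
   have "enn2real (\<integral>\<^sup>+x. ennreal (?f x) \<partial>lborel) = enn2real (\<integral>\<^sup>+x. ennreal (- ?f x) \<partial>lborel)"
    using box0[of p q] unfolding real_lebesgue_integral_def[OF iK] by simp
   then have "(\<integral>\<^sup>+x. ennreal (?f x) \<partial>lborel) = (\<integral>\<^sup>+x. ennreal (- ?f x) \<partial>lborel)" using fin by (metis ennreal_enn2real)
   then show ?thesis by simp
  qed
  then show "emeasure (N 1) X = emeasure (N (- 1)) X" by (simp only: X em)
 next
  fix n
  have "emeasure (N 1) (box (- real n, - real n) (real n, real n)) <= (\<integral>\<^sup>+x. ennreal (norm (K x)) \<partial>lborel)"
   unfolding em by (intro nn_integral_mono ennreal_leI) (auto simp: indicator_def)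
  also have "... < \<infinity>" using K by (simp add: integrable_iff_bounded)
  finally show "emeasure (N 1) (box (- real n, - real n) (real n, real n)) ~= \<infinity>" by simp
 next
  show "(\<Union>n. box (- real n, - real n) (real n, real n)) = (UNIV :: plane set)"
  proof (intro equalityI subsetI)
   fix x :: plane
   obtain n :: nat where "abs (fst x) + abs (snd x) < real n" using reals_Archimedean2 by blast
   then have "x : box (- real n, - real n) (real n, real n)" by (cases x) (auto simp: box_def Basis_prod_def)
   then show "x : (\<Union>n. box (- real n, - real n) (real n, real n))" by blast
  qed simp
 qed auto
 then have "density lborel (%x. ennreal (K x)) = density lborel (%x. ennreal (- K x))" by (simp add: N_def)
 then have "AE x in lborel. ennreal (K x) = ennreal (- K x)" by (subst (asm) sigma_finite_measure.density_unique_iff[OF sigma_finite_lborel]) auto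
 then have "AE x in lborel. K x = 0"
 proof eventually_elim
  case (elim x)
  then show ?case by (cases "K x >= 0") (auto simp: ennreal_neg)
 qed
 then show ?thesis unfolding AE_tor by eventually_elim (auto simp: K_def)
qed

lemma weak_gradient_unique:
 assumes g: "weak_gradient L g G" and h: "weak_gradient L h G'" and gh: "AE x in tor. g x = h x"
 shows "AE x in tor. G x = G' x"
proof -
 have i: "integrable tor g" "integrable tor h" "integrable tor G" "integrable tor G'" using g h by (auto simp: weak_gradient_iff)
 note i' = i(3,4)[unfolded integrable_tor_pair]
 have eq: "(\<integral>x. g x * f x \<partial>tor) = (\<integral>x. h x * f x \<partial>tor)" if "continuous_on UNIV f" for f
 proof (rule integral_cong_AE)
  show "AE x in tor. g x * f x = h x * f x" using gh by eventually_elim simp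
 qed (auto intro!: borel_measurable_integrable integrable_mult_continuous i that)
 have z: "(\<integral>x. (fst (G x) - fst (G' x)) * ph x \<partial>tor) = 0 & (\<integral>x. (snd (G x) - snd (G' x)) * ph x \<partial>tor) = 0"
  if ph: "C1_periodic L ph" for ph
 proof -
  have gc: "continuous_on UNIV (%x. fst (grad ph x))" "continuous_on UNIV (%x. snd (grad ph x))" using ph by (auto simp: C1_periodic_def intro!: continuous_intros)
  have "(\<integral>x. fst (G x) * ph x \<partial>tor) = (\<integral>x. fst (G' x) * ph x \<partial>tor)"
   "(\<integral>x. snd (G x) * ph x \<partial>tor) = (\<integral>x. snd (G' x) * ph x \<partial>tor)"
   using g h ph eq[OF gc(1)] eq[OF gc(2)] unfolding weak_gradient_iff by (metis add.inverse_inverse)+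
  then show ?thesis using i' integrable_mult_continuous[OF _ C1_continuous[OF ph]] by (simp add: left_diff_distrib)
 qed
 have "AE x in tor. fst (G x) - fst (G' x) = 0" "AE x in tor. snd (G x) - snd (G' x) = 0"
  by (rule orthogonal_test_zero[OF Bochner_Integration.integrable_diff]; use i' z in blast)+
 then show ?thesis by eventually_elim (simp add: prod_eq_iff)
qed

lemma H1_series_grad:
 assumes H1: "(%k. eigval L k * (u k)^2) summable_on modes"
 obtains G1 G2 where "represents L (dc1 u) G1" "represents L (dc2 u) G2"
  "AE x in tor. series_grad L u x = (G1 x, G2 x)" "integrable tor (series_grad L u)"
proof -
 obtain g where g: "represents L u g" using riesz_fischer[OF Hspace_1_l2[OF H1]] by metis
 obtain G1 G2 where G: "represents L (dc1 u) G1" "represents L (dc2 u) G2" "weak_gradient L g (%x. (G1 x, G2 x))" by (rule H1_weak_gradient[OF H1 g])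
 have "EX g. represents L u g & weak_gradient L g (series_grad L u)" unfolding series_grad_def by (rule someI[where x="%x. (G1 x, G2 x)"]) (use g G in blast)
 then obtain h where h: "represents L u h" "weak_gradient L h (series_grad L u)" by blast
 have "AE x in tor. series_grad L u x = (G1 x, G2 x)" using h G g by (intro weak_gradient_unique[OF h(2) G(3)] represents_unique_AE) auto
 moreover have "integrable tor (series_grad L u)" using h by (simp add: weak_gradient_iff)
 ultimately show thesis using G that by blast
qed

lemma nonlinearity_eq: "nonlinearity L u k = (\<integral>x. flux (series_grad L u x) \<bullet> grad (bf k) x \<partial>tor)"
 by (simp add: nonlinearity_def div_series_def set_integral_tor)

lemma norm_grad_e: "norm (grad (bf k) x) <= 4 * kp / L * cnorm k"
proof -
 have "norm (grad (bf k) x) <= abs (d1 k x) + abs (d2 k x)" unfolding grad_e by (rule order_trans[OF norm_Pair_le]) simp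
 also have "... <= kp * cnorm k * (2 / L) + kp * cnorm k * (2 / L)"
 proof (intro add_mono)
  have c: "abs (real_of_int (fst k)) <= cnorm k" "abs (real_of_int (snd k)) <= cnorm k" using cnorm_le_iff[of k "cnorm k"] by linarith+
  show "abs (d1 k x) <= kp * cnorm k * (2 / L)" "abs (d2 k x) <= kp * cnorm k * (2 / L)"
   unfolding d1_def d2_def abs_mult using kp_pos c by (intro mult_mono e_bound; simp)+
 qed
 finally show ?thesis by (simp add: algebra_simps)
qed

lemma norm_integral_le_nn:
 fixes f :: "plane => real"
 shows "ennreal (abs (\<integral>x. f x \<partial>tor)) <= (\<integral>\<^sup>+x. ennreal (abs (f x)) \<partial>tor)"
proof (cases "integrable tor f")
 case True then show ?thesis using integral_norm_bound_ennreal[OF True] by simp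
qed (simp add: not_integrable_integral_eq)

text \<open>The bound by the mean of the flux is what makes the nonlinearity small: the flux is small where the gradient is large.\<close>

lemma nonlinearity_le_flux:
 "ennreal (abs (nonlinearity L u k)) <= ennreal (4 * kp / L * cnorm k) * (\<integral>\<^sup>+x. ennreal (norm (flux (series_grad L u x))) \<partial>tor)"
 if "integrable tor (series_grad L u)"
proof -
 note [measurable] = borel_measurable_integrable[OF that]
 have "ennreal (abs (nonlinearity L u k)) <= (\<integral>\<^sup>+x. ennreal (abs (flux (series_grad L u x) \<bullet> grad (bf k) x)) \<partial>tor)"
  unfolding nonlinearity_eq by (rule norm_integral_le_nn)
 also have "... <= (\<integral>\<^sup>+x. ennreal (4 * kp / L * cnorm k) * ennreal (norm (flux (series_grad L u x))) \<partial>tor)"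
 proof (rule nn_integral_mono)
  fix x
  have "abs (flux (series_grad L u x) \<bullet> grad (bf k) x) <= norm (flux (series_grad L u x)) * norm (grad (bf k) x)" by (rule Cauchy_Schwarz_ineq2)
  also have "... <= norm (flux (series_grad L u x)) * (4 * kp / L * cnorm k)" by (intro mult_left_mono norm_grad_e) auto
  finally show "ennreal (abs (flux (series_grad L u x) \<bullet> grad (bf k) x)) <= ennreal (4 * kp / L * cnorm k) * ennreal (norm (flux (series_grad L u x)))"
   using kp_pos L_pos by (subst ennreal_mult[symmetric]) (auto simp: mult_ac intro!: ennreal_leI)
 qed
 also have "... = ennreal (4 * kp / L * cnorm k) * (\<integral>\<^sup>+x. ennreal (norm (flux (series_grad L u x))) \<partial>tor)" by (rule nn_integral_cmult) measurable
 finally show ?thesis .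
qed

lemma nonlinearity_bound: "abs (nonlinearity L u k) <= 2 * kp * L * cnorm k"
proof -
 have "ennreal (abs (nonlinearity L u k)) <= (\<integral>\<^sup>+x. ennreal (abs (flux (series_grad L u x) \<bullet> grad (bf k) x)) \<partial>tor)"
  unfolding nonlinearity_eq by (rule norm_integral_le_nn)
 also have "... <= (\<integral>\<^sup>+x. ennreal (2 * kp / L * cnorm k) \<partial>tor)"
 proof (intro nn_integral_mono ennreal_leI)
  fix x
  have "abs (flux (series_grad L u x) \<bullet> grad (bf k) x) <= norm (flux (series_grad L u x)) * norm (grad (bf k) x)" (is "?l <= _") by (rule Cauchy_Schwarz_ineq2)
  also have "... <= (1 / 2) * (4 * kp / L * cnorm k)" by (intro mult_mono norm_grad_e norm_flux_le_half) auto
  finally show "?l <= 2 * kp / L * cnorm k" by simp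
 qed
 also have "... = ennreal (2 * kp / L * cnorm k * L^2)" using kp_pos L_pos by (simp add: emeasure_tor flip: ennreal_mult)
 also have "2 * kp / L * cnorm k * L^2 = 2 * kp * L * cnorm k" using L_pos by (simp add: power2_eq_square)
 finally show ?thesis using kp_pos L_pos by (subst (asm) ennreal_le_iff) auto
qed

definition gradPS :: "nat => series => plane => plane" where
 "gradPS n u x = (PS (square n) (dc1 u) x, PS (square n) (dc2 u) x)"

lemma gradPS_measurable [measurable]: "gradPS n u : borel_measurable borel" unfolding gradPS_def[abs_def] by measurable

text \<open>The flux is Lipschitz and the gradients of the partial sums converge in mean, so the mean flux even converges.\<close>

lemma flux_liminf:
 assumes H1: "(%k. eigval L k * (u k)^2) summable_on modes"
 shows "(\<integral>\<^sup>+x. ennreal (norm (flux (series_grad L u x))) \<partial>tor)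
   <= liminf (%n. \<integral>\<^sup>+x. ennreal (norm (flux (gradPS n u x))) \<partial>tor)"
proof -
 obtain G1 G2 where G: "represents L (dc1 u) G1" "represents L (dc2 u) G2"
  "AE x in tor. series_grad L u x = (G1 x, G2 x)" "integrable tor (series_grad L u)" by (rule H1_series_grad[OF H1])
 note [measurable] = G(1,2)[THEN represents_measurable]
 define D where "D n = (\<integral>\<^sup>+x. ennreal (abs (G1 x - PS (square n) (dc1 u) x)) \<partial>tor) + (\<integral>\<^sup>+x. ennreal (abs (G2 x - PS (square n) (dc2 u) x)) \<partial>tor)" for n
 have D0: "D ----> 0 + 0" unfolding D_def by (intro tendsto_add dist2_L1_tendsto represents_square_limit G) auto
 define Q where "Q n = (\<integral>\<^sup>+x. ennreal (norm (flux (gradPS n u x))) \<partial>tor)" for n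
 have le: "(\<integral>\<^sup>+x. ennreal (norm (flux (series_grad L u x))) \<partial>tor) <= Q n + D n" for n
 proof -
  have "(\<integral>\<^sup>+x. ennreal (norm (flux (series_grad L u x))) \<partial>tor) = (\<integral>\<^sup>+x. ennreal (norm (flux (G1 x, G2 x))) \<partial>tor)"
   by (rule nn_integral_cong_AE, use G(3) in eventually_elim) simp
  also have "... <= (\<integral>\<^sup>+x. ennreal (norm (flux (gradPS n u x))) +
    (ennreal (abs (G1 x - PS (square n) (dc1 u) x)) + ennreal (abs (G2 x - PS (square n) (dc2 u) x))) \<partial>tor)"
  proof (rule nn_integral_mono)
   fix x
   have "norm (flux (G1 x, G2 x)) <= norm (flux (gradPS n u x)) + norm ((G1 x, G2 x) - gradPS n u x)"
    using norm_flux_lipschitz[of "(G1 x, G2 x)" "gradPS n u x"] by linarith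
   also have "norm ((G1 x, G2 x) - gradPS n u x) <= abs (G1 x - PS (square n) (dc1 u) x) + abs (G2 x - PS (square n) (dc2 u) x)"
    unfolding gradPS_def diff_Pair by (rule order_trans[OF norm_Pair_le]) simp
   finally show "ennreal (norm (flux (G1 x, G2 x))) <= ennreal (norm (flux (gradPS n u x))) +
    (ennreal (abs (G1 x - PS (square n) (dc1 u) x)) + ennreal (abs (G2 x - PS (square n) (dc2 u) x)))"
    by (simp flip: ennreal_plus)
  qed
  also have "... = Q n + D n" unfolding Q_def D_def by (simp add: nn_integral_add)
  finally show ?thesis .
 qed
 have "(\<integral>\<^sup>+x. ennreal (norm (flux (series_grad L u x))) \<partial>tor) <= liminf Q"
 proof (rule ennreal_le_epsilon)
  fix d :: real assume "0 < d"
  then have ev: "eventually (%n. D n <= ennreal d) sequentially" using D0 by (simp add: tendsto_0_ennreal_iff)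
  have "(\<integral>\<^sup>+x. ennreal (norm (flux (series_grad L u x))) \<partial>tor) <= liminf (%n. Q n + ennreal d)" (is "?l <= _")
   by (rule Liminf_bounded, use ev in eventually_elim) (rule order_trans[OF le add_left_mono])
  also have "... = liminf Q + ennreal d" by (rule Liminf_add_const) auto
  finally show "?l <= liminf Q + ennreal d" .
 qed
 then show ?thesis by (simp add: Q_def[abs_def])
qed

end

lemma periodic_shift_int:
 assumes "periodic L g"
 shows "g (x + of_int m * L, y + of_int n * L) = g (x, y)"
proof -
 have p: "g (x + L, y) = g (x, y)" "g (x, y + L) = g (x, y)" for x y using assms by (auto simp: periodic_def)
 have n1: "g (x + real j * L, y) = g (x, y)" "g (x, y + real j * L) = g (x, y)" for x y j
 proof (induction j)
  case (Suc j)
  { case 1 then show ?case using p(1)[of "x + real j * L" y] Suc by (simp add: algebra_simps) }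
  { case 2 then show ?case using p(2)[of x "y + real j * L"] Suc by (simp add: algebra_simps) }
 qed auto
 have 1: "g (x + of_int m * L, y) = g (x, y)" for x y m
 proof (cases "m >= 0")
  case True then show ?thesis using n1(1)[of x "nat m" y] by simp
 next
  case False then show ?thesis using n1(1)[of "x + of_int m * L" "nat (- m)" y] by simp
 qed
 have 2: "g (x, y + of_int m * L) = g (x, y)" for x y m
 proof (cases "m >= 0")
  case True then show ?thesis using n1(2)[of x y "nat m"] by simp
 next
  case False then show ?thesis using n1(2)[of x "y + of_int m * L" "nat (- m)"] by simp
 qed
 show ?thesis by (simp add: 1 2)
qed

context flat_torus begin

lemma periodic_reduce:
 obtains y where "y : torus L" "!!g. periodic L g ==> g x = (g y :: 'b)"
proof -
 define r where "r s = s - of_int \<lfloor>s / L\<rfloor> * L" for s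
 have r: "0 <= r s" "r s <= L" for s
 proof -
  have "of_int \<lfloor>s / L\<rfloor> * L <= s / L * L" "s / L * L <= (of_int \<lfloor>s / L\<rfloor> + 1) * L" using L_pos by (intro mult_right_mono; linarith)+
  then show "0 <= r s" "r s <= L" using L_pos by (auto simp: r_def algebra_simps)
 qed
 show thesis
 proof (rule that)
  show "(r (fst x), r (snd x)) \<in> torus L" using r by (simp add: torus_Times)
  fix g :: "plane => 'b" assume g: "periodic L g"
  show "g x = g (r (fst x), r (snd x))" using periodic_shift_int[OF g, of "r (fst x)" "\<lfloor>fst x / L\<rfloor>" "r (snd x)" "\<lfloor>snd x / L\<rfloor>"]
   by (simp add: r_def)
 qed
qed

lemma PS_periodic: "periodic L (PS F u)" using e_periodic by (simp add: periodic_def)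

lemma PS_abs_le: "abs (PS F u x) <= 2 / L * (SUM k:F. abs (u k))"
proof -
 have "abs (PS F u x) <= (SUM k:F. abs (u k * bf k x))" by (rule sum_abs)
 also have "... <= (SUM k:F. 2 / L * abs (u k))" unfolding abs_mult by (rule sum_mono) (metis e_bound abs_ge_zero mult.commute mult_left_mono)
 finally show ?thesis by (simp add: sum_distrib_left)
qed

section \<open>Absolutely convergent series\<close>

definition series_sum :: "series => plane => real" where
 "series_sum c x = (\<Sum>\<^sub>\<infinity>k\<in>modes. c k * bf k x)"

lemma series_sum_limit:
 assumes "(%k. abs (c k)) summable_on modes"
 shows "(%n. PS (square n) c x) ----> series_sum c x" unfolding series_sum_def by (rule summable_square_limit[OF abs_summable_PS(1)[OF assms]])

lemma series_sum_periodic: "periodic L (series_sum c)" using e_periodic by (simp add: periodic_def series_sum_def)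

lemma series_sum_uniform_limit:
 fixes c :: "'a => series"
 assumes b: "b summable_on modes" and cb: "!!p k. p : A ==> k : modes ==> abs (c p k) <= b k"
 shows "uniform_limit (A \<times> UNIV) (%n (p, x). PS (square n) (c p) x) (%(p, x). series_sum (c p) x) sequentially"
proof (rule uniform_limitI)
 fix h :: real assume h: "h > 0"
 show "\<forall>\<^sub>F n in sequentially. ALL y:A \<times> UNIV. dist ((%(p, x). PS (square n) (c p) x) y) ((%(p, x). series_sum (c p) x) y) < h"
 proof (cases "A = {}")
  case False
  then have b0: "0 <= b k" if "k : modes" for k using cb that by fastforce
  obtain m where m: "!!F. finite F ==> F <= modes ==> F \<inter> square m = {} ==> sum b F < h * L / 4"
   by (rule tail_small[OF b0 b, of "h * L / 4"]) (use h L_pos in auto)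
  have "dist (PS (square n) (c p) x) (series_sum (c p) x) < h" if n: "n >= m" and p: "p : A" for n p x
  proof -
   have s: "(%k. abs (c p k)) summable_on modes" using cb p by (intro summable_on_comparison_test[OF b]) auto
   have "(%N. abs (PS (square N) (c p) x - PS (square n) (c p) x)) ----> (abs (series_sum (c p) x - PS (square n) (c p) x))" by (intro tendsto_intros series_sum_limit s)
   moreover have "abs (PS (square N) (c p) x - PS (square n) (c p) x) <= h / 2" if "N >= n" for N
   proof -
    have "PS (square N) (c p) x - PS (square n) (c p) x = PS (square N - square n) (c p) x" using square_mono[OF that] by (simp add: sum_diff)
    then have "abs (PS (square N) (c p) x - PS (square n) (c p) x) <= 2 / L * (SUM k:square N - square n. abs (c p k))" by (simp only: PS_abs_le)
    also have "... <= 2 / L * (SUM k:square N - square n. b k)" using cb[OF p] square_modes[of N] L_pos by (intro mult_left_mono sum_mono) (blast, simp)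
    also have "... <= 2 / L * (h * L / 4)"
    proof (intro mult_left_mono less_imp_le[OF m])
     show "square N - square n <= modes" using square_modes by blast
     show "(square N - square n) \<inter> square m = {}" using square_mono[OF n] by blast
    qed (use L_pos in auto)
    finally show ?thesis using L_pos by simp
   qed
   ultimately have "abs (series_sum (c p) x - PS (square n) (c p) x) <= h / 2" by (intro LIMSEQ_le_const2) auto
   then show ?thesis using h by (simp add: dist_real_def abs_minus_commute)
  qed
  note d = this
  show ?thesis unfolding eventually_sequentially
  proof (intro exI[of _ m] allI impI ballI)
   fix n and y :: "'a \<times> plane" assume "n >= m" "y : A \<times> UNIV"
   then show "dist ((%(p, x). PS (square n) (c p) x) y) ((%(p, x). series_sum (c p) x) y) < h" using d[of n "fst y" "snd y"] by (simp add: case_prod_beta' mem_Times_iff)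
  qed
 qed simp
qed

lemma series_sum_continuous:
 fixes c :: "'a::topological_space => series"
 assumes "b summable_on modes" and "!!p k. p : A ==> k : modes ==> abs (c p k) <= b k"
  and c: "!!k. k : modes ==> continuous_on A (%p. c p k)"
 shows "continuous_on (A \<times> UNIV) (%(p, x). series_sum (c p) x)"
proof (rule uniform_limit_theorem[OF _ series_sum_uniform_limit[OF assms(1,2)]])
 have "continuous_on (A \<times> UNIV) (%z. PS (square n) (c (fst z)) (snd z))" for n using square_modes by (intro continuous_intros continuous_on_compose2[OF c]) auto
 then show "\<forall>\<^sub>F n in sequentially. continuous_on (A \<times> UNIV) (%(p, x). PS (square n) (c p) x)" by (simp add: case_prod_beta')
qed auto

text \<open>The square partial sums converge uniformly, by absolute summability.\<close>

lemma series_sum_represents: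
 assumes s: "(%k. abs (c k)) summable_on modes"
 shows "represents L c (series_sum c)"
proof (rule represents_uniform_limit)
 have "continuous_on ({0::real} \<times> UNIV) (%(p, x). series_sum c x)" by (rule series_sum_continuous[OF s]) auto
 then have "continuous_on UNIV (%x. (%(p, x). series_sum c x) (0::real, x))" by (rule continuous_on_compose2) (auto intro!: continuous_intros)
 then have "continuous_on UNIV (series_sum c)" by simp
 then show "series_sum c : borel_measurable tor" by (intro borel_measurable_tor borel_measurable_continuous_onI)
 fix d :: real assume d: "d > 0"
 define \<eta> where "\<eta> = min 1 d"
 have \<eta>: "\<eta> > 0" "\<eta>^2 <= d" using d by (auto simp: \<eta>_def min_def power2_eq_square mult_left_le)
 obtain m where m: "!!F. finite F ==> F <= modes ==> F \<inter> square m = {} ==> (SUM k:F. abs (c k)) < \<eta>" by (rule tail_small[OF _ s \<eta>(1)]) auto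
 have "uniform_limit ({0::real} \<times> UNIV) (%n (p, x). PS (square n) c x) (%(p, x). series_sum c x) sequentially" by (rule series_sum_uniform_limit[OF s]) auto
 from uniform_limitD[OF this \<eta>(1)] obtain n0 where n0: "!!n x. n >= n0 ==> dist (PS (square n) c x) (series_sum c x) < \<eta>"
  by (auto simp: eventually_sequentially)
 define n where "n = max m n0"
 let ?c = "%k. if k : square n then c k else 0"
 have 1: "represents L ?c (PS (square n) c)" by (rule represents_finite) (auto simp: square_modes)
 have 2: "(series_sum c x - PS (square n) c x)^2 <= d" for x
 proof -
  have "abs (series_sum c x - PS (square n) c x) <= \<eta>" using n0[of n x] by (simp add: n_def dist_real_def abs_minus_commute)
  then have "(series_sum c x - PS (square n) c x)^2 <= \<eta>^2" by (rule power2_le_iff_abs_le[THEN iffD2, rotated]) (use \<eta> in auto)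
  then show ?thesis using \<eta> by simp
 qed
 have 3: "(SUM k:F. (c k - ?c k)^2) <= d" if F: "finite F" "F <= modes" for F
 proof -
  have "(SUM k:F. (c k - ?c k)^2) = (SUM k:F - square n. (c k)^2)" using F by (intro sum.mono_neutral_cong_right) auto
  also have "... <= (SUM k:F - square n. abs (c k))^2"
  proof -
   let ?F = "F - square n"
   have "(SUM k:?F. (c k)^2) <= (SUM k:?F. abs (c k) * (SUM k:?F. abs (c k)))"
   proof (rule sum_mono)
    fix k assume "k : ?F"
    then have "abs (c k) <= (SUM k:?F. abs (c k))" using F by (intro member_le_sum) auto
    then have "abs (c k) * abs (c k) <= abs (c k) * (SUM k:?F. abs (c k))" by (rule mult_left_mono) simp
    then show "(c k)^2 <= abs (c k) * (SUM k:?F. abs (c k))" by (simp add: power2_eq_square)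
   qed
   then show ?thesis by (simp add: power2_eq_square sum_distrib_right)
  qed
  also have "... <= \<eta>^2"
  proof (rule power_mono)
   have "(F - square n) \<inter> square m = {}" using square_mono[of m n] by (auto simp: n_def)
   then show "(SUM k:F - square n. abs (c k)) <= \<eta>" using F by (intro less_imp_le[OF m]) (blast | simp)+
  qed (simp add: sum_nonneg)
  finally show ?thesis using \<eta> by simp
 qed
 show "EX c' h. represents L c' h & (ALL x:torus L. (series_sum c x - h x)^2 <= d) &
    (ALL F. finite F --> F <= modes --> (SUM k:F. (c k - c' k)^2) <= d)"
  using 1 2 3 by blast
qed

section \<open>The Fejer kernel\<close>

definition fj :: "nat => int => real" where "fj N j = max 0 (1 - abs (real_of_int j) / real N)"
definition fej :: "nat => idx => real" where "fej N k = fj N (fst k) * fj N (snd k)"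
definition fker :: "nat => real => real => real" where
 "fker N a b = (SUM j:{- int N..int N}. fj N j * trig L j a * trig L j b)"

lemma fj_bounds: "0 <= fj N j" "fj N j <= 1" by (auto simp: fj_def)
lemma fj_uminus [simp]: "fj N (- j) = fj N j" by (simp add: fj_def)

lemma fej_bounds: "0 <= fej N k" "fej N k <= 1" using fj_bounds by (auto simp: fej_def mult_le_one)

lemma fej_zero: "N >= 1 ==> cnorm k >= N ==> fej N k = 0"
proof -
 assume N: "N >= 1" "cnorm k >= N"
 then have "real N <= abs (real_of_int (fst k)) \<or> real N <= abs (real_of_int (snd k))" by (auto simp: cnorm_def max_def split: if_splits)
 then show ?thesis using N by (auto simp: fej_def fj_def)
qed

lemma fej_near_one: "N >= 1 ==> 1 - fej N k <= 2 * cnorm k / N"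
proof -
 assume N: "N >= 1"
 have c: "abs (real_of_int (fst k)) <= cnorm k" "abs (real_of_int (snd k)) <= cnorm k" using cnorm_le_iff[of k "cnorm k"] by linarith+
 have *: "1 - fj N j <= cnorm k / N" if "abs (real_of_int j) <= cnorm k" for j
 proof -
  have "1 - fj N j <= abs (real_of_int j) / N" by (simp add: fj_def)
  also have "... <= cnorm k / N" using that by (intro divide_right_mono) auto
  finally show ?thesis .
 qed
 have "1 - fej N k = (1 - fj N (fst k)) + fj N (fst k) * (1 - fj N (snd k))" by (simp add: fej_def algebra_simps)
 also have "... <= cnorm k / N + 1 * (cnorm k / N)" using fj_bounds c by (intro add_mono mult_mono *) auto
 finally show ?thesis by simp
qed

text \<open>The Fejer kernel is a squared modulus, hence nonnegative; nonnegativity is the reason for using it.\<close>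

lemma fejer_square_identity:
 "real N + 2 * (\<Sum>j=1..N. (real N - real j) * cos (real j * z))
  = (SUM n<N. cos (real n * z))^2 + (SUM n<N. sin (real n * z))^2"
proof (induction N)
 case (Suc N)
 let ?C = "SUM n<N. cos (real n * z)" and ?S = "SUM n<N. sin (real n * z)"
 have "real (Suc N) + 2 * (\<Sum>j=1..Suc N. (real (Suc N) - real j) * cos (real j * z))
   = real (Suc N) + 2 * (\<Sum>j=1..N. (real (Suc N) - real j) * cos (real j * z))" by simp
 also have "... = (real N + 2 * (\<Sum>j=1..N. (real N - real j) * cos (real j * z))) + (1 + 2 * (\<Sum>j=1..N. cos (real j * z)))"
 proof -
  have "(\<Sum>j=1..N. (real (Suc N) - real j) * cos (real j * z)) = (\<Sum>j=1..N. (real N - real j) * cos (real j * z)) + (\<Sum>j=1..N. cos (real j * z))"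
   unfolding sum.distrib[symmetric] by (intro sum.cong refl) (simp add: algebra_simps)
  then show ?thesis by simp
 qed
 also have "... = ?C^2 + ?S^2 + (1 + 2 * (\<Sum>j=1..N. cos (real j * z)))" by (simp only: Suc.IH)
 also have "(\<Sum>j=1..N. cos (real j * z)) = (SUM n<N. cos (real (N - n) * z))" by (rule sum.reindex_bij_witness[of _ "%n. N - n" "%j. N - j"]) auto
 also have "... = (SUM n<N. cos (real N * z) * cos (real n * z) + sin (real N * z) * sin (real n * z))"
  by (intro sum.cong) (auto simp: of_nat_diff left_diff_distrib cos_diff)
 also have "... = cos (real N * z) * ?C + sin (real N * z) * ?S" by (simp add: sum.distrib sum_distrib_left)
 also have "?C^2 + ?S^2 + (1 + 2 * (cos (real N * z) * ?C + sin (real N * z) * ?S))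
   = (?C + cos (real N * z))^2 + (?S + sin (real N * z))^2"
 proof -
  have "(cos (real N * z))^2 + (sin (real N * z))^2 = 1" by simp
  then show ?thesis unfolding power2_sum by argo
 qed
 finally show ?case by simp
qed simp

lemma trig_pair: "j ~= 0 ==> trig L j a * trig L j b + trig L (- j) a * trig L (- j) b = 2 / L * cos (kp * j * (a - b))"
proof -
 assume j: "j ~= 0"
 have s: "sqrt (2 / L) * sqrt (2 / L) = 2 / L" using L_pos by simp
 have "cos (kp * j * (a - b)) = cos (kp * j * a) * cos (kp * j * b) + sin (kp * j * a) * sin (kp * j * b)" by (simp only: right_diff_distrib cos_diff)
 then have "2 / L * cos (kp * j * (a - b)) = (sqrt (2 / L) * cos (kp * j * a)) * (sqrt (2 / L) * cos (kp * j * b)) + (sqrt (2 / L) * sin (kp * j * a)) * (sqrt (2 / L) * sin (kp * j * b))"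
  by (subst s[symmetric]) (simp only: algebra_simps)
 then show ?thesis using j by (auto simp: trig_alt)
qed

lemma sum_symmetric_int:
 fixes f :: "int => real"
 shows "(SUM j:{- int N..int N}. f j) = f 0 + (\<Sum>j=1..N. f (int j) + f (- int j))"
proof (induction N)
 case (Suc N)
 have "{- int (Suc N)..int (Suc N)} = insert (int (Suc N)) (insert (- int (Suc N)) {- int N..int N})" by auto
 then show ?case using Suc by simp
qed simp

lemma fker_formula:
 assumes "N >= 1"
 shows "fker N a b = 1 / (L * N) * ((SUM n<N. cos (real n * (kp * (a - b))))^2 + (SUM n<N. sin (real n * (kp * (a - b))))^2)"
proof -
 let ?z = "kp * (a - b)"
 have "fker N a b = 1 / L + (\<Sum>j=1..N. fj N (int j) * (trig L (int j) a * trig L (int j) b + trig L (- int j) a * trig L (- int j) b))"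
  using L_pos unfolding fker_def sum_symmetric_int by (simp add: fj_def trig_alt[of 0] algebra_simps)
 also have "... = 1 / L + (\<Sum>j=1..N. (1 - real j / N) * (2 / L * cos (real j * ?z)))"
  using assms by (intro arg_cong2[where f="(+)"] refl sum.cong) (auto simp: trig_pair fj_def mult_ac)
 also have "... = 1 / (L * N) * (real N + 2 * (\<Sum>j=1..N. (real N - real j) * cos (real j * ?z)))"
  using assms L_pos by (simp add: sum_distrib_left distrib_left) (intro sum.cong refl, simp add: field_simps)
 finally show ?thesis by (simp only: fejer_square_identity)
qed

lemma fker_nonneg: "N >= 1 ==> 0 <= fker N a b" using L_pos by (simp add: fker_formula)

lemma int1_sum:
 assumes "!!j. j : J ==> continuous_on UNIV (f j)"
 shows "int1 (%x. SUM j:J. f j x) = (SUM j:J. int1 (f j))" unfolding int1_def sum_distrib_right by (intro Bochner_Integration.integral_sum int1_integrable assms)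

lemma int1_trig: "int1 (trig L j) = (if j = 0 then sqrt L else 0)"
proof -
 have "int1 (%z. trig L 0 z * trig L j z) = 1 / sqrt L * int1 (trig L j)" by (simp add: trig_alt[of 0] int1_cmult[of "1 / sqrt L" "trig L j", simplified])
 then show ?thesis using trig_orthonormal[of 0 j] L_pos by (auto simp: field_simps split: if_splits)
qed

lemma fker_integral: "int1 (fker N a) = 1"
proof -
 have "int1 (fker N a) = (SUM j:{- int N..int N}. int1 (%b. fj N j * trig L j a * trig L j b))" unfolding fker_def[abs_def] by (rule int1_sum) (intro continuous_intros)
 also have "... = (SUM j:{- int N..int N}. if j = 0 then 1 else 0)" using L_pos by (intro sum.cong refl) (simp add: int1_cmult int1_trig fj_def trig_alt[of 0])
 finally show ?thesis by simp
qed

abbreviation fbox :: "nat => idx set" where "fbox N \<equiv> {- int N..int N} \<times> {- int N..int N}"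

lemma fker2: "(SUM k:fbox N. (fej N k * bf k x) * bf k y) = fker N (fst x) (fst y) * fker N (snd x) (snd y)" unfolding fker_def sum_product sum.cartesian_product
 by (intro sum.cong) (auto simp: fej_def basis_fun_def)

lemma fker2_integral: "(\<integral>y. fker N (fst x) (fst y) * fker N (snd x) (snd y) \<partial>tor) = 1"
proof -
 have c: "continuous_on A (%y. fker N a (f y))" if "continuous_on A f" for A f a unfolding fker_def by (intro continuous_intros that)
 have "(\<integral>y. fker N (fst x) (fst y) * fker N (snd x) (snd y) \<partial>tor) = int1 (%a. int1 (%b. fker N (fst x) a * fker N (snd x) b))"
  by (subst integral_tor_Fubini(1)) (auto intro!: continuous_intros c)
 also have "... = int1 (%a. fker N (fst x) a)" by (simp add: int1_cmult fker_integral)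
 finally show ?thesis using fker_integral[of N "fst x"] by simp
qed

definition fejer_mean :: "nat => series => plane => real" where
 "fejer_mean N u = PS (square N) (%k. fej N k * u k)"

lemma fbox_square: "fbox N = insert (0, 0) (square N)" "(0, 0) \<notin> square N" by (auto simp: square_def modes_def cnorm_le_iff)

lemma fejer_mean_larger:
 assumes "N >= 1" "M >= N" shows "fejer_mean N u x = PS (square M) (%k. fej N k * u k) x" unfolding fejer_mean_def
proof (rule sum.mono_neutral_left[OF finite_square square_mono[OF assms(2)]], intro ballI)
 fix k assume "k : square M - square N"
 then have "cnorm k >= N" by (auto simp: square_def)
 then show "fej N k * u k * bf k x = 0" using fej_zero[OF assms(1)] by simp
qed

lemma bij_flip_fbox: "bij_betw flip1 (fbox N) (fbox N)" "bij_betw flip2 (fbox N) (fbox N)"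
 by (rule bij_betw_byWitness[where f'=flip1] bij_betw_byWitness[where f'=flip2]; force simp: flip1_def flip2_def)+

text \<open>The gradient of a Fejer mean is the convolution of the weak gradient with a probability kernel, so it inherits the bound of the weak gradient.\<close>

lemma fejer_gradient_bound:
 assumes u0: "u (0, 0) = 0" and g: "represents L u g" and G: "weak_gradient L g G"
  and K: "AE x in tor. norm (G x) <= K" and N: "N >= 1"
 shows "abs (SUM k:square N. (fej N k * u k) * d1 k x) <= K" "abs (SUM k:square N. (fej N k * u k) * d2 k x) <= K"
proof -
 have gi: "integrable tor g" and Gi: "integrable tor G" using G by (auto simp: weak_gradient_iff)
 define \<phi> where "\<phi> y = (SUM k:fbox N. (fej N k * bf k x) * bf k y)" for y
 have \<phi>C: "C1_periodic L \<phi>" unfolding \<phi>_def[abs_def] by (rule trig_poly_C1)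
 have grad\<phi>: "grad \<phi> y = (SUM k:fbox N. (fej N k * bf k x) * d1 k y, SUM k:fbox N. (fej N k * bf k x) * d2 k y)" for y
  unfolding \<phi>_def[abs_def] by (rule grad_eqI[OF trig_poly_gderiv])
 have coeff: "u k = (\<integral>y. g y * bf k y \<partial>tor)" for k using represents_coeff[OF g, of k] u0 by (cases "k : modes") (auto simp: modes_def)
 have \<phi>0: "0 <= \<phi> y" for y unfolding \<phi>_def fker2 using fker_nonneg[OF N] by simp
 have \<phi>1: "(\<integral>y. \<phi> y \<partial>tor) = 1" unfolding \<phi>_def fker2 by (rule fker2_integral)
 have ii: "integrable tor (%y. h y * f y)" if "integrable tor h" "continuous_on UNIV f" for h f :: "plane => real" using that by (rule integrable_mult_continuous)
 have pull: "(SUM k:fbox N. (fej N k * u k) * D k) = (\<integral>y. g y * (SUM k:fbox N. fej N k * bf k y * D k) \<partial>tor)" for D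
 proof -
  have "(\<integral>y. g y * (SUM k:fbox N. fej N k * bf k y * D k) \<partial>tor) = (\<integral>y. (SUM k:fbox N. (fej N k * D k) * (g y * bf k y)) \<partial>tor)"
   by (simp add: sum_distrib_left mult_ac)
  also have "... = (SUM k:fbox N. (fej N k * D k) * (\<integral>y. g y * bf k y \<partial>tor))"
   by (subst Bochner_Integration.integral_sum) (auto intro!: ii gi e_continuous)
  also have "... = (SUM k:fbox N. (fej N k * u k) * D k)" by (simp add: coeff[symmetric] mult_ac)
  finally show ?thesis ..
 qed
 have Kb: "abs (\<integral>y. h y * \<phi> y \<partial>tor) <= K" if hK: "AE y in tor. abs (h y) <= K" and h: "integrable tor h" for h
 proof -
  have "norm (\<integral>y. h y * \<phi> y \<partial>tor) <= (\<integral>y. norm (h y * \<phi> y) \<partial>tor)" by (rule integral_norm_bound)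
  also have "... <= (\<integral>y. K * \<phi> y \<partial>tor)"
  proof (rule integral_mono_AE)
   show "integrable tor (%y. norm (h y * \<phi> y))" using ii[OF h C1_continuous[OF \<phi>C]] by simp
   show "integrable tor (%y. K * \<phi> y)" using continuous_integrable_tor[OF C1_continuous[OF \<phi>C]] by simp
   show "AE y in tor. norm (h y * \<phi> y) <= K * \<phi> y" using hK by eventually_elim (use \<phi>0 in \<open>auto simp: abs_mult intro!: mult_right_mono\<close>)
  qed
  finally show ?thesis using \<phi>1 by simp
 qed
 have Gi': "integrable tor (%y. fst (G y))" "integrable tor (%y. snd (G y))" using Gi[unfolded integrable_tor_pair] by (rule conjunct1, rule conjunct2)
 have nb: "AE y in tor. abs (fst (G y)) <= K" "AE y in tor. abs (snd (G y)) <= K"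
 proof -
  have "abs (fst z) <= norm z" "abs (snd z) <= norm z" for z :: plane using norm_fst_le[of "fst z" "snd z"] norm_snd_le[of "snd z" "fst z"] by simp_all
  note n = this
  show "AE y in tor. abs (fst (G y)) <= K" "AE y in tor. abs (snd (G y)) <= K" by (rule eventually_mono[OF K], rule order_trans[OF n(1)], assumption)
     (rule eventually_mono[OF K], rule order_trans[OF n(2)], assumption)
 qed
 have ins: "(SUM k:square N. (fej N k * u k) * D k) = (SUM k:fbox N. (fej N k * u k) * D k)" for D unfolding fbox_square(1) using fbox_square(2) u0 by simp
 have "(SUM k:fbox N. fej N k * bf k y * d1 k x) = - fst (grad \<phi> y)" for y
 proof -
  have "(SUM k:fbox N. fej N k * bf k y * d1 k x) = (SUM k:fbox N. fej N (flip1 k) * bf (flip1 k) y * d1 (flip1 k) x)"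
   by (rule sum.reindex_bij_betw[OF bij_flip_fbox(1), symmetric])
  also have "... = - fst (grad \<phi> y)" unfolding grad\<phi> fst_conv sum_negf[symmetric] by (intro sum.cong refl) (simp add: d1_flip fej_def)
  finally show ?thesis .
 qed
 then have "(SUM k:square N. (fej N k * u k) * d1 k x) = - (\<integral>y. g y * fst (grad \<phi> y) \<partial>tor)" unfolding ins pull by simp
 also have "... = (\<integral>y. fst (G y) * \<phi> y \<partial>tor)" using G \<phi>C by (simp add: weak_gradient_iff)
 finally show "abs (SUM k:square N. (fej N k * u k) * d1 k x) <= K" using Kb[OF nb(1) Gi'(1)] by simp
 have "(SUM k:fbox N. fej N k * bf k y * d2 k x) = - snd (grad \<phi> y)" for y
 proof -
  have "(SUM k:fbox N. fej N k * bf k y * d2 k x) = (SUM k:fbox N. fej N (flip2 k) * bf (flip2 k) y * d2 (flip2 k) x)"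
   by (rule sum.reindex_bij_betw[OF bij_flip_fbox(2), symmetric])
  also have "... = - snd (grad \<phi> y)" unfolding grad\<phi> snd_conv sum_negf[symmetric] by (intro sum.cong refl) (simp add: d2_flip fej_def)
  finally show ?thesis .
 qed
 then have "(SUM k:square N. (fej N k * u k) * d2 k x) = - (\<integral>y. g y * snd (grad \<phi> y) \<partial>tor)" unfolding ins pull by simp
 also have "... = (\<integral>y. snd (G y) * \<phi> y \<partial>tor)" using G \<phi>C by (simp add: weak_gradient_iff)
 finally show "abs (SUM k:square N. (fej N k * u k) * d2 k x) <= K" using Kb[OF nb(2) Gi'(2)] by simp
qed

lemma lipschitz_of_partials:
 fixes f :: "plane => real"
 assumes g: "!!x. GDERIV f x :> D x" and K: "!!x. abs (fst (D x)) <= K" "!!x. abs (snd (D x)) <= K"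
 shows "abs (f x - f y) <= K * (abs (fst x - fst y) + abs (snd x - snd y))"
proof -
 have 1: "norm (f (a, c) - f (b, c)) <= K * norm (a - b)" for a b c by (rule field_differentiable_bound[of UNIV "%s. f (s, c)" "%s. fst (D (s, c))"])
    (use gderiv_partials(1)[OF g] K in auto)
 have 2: "norm (f (c, a) - f (c, b)) <= K * norm (a - b)" for a b c by (rule field_differentiable_bound[of UNIV "%s. f (c, s)" "%s. snd (D (c, s))"])
    (use gderiv_partials(2)[OF g] K in auto)
 show ?thesis using 1[of "fst x" "snd x" "fst y"] 2[of "fst y" "snd x" "snd y"] by (cases x; cases y) (simp add: algebra_simps)
qed

text \<open>A Lipschitz function that is not small at a point is not small on a square around it, and the size of that square depends only on the constant.\<close>

lemma small_of_lipschitz_L2: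
 assumes \<Lambda>: "\<Lambda> >= 0" and d: "d > 0"
 obtains \<eta> where "\<eta> > 0" "!!f x. continuous_on UNIV f ==> (!!x y. abs (f x - f y) <= \<Lambda> * (abs (fst x - fst y) + abs (snd x - snd y)))
   ==> (\<integral>x. (f x)^2 \<partial>tor) <= \<eta> ==> x : torus L ==> abs (f x) <= d"
proof -
 define r where "r = min (L / 2) (d / (4 * (\<Lambda> + 1)))"
 have r: "r > 0" using L_pos \<Lambda> d by (auto simp: r_def)
 have rL: "r <= L / 2" unfolding r_def by (rule min.cobounded1)
 have "r <= d / (4 * (\<Lambda> + 1))" by (simp add: r_def)
 then have "4 * (\<Lambda> + 1) * r <= d" using \<Lambda> by (simp add: field_simps)
 then have \<Lambda>r: "\<Lambda> * (r + r) <= d / 2" using r by (simp add: algebra_simps)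
 define \<eta> where "\<eta> = (d / 2)^2 * r^2 / 2"
 show thesis
 proof (rule that[of \<eta>])
  show "\<eta> > 0" using d r by (simp add: \<eta>_def)
  fix f x assume f: "continuous_on UNIV f" "!!x y. abs (f x - f y) <= \<Lambda> * (abs (fst x - fst y) + abs (snd x - snd y))"
   "(\<integral>x. (f x)^2 \<partial>tor) <= \<eta>" "x : torus L"
  show "abs (f x) <= d"
  proof (rule ccontr)
   assume "\<not> (abs (f x)) <= d"
   define lo where "lo s = (if s <= L / 2 then s else s - r)" for s
   have lo: "0 <= lo s" "lo s + r <= L" "lo s <= s" "s <= lo s + r" if "0 <= s" "s <= L" for s using that r rL by (auto simp: lo_def)
   have x: "0 <= fst x" "fst x <= L" "0 <= snd x" "snd x <= L" using f(4) by (cases x; simp add: torus_Times)+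
   let ?Q = "cbox (lo (fst x), lo (snd x)) (lo (fst x) + r, lo (snd x) + r)"
   have Qe: "?Q = {lo (fst x)..lo (fst x) + r} \<times> {lo (snd x)..lo (snd x) + r}" by (auto simp: cbox_def Basis_prod_def)
   have Q: "?Q <= torus L" unfolding Qe torus_Times using lo(1,2)[OF x(1,2)] lo(1,2)[OF x(3,4)] by auto
   have Qs: "?Q : sets tor" using Q by (simp add: tor_def sets_restrict_space_iff)
   have "emeasure tor ?Q = ennreal (r^2)" using Q r by (simp add: tor_def emeasure_restrict_space emeasure_lborel_cbox_eq
     Basis_prod_def prod.union_disjoint inner_prod_def power2_eq_square)
   then have mQ: "measure tor ?Q = r^2" by (simp add: measure_def)
   have low: "(d / 2)^2 <= (f y)^2" if "y : ?Q" for y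
   proof -
    have y: "lo (fst x) <= fst y" "fst y <= lo (fst x) + r" "lo (snd x) <= snd y" "snd y <= lo (snd x) + r" using that unfolding Qe by (cases y; simp)+
    have "abs (fst x - fst y) <= r" "abs (snd x - snd y) <= r" using y lo(3,4) x by (smt (verit))+
    then have "\<Lambda> * (abs (fst x - fst y) + abs (snd x - snd y)) <= \<Lambda> * (r + r)" using \<Lambda> by (intro mult_left_mono) auto
    then have "abs (f x - f y) <= d / 2" using f(2)[of x y] \<Lambda>r by linarith
    then have "d / 2 <= abs (f y)" using \<open>\<not> (abs (f x)) <= d\<close> by linarith
    then show ?thesis using d by (simp add: abs_le_square_iff[symmetric])
   qed
   have "(d / 2)^2 * r^2 = (\<integral>y. (d / 2)^2 * indicator ?Q y \<partial>tor)" using Qs mQ Q by (simp add: Int_absorb2)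
   also have "... <= (\<integral>y. (f y)^2 \<partial>tor)"
    using Qs low by (intro integral_mono integrable_mult_right integrable_real_indicator continuous_integrable_tor continuous_intros f)
      (auto simp: indicator_def finT.emeasure_finite less_top[symmetric])
   also have "... <= \<eta>" by (rule f(3))
   finally have "(d / 2)^2 * r^2 <= (d / 2)^2 * r^2 / 2" by (simp add: \<eta>_def)
   moreover have "(d / 2)^2 * r^2 > 0" using d r by simp
   ultimately show False by linarith
  qed
 qed
qed

lemma l2_sum_le:
 assumes "(%k. (u k :: real)^2) summable_on modes" "finite F" "F <= modes"
 shows "(SUM k:F. (u k)^2) <= (\<Sum>\<^sub>\<infinity>k\<in>modes. (u k)^2)" using assms by (intro finite_sum_le_infsum) auto

lemma fej_l2_close:
 assumes l2: "(%k. (u k)^2) summable_on modes" and h: "h > 0"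
 obtains N0 where "N0 >= 1" "!!N F. N >= N0 ==> finite F ==> F <= modes ==> (SUM k:F. (u k - fej N k * u k)^2) <= h"
proof -
 obtain m where m: "!!F. finite F ==> F <= modes ==> F \<inter> square m = {} ==> (SUM k:F. (u k)^2) < h / 2" by (rule tail_small[OF _ l2, of "h / 2"]) (use h in auto)
 define U where "U = (\<Sum>\<^sub>\<infinity>k\<in>modes. (u k)^2)"
 have "(%N. (2 * real m / real N)^2 * U) ----> 0^2 * U"
  by (intro tendsto_intros tendsto_divide_0[OF tendsto_const] filterlim_at_top_imp_at_infinity filterlim_real_sequentially)
 then have "eventually (%N. (2 * real m / real N)^2 * U < h / 2) sequentially" using h by (intro order_tendstoD) auto
 then obtain N1 where N1: "!!N. N >= N1 ==> (2 * real m / real N)^2 * U < h / 2" by (auto simp: eventually_sequentially)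
 show thesis
 proof (rule that[of "max 1 N1"])
  fix N F assume N: "max 1 N1 <= N" and F: "finite F" "F <= modes"
  have d: "(u k - fej N k * u k)^2 = (1 - fej N k)^2 * (u k)^2" for k by (simp add: power_mult_distrib[symmetric] left_diff_distrib)
  have "(SUM k:F. (u k - fej N k * u k)^2) = (SUM k:F \<inter> square m. (u k - fej N k * u k)^2) + (SUM k:F - square m. (u k - fej N k * u k)^2)" (is "?l = _")
   using F by (simp add: sum.Int_Diff)
  also have "... <= (SUM k:F \<inter> square m. (2 * real m / real N)^2 * (u k)^2) + (SUM k:F - square m. 1 * (u k)^2)" unfolding d
  proof (intro add_mono sum_mono mult_right_mono)
   fix k assume "k : F \<inter> square m"
   then have "1 - fej N k <= 2 * real m / N" using N by (intro order_trans[OF fej_near_one divide_right_mono]) (auto simp: square_def)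
   then show "(1 - fej N k)^2 <= (2 * real m / real N)^2" using fej_bounds(2)[of N k] by (intro power_mono) auto
  next
   fix k show "(1 - fej N k)^2 <= 1" using fej_bounds[of N k] by (intro power_le_one) auto
  qed auto
  also have "... <= (2 * real m / real N)^2 * U + h / 2"
  proof (intro add_mono)
   have "(SUM k:F \<inter> square m. (u k)^2) <= U" unfolding U_def using F by (intro l2_sum_le l2) auto
   then show "(SUM k:F \<inter> square m. (2 * real m / real N)^2 * (u k)^2) <= (2 * real m / real N)^2 * U"
    unfolding sum_distrib_left[symmetric] by (intro mult_left_mono) auto
   show "(SUM k:F - square m. 1 * (u k)^2) <= h / 2" using m[of "F - square m"] F by (simp add: Diff_Int_distrib2 less_imp_le subset_iff)
  qed
  also have "... <= h" using N1[of N] N by simp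
  finally show "?l <= h" .
 qed simp
qed

lemma fejer_mean_continuous: "continuous_on UNIV (fejer_mean N u)" unfolding fejer_mean_def by (intro continuous_intros)

text \<open>The means are uniformly Lipschitz and Cauchy in mean square, hence uniformly Cauchy.\<close>

lemma fejer_uniform_limit:
 assumes u0: "u (0, 0) = 0" and H1: "(%k. eigval L k * (u k)^2) summable_on modes" and W: "series_in_W1inf L u"
 obtains g where "uniform_limit UNIV (%N. fejer_mean N u) g sequentially"
proof -
 from W obtain g G where g: "represents L u g" "weak_gradient L g G" and Gb: "ess_bounded L G" by (auto simp: series_in_W1inf_def W1inf_def)
 from Gb obtain K0 where "AE x in tor. norm (G x) <= K0" by (auto simp: ess_bounded_def AE_tor)
 then have K: "AE x in tor. norm (G x) <= max 0 K0" by (rule eventually_mono) (rule max.coboundedI2)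
 define K where "K = max 0 K0"
 note K = K[folded K_def]
 note l2 = Hspace_1_l2[OF H1]
 have "0 <= K" by (simp add: K_def)
 have der: "GDERIV (fejer_mean N u) x :> (SUM k:square N. (fej N k * u k) * d1 k x, SUM k:square N. (fej N k * u k) * d2 k x)" for N x
  unfolding fejer_mean_def by (rule trig_poly_gderiv)
 have "uniformly_Cauchy_on UNIV (%N. fejer_mean N u)" unfolding uniformly_Cauchy_on_def
 proof (intro allI impI)
  fix \<delta> :: real assume \<delta>: "\<delta> > 0"
  have K2: "0 <= 2 * K" and \<delta>2: "\<delta> / 2 > 0" using \<open>0 <= K\<close> \<delta> by auto
  obtain h where h: "h > 0" "!!f x. continuous_on UNIV f ==> (!!x y. abs (f x - f y) <= (2 * K) * (abs (fst x - fst y) + abs (snd x - snd y)))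
   ==> (\<integral>x. (f x)^2 \<partial>tor) <= h ==> x : torus L ==> abs (f x) <= \<delta> / 2"
   using small_of_lipschitz_L2[OF K2 \<delta>2] by blast
  obtain N0 where N0: "N0 >= 1" "!!N F. N >= N0 ==> finite F ==> F <= modes ==> (SUM k:F. (u k - fej N k * u k)^2) <= h / 4"
   by (rule fej_l2_close[OF l2, of "h / 4"]) (use h(1) in auto)
  have "abs (fejer_mean N u x - fejer_mean M u x) <= \<delta> / 2" if N: "N >= N0" "M >= N0" for N M x
  proof -
   let ?f = "%x. fejer_mean N u x - fejer_mean M u x"
   obtain y where y: "y : torus L" "!!g :: plane => real. periodic L g ==> g x = g y" by (rule periodic_reduce[of x]) blast
   have "periodic L ?f" using PS_periodic by (simp add: periodic_def fejer_mean_def)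
   then have "?f x = ?f y" by (rule y(2))
   moreover have "abs (?f y) <= \<delta> / 2"
   proof (rule h(2)[OF _ _ _ y(1)])
    show "continuous_on UNIV ?f" by (intro continuous_intros fejer_mean_continuous)
    have lip: "abs (fejer_mean n u a - fejer_mean n u b) <= K * (abs (fst a - fst b) + abs (snd a - snd b))" if "n >= 1" for n a b
     using fejer_gradient_bound[OF u0 g K that] by (intro lipschitz_of_partials[OF der]) auto
    show "abs (?f a - ?f b) <= 2 * K * (abs (fst a - fst b) + abs (snd a - snd b))" for a b
     using lip[of N a b] lip[of M a b] N N0(1) by (simp add: algebra_simps abs_le_iff)
    define R where "R = max N M"
    have e: "?f x = PS (square R) (%k. fej N k * u k - fej M k * u k) x" for x
     using N N0(1) by (simp add: fejer_mean_larger[of _ R] R_def sum_subtractf left_diff_distrib)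
    have "(\<integral>x. (?f x)^2 \<partial>tor) = (SUM k:square R. (fej N k * u k - fej M k * u k)^2)" unfolding e by (rule e_sum_sq) simp
    also have "... <= (SUM k:square R. 2 * (u k - fej N k * u k)^2 + 2 * (u k - fej M k * u k)^2)"
    proof (rule sum_mono)
     fix k
     have "(a - b)^2 <= 2 * (c - a)^2 + 2 * (c - b)^2" for a b c :: real using zero_le_power2[of "a + b - 2 * c"] by (simp add: power2_eq_square algebra_simps)
     then show "(fej N k * u k - fej M k * u k)^2 <= 2 * (u k - fej N k * u k)^2 + 2 * (u k - fej M k * u k)^2" .
    qed
    also have "... <= 2 * (h / 4) + 2 * (h / 4)" unfolding sum.distrib sum_distrib_left[symmetric] by (intro add_mono mult_left_mono N0 N) (auto simp: square_modes)
    finally show "(\<integral>x. (?f x)^2 \<partial>tor) <= h" by simp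
   qed
   ultimately show ?thesis by simp
  qed
  note d = this
  show "EX M. ALL x:UNIV. ALL m>=M. ALL n>=M. dist (fejer_mean m u x) (fejer_mean n u x) < \<delta>"
  proof (intro exI[of _ N0] ballI allI impI)
   fix x m n assume "m >= N0" "n >= N0"
   from d[OF this, of x] \<delta> show "dist (fejer_mean m u x) (fejer_mean n u x) < \<delta>" unfolding dist_real_def by linarith
  qed
 qed
 then have "uniformly_convergent_on UNIV (%N. fejer_mean N u)" by (rule Cauchy_uniformly_convergent)
 then show thesis using that by (auto simp: uniformly_convergent_on_def)
qed

section \<open>Comparison of the semigroup with the Fejer means\<close>

definition decay :: "real => idx => real" where "decay t k = exp (- t * (eigval L k)^2)"

lemma decay_bounds: "t >= 0 ==> 0 < decay t k & decay t k <= 1" by (simp add: decay_def)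

lemma eigval_sq_ge: "kp ^ 4 * real (cnorm k) ^ 4 <= (eigval L k)^2"
proof -
 have "(kp^2 * (real (cnorm k))^2)^2 <= (eigval L k)^2" by (intro power_mono eigval_bounds) auto
 then show ?thesis by (simp add: power_mult_distrib flip: power_mult)
qed

lemma eigval_sq_le: "(eigval L k)^2 <= 4 * kp ^ 4 * real (cnorm k) ^ 4"
proof -
 have "(eigval L k)^2 <= (2 * kp^2 * (real (cnorm k))^2)^2" by (intro power_mono eigval_bounds eigval_nonneg)
 then show ?thesis by (simp add: power_mult_distrib flip: power_mult)
qed

lemma decay_le: "t > 0 ==> k : modes ==> decay t k <= 1 / (t * kp ^ 4 * real (cnorm k) ^ 4)"
proof -
 assume t: "t > 0" and k: "k : modes"
 have c: "real (cnorm k) > 0" using cnorm_pos[OF k] by simp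
 let ?y = "t * (kp ^ 4 * real (cnorm k) ^ 4)"
 have y: "?y > 0" using t c kp_pos by simp
 have "?y <= t * (eigval L k)^2" using t by (intro mult_left_mono eigval_sq_ge) auto
 also have "... <= exp (t * (eigval L k)^2)" using exp_ge_add_one_self[of "t * (eigval L k)^2"] by linarith
 finally have "1 / exp (t * (eigval L k)^2) <= 1 / ?y" using y by (intro divide_left_mono) auto
 then show ?thesis by (simp add: decay_def exp_minus inverse_eq_divide mult_ac)
qed

lemma decay_near_one: "t >= 0 ==> 1 - decay t k <= t * (4 * kp ^ 4 * real (cnorm k) ^ 4)"
proof -
 assume t: "t >= 0"
 have "1 - decay t k <= t * (eigval L k)^2" using exp_ge_add_one_self[of "- t * (eigval L k)^2"] by (simp add: decay_def)
 also have "... <= t * (4 * kp ^ 4 * real (cnorm k) ^ 4)" using t by (intro mult_left_mono eigval_sq_le)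
 finally show ?thesis .
qed

text \<open>The difference of the multipliers of the semigroup at time \<open>t\<close> and of the Fejer mean of order \<open>N\<close>, compared when \<open>t\<close> is of order the inverse fourth power of \<open>N\<close>. The biharmonic heat kernel is not positive, so the bound for the means is transferred in this way.\<close>

definition mult_gap :: "real => nat => idx => real" where "mult_gap t N k = abs (decay t k - fej N k)"

lemma mult_gap_low:
 assumes N: "N >= 1" "t >= 0" "t * real N ^ 4 <= 16" and k: "cnorm k <= N"
 shows "mult_gap t N k <= (64 * kp ^ 4 + 2) * cnorm k / N"
proof -
 define r where "r = real (cnorm k) / N"
 have r: "0 <= r" "r <= 1" using N k by (auto simp: r_def)
 have cn: "real (cnorm k) = r * N" using N by (simp add: r_def)
 have "mult_gap t N k <= (1 - decay t k) + (1 - fej N k)" using decay_bounds[OF N(2), of k] fej_bounds[of N k] by (auto simp: mult_gap_def)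
 also have "... <= t * (4 * kp ^ 4 * real (cnorm k) ^ 4) + 2 * cnorm k / N" using N by (intro add_mono decay_near_one fej_near_one)
 also have "t * (4 * kp ^ 4 * real (cnorm k) ^ 4) = 4 * kp ^ 4 * (t * real N ^ 4) * r ^ 4" by (simp add: cn power_mult_distrib mult_ac)
 also have "... <= 4 * kp ^ 4 * 16 * r"
 proof (intro mult_mono N)
  have "r ^ 4 <= r ^ 1" using r by (intro power_decreasing) auto
  then show "r ^ 4 <= r" by simp
 qed (use r N in auto)
 finally show ?thesis by (simp add: r_def algebra_simps add_divide_distrib)
qed

lemma mult_gap_high:
 assumes N: "N >= 1" "t > 0" "1 <= t * real N ^ 4" and k: "cnorm k > N" "k : modes"
 shows "mult_gap t N k <= real N ^ 4 / (kp ^ 4 * real (cnorm k) ^ 4)"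
proof -
 have c: "real (cnorm k) > 0" using k by simp
 have "mult_gap t N k = decay t k" using fej_zero[of N k] N k decay_bounds[of t k] by (simp add: mult_gap_def)
 also have "... <= 1 / (t * kp ^ 4 * real (cnorm k) ^ 4)" by (rule decay_le[OF N(2) k(2)])
 also have "... <= real N ^ 4 / (kp ^ 4 * real (cnorm k) ^ 4)" using N c kp_pos by (simp add: field_simps)
 finally show ?thesis .
qed

definition gap_const :: real where "gap_const = (64 * kp ^ 4 + 2)^2 / kp^2 + 1 / kp ^ 10"

lemma gap_const_pos: "gap_const > 0" unfolding gap_const_def using kp_pos by (intro add_nonneg_pos) auto

text \<open>Low modes contribute through the vanishing of both multipliers minus one at the origin, high modes through the decay of the semigroup; the two balance at wave number \<open>N\<close>.\<close>

lemma mult_gap_sum: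
 assumes N: "N >= 1" "t > 0" "1 <= t * real N ^ 4" "t * real N ^ 4 <= 16"
 shows "(SUM k:square M. (mult_gap t N k)^2 / eigval L k) <= 24 * gap_const"
proof -
 define h where "h n = gap_const * (if n <= N then 1 / (real N)^2 else (real N)^2 / real n ^ 4)" for n
 have h0: "h n >= 0" for n using gap_const_pos by (simp add: h_def)
 have c1: "(64 * kp ^ 4 + 2)^2 / kp^2 <= gap_const" "1 / kp ^ 10 <= gap_const" using kp_pos by (simp_all add: gap_const_def)
 have "(mult_gap t N k)^2 / eigval L k <= h (cnorm k)" if k: "k : modes" for k
 proof -
  define n where "n = cnorm k"
  have n: "real n > 0" using cnorm_pos[OF k] by (simp add: n_def)
  have ev: "0 < kp^2 * (real n)^2" "kp^2 * (real n)^2 <= eigval L k" using n kp_pos eigval_bounds(1)[of k] by (auto simp: n_def)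
  have g0: "0 <= mult_gap t N k" by (simp add: mult_gap_def)
  show ?thesis
  proof (cases "n <= N")
   case True
   have "(mult_gap t N k)^2 / eigval L k <= ((64 * kp ^ 4 + 2) * n / N)^2 / (kp^2 * (real n)^2)"
    using mult_gap_low[of N t k] N True ev g0 unfolding n_def by (intro frac_le power_mono) auto
   also have "... = ((64 * kp ^ 4 + 2)^2 / kp^2) * (1 / (real N)^2)" using n by (simp add: power_mult_distrib power_divide)
   also have "... <= gap_const * (1 / (real N)^2)" by (intro mult_right_mono c1) auto
   finally show ?thesis using True by (simp add: h_def n_def)
  next
   case False
   have "(mult_gap t N k)^2 / eigval L k <= (real N ^ 4 / (kp ^ 4 * real n ^ 4))^2 / (kp^2 * (real n)^2)"
    using mult_gap_high[of N t k] N False ev g0 k unfolding n_def by (intro frac_le power_mono) auto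
   also have "... = (1 / kp ^ 10) * ((real N)^2 / real n ^ 4 * (real N / real n) ^ 6)"
    using n kp_pos by (simp add: field_simps power_mult_distrib flip: power_mult power_add)
   also have "... <= gap_const * ((real N)^2 / real n ^ 4 * 1)" using False n by (intro mult_mono c1 power_le_one) (use gap_const_pos in auto)
   finally show ?thesis using False by (simp add: h_def n_def)
  qed
 qed
 then have "(SUM k:square M. (mult_gap t N k)^2 / eigval L k) <= 12 * (SUM n<M. Suc n * h (Suc n))" by (rule sum_square_le) (auto intro: h0)
 also have "(SUM n<M. Suc n * h (Suc n)) <= gap_const * (if M <= N then M / N else 2 - N / M)"
 proof (induction M)
  case (Suc M)
  have N0: "real N > 0" using N by simp
  have step: "Suc M * h (Suc M) <= gap_const * ((if Suc M <= N then Suc M / N else 2 - N / Suc M) - (if M <= N then M / N else 2 - N / M))"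
  proof (cases "Suc M <= N")
   case True
   have "Suc M * (1 / (real N)^2) <= real N * (1 / (real N)^2)" using True by (intro mult_right_mono) auto
   also have "... = Suc M / N - M / N" using N0 by (simp add: power2_eq_square field_simps)
   finally have "gap_const * (Suc M * (1 / (real N)^2)) <= gap_const * (Suc M / N - M / N)" using gap_const_pos by (intro mult_left_mono) auto
   moreover have "Suc M * h (Suc M) = gap_const * (Suc M * (1 / (real N)^2))" unfolding h_def if_P[OF True] by (rule mult.left_commute)
   ultimately show ?thesis using True by simp
  next
   case False
   then have M: "M >= N" "real M > 0" using N by auto
   have "Suc M * ((real N)^2 / real (Suc M) ^ 4) <= N / M - N / Suc M"
   proof -
    define S where "S = real (Suc M)"
    have S: "S > 0" "real M = S - 1" "S > real M" by (auto simp: S_def)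
    have e1: "S * ((real N)^2 / S ^ 4) = (real N)^2 / (S * S * S)" using S(1) by (simp add: power4_eq_xxxx)
    have "N / M - N / S = N * (S - real M) / (real M * S)" using M S(1) by (simp add: field_simps)
    then have e2: "N / M - N / S = N / (real M * S)" using S(2) by simp
    have "real N * real M <= S * S" using M S by (intro mult_mono) auto
    then have "(real N * real N) * (real M * S) <= real N * (S * S * S)" using mult_right_mono[of "real N * real M" "S * S" "real N * S"] S(1) by (simp add: mult_ac)
    then have "(real N)^2 / (S * S * S) <= N / (real M * S)" using M S(1) by (simp add: divide_simps power2_eq_square mult_ac)
    then show ?thesis unfolding S_def[symmetric] e1 e2 .
   qed
   moreover have "(if M <= N then M / N else 2 - N / M) = 2 - N / M" using M N0 by auto
   moreover have "Suc M * h (Suc M) = gap_const * (Suc M * ((real N)^2 / real (Suc M) ^ 4))" unfolding h_def if_not_P[OF False] by (rule mult.left_commute)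
   ultimately show ?thesis using False mult_left_mono[OF _ less_imp_le[OF gap_const_pos], of "Suc M * ((real N)^2 / real (Suc M) ^ 4)" "N / M - N / Suc M"] by simp
  qed
  then show ?case using Suc by (simp add: algebra_simps)
 qed (use N in simp)
 also have "... <= gap_const * 2" using gap_const_pos N by (intro mult_left_mono) (auto simp: divide_simps)
 finally show ?thesis by simp
qed

text \<open>By Cauchy--Schwarz the error is at most the root of the sum above times the root of the energy. This makes the high modes small; the finitely many low ones have vanishing gaps.\<close>

lemma semigroup_near_fejer:
 assumes H1: "(%k. eigval L k * (u k)^2) summable_on modes" and d: "d > 0"
 obtains N0 where "N0 >= 1" "!!N t M. N >= N0 ==> t > 0 ==> 1 <= t * real N ^ 4 ==> t * real N ^ 4 <= 16 ==>
   (SUM k:square M. mult_gap t N k * abs (u k)) <= d"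
proof -
 have C: "24 * gap_const > 0" using gap_const_pos by simp
 define \<eta> where "\<eta> = (d / 2)^2 / (24 * gap_const)"
 have \<eta>: "\<eta> > 0" "24 * gap_const * \<eta> = (d / 2)^2" using C d by (auto simp: \<eta>_def)
 obtain m where m: "!!F. finite F ==> F <= modes ==> F \<inter> square m = {} ==> (SUM k:F. eigval L k * (u k)^2) < \<eta>"
  by (rule tail_small[OF _ H1 \<eta>(1)]) (auto intro!: mult_nonneg_nonneg eigval_nonneg)
 define A where "A = (64 * kp ^ 4 + 2) * m * (SUM k:square m. abs (u k))"
 have "A >= 0" unfolding A_def by (intro mult_nonneg_nonneg sum_nonneg) auto
 obtain N1 where N1: "A / (d / 2) <= real N1" using real_arch_simple by blast
 show thesis
 proof (rule that[of "max 1 (max m N1)"])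
  fix N t M assume N: "max 1 (max m N1) <= N" and t: "t > 0" "1 <= t * real N ^ 4" "t * real N ^ 4 <= 16"
  have N': "N >= 1" "N >= m" "N >= N1" using N by auto
  have low: "(SUM k:square M \<inter> square m. mult_gap t N k * abs (u k)) <= d / 2"
  proof -
   have "(SUM k:square M \<inter> square m. mult_gap t N k * abs (u k)) <= (SUM k:square m. mult_gap t N k * abs (u k))" by (intro sum_mono2) (auto simp: mult_gap_def)
   also have "... <= (SUM k:square m. ((64 * kp ^ 4 + 2) * m / N) * abs (u k))"
   proof (intro sum_mono mult_right_mono)
    fix k assume "k : square m"
    then have k: "cnorm k <= m" by (simp add: square_def)
    have "mult_gap t N k <= (64 * kp ^ 4 + 2) * cnorm k / N" using mult_gap_low[of N t k] N' t k by auto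
    also have "... <= (64 * kp ^ 4 + 2) * m / N" using k kp_pos by (intro divide_right_mono mult_left_mono) auto
    finally show "mult_gap t N k <= (64 * kp ^ 4 + 2) * m / N" .
   qed auto
   also have "... = A / N" unfolding sum_distrib_left[symmetric] by (simp add: A_def)
   also have "... <= d / 2"
   proof -
    have "A / (d / 2) <= real N" using N1 N' by linarith
    then show ?thesis using d N' by (simp add: field_simps)
   qed
   finally show ?thesis .
  qed
  have high: "(SUM k:square M - square m. mult_gap t N k * abs (u k)) <= d / 2"
  proof -
   let ?F = "square M - square m"
   have pos: "eigval L k > 0" if "k : ?F" for k using that square_modes eigval_pos by blast
   have "(SUM k:?F. mult_gap t N k * abs (u k)) = (SUM k:?F. abs (mult_gap t N k / sqrt (eigval L k)) * abs (sqrt (eigval L k) * u k))"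
   proof (intro sum.cong refl)
    fix k assume "k : ?F"
    then have "sqrt (eigval L k) > 0" using pos by simp
    then show "mult_gap t N k * abs (u k) = abs (mult_gap t N k / sqrt (eigval L k)) * abs (sqrt (eigval L k) * u k)" by (simp add: abs_mult mult_gap_def)
   qed
   also have "... <= L2_set (%k. mult_gap t N k / sqrt (eigval L k)) ?F * L2_set (%k. sqrt (eigval L k) * u k) ?F" by (rule L2_set_mult_ineq)
   also have "L2_set (%k. mult_gap t N k / sqrt (eigval L k)) ?F <= sqrt (24 * gap_const)" unfolding L2_set_def
   proof (rule real_sqrt_le_mono)
    have "(SUM k:?F. (mult_gap t N k / sqrt (eigval L k))^2) <= (SUM k:square M. (mult_gap t N k)^2 / eigval L k)"
     by (simp add: power_divide eigval_nonneg) (intro sum_mono2; auto simp: eigval_nonneg)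
    also have "... <= 24 * gap_const" using N' t by (intro mult_gap_sum) auto
    finally show "(SUM k:?F. (mult_gap t N k / sqrt (eigval L k))^2) <= 24 * gap_const" .
   qed
   also have "L2_set (%k. sqrt (eigval L k) * u k) ?F <= sqrt \<eta>" unfolding L2_set_def
   proof (rule real_sqrt_le_mono)
    have "(SUM k:?F. (sqrt (eigval L k) * u k)^2) = (SUM k:?F. eigval L k * (u k)^2)" by (simp add: power_mult_distrib eigval_nonneg)
    also have "... < \<eta>" using square_modes by (intro m) auto
    finally show "(SUM k:?F. (sqrt (eigval L k) * u k)^2) <= \<eta>" by simp
   qed
   also have "sqrt (24 * gap_const) * sqrt \<eta> = d / 2" using d by (simp only: real_sqrt_mult[symmetric] \<eta>(2)) simp
   finally show ?thesis using C by (simp add: mult_left_mono mult_right_mono L2_set_nonneg)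
  qed
  have "(SUM k:square M. mult_gap t N k * abs (u k)) = (SUM k:square M \<inter> square m. mult_gap t N k * abs (u k)) + (SUM k:square M - square m. mult_gap t N k * abs (u k))"
   by (simp add: sum.Int_Diff)
  then show "(SUM k:square M. mult_gap t N k * abs (u k)) <= d" using low high by simp
 qed simp
qed

lemma cnorm_power_summable:
 assumes "p >= 3" "C >= 0" shows "(%k. C / real (cnorm k) ^ p) summable_on modes"
proof (rule summable_on_modes(1)[where h="%n. C / real n ^ p"])
 have "summable (%n. inverse (real n ^ (p - 1)))" using assms by (intro inverse_power_summable) auto
 then have "summable (%n. C * inverse (real (Suc n) ^ (p - 1)))" by (subst (asm) summable_Suc_iff[symmetric]) (rule summable_mult)
 moreover have "C * inverse (real (Suc n) ^ (p - 1)) = real (Suc n) * (C / real (Suc n) ^ p)" for n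
 proof -
  have "real (Suc n) ^ p = real (Suc n) * real (Suc n) ^ (p - 1)" using assms by (metis Suc_le_D diff_Suc_1 numeral_3_eq_3 power_Suc)
  then show ?thesis by (simp add: divide_inverse del: of_nat_Suc)
 qed
 ultimately show "summable (%n. real (Suc n) * (C / real (Suc n) ^ p))" by (simp only:)
qed (use assms in auto)

text \<open>For positive times the series converges absolutely. At time zero continuity follows because the semigroup stays close to Fejer means, which converge uniformly; here the bounded weak gradient of the initial value is used.\<close>

lemma semigroup_version:
 assumes u: "u : Hspace L 1" and W: "series_in_W1inf L u"
 obtains v where "continuous_on ({0..} \<times> UNIV) (%(t, x). v t x)" "!!t. periodic L (v t)"
  "!!t. t >= 0 ==> represents L (semigroup_A L t u) (v t)"
proof -
 have u0: "u (0, 0) = 0" and H1: "(%k. eigval L k * (u k)^2) summable_on modes" using u by (auto simp: Hspace_1)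
 note l2 = Hspace_1_l2[OF H1]
 obtain g where g: "uniform_limit UNIV (%N. fejer_mean N u) g sequentially" by (rule fejer_uniform_limit[OF u0 H1 W])
 have gc: "continuous_on UNIV g" by (rule uniform_limit_theorem[OF _ g]) (simp_all add: fejer_mean_continuous)
 have gp: "periodic L g"
 proof -
  have lim: "(%N. fejer_mean N u x) ----> g x" for x by (rule tendsto_uniform_limitI[OF g]) simp
  have p: "fejer_mean N u (x + L, y) = fejer_mean N u (x, y)" "fejer_mean N u (x, y + L) = fejer_mean N u (x, y)" for N x y
   using PS_periodic by (auto simp: periodic_def fejer_mean_def)
  show ?thesis unfolding periodic_def using LIMSEQ_unique[OF lim[of "(_ + L, _)", unfolded p] lim] LIMSEQ_unique[OF lim[of "(_, _ + L)", unfolded p] lim] by auto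
 qed
 define v where "v t = (if t = 0 then g else series_sum (%k. decay t k * u k))" for t
 define B where "B = sqrt (\<Sum>\<^sub>\<infinity>k\<in>modes. (u k)^2)"
 have B: "abs (u k) <= B" if "k : modes" for k
 proof -
  have "(SUM k:{k}. (u k)^2) <= (\<Sum>\<^sub>\<infinity>k\<in>modes. (u k)^2)" using that by (intro l2_sum_le l2) auto
  then have "sqrt ((u k)^2) <= B" unfolding B_def by (intro real_sqrt_le_mono) simp
  then show ?thesis by simp
 qed
 have B0: "B >= 0" unfolding B_def by (intro real_sqrt_ge_zero infsum_nonneg) simp
 have bnd: "abs (decay t k * u k) <= (B / (\<tau> * kp ^ 4)) / real (cnorm k) ^ 4" if "0 < \<tau>" "\<tau> <= t" "k : modes" for \<tau> t k
 proof -
  have c: "real (cnorm k) > 0" using cnorm_pos[OF that(3)] by simp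
  have "abs (decay t k * u k) <= (1 / (t * kp ^ 4 * real (cnorm k) ^ 4)) * B"
   unfolding abs_mult using decay_bounds[of t k] decay_le[of t k] B[of k] that by (intro mult_mono) auto
  also have "... <= (1 / (\<tau> * kp ^ 4 * real (cnorm k) ^ 4)) * B" using that c kp_pos B0 by (intro mult_right_mono divide_left_mono mult_right_mono mult_pos_pos) auto
  finally show ?thesis by (simp add: mult_ac)
 qed
 have sm: "(%k. (B / (\<tau> * kp ^ 4)) / real (cnorm k) ^ 4) summable_on modes" if "\<tau> > 0" for \<tau> using that B0 kp_pos by (intro cnorm_power_summable) auto
 have as: "(%k. abs (decay t k * u k)) summable_on modes" if "t > 0" for t using bnd[OF that order_refl] by (intro summable_on_comparison_test[OF sm[OF that]]) auto
 have near0: "EX \<tau>>0. ALL t x. 0 <= t & t < \<tau> --> abs (v t x - g x) <= \<delta>" if \<delta>: "\<delta> > 0" for \<delta>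
 proof -
  have \<delta>': "\<delta> * L / 4 > 0" using \<delta> L_pos by simp
  obtain N0 where N0: "N0 >= 1" "!!N t M. N >= N0 ==> t > 0 ==> 1 <= t * real N ^ 4 ==> t * real N ^ 4 <= 16 ==>
    (SUM k:square M. mult_gap t N k * abs (u k)) <= \<delta> * L / 4" using semigroup_near_fejer[OF H1 \<delta>'] by blast
  obtain N1 where N1: "!!N x. N >= N1 ==> abs (fejer_mean N u x - g x) < \<delta> / 2"
   using uniform_limitD[OF g, of "\<delta> / 2"] \<delta> by (auto simp: eventually_sequentially dist_real_def)
  define n where "n = max N0 N1"
  have n: "real n >= 1" using N0(1) by (simp add: n_def)
  define \<tau> where "\<tau> = 1 / real n ^ 4"
  have "abs (v t x - g x) <= \<delta>" if t: "0 <= t" "t < \<tau>" for t x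
  proof (cases "t = 0")
   case False
   then have t0: "t > 0" using t by simp
   define y where "y = root 4 (1 / t)"
   have y4: "y ^ 4 = 1 / t" using t0 by (simp add: y_def)
   have "real n ^ 4 <= 1 / t" using t t0 n by (simp add: \<tau>_def field_simps)
   then have ny: "real n <= y" using n t0 unfolding y4[symmetric] by (subst (asm) power_mono_iff) (auto simp: y_def)
   define N where "N = nat \<lceil>y\<rceil>"
   have N: "y <= real N" "real N <= 2 * y" using ny n unfolding N_def by linarith+
   have 1: "1 <= t * real N ^ 4"
   proof -
    have "t * y ^ 4 <= t * real N ^ 4" using N ny n t0 by (intro mult_left_mono power_mono) auto
    then show ?thesis using y4 t0 by simp
   qed
   have 2: "t * real N ^ 4 <= 16"
   proof -
    have "t * real N ^ 4 <= t * (2 * y) ^ 4" using N ny n t0 by (intro mult_left_mono power_mono) auto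
    then show ?thesis using y4 t0 by (simp add: power_mult_distrib)
   qed
   have Nn: "N >= n" using N ny by linarith
   have NN: "N >= N0" "N >= N1" "N >= 1" using Nn N0(1) by (auto simp: n_def)
   have "(%M. PS (square M) (%k. decay t k * u k) x - fejer_mean N u x) ----> series_sum (%k. decay t k * u k) x - fejer_mean N u x"
    by (intro tendsto_intros series_sum_limit as t0)
   then have "(%M. abs (PS (square M) (%k. decay t k * u k) x - fejer_mean N u x)) ----> (abs (series_sum (%k. decay t k * u k) x - fejer_mean N u x))"
    by (rule tendsto_rabs)
   moreover have "abs (PS (square M) (%k. decay t k * u k) x - fejer_mean N u x) <= \<delta> / 2" if "M >= N" for M
   proof -
    have "PS (square M) (%k. decay t k * u k) x - fejer_mean N u x = PS (square M) (%k. decay t k * u k - fej N k * u k) x"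
     using fejer_mean_larger[OF NN(3) that] by (simp add: sum_subtractf left_diff_distrib)
    then have "abs (PS (square M) (%k. decay t k * u k) x - fejer_mean N u x) <= 2 / L * (SUM k:square M. abs (decay t k * u k - fej N k * u k))"
     by (simp only: PS_abs_le)
    also have "(SUM k:square M. abs (decay t k * u k - fej N k * u k)) = (SUM k:square M. mult_gap t N k * abs (u k))"
     unfolding mult_gap_def abs_mult[symmetric] left_diff_distrib ..
    also have "2 / L * ... <= 2 / L * (\<delta> * L / 4)" using L_pos by (intro mult_left_mono N0(2) NN t0 1 2) auto
    finally show ?thesis using L_pos by simp
   qed
   ultimately have "abs (series_sum (%k. decay t k * u k) x - fejer_mean N u x) <= \<delta> / 2" by (intro LIMSEQ_le_const2) auto
   moreover have "v t x = series_sum (%k. decay t k * u k) x" using False by (simp add: v_def)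
   ultimately show ?thesis using N1[OF NN(2), of x] by linarith
  qed (use \<delta> in \<open>simp add: v_def\<close>)
  then show ?thesis using n by (intro exI[of _ \<tau>]) (auto simp: \<tau>_def)
 qed
 have cpos: "continuous_on ({\<tau>..} \<times> UNIV) (%(t, x). v t x)" if "\<tau> > 0" for \<tau>
 proof -
  have "continuous_on ({\<tau>..} \<times> UNIV) (%(t, x). series_sum (%k. decay t k * u k) x)"
   using bnd[OF that] by (intro series_sum_continuous[OF sm[OF that]]) (auto simp: decay_def intro!: continuous_intros)
  then show ?thesis using that by (subst continuous_on_cong[OF refl]) (auto simp: v_def)
 qed
 have cont: "continuous_on ({0..} \<times> UNIV) (%(t, x). v t x)" unfolding continuous_on_iff
 proof (intro ballI allI impI)
  fix p :: "real \<times> plane" and \<delta> :: real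
  assume p: "p : {0..} \<times> UNIV" and \<delta>: "\<delta> > 0"
  obtain t x where tx: "p = (t, x)" "t >= 0" using p by (cases p) auto
  show "EX d>0. ALL q:{0..} \<times> UNIV. dist q p < d --> dist (case q of (t, x) => v t x) (case p of (t, x) => v t x) < \<delta>"
  proof (cases "t = 0")
   case True
   obtain \<tau> where \<tau>: "\<tau> > 0" "!!t x. 0 <= t ==> t < \<tau> ==> abs (v t x - g x) <= \<delta> / 3" using near0[of "\<delta> / 3"] \<delta> by auto
   obtain d where d: "d > 0" "!!y. dist y x < d ==> dist (g y) (g x) < \<delta> / 3"
    using gc[unfolded continuous_on_iff, rule_format, of x "\<delta> / 3"] \<delta> by auto
   show ?thesis
   proof (intro exI[of _ "min \<tau> d"] conjI ballI impI)
    fix q :: "real \<times> plane" assume q: "q : {0..} \<times> UNIV" "dist q p < min \<tau> d"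
    have "dist (fst q) t < \<tau>" "dist (snd q) x < d" using q dist_fst_le[of q p] dist_snd_le[of q p] by (auto simp: tx)
    then have "abs (v (fst q) (snd q) - g (snd q)) <= \<delta> / 3" "abs (g (snd q) - g x) < \<delta> / 3"
     using \<tau>(2)[of "fst q" "snd q"] d(2)[of "snd q"] q True by (auto simp: dist_real_def)
    then have "abs (v (fst q) (snd q) - g x) < \<delta>" using \<delta> by linarith
    then show "dist (case q of (t, x) => v t x) (case p of (t, x) => v t x) < \<delta>" using True by (simp add: tx v_def[of 0] dist_real_def case_prod_beta')
   qed (use \<tau> d in auto)
  next
   case False
   then have t: "t / 2 > 0" using tx by simp
   obtain d where d: "d > 0" "!!q. q : {t / 2..} \<times> UNIV ==> dist q p < d ==> dist (case q of (t, x) => v t x) (case p of (t, x) => v t x) < \<delta>"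
    using cpos[OF t, unfolded continuous_on_iff, rule_format, of p \<delta>] t \<delta> unfolding tx by auto
   show ?thesis
   proof (intro exI[of _ "min (t / 2) d"] conjI ballI impI)
    fix q :: "real \<times> plane" assume q: "q : {0..} \<times> UNIV" "dist q p < min (t / 2) d"
    have "dist (fst q) t < t / 2" using q dist_fst_le[of q p] by (auto simp: tx)
    then have "q : {t / 2..} \<times> UNIV" by (cases q) (auto simp: dist_real_def abs_if split: if_splits)
    then show "dist (case q of (t, x) => v t x) (case p of (t, x) => v t x) < \<delta>" using d(2) q by auto
   qed (use t d in auto)
  qed
 qed
 have rep0: "represents L u g"
 proof (rule represents_uniform_limit)
  show "g : borel_measurable tor" using gc by (intro borel_measurable_tor borel_measurable_continuous_onI)
  fix \<delta> :: real assume \<delta>: "\<delta> > 0"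
  define \<eta> where "\<eta> = min 1 \<delta>"
  have \<eta>: "\<eta> > 0" "\<eta>^2 <= \<delta>" using \<delta> by (auto simp: \<eta>_def min_def power2_eq_square mult_left_le)
  obtain N0 where N0: "N0 >= 1" "!!N F. N >= N0 ==> finite F ==> F <= modes ==> (SUM k:F. (u k - fej N k * u k)^2) <= \<delta>"
   using fej_l2_close[OF l2 \<delta>] by blast
  obtain N1 where N1: "!!N x. N >= N1 ==> abs (fejer_mean N u x - g x) < \<eta>"
   using uniform_limitD[OF g, of \<eta>] \<eta> by (auto simp: eventually_sequentially dist_real_def)
  define N where "N = max N0 N1"
  let ?c = "%k. if k : square N then fej N k * u k else 0"
  have "represents L ?c (fejer_mean N u)" unfolding fejer_mean_def by (rule represents_finite) (auto simp: square_modes)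
  moreover have "(g x - fejer_mean N u x)^2 <= \<delta>" for x
  proof -
   have "abs (g x - fejer_mean N u x) <= \<eta>" using N1[of N x] by (simp add: N_def abs_minus_commute)
   then have "(g x - fejer_mean N u x)^2 <= \<eta>^2" by (rule power2_le_iff_abs_le[THEN iffD2, rotated]) (use \<eta> in auto)
   then show ?thesis using \<eta> by simp
  qed
  moreover have "(SUM k:F. (u k - ?c k)^2) <= \<delta>" if "finite F" "F <= modes" for F
  proof -
   have "?c k = fej N k * u k" if "k : F" for k
   proof (cases "k : square N")
    case False
    then have "cnorm k >= N" using that \<open>F <= modes\<close> by (auto simp: square_def)
    then show ?thesis using False fej_zero[of N k] N0(1) by (simp add: N_def)
   qed simp
   then have "(SUM k:F. (u k - ?c k)^2) = (SUM k:F. (u k - fej N k * u k)^2)" by (intro sum.cong) auto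
   then show ?thesis using N0(2)[of N F] that by (simp add: N_def)
  qed
  ultimately show "EX c h. represents L c h & (ALL x:torus L. (g x - h x)^2 <= \<delta>) &
    (ALL F. finite F --> F <= modes --> (SUM k:F. (u k - c k)^2) <= \<delta>)" by blast
 qed
 have sem: "semigroup_A L t u = (%k. decay t k * u k)" for t by (simp add: semigroup_A_def decay_def)
 show thesis
 proof (rule that[OF cont])
  show "periodic L (v t)" for t using gp series_sum_periodic by (simp add: v_def)
  show "represents L (semigroup_A L t u) (v t)" if "t >= 0" for t
  proof (cases "t = 0")
   case True
   then show ?thesis using rep0 by (simp add: sem decay_def v_def)
  next
   case False
   then show ?thesis using that series_sum_represents[OF as] by (simp add: sem v_def)
  qed
 qed
qed

end

section \<open>Gaussian random variables\<close>

text \<open>The characteristic function covers the degenerate case and passes to limits directly.\<close>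

definition gauss :: "'w measure => ('w => real) => real => bool" where
 "gauss M X v \<longleftrightarrow> X : borel_measurable M & 0 <= v &
   (ALL t. char (distr M borel X) t = complex_of_real (exp (- (t^2 * v) / 2)))"

lemma gauss_measurable: "gauss M X v ==> X : borel_measurable M" by (simp add: gauss_def)
lemma gauss_nonneg: "gauss M X v ==> 0 <= v" by (simp add: gauss_def)

text \<open>The even moments of the standard normal distribution.\<close>

definition mom :: "nat => real" where "mom m = fact (2 * m) / (2 ^ m * fact m)"

lemma mom_pos: "mom m > 0" by (simp add: mom_def)

context prob_space begin

lemma gauss_sum:
 assumes I: "finite I" and ind: "indep_vars (%_. borel) X I" and g: "!!i. i : I ==> gauss M (X i) (v i)"
 shows "gauss M (%w. SUM i:I. X i w) (SUM i:I. v i)" unfolding gauss_def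
proof (intro conjI allI)
 show "(%w. SUM i:I. X i w) : borel_measurable M" using g gauss_measurable by (intro borel_measurable_sum) blast
 show "0 <= sum v I" using g gauss_nonneg by (intro sum_nonneg) blast
 fix t
 have "char (distr M borel (%w. SUM i:I. X i w)) t = (\<Prod>i\<in>I. char (distr M borel (X i)) t)" (is "?l = _") by (rule char_distr_sum[OF ind])
 also have "... = (\<Prod>i\<in>I. complex_of_real (exp (- (t^2 * v i) / 2)))" using g by (intro prod.cong) (auto simp: gauss_def)
 also have "... = complex_of_real (exp (SUM i:I. - (t^2 * v i) / 2))" using I by (simp add: exp_sum)
 also have "(SUM i:I. - (t^2 * v i) / 2) = - (t^2 * sum v I) / 2" by (simp add: sum_distrib_left sum_negf sum_divide_distrib)
 finally show "?l = complex_of_real (exp (- (t^2 * sum v I) / 2))" .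
qed

lemma char_distr_eq: "X : borel_measurable M ==> char (distr M borel X) t = (CLINT w|M. iexp (t * X w))" by (simp add: char_def integral_distr)

lemma gauss_cmult: assumes "gauss M X v" shows "gauss M (%w. c * X w) (c^2 * v)"
proof -
 note [measurable] = gauss_measurable[OF assms]
 have "char (distr M borel (%w. c * X w)) t = char (distr M borel X) (t * c)" for t by (simp add: char_distr_eq mult.assoc)
 then show ?thesis using assms by (simp add: gauss_def power_mult_distrib mult.assoc)
qed

lemma gauss_AE: assumes "gauss M X v" "Y : borel_measurable M" "AE w in M. X w = Y w" shows "gauss M Y v"
proof -
 note [measurable] = gauss_measurable[OF assms(1)] assms(2)
 have "distr M borel X = distr M borel Y" using assms(3) by (intro distr_cong_AE) auto
 then show ?thesis using assms by (simp add: gauss_def)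
qed

lemma gauss_zero: "gauss M (%_. 0) 0" by (simp add: gauss_def char_distr_eq prob_space del: distr_const)

lemma gauss_normal:
 assumes X: "distributed M lborel X (normal_density 0 s)" and s: "s > 0"
 shows "gauss M X (s^2)"
proof -
 have "distributed M lborel (%x. (X x - 0) / s) std_normal_density" using X normal_standard_normal_convert[OF s, of X 0] by simp
 then have "distr M lborel (%x. X x / s) = std_normal_distribution" by (simp add: distributed_distr_eq_density)
 moreover have "distr M lborel (%x. X x / s) = distr M borel (%x. X x / s)" by (intro distr_cong) auto
 ultimately have d: "distr M borel (%x. X x / s) = std_normal_distribution" by simp
 have [measurable]: "X : borel_measurable M" using distributed_measurable[OF X] by simp
 have "gauss M (%x. X x / s) 1" unfolding gauss_def d char_std_normal_distribution by simp
 from gauss_cmult[OF this, of s] show ?thesis using s by simp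
qed

lemma gauss_distr:
 assumes g: "gauss M X v" and v: "v > 0"
 shows "distributed M lborel X (normal_density 0 (sqrt v))"
proof -
 note [measurable] = gauss_measurable[OF g]
 define N where "N = density lborel (%x. ennreal (normal_density 0 (sqrt v) x))"
 interpret N: prob_space N unfolding N_def by (rule prob_space_normal_density) (use v in auto)
 have sN [measurable_cong]: "sets N = sets borel" by (simp add: N_def)
 have idN: "distributed N lborel (%x. x) (normal_density 0 (sqrt v))" unfolding distributed_def by (auto simp: N_def distr_id2)
 from N.gauss_normal[OF this] v have "gauss N (%x. x) v" by simp
 moreover have "distr N borel (%x. x) = N" by (rule distr_id2) (simp add: sN)
 ultimately have cN: "char N t = complex_of_real (exp (- (t^2 * v) / 2))" for t by (simp add: gauss_def)
 have "distr M borel X = N"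
 proof (rule Levy_uniqueness)
  show "real_distribution (distr M borel X)" by (rule real_distribution_distr) measurable
  show "real_distribution N" by (intro real_distribution.intro N.prob_space_axioms real_distribution_axioms.intro) (simp_all add: N_def)
  show "char (distr M borel X) = char N" using g cN by (simp add: gauss_def fun_eq_iff)
 qed
 moreover have "distr M lborel X = distr M borel X" by (intro distr_cong) auto
 ultimately show ?thesis unfolding distributed_def by (simp add: N_def)
qed

lemma gauss_zero_AE:
 assumes g: "gauss M X 0" shows "AE w in M. X w = 0"
proof -
 note [measurable] = gauss_measurable[OF g]
 have "distr M borel X = distr M borel (%_. 0)"
 proof (rule Levy_uniqueness)
  show "real_distribution (distr M borel X)" "real_distribution (distr M borel (%_. 0))" by (rule real_distribution_distr, measurable)+
  show "char (distr M borel X) = char (distr M borel (%_. 0))" using g gauss_zero by (simp add: gauss_def fun_eq_iff)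
 qed
 then have "AE x in distr M borel X. x = 0" by (simp only: AE_distr_iff) (simp add: AE_distr_iff)
 then show ?thesis by (subst (asm) AE_distr_iff) auto
qed

lemma gauss_moment:
 assumes g: "gauss M X v"
 shows "(\<integral>\<^sup>+w. ennreal (X w ^ (2 * m)) \<partial>M) = ennreal (mom m * v ^ m)"
proof (cases "v = 0")
 case True
 have "(\<integral>\<^sup>+w. ennreal (X w ^ (2 * m)) \<partial>M) = (\<integral>\<^sup>+w. ennreal (0 ^ (2 * m)) \<partial>M)"
  by (rule nn_integral_cong_AE, use gauss_zero_AE[OF g[unfolded True]] in eventually_elim) simp
 then show ?thesis using True by (cases m) (auto simp: mom_def emeasure_space_1)
next
 case False
 then have v: "v > 0" using gauss_nonneg[OF g] by simp
 note d = gauss_distr[OF g v]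
 have "(\<integral>\<^sup>+w. ennreal (X w ^ (2 * m)) \<partial>M) = (\<integral>\<^sup>+x. ennreal (normal_density 0 (sqrt v) x) * ennreal (x ^ (2 * m)) \<partial>lborel)"
  by (rule distributed_nn_integral[OF d, symmetric]) measurable
 also have "... = (\<integral>\<^sup>+x. ennreal (normal_density 0 (sqrt v) x * (x - 0) ^ (2 * m)) \<partial>lborel)" by (intro nn_integral_cong) (simp add: ennreal_mult)
 also have "... = ennreal (fact (2 * m) / ((2 / (sqrt v)^2)^m * fact m))" using normal_moment_even[of "sqrt v" 0 m] v
  by (intro nn_integral_eq_integral[THEN trans] arg_cong[where f=ennreal] has_bochner_integral_integral_eq)
    (auto simp: has_bochner_integral_iff)
 also have "fact (2 * m) / ((2 / (sqrt v)^2)^m * fact m) = mom m * v ^ m" using v by (simp add: mom_def power_divide field_simps)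
 finally show ?thesis .
qed

lemma gauss_second: "gauss M X v ==> (\<integral>\<^sup>+w. ennreal ((X w)^2) \<partial>M) = ennreal v" using gauss_moment[of X v 1] by (simp add: mom_def)

text \<open>The density is at most the inverse of the standard deviation times a constant below one half.\<close>

lemma gauss_small_ball:
 assumes g: "gauss M X v" and v: "v > 0" and K: "K >= 0"
 shows "(\<integral>\<^sup>+w. indicator {x. abs x < K} (X w) \<partial>M) <= ennreal (K / sqrt v)"
proof -
 note d = gauss_distr[OF g v]
 have "(\<integral>\<^sup>+w. indicator {x. abs x < K} (X w) \<partial>M) = (\<integral>\<^sup>+x. ennreal (normal_density 0 (sqrt v) x) * indicator {x. abs x < K} x \<partial>lborel)"
  by (rule distributed_nn_integral[OF d, symmetric]) measurable
 also have "... <= (\<integral>\<^sup>+x. ennreal (1 / (2 * sqrt v)) * indicator {-K..K} x \<partial>lborel)"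
 proof (rule nn_integral_mono)
  fix x
  have "normal_density 0 (sqrt v) x <= 1 / sqrt (2 * pi * v)" using v by (simp add: normal_density_def divide_simps mult_le_cancel_right1)
  also have "... <= 1 / (2 * sqrt v)"
  proof -
   have "2 * sqrt v = sqrt (4 * v)" by (simp add: real_sqrt_mult)
   also have "... <= sqrt (2 * pi * v)" using pi_gt3 v by (intro real_sqrt_le_mono mult_right_mono) auto
   finally show ?thesis using v by (intro divide_left_mono) auto
  qed
  finally show "ennreal (normal_density 0 (sqrt v) x) * indicator {x. abs x < K} x <= ennreal (1 / (2 * sqrt v)) * indicator {-K..K} x"
   by (auto simp: indicator_def intro!: ennreal_leI)
 qed
 also have "... = ennreal (1 / (2 * sqrt v)) * ennreal (2 * K)" using K by (simp add: nn_integral_cmult)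
 also have "... = ennreal (K / sqrt v)" using v K by (simp flip: ennreal_mult)
 finally show ?thesis .
qed

lemma L2_L1_tendsto:
 assumes [measurable]: "!!n. Y n : borel_measurable M"
  and lim: "(%n::nat. \<integral>\<^sup>+w. ennreal ((Y n w)^2) \<partial>M) ----> 0"
 shows "(%n. \<integral>\<^sup>+w. ennreal (abs (Y n w)) \<partial>M) ----> 0"
proof (rule order_tendstoI)
 fix a :: ennreal assume "0 < a"
 then obtain r where r: "0 < ennreal r" "ennreal r < a" using dense by (metis ennreal_cases less_le_trans not_less_iff_gr_or_eq top_greatest not_top_less)
 then have r0: "r > 0" by simp
 have "eventually (%n. (\<integral>\<^sup>+w. ennreal ((Y n w)^2) \<partial>M) < ennreal ((r/2)^2)) sequentially" using lim r0 by (intro order_tendstoD) auto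
 then show "eventually (%n. (\<integral>\<^sup>+w. ennreal (abs (Y n w)) \<partial>M) < a) sequentially"
 proof eventually_elim
  case (elim n)
  have am: "abs y <= r/2 + (2/r) * y^2" for y :: real
  proof (cases "abs y <= r/2")
   case False
   then have "1 <= (2/r) * abs y" using r0 by (simp add: field_simps)
   then have "abs y * 1 <= abs y * ((2/r) * abs y)" by (intro mult_left_mono) auto
   then show ?thesis using r0 by (simp add: power2_eq_square mult_ac add_increasing)
  qed (use r0 in \<open>simp add: add_increasing2\<close>)
  have "(\<integral>\<^sup>+w. ennreal (abs (Y n w)) \<partial>M) <= (\<integral>\<^sup>+w. ennreal (r/2) + ennreal (2/r) * ennreal ((Y n w)^2) \<partial>M)"
   using am r0 by (intro nn_integral_mono) (simp flip: ennreal_plus ennreal_mult)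
  also have "... = ennreal (r/2) + ennreal (2/r) * (\<integral>\<^sup>+w. ennreal ((Y n w)^2) \<partial>M)"
   by (simp add: nn_integral_add nn_integral_cmult emeasure_space_1)
  also have "... <= ennreal (r/2) + ennreal (2/r) * ennreal ((r/2)^2)" using elim by (intro add_left_mono mult_left_mono) auto
  also have "... = ennreal r" using r0 by (simp add: power2_eq_square flip: ennreal_plus ennreal_mult)
  finally show ?case using r by simp
 qed
qed simp

text \<open>Mean-square convergence implies convergence of the characteristic functions.\<close>

lemma gauss_limit:
 assumes g: "!!n. gauss M (X n) (v n)" and X [measurable]: "X' : borel_measurable M"
  and lim: "(%n::nat. \<integral>\<^sup>+w. ennreal ((X n w - X' w)^2) \<partial>M) ----> 0" and v: "v ----> v'"
 shows "gauss M X' v'" unfolding gauss_def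
proof (intro conjI allI X)
 note [measurable] = gauss_measurable[OF g]
 show "0 <= v'" using v gauss_nonneg[OF g] by (intro LIMSEQ_le_const[OF v]) auto
 fix t
 have L1: "(%n. \<integral>\<^sup>+w. ennreal (abs (X n w - X' w)) \<partial>M) ----> 0" by (rule L2_L1_tendsto[OF _ lim]) measurable
 have "(%n. CLINT w|M. iexp (t * X n w)) ----> (CLINT w|M. iexp (t * X' w))"
 proof (rule tendsto_L1_int)
  show "integrable M (%w. iexp (t * X n w))" "integrable M (%w. iexp (t * X' w))" for n by (rule integrable_const_bound[of _ 1]; simp)+
  have bd: "norm (iexp a - iexp b) <= abs (a - b)" for a b :: real
  proof -
   have "iexp a - iexp b = iexp b * (iexp (a - b) - 1)" by (simp add: right_diff_distrib exp_add[symmetric] algebra_simps)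
   then have "norm (iexp a - iexp b) = norm (iexp (a - b) - 1)" by (simp add: norm_mult)
   also have "... <= abs (a - b)" using iexp_approx1[of "a - b" 0] by simp
   finally show ?thesis .
  qed
  have "(%n. ennreal (abs t) * (\<integral>\<^sup>+w. ennreal (abs (X n w - X' w)) \<partial>M)) ----> ennreal (abs t) * 0" using L1 by (intro ennreal_tendsto_cmult) auto
  then have l0: "(%n. ennreal (abs t) * (\<integral>\<^sup>+w. ennreal (abs (X n w - X' w)) \<partial>M)) ----> 0" by simp
  have le: "(\<integral>\<^sup>+w. ennreal (norm (iexp (t * X n w) - iexp (t * X' w))) \<partial>M) <= ennreal (abs t) * (\<integral>\<^sup>+w. ennreal (abs (X n w - X' w)) \<partial>M)" for n
  proof -
   have "(\<integral>\<^sup>+w. ennreal (norm (iexp (t * X n w) - iexp (t * X' w))) \<partial>M) <= (\<integral>\<^sup>+w. ennreal (abs t) * ennreal (abs (X n w - X' w)) \<partial>M)"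
   proof (rule nn_integral_mono)
    fix w
    have "norm (iexp (t * X n w) - iexp (t * X' w)) <= abs t * abs (X n w - X' w)"
     using bd[of "t * X n w" "t * X' w"] by (simp add: abs_mult right_diff_distrib[symmetric])
    then show "ennreal (norm (iexp (t * X n w) - iexp (t * X' w))) <= ennreal (abs t) * ennreal (abs (X n w - X' w))"
     by (subst ennreal_mult[symmetric]) (auto intro: ennreal_leI)
   qed
   also have "... = ennreal (abs t) * (\<integral>\<^sup>+w. ennreal (abs (X n w - X' w)) \<partial>M)" by (rule nn_integral_cmult) measurable
   finally show ?thesis .
  qed
  show "(%n. \<integral>\<^sup>+w. ennreal (norm (iexp (t * X n w) - iexp (t * X' w))) \<partial>M) ----> 0" by (rule tendsto_0_le_ennreal[OF l0 le])
 qed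
 then have "(%n. char (distr M borel (X n)) t) ----> char (distr M borel X') t" by (simp add: char_distr_eq)
 moreover have "(%n. char (distr M borel (X n)) t) = (%n. complex_of_real (exp (- (t^2 * v n) / 2)))" using g by (simp add: gauss_def)
 moreover have "(%n. complex_of_real (exp (- (t^2 * v n) / 2))) ----> complex_of_real (exp (- (t^2 * v') / 2))" by (intro tendsto_intros v) auto
 ultimately show "char (distr M borel X') t = complex_of_real (exp (- (t^2 * v') / 2))" using LIMSEQ_unique by metis
qed

end

section \<open>Linear functionals of Wiener processes\<close>

text \<open>Induction on the times, splitting off the last: a linear combination of values is one of increments over consecutive times, plus a multiple of the value at zero.\<close>

lemma linear_combination_increments:
 fixes c :: "real => real"
 assumes "finite F" "F <= {0..}"
 shows "EX n s d h. s 0 = 0 & (ALL i<n. s i <= s (Suc i)) & s n = Max (insert 0 F) &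
  (ALL f :: real => real. (SUM t:F. c t * f t) = (SUM i<n::nat. d i * (f (s (Suc i)) - f (s i))) + h * f 0)"
 using assms
proof (induction F rule: finite_linorder_max_induct)
 case empty
 show ?case by (intro exI[of _ 0] exI[of _ "%_. 0"] exI[of _ "%_. 0"] exI[of _ 0]) simp
next
 case (insert b F)
 then obtain n s d h where *: "s 0 = 0" "ALL i<n. s i <= s (Suc i)" "s n = Max (insert 0 F)"
  "!!f :: real => real. (SUM t:F. c t * f t) = (SUM i<n::nat. d i * (f (s (Suc i)) - f (s i))) + h * f 0" by auto
 define s' where "s' i = (if i = Suc n then b else s i)" for i
 define d' where "d' i = (if i = n then c b else d i + c b)" for i
 have b: "s n <= b" using insert * by (auto intro: less_imp_le)
 have "s' 0 = 0" "ALL i<Suc n. s' i <= s' (Suc i)" using * b by (auto simp: s'_def less_Suc_eq)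
 moreover have "s' (Suc n) = Max (insert 0 (insert b F))"
 proof -
  have "Max (insert 0 (insert b F)) = b" using insert by (intro Max_eqI) (auto intro: less_imp_le)
  then show ?thesis by (simp add: s'_def)
 qed
 moreover have "(SUM t:insert b F. c t * f t) = (SUM i<Suc n. d' i * (f (s' (Suc i)) - f (s' i))) + (h + c b) * f 0" for f :: "real => real"
 proof -
  have "(SUM i<Suc n. d' i * (f (s' (Suc i)) - f (s' i))) = (SUM i<n. (d i + c b) * (f (s (Suc i)) - f (s i))) + c b * (f b - f (s n))" (is "?l = _") by (simp add: d'_def s'_def)
  also have "(SUM i<n. (d i + c b) * (f (s (Suc i)) - f (s i))) = (SUM i<n. d i * (f (s (Suc i)) - f (s i))) + c b * (SUM i<n. f (s (Suc i)) - f (s i))"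
   by (simp add: distrib_right sum.distrib sum_distrib_left)
  also have "(SUM i<n. f (s (Suc i)) - f (s i)) = f (s n) - f 0" using sum_lessThan_telescope[of "%i. f (s i)" n] *(1) by simp
  finally have 1: "?l = (SUM i<n. d i * (f (s (Suc i)) - f (s i))) + c b * (f b - f 0)" by (simp add: algebra_simps)
  have "b \<notin> F" using insert by auto
  then have "(SUM t:insert b F. c t * f t) = c b * f b + (SUM t:F. c t * f t)" using insert by simp
  then show ?thesis unfolding 1 *(4) by (simp add: algebra_simps)
 qed
 ultimately show ?case by blast
qed

text \<open>Increments over arbitrary, possibly overlapping intervals; sums and differences of such families are again of this form, which avoids common refinements of partitions.\<close>

definition incr :: "(real => real) => 'i set => ('i => real) => ('i => real) => ('i => real) => real" where
 "incr f P d a b = (SUM p:P. d p * (f (b p) - f (a p)))"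

definition incr_fun :: "'i set => ('i => real) => ('i => real) => ('i => real) => real => real" where
 "incr_fun P d a b r = (SUM p:P. d p * indicator {a p<..b p} r)"

lemma incr_linear_combination:
 assumes "finite P"
 obtains c where "!!f. incr f P d a b = (SUM t:a ` P \<union> b ` P. c t * f t)"
proof -
 let ?F = "a ` P \<union> b ` P"
 define c where "c t = (SUM p:P. d p * ((if b p = t then 1 else 0) - (if a p = t then 1 else 0)))" for t
 have "incr f P d a b = (SUM t:?F. c t * f t)" for f
 proof -
  have "(SUM t:?F. c t * f t) = (SUM t:?F. SUM p:P. d p * ((if b p = t then f t else 0) - (if a p = t then f t else 0)))"
   unfolding c_def sum_distrib_right by (intro sum.cong refl) auto
  also have "... = (SUM p:P. SUM t:?F. d p * ((if b p = t then f t else 0) - (if a p = t then f t else 0)))" by (rule sum.swap)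
  also have "... = (SUM p:P. d p * (f (b p) - f (a p)))"
  proof (intro sum.cong refl)
   fix p assume "p : P"
   then show "(SUM t:?F. d p * ((if b p = t then f t else 0) - (if a p = t then f t else 0))) = d p * (f (b p) - f (a p))"
    using assms by (simp add: sum_distrib_left[symmetric] sum_subtractf)
  qed
  finally show ?thesis by (simp add: incr_def)
 qed
 then show thesis by (rule that)
qed

context prob_space begin

context fixes B assumes W: "wiener_process M B" begin

lemma W_measurable: "t >= 0 ==> B t : borel_measurable M" using W by (simp add: wiener_process_def)

lemma W_increment_gauss: "0 <= s ==> s <= t ==> gauss M (%w. B t w - B s w) (t - s)"
proof (cases "s = t")
 case False
 assume "0 <= s" "s <= t"
 then have "distributed M lborel (%w. B t w - B s w) (normal_density 0 (sqrt (t - s)))" using W False by (simp add: wiener_process_def)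
 from gauss_normal[OF this] show ?thesis using \<open>s <= t\<close> False by simp
qed (use gauss_zero in simp)

lemma W_step_gauss:
 assumes "0 <= s 0" "!!i. i < n ==> s i <= s (Suc i)"
 shows "gauss M (%w. SUM i<n. c i * (B (s (Suc i)) w - B (s i) w)) (SUM i<n. (c i)^2 * (s (Suc i) - s i))"
proof (rule gauss_sum)
 have nn: "0 <= s i" if "i <= n" for i using that assms by (induction i) (auto intro: order_trans)
 have "indep_vars (%_. borel) (%i w. B (s (Suc i)) w - B (s i) w) {..<n}" using W assms unfolding wiener_process_def by blast
 then have "indep_vars (%_. borel) (%i w. (%x. c i * x) (B (s (Suc i)) w - B (s i) w)) {..<n}" by (rule indep_vars_compose2) auto
 then show "indep_vars (%_. borel) (%i w. c i * (B (s (Suc i)) w - B (s i) w)) {..<n}" .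
 show "gauss M (%w. c i * (B (s (Suc i)) w - B (s i) w)) ((c i)^2 * (s (Suc i) - s i))" if "i : {..<n}" for i
  using that nn assms by (intro gauss_cmult W_increment_gauss) auto
qed simp

lemma W_zero: "AE w in M. B 0 w = 0" using W by (simp add: wiener_process_def)

lemma W_gauss: "t >= 0 ==> gauss M (B t) t"
proof -
 assume t: "t >= 0"
 have "gauss M (%w. B t w - B 0 w) (t - 0)" using t by (intro W_increment_gauss) auto
 moreover have "AE w in M. B t w - B 0 w = B t w" using W_zero by eventually_elim simp
 ultimately show ?thesis using gauss_AE[OF _ W_measurable[OF t]] by simp
qed

lemma W_linear_gauss:
 assumes F: "finite F" "F <= {0..}"
 obtains v where "gauss M (%w. SUM t:F. c t * B t w) v"
proof -
 obtain n s d h where *: "s 0 = 0" "ALL i<n. s i <= s (Suc i)"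
  "!!f :: real => real. (SUM t:F. c t * f t) = (SUM i<n::nat. d i * (f (s (Suc i)) - f (s i))) + h * f 0" using linear_combination_increments[OF F, of c] by auto
 have "gauss M (%w. SUM t:F. c t * B t w) (SUM i<n. (d i)^2 * (s (Suc i) - s i))"
 proof (rule gauss_AE[OF W_step_gauss])
  show "(%w. SUM t:F. c t * B t w) : borel_measurable M" using F by (intro borel_measurable_sum borel_measurable_times W_measurable) auto
  show "AE w in M. (SUM i<n. d i * (B (s (Suc i)) w - B (s i) w)) = (SUM t:F. c t * B t w)" using W_zero
  proof eventually_elim
   case (elim w)
   then show ?case using *(3)[of "%t. B t w"] by simp
  qed
 qed (use * in auto)
 then show thesis by (rule that)
qed

lemma W_square_integrable: "t >= 0 ==> integrable M (%w. (B t w)^2)" "t >= 0 ==> expectation (%w. (B t w)^2) = t"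
proof -
 assume t: "t >= 0"
 note [measurable] = W_measurable[OF t]
 note m = gauss_second[OF W_gauss[OF t]]
 show i: "integrable M (%w. (B t w)^2)" using m by (intro integrableI_nonneg) auto
 show "expectation (%w. (B t w)^2) = t" using m t by (simp add: nn_integral_eq_integral[OF i])
qed

lemma W_product:
 assumes "0 <= s" "0 <= t"
 shows "integrable M (%w. B s w * B t w)" "expectation (%w. B s w * B t w) = min s t"
proof -
 have *: "integrable M (%w. B s w * B t w) & expectation (%w. B s w * B t w) = s" if st: "0 <= s" "s <= t" for s t
 proof -
  have t0: "0 <= t" using st by simp
  note [measurable] = W_measurable[OF st(1)] W_measurable[OF t0]
  note m = gauss_second[OF W_increment_gauss[OF st]]
  have i: "integrable M (%w. (B t w - B s w)^2)" using m by (intro integrableI_nonneg) auto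
  have e: "expectation (%w. (B t w - B s w)^2) = t - s" using m st by (simp add: nn_integral_eq_integral[OF i])
  have p: "B s w * B t w = ((B t w)^2 + (B s w)^2 - (B t w - B s w)^2) / 2" for w by (simp add: power2_eq_square algebra_simps)
  show ?thesis unfolding p using i e st t0 W_square_integrable by simp
 qed
 show "integrable M (%w. B s w * B t w)" "expectation (%w. B s w * B t w) = min s t" using *[of s t] *[of t s] assms by (cases "s <= t"; simp add: mult.commute min_def)+
qed

lemma W_increment_product:
 assumes "0 <= a" "a <= b" "0 <= c" "c <= d"
 shows "integrable M (%w. (B b w - B a w) * (B d w - B c w))"
  "expectation (%w. (B b w - B a w) * (B d w - B c w)) = (\<integral>r. indicator {a<..b} r * indicator {c<..d} r \<partial>lborel)"
proof -
 have p: "(B b w - B a w) * (B d w - B c w) = B b w * B d w - B b w * B c w - B a w * B d w + B a w * B c w" for w by (simp add: algebra_simps)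
 have nn: "0 <= b" "0 <= d" using assms by auto
 show "integrable M (%w. (B b w - B a w) * (B d w - B c w))" unfolding p using W_product(1) assms nn by simp
 have "expectation (%w. (B b w - B a w) * (B d w - B c w)) = min b d - min b c - min a d + min a c" (is "?l = _") unfolding p using W_product assms nn by simp
 also have "... = (\<integral>r. indicator {max a c<..min b d} r \<partial>lborel)" using assms by (simp add: max_def min_def)
 also have "... = (\<integral>r. indicator {a<..b} r * indicator {c<..d} r \<partial>lborel)" by (intro Bochner_Integration.integral_cong) (auto simp: indicator_def)
 finally show "?l = (\<integral>r. indicator {a<..b} r * indicator {c<..d} r \<partial>lborel)" .
qed

text \<open>Expands the square and uses that two increments have the length of the overlap of their intervals as covariance.\<close>

lemma W_isometry:
 assumes P: "finite P" and ab: "!!p. p : P ==> 0 <= a p & a p <= b p"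
 shows "expectation (%w. (incr (%t. B t w) P d a b)^2) = (\<integral>r. (incr_fun P d a b r)^2 \<partial>lborel)"
proof -
 have "expectation (%w. (incr (%t. B t w) P d a b)^2)
   = expectation (%w. SUM p:P. SUM q:P. d p * d q * ((B (b p) w - B (a p) w) * (B (b q) w - B (a q) w)))"
  unfolding incr_def power2_eq_square sum_product by (simp add: mult_ac)
 also have "... = (SUM p:P. SUM q:P. d p * d q * expectation (%w. (B (b p) w - B (a p) w) * (B (b q) w - B (a q) w)))"
  using ab W_increment_product(1) by (simp add: Bochner_Integration.integral_sum Bochner_Integration.integrable_sum)
 also have "... = (SUM p:P. SUM q:P. d p * d q * (\<integral>r. indicator {a p<..b p} r * indicator {a q<..b q} r \<partial>lborel))"
  using ab W_increment_product(2) by (intro sum.cong refl) auto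
 also have "... = (\<integral>r. (SUM p:P. SUM q:P. d p * d q * (indicator {a p<..b p} r * indicator {a q<..b q} r)) \<partial>lborel)"
 proof -
  have "integrable lborel (%r. indicator {a p<..b p} r * indicator {a q<..b q} r :: real)" for p q
  proof -
   have "emeasure lborel {a q<..b q} < \<infinity>" by (cases "a q <= b q") auto
   then have "integrable lborel (indicator {a q<..b q} :: real => real)" by (intro integrable_real_indicator) auto
   then show ?thesis using integrable_mult_indicator[of "{a p<..b p}" lborel "indicator {a q<..b q} :: real => real"] by simp
  qed
  then show ?thesis by (simp add: Bochner_Integration.integral_sum Bochner_Integration.integrable_sum)
 qed
 also have "... = (\<integral>r. (incr_fun P d a b r)^2 \<partial>lborel)" unfolding incr_fun_def power2_eq_square sum_product by (simp add: mult_ac)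
 finally show ?thesis .
qed

lemma W_incr_gauss:
 assumes P: "finite P" and ab: "!!p. p : P ==> 0 <= a p & a p <= b p"
 shows "gauss M (%w. incr (%t. B t w) P d a b) (\<integral>r. (incr_fun P d a b r)^2 \<partial>lborel)"
proof -
 obtain c where c: "!!f. incr f P d a b = (SUM t:a ` P \<union> b ` P. c t * f t)" using incr_linear_combination[OF P, where d=d and a=a and b=b] by blast
 obtain v where v: "gauss M (%w. incr (%t. B t w) P d a b) v"
  unfolding c by (rule W_linear_gauss[of "a ` P \<union> b ` P" c]) (use P ab in \<open>auto intro: order_trans\<close>)
 note [measurable] = gauss_measurable[OF v]
 note m = gauss_second[OF v]
 have i: "integrable M (%w. (incr (%t. B t w) P d a b)^2)" using m by (intro integrableI_nonneg) auto
 have "v = expectation (%w. (incr (%t. B t w) P d a b)^2)" using m gauss_nonneg[OF v] by (simp add: nn_integral_eq_integral[OF i])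
 then show ?thesis using v W_isometry[OF P ab, where d=d] by simp
qed

end

lemma incr_cong:
 fixes f g :: "real => real"
 shows "(!!p. p : P ==> f (a p) = g (a p) & f (b p) = g (b p)) ==> incr f P d a b = incr g P d a b" unfolding incr_def by (intro sum.cong) auto

lemma iid_incr_gauss:
 assumes iid: "iid_wiener M \<beta>" and F: "finite F" "F <= modes"
  and P: "!!k. k : F ==> finite (P k)" and ab: "!!k p. k : F ==> p : P k ==> 0 <= a k p & a k p <= b k p"
 shows "gauss M (%w. SUM k:F. al k * incr (%t. \<beta> k t w) (P k) (d k) (a k) (b k))
   (SUM k:F. (al k)^2 * (\<integral>r. (incr_fun (P k) (d k) (a k) (b k) r)^2 \<partial>lborel))"
proof (rule gauss_sum[OF F(1)])
 have W: "wiener_process M (\<beta> k)" if "k : F" for k using iid F that by (auto simp: iid_wiener_def)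
 have "indep_vars (%_. Pi\<^sub>M {0..} (%_. borel)) (%k w. \<lambda>t\<in>{0..}. \<beta> k t w) F" using iid F by (auto simp: iid_wiener_def intro: indep_vars_subset)
 then have "indep_vars (%_. borel) (%k w. (%f. al k * incr f (P k) (d k) (a k) (b k)) (\<lambda>t\<in>{0..}. \<beta> k t w)) F"
 proof (rule indep_vars_compose2)
  fix k assume k: "k : F"
  show "(%f. al k * incr f (P k) (d k) (a k) (b k)) \<in> borel_measurable (Pi\<^sub>M {0..} (%_. borel))" unfolding incr_def using ab[OF k]
   by (intro borel_measurable_times borel_measurable_sum borel_measurable_diff borel_measurable_const measurable_component_singleton)
     (auto intro: order_trans)
 qed
 moreover have "incr (\<lambda>t\<in>{0..}. \<beta> k t w) (P k) (d k) (a k) (b k) = incr (%t. \<beta> k t w) (P k) (d k) (a k) (b k)" if "k : F" for k w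
  using ab[OF that] by (intro incr_cong) (auto intro: order_trans)
 ultimately show "indep_vars (%_. borel) (%k w. al k * incr (%t. \<beta> k t w) (P k) (d k) (a k) (b k)) F" by (simp cong: indep_vars_cong)
 show "gauss M (%w. al k * incr (%t. \<beta> k t w) (P k) (d k) (a k) (b k)) ((al k)^2 * (\<integral>r. (incr_fun (P k) (d k) (a k) (b k) r)^2 \<partial>lborel))" if "k : F" for k
  using that P ab by (intro gauss_cmult W_incr_gauss W) auto
qed

end

section \<open>The Ornstein--Uhlenbeck integral\<close>

text \<open>The integral of the exponential kernel is approximated by left Riemann sums on uniform grids.\<close>

definition grid :: "real => nat => nat => real" where "grid t N i = t * real i / real (Suc N)"
definition kern :: "real => real => real => real" where "kern c t r = exp (- (t - r) * c)"
definition oustep :: "real => real => nat => (real => real) => real" where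
 "oustep c t N f = incr f {..<Suc N} (%i. kern c t (grid t N i)) (grid t N) (%i. grid t N (Suc i))"
definition oufun :: "real => real => nat => real => real" where
 "oufun c t N = incr_fun {..<Suc N} (%i. kern c t (grid t N i)) (grid t N) (%i. grid t N (Suc i))"
text \<open>Integration by parts turns the stochastic integral into a pathwise one, which is continuous in \<open>t\<close> for every continuous path.\<close>

definition oupath :: "real => (real => real) => real => real" where
 "oupath c f t = f t - c * exp (- t * c) * integral {0..t} (%r. exp (r * c) * f r)"

lemma grid_mono: "t >= 0 ==> grid t N i <= grid t N (Suc i)" unfolding grid_def by (intro divide_right_mono mult_left_mono) auto

lemma grid_nonneg: "t >= 0 ==> 0 <= grid t N i" by (simp add: grid_def)
lemma grid_ends: "grid t N 0 = 0" "grid t N (Suc N) = t" by (auto simp: grid_def)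
lemma grid_gap: "grid t N (Suc i) - grid t N i = t / real (Suc N)"
proof -
 have "grid t N (Suc i) - grid t N i = (t * real (Suc i) - t * real i) / real (Suc N)" unfolding grid_def by (rule diff_divide_distrib[symmetric])
 then show ?thesis by (simp add: algebra_simps)
qed

lemma grid_le: "t >= 0 ==> i <= Suc N ==> grid t N i <= t"
proof -
 assume "t >= 0" "i <= Suc N"
 then have "t * real i <= t * real (Suc N)" by (intro mult_left_mono) auto
 then show ?thesis by (simp add: grid_def divide_le_eq)
qed

lemma oustep_step_integral:
 "step_integral B (Suc N) (grid t N) (%i. kern c t (grid t N i)) w = oustep c t N (%t. B t w)" by (simp add: step_integral_def oustep_def incr_def)

lemma oufun_step_fun: "step_fun (Suc N) (grid t N) (%i. kern c t (grid t N i)) = oufun c t N" by (rule ext) (simp add: step_fun_def oufun_def incr_fun_def)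

lemma kern_deriv: "((%r. kern c t r) has_real_derivative c * kern c t r) (at r within S)" unfolding kern_def by (auto intro!: derivative_eq_intros)

lemma kern_continuous [continuous_intros]: "continuous_on A f ==> continuous_on A (%x. kern c t (f x))" unfolding kern_def by (intro continuous_intros)

lemma kern_bounds: "c >= 0 ==> r <= t ==> 0 < kern c t r & kern c t r <= 1" using mult_nonneg_nonneg[of "t - r" c] by (simp add: kern_def algebra_simps)

lemma abel_increments:
 fixes h f :: "real => real"
 shows "(SUM i<n. h (s i) * (f (s (Suc i)) - f (s i))) = h (s n) * f (s n) - h (s 0) * f (s 0) - (SUM i<n. f (s (Suc i)) * (h (s (Suc i)) - h (s i)))"
 by (induction n) (simp_all add: algebra_simps)

text \<open>Summation by parts, followed by convergence of the resulting Riemann sums.\<close>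

lemma oustep_tendsto:
 assumes f: "continuous_on {0..} f" "f 0 = 0" and t: "t >= 0" and c: "c >= 0"
 shows "(%N. oustep c t N f) ----> oupath c f t"
proof (rule LIMSEQ_I)
 fix e :: real assume e: "e > 0"
 have fc: "continuous_on {a..b} f" if "0 <= a" for a b using f(1) by (rule continuous_on_subset) (use that in auto)
 have "uniformly_continuous_on {0..t} f" using fc by (intro compact_uniformly_continuous) auto
 then obtain d where d: "d > 0" "!!x y. x : {0..t} ==> y : {0..t} ==> dist y x < d ==> dist (f y) (f x) < e / 2"
  using e unfolding uniformly_continuous_on_def by (metis half_gt_zero)
 obtain N0 where N0: "t / d < real N0" using reals_Archimedean2 by blast
 show "EX N0. ALL N>=N0. norm (oustep c t N f - oupath c f t) < e"
 proof (intro exI[of _ N0] allI impI)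
  fix N assume N: "N >= N0"
  let ?s = "grid t N"
  have gap: "?s (Suc i) - ?s i < d" for i
  proof -
   have "t / d < real (Suc N)" using N0 N by simp
   then have "t < real (Suc N) * d" using d(1) by (simp add: divide_less_eq)
   then show ?thesis unfolding grid_gap by (simp add: divide_less_eq mult.commute)
  qed
  have cont: "continuous_on {a..b} (%r. c * kern c t r * f r)" if "0 <= a" for a b by (intro continuous_intros fc that)
  have D: "abs ((SUM j<i. f (?s (Suc j)) * (kern c t (?s (Suc j)) - kern c t (?s j))) - integral {0..?s i} (%r. c * kern c t r * f r))
    <= e / 2 * (kern c t (?s i) - kern c t 0)" if "i <= Suc N" for i
   using that
  proof (induction i)
   case 0 then show ?case by (simp add: grid_ends)
  next
   case (Suc i)
   let ?a = "?s i" and ?b = "?s (Suc i)"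
   have ab: "0 <= ?a" "?a <= ?b" "?b <= t" using t grid_nonneg grid_mono grid_le Suc.prems by auto
   have I1: "integral {0..?a} (%r. c * kern c t r * f r) + integral {?a..?b} (%r. c * kern c t r * f r) = integral {0..?b} (%r. c * kern c t r * f r)"
    using ab by (intro Henstock_Kurzweil_Integration.integral_combine integrable_continuous_real cont) auto
   have K: "((%r. c * kern c t r) has_integral (kern c t ?b - kern c t ?a)) {?a..?b}"
    using ab kern_deriv by (intro fundamental_theorem_of_calculus) (auto simp: has_real_derivative_iff_has_vector_derivative[symmetric])
   have I2: "f ?b * (kern c t ?b - kern c t ?a) - integral {?a..?b} (%r. c * kern c t r * f r) = integral {?a..?b} (%r. c * kern c t r * (f ?b - f r))"
   proof -
    have "((%r. f ?b * (c * kern c t r) - c * kern c t r * f r) has_integral (f ?b * (kern c t ?b - kern c t ?a) - integral {?a..?b} (%r. c * kern c t r * f r))) {?a..?b}"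
     by (intro has_integral_diff has_integral_mult_right K integrable_integral integrable_continuous_real cont ab)
    moreover have "(%r. f ?b * (c * kern c t r) - c * kern c t r * f r) = (%r. c * kern c t r * (f ?b - f r))" by (auto simp: algebra_simps)
    ultimately show ?thesis by (simp add: integral_unique)
   qed
   have "norm (integral {?a..?b} (%r. c * kern c t r * (f ?b - f r))) <= integral {?a..?b} (%r. e / 2 * (c * kern c t r))"
   proof (rule integral_norm_bound_integral)
    show "(%r. c * kern c t r * (f ?b - f r)) integrable_on {?a..?b}" by (intro integrable_continuous_real continuous_intros fc ab)
    show "(%r. e / 2 * (c * kern c t r)) integrable_on {?a..?b}" by (intro integrable_continuous_real continuous_intros)
    fix r assume r: "r : {?a..?b}"
    have "dist (f ?b) (f r) < e / 2" using r ab gap[of i] by (intro d(2)) (auto simp: dist_real_def)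
    then have "abs (f ?b - f r) <= e / 2" by (simp add: dist_real_def)
    then have "abs (c * kern c t r) * abs (f ?b - f r) <= abs (c * kern c t r) * (e / 2)" by (intro mult_left_mono) auto
    then show "norm (c * kern c t r * (f ?b - f r)) <= e / 2 * (c * kern c t r)" using c by (simp add: abs_mult kern_def mult_ac)
   qed
   also have "... = e / 2 * (kern c t ?b - kern c t ?a)" by (rule integral_unique[OF has_integral_mult_right[OF K]])
   finally have st: "abs (integral {?a..?b} (%r. c * kern c t r * (f ?b - f r))) <= e / 2 * (kern c t ?b - kern c t ?a)" by simp
   have IH: "abs ((SUM j<i. f (?s (Suc j)) * (kern c t (?s (Suc j)) - kern c t (?s j))) - integral {0..?s i} (%r. c * kern c t r * f r))
    <= e / 2 * (kern c t (?s i) - kern c t 0)" using Suc by simp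
   have "(SUM j<Suc i. f (?s (Suc j)) * (kern c t (?s (Suc j)) - kern c t (?s j))) - integral {0..?b} (%r. c * kern c t r * f r)
    = ((SUM j<i. f (?s (Suc j)) * (kern c t (?s (Suc j)) - kern c t (?s j))) - integral {0..?a} (%r. c * kern c t r * f r)) + integral {?a..?b} (%r. c * kern c t r * (f ?b - f r))"
    using I1 I2 by simp
   moreover have "e / 2 * (kern c t ?b - kern c t 0) = e / 2 * (kern c t ?a - kern c t 0) + e / 2 * (kern c t ?b - kern c t ?a)" by (simp add: algebra_simps)
   ultimately show ?case using IH st by linarith
  qed
  have "oustep c t N f = kern c t t * f t - kern c t 0 * f 0 - (SUM j<Suc N. f (?s (Suc j)) * (kern c t (?s (Suc j)) - kern c t (?s j)))"
   unfolding oustep_def incr_def using abel_increments[of "kern c t" ?s f "Suc N"] by (simp only: grid_ends)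
  then have 1: "oustep c t N f = f t - (SUM j<Suc N. f (?s (Suc j)) * (kern c t (?s (Suc j)) - kern c t (?s j)))" using f(2) by (simp add: kern_def)
  have "integral {0..t} (%r. c * kern c t r * f r) = integral {0..t} (%r. (c * exp (- t * c)) * (exp (r * c) * f r))"
   by (intro arg_cong2[where f=integral] refl ext) (simp add: kern_def exp_diff left_diff_distrib exp_minus field_simps)
  also have "... = c * exp (- t * c) * integral {0..t} (%r. exp (r * c) * f r)" by (rule integral_mult_right)
  finally have 2: "oupath c f t = f t - integral {0..t} (%r. c * kern c t r * f r)" by (simp add: oupath_def)
  have "norm (oustep c t N f - oupath c f t) <= e / 2 * (kern c t t - kern c t 0)" (is "?l <= _") using D[OF order_refl] unfolding 1 2 grid_ends real_norm_def by linarith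
  also have "... <= e / 2 * 1" using e by (intro mult_left_mono) (auto simp: kern_def)
  finally show "?l < e" using e by simp
 qed
qed

lemma oupath_continuous:
 assumes f: "continuous_on {0..} f"
 shows "continuous_on {0..} (oupath c f)"
proof -
 have "continuous_on {0..T} (oupath c f)" for T
 proof -
  have fT: "continuous_on {0..T} f" using f by (rule continuous_on_subset) auto
  have "(%r. exp (r * c) * f r) integrable_on {0..T}" by (intro integrable_continuous_real continuous_intros fT)
  then have "continuous_on {0..T} (%t. integral {0..t} (%r. exp (r * c) * f r))" by (rule indefinite_integral_continuous_1)
  then show ?thesis unfolding oupath_def by (intro continuous_intros fT)
 qed
 note c = this
 show ?thesis unfolding continuous_on_eq_continuous_within
 proof
  fix x :: real assume x: "x : {0..}"
  have "continuous (at x within {0..x + 1}) (oupath c f)" using c[of "x + 1"] x by (auto simp: continuous_on_eq_continuous_within)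
  moreover have "at x within {0..x + 1} = at x within {0..}" by (rule at_within_nhd[where S="{x - 1<..<x + 1}"]) auto
  ultimately show "continuous (at x within {0..}) (oupath c f)" by simp
 qed
qed

lemma step_value:
 fixes s :: "nat => real"
 assumes "!!i. s i <= s (Suc i)"
 shows "(r <= s 0 \<or> r > s n --> (SUM i<n. k i * indicator {s i<..s (Suc i)} r) = (0::real))
   & (s 0 < r & r <= s n --> (EX j<n. s j < r & r <= s (Suc j) & (SUM i<n. k i * indicator {s i<..s (Suc i)} r) = k j))"
proof (induction n)
 case (Suc n)
 have m: "s 0 <= s n" by (rule lift_Suc_mono_le[of s, OF assms]) simp
 consider "r <= s 0" | "s 0 < r" "r <= s n" | "s n < r" "r <= s (Suc n)" | "r > s (Suc n)" by linarith
 then show ?case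
 proof cases
  case 1 then show ?thesis using Suc m by (auto simp: indicator_def)
 next
  case 2
  then obtain j where "j < n" "s j < r" "r <= s (Suc j)" "(SUM i<n. k i * indicator {s i<..s (Suc i)} r) = k j" using Suc by auto
  then show ?thesis using 2 m assms[of n] by (auto simp: indicator_def intro!: exI[of _ j])
 next
  case 3
  then have "(SUM i<n. k i * indicator {s i<..s (Suc i)} r) = 0" using Suc by auto
  then show ?thesis using 3 m by (auto simp: indicator_def intro!: exI[of _ n])
 next
  case 4
  then have "r > s n" using assms[of n] by linarith
  then show ?thesis using 4 m Suc by (auto simp: indicator_def)
 qed
qed simp

text \<open>The integrand as a function on the line; the variance of an increment is its squared distance in mean square.\<close>

definition okern :: "real => real => real => real" where "okern c t r = kern c t r * indicator {0<..t} r"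

definition ouvar :: "real => real => real => real" where
 "ouvar c s t = (\<integral>r. (okern c t r - okern c s r)^2 \<partial>lborel)"

lemma oufun_close:
 assumes t: "t >= 0" and c: "c >= 0"
 shows "abs (oufun c t N r - okern c t r) <= c * t / real (Suc N) * indicator {0<..t} r"
  and "0 <= oufun c t N r & oufun c t N r <= indicator {0<..t} r"
proof -
 have sv: "(r <= 0 \<or> r > t --> oufun c t N r = 0) & (0 < r & r <= t --> (EX j<Suc N. grid t N j < r & r <= grid t N (Suc j) & oufun c t N r = kern c t (grid t N j)))"
  using step_value[of "grid t N" r "Suc N" "%i. kern c t (grid t N i)", OF grid_mono[OF t]] unfolding oufun_def incr_fun_def grid_ends by blast
 have "abs (oufun c t N r - okern c t r) <= c * t / real (Suc N) * indicator {0<..t} r & 0 <= oufun c t N r & oufun c t N r <= indicator {0<..t} r"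
 proof (cases "0 < r & r <= t")
  case True
  then obtain j where j: "grid t N j < r" "r <= grid t N (Suc j)" "oufun c t N r = kern c t (grid t N j)" using sv by auto
  have k: "kern c t (grid t N j) = kern c t r * exp (- (r - grid t N j) * c)" by (simp add: kern_def exp_add[symmetric] algebra_simps)
  have kr: "0 < kern c t r" "kern c t r <= 1" using kern_bounds[OF c, of r t] True by auto
  let ?e = "exp (- (r - grid t N j) * c)"
  have "1 - ?e <= (r - grid t N j) * c" using exp_ge_add_one_self[of "- (r - grid t N j) * c"] by linarith
  also have "... <= (t / real (Suc N)) * c" using j grid_gap[of t N j] c by (intro mult_right_mono) auto
  finally have e1: "1 - ?e <= c * t / real (Suc N)" by (simp add: mult.commute)
  have e2: "0 < ?e" "?e <= 1" using j c mult_nonneg_nonneg[of "r - grid t N j" c] by (auto simp: algebra_simps)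
  have "abs (kern c t r * ?e - kern c t r) = kern c t r * (1 - ?e)"
  proof -
   have "kern c t r * ?e - kern c t r = - (kern c t r * (1 - ?e))" by (simp add: right_diff_distrib)
   then show ?thesis using kr e2 by (simp only: abs_minus abs_mult)
  qed
  also have "... <= 1 * (1 - ?e)" using kr e2 by (intro mult_right_mono) auto
  also have "... <= c * t / real (Suc N)" using e1 by simp
  finally have A: "abs (kern c t r * ?e - kern c t r) <= c * t / real (Suc N)" .
  have "0 <= kern c t r * ?e" "kern c t r * ?e <= 1" using kr e2 by (auto intro!: mult_le_one)
  with A show ?thesis unfolding j(3) k okern_def using True by simp
 next
  case False
  then show ?thesis using sv by (auto simp: okern_def indicator_def)
 qed
 then show "abs (oufun c t N r - okern c t r) <= c * t / real (Suc N) * indicator {0<..t} r"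
  "0 <= oufun c t N r & oufun c t N r <= indicator {0<..t} r" by auto
qed

lemma incr_fun_measurable [measurable]: "incr_fun P d a b : borel_measurable borel" unfolding incr_fun_def[abs_def] by measurable

lemma oufun_measurable [measurable]: "oufun c t N : borel_measurable borel" unfolding oufun_def by measurable
lemma okern_measurable [measurable]: "okern c t : borel_measurable borel" unfolding okern_def[abs_def] kern_def by measurable

lemma incr_fun_sq_integrable:
 shows "integrable lborel (%r. (incr_fun P d a b r)^2)"
proof -
 have "integrable lborel (%r. indicator {a p<..b p} r * indicator {a q<..b q} r :: real)" for p q
 proof -
  have "emeasure lborel {a q<..b q} < \<infinity>" by (cases "a q <= b q") auto
  then have "integrable lborel (indicator {a q<..b q} :: real => real)" by (intro integrable_real_indicator) auto
  then show ?thesis using integrable_mult_indicator[of "{a p<..b p}" lborel "indicator {a q<..b q} :: real => real"] by simp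
 qed
 then have "integrable lborel (%r. SUM p:P. SUM q:P. d p * d q * (indicator {a p<..b p} r * indicator {a q<..b q} r))"
  by (intro Bochner_Integration.integrable_sum integrable_mult_right)
 then show ?thesis unfolding incr_fun_def power2_eq_square sum_product by (simp add: mult_ac)
qed

lemma incr_Plus:
 assumes "finite P" "finite Q"
 shows "incr f (P <+> Q) (case_sum d (%q. - d' q)) (case_sum a a') (case_sum b b') = incr f P d a b - incr f Q d' a' b'"
 unfolding incr_def by (subst sum.Plus) (auto simp: assms sum_negf)

lemma incr_fun_Plus:
 assumes "finite P" "finite Q"
 shows "incr_fun (P <+> Q) (case_sum d (%q. - d' q)) (case_sum a a') (case_sum b b') r = incr_fun P d a b r - incr_fun Q d' a' b' r"
 unfolding incr_fun_def by (subst sum.Plus) (auto simp: assms sum_negf)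

context prob_space begin

lemma nn_cmult_const: "(\<integral>\<^sup>+r. ennreal (C * indicator {0<..t} r) \<partial>lborel) <= ennreal (C * t)" if "C >= 0" "t >= 0" for C t :: real
proof -
 have "(\<integral>\<^sup>+r. ennreal (C * indicator {0<..t} r) \<partial>lborel) = (\<integral>\<^sup>+r. ennreal C * indicator {0<..t} r \<partial>lborel)"
  by (intro nn_integral_cong) (auto simp: indicator_def)
 then show ?thesis using that by (simp add: nn_integral_cmult ennreal_mult)
qed

lemma oufun_L2:
 assumes t: "t >= 0" and c: "c >= 0"
 shows "(\<integral>\<^sup>+r. ennreal ((oufun c t N r - okern c t r)^2) \<partial>lborel) <= ennreal ((c * t / real (Suc N))^2 * t)"
proof -
 have "(\<integral>\<^sup>+r. ennreal ((oufun c t N r - okern c t r)^2) \<partial>lborel) <= (\<integral>\<^sup>+r. ennreal ((c * t / real (Suc N))^2 * indicator {0<..t} r) \<partial>lborel)"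
 proof (intro nn_integral_mono ennreal_leI)
  fix r
  have "(oufun c t N r - okern c t r)^2 <= (c * t / real (Suc N) * indicator {0<..t} r)^2"
   using oufun_close(1)[OF t c, of N r] t c by (intro power2_le_iff_abs_le[THEN iffD2]) auto
  then show "(oufun c t N r - okern c t r)^2 <= (c * t / real (Suc N))^2 * indicator {0<..t} r" by (cases "0 < r & r <= t") (auto simp: indicator_def)
 qed
 also have "... <= ennreal ((c * t / real (Suc N))^2 * t)" by (rule nn_cmult_const) (use t in auto)
 finally show ?thesis .
qed

lemma sq_triangle_nn:
 fixes f g h :: "'b => real"
 assumes [measurable]: "f : borel_measurable N" "g : borel_measurable N" "h : borel_measurable N"
 shows "(\<integral>\<^sup>+x. ennreal ((f x - h x)^2) \<partial>N) <= 2 * (\<integral>\<^sup>+x. ennreal ((f x - g x)^2) \<partial>N) + 2 * (\<integral>\<^sup>+x. ennreal ((g x - h x)^2) \<partial>N)"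
proof -
 have "(a - c)^2 <= 2 * (a - b)^2 + 2 * (b - c)^2" for a b c :: real using zero_le_power2[of "a - 2 * b + c"] by (simp add: power2_eq_square algebra_simps)
 then have "(\<integral>\<^sup>+x. ennreal ((f x - h x)^2) \<partial>N) <= (\<integral>\<^sup>+x. 2 * ennreal ((f x - g x)^2) + 2 * ennreal ((g x - h x)^2) \<partial>N)"
  by (intro nn_integral_mono) (simp flip: ennreal_plus ennreal_mult ennreal_numeral)
 then show ?thesis by (simp add: nn_integral_add nn_integral_cmult)
qed

context fixes B assumes W: "wiener_process M B" begin

lemma W_incr_diff:
 assumes P: "finite P" "finite Q" and ab: "!!p. p : P ==> 0 <= a p & a p <= b p" "!!p. p : Q ==> 0 <= a' p & a' p <= b' p"
 shows "(\<integral>\<^sup>+w. ennreal ((incr (%t. B t w) P d a b - incr (%t. B t w) Q d' a' b')^2) \<partial>M)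
   = (\<integral>\<^sup>+r. ennreal ((incr_fun P d a b r - incr_fun Q d' a' b' r)^2) \<partial>lborel)"
proof -
 let ?R = "P <+> Q" and ?d = "case_sum d (%q. - d' q)" and ?a = "case_sum a a'" and ?b = "case_sum b b'"
 have "gauss M (%w. incr (%t. B t w) ?R ?d ?a ?b) (\<integral>r. (incr_fun ?R ?d ?a ?b r)^2 \<partial>lborel)" by (rule W_incr_gauss[OF W]) (use P ab in auto)
 from gauss_second[OF this]
 have "(\<integral>\<^sup>+w. ennreal ((incr (%t. B t w) ?R ?d ?a ?b)^2) \<partial>M) = (\<integral>\<^sup>+r. ennreal ((incr_fun ?R ?d ?a ?b r)^2) \<partial>lborel)"
  by (simp add: nn_integral_eq_integral[OF incr_fun_sq_integrable])
 then show ?thesis unfolding incr_Plus[OF P] incr_fun_Plus[OF P] .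
qed

lemma W_incr_measurable:
 assumes "!!p. p : P ==> 0 <= a p & a p <= b p"
 shows "(%w. incr (%t. B t w) P d a b) : borel_measurable M" unfolding incr_def using assms
 by (intro borel_measurable_sum borel_measurable_times borel_measurable_diff borel_measurable_const W_measurable[OF W])
   (auto intro: order_trans)

lemma oustep_measurable: "t >= 0 ==> (%w. oustep c t N (%t. B t w)) \<in> borel_measurable M"
 unfolding oustep_def by (rule W_incr_measurable) (auto simp: grid_nonneg grid_mono)

lemma oustep_diff_L2:
 assumes t: "t >= 0" and c: "c >= 0" and N: "m >= N"
 shows "(\<integral>\<^sup>+w. ennreal ((oustep c t m (%t. B t w) - oustep c t N (%t. B t w))^2) \<partial>M) <= ennreal (4 * ((c * t / real (Suc N))^2 * t))"
proof -
 have "(\<integral>\<^sup>+w. ennreal ((oustep c t m (%t. B t w) - oustep c t N (%t. B t w))^2) \<partial>M) = (\<integral>\<^sup>+r. ennreal ((oufun c t m r - oufun c t N r)^2) \<partial>lborel)"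
  unfolding oustep_def oufun_def by (rule W_incr_diff) (auto simp: t grid_nonneg grid_mono)
 also have "... <= 2 * (\<integral>\<^sup>+r. ennreal ((oufun c t m r - okern c t r)^2) \<partial>lborel) + 2 * (\<integral>\<^sup>+r. ennreal ((okern c t r - oufun c t N r)^2) \<partial>lborel)"
  by (rule sq_triangle_nn) auto
 also have "(\<integral>\<^sup>+r. ennreal ((okern c t r - oufun c t N r)^2) \<partial>lborel) = (\<integral>\<^sup>+r. ennreal ((oufun c t N r - okern c t r)^2) \<partial>lborel)"
  by (simp add: power2_commute)
 also have "2 * (\<integral>\<^sup>+r. ennreal ((oufun c t m r - okern c t r)^2) \<partial>lborel) + 2 * ...
   <= 2 * ennreal ((c * t / real (Suc N))^2 * t) + 2 * ennreal ((c * t / real (Suc N))^2 * t)"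
 proof (intro add_mono mult_left_mono oufun_L2 t c)
  have "c * t / real (Suc m) <= c * t / real (Suc N)" using N t c by (intro divide_left_mono) auto
  then have "(c * t / real (Suc m))^2 * t <= (c * t / real (Suc N))^2 * t" using t c by (intro mult_right_mono power_mono) auto
  then show "(\<integral>\<^sup>+r. ennreal ((oufun c t m r - okern c t r)^2) \<partial>lborel) <= ennreal ((c * t / real (Suc N))^2 * t)"
   using oufun_L2[OF t c, of m] by (meson ennreal_leI order_trans)
 qed auto
 also have "... = ennreal (4 * ((c * t / real (Suc N))^2 * t))"
 proof -
  have "0 <= (c * t / real (Suc N))^2 * t" using t by simp
  then show ?thesis by (subst ennreal_mult) (auto simp: distrib_right[symmetric])
 qed
 finally show ?thesis .
qed

text \<open>Two approximating sequences of step functions are close in mean square, and by the isometry so are their integrals.\<close>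

lemma has_wiener_integral_unique:
 assumes I: "has_wiener_integral M B f a b I" and J: "has_wiener_integral M B f a b J"
  and f [measurable]: "f : borel_measurable borel" and a: "0 <= a"
 shows "AE w in M. I w = J w"
proof -
 obtain n s c where 1: "!!j. partition_of a b (n j) (s j)"
  "(%j. \<integral>\<^sup>+r\<in>{a..b}. ennreal ((f r - step_fun (n j) (s j) (c j) r)^2) \<partial>lborel) ----> 0"
  "(%j. \<integral>\<^sup>+w. ennreal ((I w - step_integral B (n j) (s j) (c j) w)^2) \<partial>M) ----> 0"
  and Im [measurable]: "I : borel_measurable M" using I unfolding has_wiener_integral_def by blast
 obtain n' s' c' where 2: "!!j. partition_of a b (n' j) (s' j)"
  "(%j. \<integral>\<^sup>+r\<in>{a..b}. ennreal ((f r - step_fun (n' j) (s' j) (c' j) r)^2) \<partial>lborel) ----> 0"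
  "(%j. \<integral>\<^sup>+w. ennreal ((J w - step_integral B (n' j) (s' j) (c' j) w)^2) \<partial>M) ----> 0"
  and Jm [measurable]: "J : borel_measurable M" using J unfolding has_wiener_integral_def by blast
 have pm: "a <= s i & s i <= b" if "partition_of a b n s" "i <= n" for n s i
 proof -
  have "s 0 <= s i" using that by (induction i) (auto simp: partition_of_def intro: order_trans)
  moreover have "s (n - j) <= s n" if "j <= n" for j using that
  proof (induction j)
   case (Suc j)
   then have "s (n - Suc j) <= s (Suc (n - Suc j))" using \<open>partition_of a b n s\<close> by (auto simp: partition_of_def)
   then show ?case using Suc by (simp add: Suc_diff_Suc)
  qed simp
  from this[of "n - i"] that(2) have "s i <= s n" by simp
  ultimately show ?thesis using that(1) by (simp add: partition_of_def)
 qed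
 have si: "step_integral B n s c w = incr (%t. B t w) {..<n} c s (%i. s (Suc i))" for n s c w by (simp add: step_integral_def incr_def)
 have sf: "step_fun n s c r = incr_fun {..<n} c s (%i. s (Suc i)) r" for n s c r by (simp add: step_fun_def incr_fun_def)
 have pos: "0 <= s i & s i <= s (Suc i)" if "partition_of a b n s" "i < n" for n s i using pm[OF that(1), of i] that a by (auto simp: partition_of_def)
 have supp: "step_fun n s c r = step_fun n s c r * indicator {a..b} r" if p: "partition_of a b n s" for n s c r
 proof -
  have "c i * indicator {s i<..s (Suc i)} r = c i * indicator {s i<..s (Suc i)} r * indicator {a..b} r" if "i < n" for i
   using pm[OF p, of i] pm[OF p, of "Suc i"] that by (auto simp: indicator_def)
  then show ?thesis unfolding step_fun_def sum_distrib_right by (intro sum.cong) auto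
 qed
 have m1 [measurable]: "step_integral B (n j) (s j) (c j) : borel_measurable M" "step_integral B (n' j) (s' j) (c' j) : borel_measurable M" for j
  unfolding si[abs_def] using pos[OF 1(1)] pos[OF 2(1)] by (auto intro!: W_incr_measurable)
 have [measurable]: "step_fun n s c : borel_measurable borel" for n s c unfolding sf[abs_def] by measurable
 define Q where "Q j = (\<integral>\<^sup>+w. ennreal ((step_integral B (n j) (s j) (c j) w - step_integral B (n' j) (s' j) (c' j) w)^2) \<partial>M)" for j
 have Qle: "Q j <= 2 * (\<integral>\<^sup>+r\<in>{a..b}. ennreal ((f r - step_fun (n j) (s j) (c j) r)^2) \<partial>lborel)
    + 2 * (\<integral>\<^sup>+r\<in>{a..b}. ennreal ((f r - step_fun (n' j) (s' j) (c' j) r)^2) \<partial>lborel)" for j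
 proof -
  have "Q j = (\<integral>\<^sup>+r. ennreal ((step_fun (n j) (s j) (c j) r - step_fun (n' j) (s' j) (c' j) r)^2) \<partial>lborel)"
   unfolding Q_def si sf by (rule W_incr_diff) (use pos[OF 1(1)] pos[OF 2(1)] in auto)
  also have "... = (\<integral>\<^sup>+r. ennreal ((step_fun (n j) (s j) (c j) r * indicator {a..b} r - step_fun (n' j) (s' j) (c' j) r * indicator {a..b} r)^2) \<partial>lborel)"
   using supp[OF 1(1)] supp[OF 2(1)] by (intro nn_integral_cong) metis
  also have "... <= 2 * (\<integral>\<^sup>+r. ennreal ((step_fun (n j) (s j) (c j) r * indicator {a..b} r - f r * indicator {a..b} r)^2) \<partial>lborel)
    + 2 * (\<integral>\<^sup>+r. ennreal ((f r * indicator {a..b} r - step_fun (n' j) (s' j) (c' j) r * indicator {a..b} r)^2) \<partial>lborel)"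
   by (rule sq_triangle_nn) measurable
  also have "(%r. ennreal ((step_fun (n j) (s j) (c j) r * indicator {a..b} r - f r * indicator {a..b} r)^2)) = (%r. ennreal ((f r - step_fun (n j) (s j) (c j) r)^2) * indicator {a..b} r)"
   by (auto simp: indicator_def power2_commute)
  also have "(%r. ennreal ((f r * indicator {a..b} r - step_fun (n' j) (s' j) (c' j) r * indicator {a..b} r)^2)) = (%r. ennreal ((f r - step_fun (n' j) (s' j) (c' j) r)^2) * indicator {a..b} r)"
   by (auto simp: indicator_def)
  finally show ?thesis .
 qed
 define A where "A j = (\<integral>\<^sup>+w. ennreal ((I w - step_integral B (n j) (s j) (c j) w)^2) \<partial>M)" for j
 define C where "C j = (\<integral>\<^sup>+w. ennreal ((J w - step_integral B (n' j) (s' j) (c' j) w)^2) \<partial>M)" for j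
 have le: "(\<integral>\<^sup>+w. ennreal ((I w - J w)^2) \<partial>M) <= 2 * A j + 2 * (2 * (2 * (\<integral>\<^sup>+r\<in>{a..b}. ennreal ((f r - step_fun (n j) (s j) (c j) r)^2) \<partial>lborel)
    + 2 * (\<integral>\<^sup>+r\<in>{a..b}. ennreal ((f r - step_fun (n' j) (s' j) (c' j) r)^2) \<partial>lborel)) + 2 * C j)" (is "_ <= ?R j") for j
 proof -
  have "(\<integral>\<^sup>+w. ennreal ((I w - J w)^2) \<partial>M) <= 2 * A j + 2 * (\<integral>\<^sup>+w. ennreal ((step_integral B (n j) (s j) (c j) w - J w)^2) \<partial>M)"
   unfolding A_def by (rule sq_triangle_nn) measurable
  also have "(\<integral>\<^sup>+w. ennreal ((step_integral B (n j) (s j) (c j) w - J w)^2) \<partial>M) <= 2 * Q j + 2 * (\<integral>\<^sup>+w. ennreal ((step_integral B (n' j) (s' j) (c' j) w - J w)^2) \<partial>M)"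
   unfolding Q_def by (rule sq_triangle_nn) measurable
  also have "(\<integral>\<^sup>+w. ennreal ((step_integral B (n' j) (s' j) (c' j) w - J w)^2) \<partial>M) = C j" by (simp add: C_def power2_commute)
  finally show ?thesis using Qle[of j] by (meson add_left_mono add_right_mono mult_left_mono order_trans zero_le)
 qed
 have "?R ----> 2 * 0 + 2 * (2 * (2 * 0 + 2 * 0) + 2 * 0)" using 1(2,3) 2(2,3) unfolding A_def C_def by (intro tendsto_add ennreal_tendsto_cmult) auto
 then have "(\<integral>\<^sup>+w. ennreal ((I w - J w)^2) \<partial>M) <= 2 * 0 + 2 * (2 * (2 * 0 + 2 * 0) + 2 * 0)"
  by (rule LIMSEQ_le_const) (intro exI[of _ 0] allI impI le)
 then have "(\<integral>\<^sup>+w. ennreal ((I w - J w)^2) \<partial>M) = 0" by simp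
 then have "AE w in M. ennreal ((I w - J w)^2) = 0" by (subst (asm) nn_integral_0_iff_AE) measurable
 then show ?thesis by eventually_elim simp
qed

text \<open>The pathwise formula is defined for every outcome after redefinition on a null set, and it is the mean-square limit of the step integrals, hence a value of the Wiener integral.\<close>

lemma ou_version:
 assumes c: "c >= 0"
 obtains X where "!!t. t >= 0 ==> X t : borel_measurable M" "!!w. continuous_on {0..} (%t. X t w)" "!!w. X 0 w = 0"
  "!!t N. t >= 0 ==> (\<integral>\<^sup>+w. ennreal ((X t w - oustep c t N (%t. B t w))^2) \<partial>M) <= ennreal (4 * ((c * t / real (Suc N))^2 * t))"
  "!!t. t >= 0 ==> AE w in M. wiener_integral M B (%s. exp (- (t - s) * c)) 0 t w = X t w"
proof -
 have "AE w in M. B 0 w = 0 & continuous_on {0..} (%t. B t w)" using W by (simp add: wiener_process_def)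
 then obtain N0 where N0: "!!w. w : space M - N0 ==> B 0 w = 0 & continuous_on {0..} (%t. B t w)" "N0 : null_sets M" by (rule AE_E3) blast
 define G where "G = space M - N0"
 have [measurable]: "G : sets M" using N0 by (auto simp: G_def)
 have G: "B 0 w = 0" "continuous_on {0..} (%t. B t w)" if "w : G" for w using that N0 by (auto simp: G_def)
 have aeG: "AE w in M. w : G" using AE_not_in[OF N0(2)] by (auto simp: G_def elim!: eventually_mono)
 define X where "X t w = (if w : G then oupath c (%t. B t w) t else 0)" for t w
 have lim: "(%N. indicator G w * oustep c t N (%t. B t w)) ----> X t w" if t: "t >= 0" for t w
  using oustep_tendsto[OF G(2,1) t c, of w] by (auto simp: X_def indicator_def)
 have Xm: "X t : borel_measurable M" if t: "t >= 0" for t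
 proof (rule borel_measurable_LIMSEQ_real[OF lim[OF t]])
  note [measurable] = oustep_measurable[OF t]
  show "(%w. indicator G w * oustep c t N (%t. B t w)) \<in> borel_measurable M" for N by measurable
 qed
 have Xc: "continuous_on {0..} (%t. X t w)" for w using oupath_continuous[OF G(2), of w c] by (cases "w : G") (simp_all add: X_def)
 have X0: "X 0 w = 0" for w using G(1) by (simp add: X_def oupath_def)
 have L2: "(\<integral>\<^sup>+w. ennreal ((X t w - oustep c t N (%t. B t w))^2) \<partial>M) <= ennreal (4 * ((c * t / real (Suc N))^2 * t))"
  if t: "t >= 0" for t N
 proof -
  note [measurable] = oustep_measurable[OF t] Xm[OF t]
  have "(\<integral>\<^sup>+w. ennreal ((X t w - oustep c t N (%t. B t w))^2) \<partial>M)
    = (\<integral>\<^sup>+w. liminf (%m. ennreal ((oustep c t m (%t. B t w) - oustep c t N (%t. B t w))^2)) \<partial>M)"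
  proof (rule nn_integral_cong_AE, use aeG in eventually_elim)
   case (elim w)
   have "(%m. oustep c t m (%t. B t w)) ----> X t w" using lim[OF t, of w] elim by simp
   then have "(%m. ennreal ((oustep c t m (%t. B t w) - oustep c t N (%t. B t w))^2)) ----> ennreal ((X t w - oustep c t N (%t. B t w))^2)"
    by (intro tendsto_intros tendsto_ennrealI)
   then show ?case by (rule lim_imp_Liminf[OF trivial_limit_sequentially, symmetric])
  qed
  also have "... <= liminf (%m. \<integral>\<^sup>+w. ennreal ((oustep c t m (%t. B t w) - oustep c t N (%t. B t w))^2) \<partial>M)"
   by (rule nn_integral_liminf) measurable
  also have "... <= ennreal (4 * ((c * t / real (Suc N))^2 * t))"
   by (rule Liminf_le) ((rule eventually_sequentiallyI[of N], rule oustep_diff_L2[OF t c], assumption) | simp)+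
  finally show ?thesis .
 qed
 have zero: "(%N. ennreal (C * ((c * t / real (Suc N))^2 * t))) ----> 0" for C t
 proof -
  have "(%N. C * ((c * t / real (Suc N))^2 * t)) ----> C * (0^2 * t)" by (intro tendsto_intros tendsto_divide_0[OF tendsto_const] filterlim_at_top_imp_at_infinity
     filterlim_compose[OF filterlim_real_sequentially filterlim_Suc])
  from tendsto_ennrealI[OF this] show ?thesis by simp
 qed
 have hw: "has_wiener_integral M B (%s. exp (- (t - s) * c)) 0 t (X t)" if t: "t >= 0" for t unfolding has_wiener_integral_def
 proof (intro conjI Xm[OF t] exI allI)
  show "partition_of 0 t (Suc N) (grid t N)" for N using grid_mono[OF t] by (auto simp: partition_of_def grid_ends)
  show "(%N. \<integral>\<^sup>+w. ennreal ((X t w - step_integral B (Suc N) (grid t N) (%i. kern c t (grid t N i)) w)^2) \<partial>M) ----> 0"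
   unfolding oustep_step_integral by (rule tendsto_0_le_ennreal[OF zero L2[OF t]])
  have le: "(\<integral>\<^sup>+r\<in>{0..t}. ennreal ((exp (- (t - r) * c) - step_fun (Suc N) (grid t N) (%i. kern c t (grid t N i)) r)^2) \<partial>lborel)
    <= ennreal (1 * ((c * t / real (Suc N))^2 * t))" for N
  proof -
   have "(\<integral>\<^sup>+r\<in>{0..t}. ennreal ((exp (- (t - r) * c) - step_fun (Suc N) (grid t N) (%i. kern c t (grid t N i)) r)^2) \<partial>lborel)
    <= (\<integral>\<^sup>+r. ennreal ((oufun c t N r - okern c t r)^2) \<partial>lborel)"
   proof (rule nn_integral_mono_AE, use AE_lborel_singleton[of 0] in eventually_elim)
    case (elim r)
    then show ?case unfolding oufun_step_fun by (auto simp: indicator_def okern_def kern_def power2_commute)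
   qed
   then show ?thesis using oufun_L2[OF t c, of N] by simp
  qed
  show "(%N. \<integral>\<^sup>+r\<in>{0..t}. ennreal ((exp (- (t - r) * c) - step_fun (Suc N) (grid t N) (%i. kern c t (grid t N i)) r)^2) \<partial>lborel) ----> 0"
   by (rule tendsto_0_le_ennreal[OF zero le])
 qed
 have "AE w in M. wiener_integral M B (%s. exp (- (t - s) * c)) 0 t w = X t w" if t: "t >= 0" for t
 proof (rule has_wiener_integral_unique[OF _ hw[OF t]])
  show "has_wiener_integral M B (%s. exp (- (t - s) * c)) 0 t (wiener_integral M B (%s. exp (- (t - s) * c)) 0 t)"
   unfolding wiener_integral_def by (rule someI[of _ "X t"]) (rule hw[OF t])
 qed auto
 with Xm Xc X0 L2 show thesis by (rule that)
qed

end

text \<open>The step integrals of all modes are jointly Gaussian as linear combinations of independent increments; Gaussian laws are closed under mean-square limits.\<close>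

lemma ou_gauss:
 assumes iid: "iid_wiener M \<beta>" and c: "!!k. k : modes ==> c k >= 0"
  and Xm: "!!k t. k : modes ==> t >= 0 ==> X k t : borel_measurable M"
  and L2: "!!k t N. k : modes ==> t >= 0 ==> (\<integral>\<^sup>+om. ennreal ((X k t om - oustep (c k) t N (%t. \<beta> k t om))^2) \<partial>M) <= ennreal (4 * ((c k * t / real (Suc N))^2 * t))"
  and F: "finite F" "F <= modes" and st: "0 <= s" "0 <= t"
 shows "gauss M (%om. SUM k:F. a k * (X k t om - X k s om)) (SUM k:F. (a k)^2 * ouvar (c k) s t)"
proof (rule gauss_limit)
 have W: "wiener_process M (\<beta> k)" if "k : F" for k using iid F that by (auto simp: iid_wiener_def)
 define S where "S k t N om = oustep (c k) t N (%t. \<beta> k t om)" for k t N om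
 let ?A = "%N om. SUM k:F. a k * (S k t N om - S k s N om)"
 let ?B = "%om. SUM k:F. a k * (X k t om - X k s om)"
 let ?c = "%k. 2 * real (card F) * (a k)^2"
 let ?P = "%N. {..<Suc N} <+> {..<Suc N}"
 show "gauss M (%om. ?A N om) (SUM k:F. (a k)^2 * (\<integral>r. (oufun (c k) t N r - oufun (c k) s N r)^2 \<partial>lborel))" for N
 proof -
  have "gauss M (%om. SUM k:F. a k * incr (%t. \<beta> k t om) (?P N) (case_sum (%i. kern (c k) t (grid t N i)) (%i. - kern (c k) s (grid s N i)))
    (case_sum (grid t N) (grid s N)) (case_sum (%i. grid t N (Suc i)) (%i. grid s N (Suc i))))
   (SUM k:F. (a k)^2 * (\<integral>r. (incr_fun (?P N) (case_sum (%i. kern (c k) t (grid t N i)) (%i. - kern (c k) s (grid s N i)))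
    (case_sum (grid t N) (grid s N)) (case_sum (%i. grid t N (Suc i)) (%i. grid s N (Suc i))) r)^2 \<partial>lborel))"
   by (rule iid_incr_gauss[OF iid F]) (use st in \<open>auto simp: grid_nonneg grid_mono\<close>)
  then show ?thesis unfolding incr_Plus[OF finite_lessThan finite_lessThan] incr_fun_Plus[OF finite_lessThan finite_lessThan] unfolding S_def oustep_def oufun_def .
 qed
 show "(%om. ?B om) : borel_measurable M" using F st by (intro borel_measurable_sum borel_measurable_times borel_measurable_diff borel_measurable_const Xm) auto
 show "(%N. SUM k:F. (a k)^2 * (\<integral>r. (oufun (c k) t N r - oufun (c k) s N r)^2 \<partial>lborel)) ----> (SUM k:F. (a k)^2 * ouvar (c k) s t)"
 proof (intro tendsto_sum tendsto_mult tendsto_const)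
  fix k assume k: "k : F"
  then have ck: "c k >= 0" using F by (intro c) blast
  have pt: "(%N. oufun (c k) t N r) ----> okern (c k) t r" if "t >= 0" for t r
  proof -
   have "(%N. c k * t / real (Suc N) * indicator {0<..t} r) ----> 0 * indicator {0<..t} r"
    by (intro tendsto_intros tendsto_divide_0[OF tendsto_const] filterlim_at_top_imp_at_infinity
     filterlim_compose[OF filterlim_real_sequentially filterlim_Suc])
   then have z: "(%N. c k * t / real (Suc N) * indicator {0<..t} r) ----> 0" by simp
   have "(%N. oufun (c k) t N r - okern (c k) t r) ----> 0" by (rule Lim_null_comparison[OF _ z]) (use oufun_close(1)[OF that ck] in auto)
   then show ?thesis by (simp add: LIM_zero_iff)
  qed
  show "(%N. \<integral>r. (oufun (c k) t N r - oufun (c k) s N r)^2 \<partial>lborel) ----> ouvar (c k) s t" unfolding ouvar_def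
  proof (rule integral_dominated_convergence[where w="%r. indicator {0..max s t} r"])
   show "integrable lborel (%r. indicator {0..max s t} r :: real)" using st by (intro integrable_real_indicator) auto
   show "AE r in lborel. (%N. (oufun (c k) t N r - oufun (c k) s N r)^2) ----> (okern (c k) t r - okern (c k) s r)^2" by (intro AE_I2 tendsto_intros pt st)
   show "AE r in lborel. norm ((oufun (c k) t N r - oufun (c k) s N r)^2) <= indicator {0..max s t} r" for N
   proof (rule AE_I2)
    fix r
    have "0 <= oufun (c k) t N r" "oufun (c k) t N r <= indicator {0<..t} r" "0 <= oufun (c k) s N r" "oufun (c k) s N r <= indicator {0<..s} r"
     using oufun_close(2)[OF st(2) ck, of N r] oufun_close(2)[OF st(1) ck, of N r] by auto
    then have "abs (oufun (c k) t N r - oufun (c k) s N r) <= indicator {0..max s t} r"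
    proof -
     have "indicator {0<..t} r <= (indicator {0..max s t} r :: real)" "indicator {0<..s} r <= (indicator {0..max s t} r :: real)" by (auto simp: indicator_def)
     then show ?thesis using \<open>0 <= oufun (c k) t N r\<close> \<open>oufun (c k) t N r <= indicator {0<..t} r\<close>
      \<open>0 <= oufun (c k) s N r\<close> \<open>oufun (c k) s N r <= indicator {0<..s} r\<close> by linarith
    qed
    then have "(oufun (c k) t N r - oufun (c k) s N r)^2 <= (indicator {0..max s t} r)^2" by (intro power2_le_iff_abs_le[THEN iffD2]) auto
    then show "norm ((oufun (c k) t N r - oufun (c k) s N r)^2) <= indicator {0..max s t} r" by (cases "0 <= r & r <= max s t") (auto simp: indicator_def)
   qed
  qed measurable
 qed
 define D where "D k N = (\<integral>\<^sup>+om. ennreal ((X k t om - S k t N om)^2) \<partial>M) + (\<integral>\<^sup>+om. ennreal ((X k s om - S k s N om)^2) \<partial>M)" for k N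
 have Sm: "S k t N : borel_measurable M" if "k : F" "t >= 0" for k t N unfolding S_def[abs_def] by (rule oustep_measurable[OF W[OF that(1)] that(2)])
 have Dlim: "D k ----> 0" if k: "k : F" for k
 proof -
  have z: "(%N. ennreal (4 * ((c k * t / real (Suc N))^2 * t))) ----> 0" for t
  proof -
   have "(%N. 4 * ((c k * t / real (Suc N))^2 * t)) ----> 4 * (0^2 * t)" by (intro tendsto_intros tendsto_divide_0[OF tendsto_const] filterlim_at_top_imp_at_infinity
     filterlim_compose[OF filterlim_real_sequentially filterlim_Suc])
   from tendsto_ennrealI[OF this] show ?thesis by simp
  qed
  have "(%N. \<integral>\<^sup>+om. ennreal ((X k t om - S k t N om)^2) \<partial>M) ----> 0" if "t >= 0" for t
   unfolding S_def by (rule tendsto_0_le_ennreal[OF z L2]) (use k F that in auto)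
  from tendsto_add[OF this[OF st(2)] this[OF st(1)]] show ?thesis by (simp add: D_def[abs_def])
 qed
 have le: "(\<integral>\<^sup>+om. ennreal ((?A N om - ?B om)^2) \<partial>M)
   <= (SUM k:F. ennreal (?c k) * D k N)" for N
 proof -
  have alg: "(?A N om - ?B om)^2
    <= (SUM k:F. ?c k * ((X k t om - S k t N om)^2 + (X k s om - S k s N om)^2))" for om
  proof -
   let ?y = "%k. a k * ((X k s om - S k s N om) - (X k t om - S k t N om))"
   have "(?A N om - ?B om) = (SUM k:F. ?y k)" by (simp add: sum_subtractf[symmetric] algebra_simps)
   then have "(?A N om - ?B om)^2 <= real (card F) * (SUM k:F. (?y k)^2)" using sum_squared_le_sum_of_squares[of ?y F] F by (simp add: mult.commute)
   also have "... <= real (card F) * (SUM k:F. 2 * (a k)^2 * ((X k t om - S k t N om)^2 + (X k s om - S k s N om)^2))"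
   proof (intro mult_left_mono sum_mono)
    fix k
    have "(x - y)^2 <= 2 * (y^2 + x^2)" for x y :: real using zero_le_power2[of "x + y"] by (simp add: power2_eq_square algebra_simps)
    then have "(a k)^2 * ((X k s om - S k s N om) - (X k t om - S k t N om))^2 <= (a k)^2 * (2 * ((X k t om - S k t N om)^2 + (X k s om - S k s N om)^2))"
     by (intro mult_left_mono) auto
    then show "(?y k)^2 <= 2 * (a k)^2 * ((X k t om - S k t N om)^2 + (X k s om - S k s N om)^2)" by (simp add: power_mult_distrib distrib_left mult_ac)
   qed simp
   finally show ?thesis by (simp add: sum_distrib_left mult_ac)
  qed
  have "(\<integral>\<^sup>+om. ennreal ((?A N om - ?B om)^2) \<partial>M)
   <= (\<integral>\<^sup>+om. (SUM k:F. ennreal (?c k) * (ennreal ((X k t om - S k t N om)^2) + ennreal ((X k s om - S k s N om)^2))) \<partial>M)"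
  proof (rule nn_integral_mono)
   fix om
   have "ennreal ((?A N om - ?B om)^2)
     <= ennreal (SUM k:F. ?c k * ((X k t om - S k t N om)^2 + (X k s om - S k s N om)^2))"
    by (intro ennreal_leI alg)
   also have "... = (SUM k:F. ennreal (?c k) * (ennreal ((X k t om - S k t N om)^2) + ennreal ((X k s om - S k s N om)^2)))"
   proof -
    have "ennreal (?c k * (x^2 + y^2)) = ennreal (?c k) * (ennreal (x^2) + ennreal (y^2))" for k x y by (subst ennreal_mult) simp_all
    then show ?thesis by (subst sum_ennreal[symmetric]) (auto intro!: mult_nonneg_nonneg)
   qed
   finally show "ennreal ((?A N om - ?B om)^2) <= ..." .
  qed
  also have "... = (SUM k:F. ennreal (?c k) * D k N)"
  proof -
   have m: "(%om. ennreal ((X k t om - S k t N om)^2)) \<in> borel_measurable M" if "k : F" "t >= 0" for k t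
    by (intro measurable_compose[OF _ measurable_ennreal] borel_measurable_power borel_measurable_diff Xm Sm) (use that F in auto)
   show ?thesis unfolding D_def using m st by (subst nn_integral_sum) (auto intro!: sum.cong simp: nn_integral_cmult nn_integral_add)
  qed
  finally show ?thesis .
 qed
 have "(%N. SUM k:F. ennreal (?c k) * D k N) ----> (SUM k:F. ennreal (?c k) * 0)" by (intro tendsto_sum ennreal_tendsto_cmult Dlim) auto
 then have "(%N. SUM k:F. ennreal (?c k) * D k N) ----> 0" by simp
 from tendsto_0_le_ennreal[OF this le]
 show "(%N. \<integral>\<^sup>+om. ennreal ((?A N om - ?B om)^2) \<partial>M) ----> 0" .
qed

lemma ouvar_formula:
 assumes st: "0 <= s" "s <= t" and c: "c > 0"
 shows "ouvar c s t = (2 * (1 - exp (- (t - s) * c)) - (exp (- s * c) - exp (- t * c))^2) / (2 * c)"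
proof -
 have prodint: "(\<integral>r. okern c a r * okern c b r \<partial>lborel) = (exp (- (b - a) * c) - exp (- (a + b) * c)) / (2 * c)
   & integrable lborel (%r. okern c a r * okern c b r)" if ab: "0 <= a" "a <= b" for a b
 proof -
  have "has_bochner_integral lborel (%r. exp (- (a + b - 2 * r) * c) * indicator {0..a} r) (exp (- (a + b - 2 * a) * c) / (2 * c) - exp (- (a + b - 2 * 0) * c) / (2 * c))"
   using ab c by (intro has_bochner_integral_FTC_Icc_real) (auto intro!: derivative_eq_intros continuous_intros)
  moreover have "AE r in lborel. exp (- (a + b - 2 * r) * c) * indicator {0..a} r = okern c a r * okern c b r" using AE_lborel_singleton[of 0]
  proof eventually_elim
   case (elim r)
   then show ?case using ab by (auto simp: okern_def kern_def indicator_def exp_add[symmetric] algebra_simps)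
  qed
  ultimately have "has_bochner_integral lborel (%r. okern c a r * okern c b r) (exp (- (a + b - 2 * a) * c) / (2 * c) - exp (- (a + b - 2 * 0) * c) / (2 * c))"
   by (subst has_bochner_integral_cong_AE[symmetric]) (auto simp: okern_def kern_def)
  then show ?thesis by (auto simp: has_bochner_integral_iff diff_divide_distrib algebra_simps)
 qed
 have sq: "(okern c t r - okern c s r)^2 = okern c t r * okern c t r + okern c s r * okern c s r - 2 * (okern c s r * okern c t r)" for r
  by (simp add: power2_eq_square algebra_simps)
 have t0: "0 <= t" using st by simp
 have "ouvar c s t = (1 - exp (- (t + t) * c)) / (2 * c) + (1 - exp (- (s + s) * c)) / (2 * c) - 2 * ((exp (- (t - s) * c) - exp (- (s + t) * c)) / (2 * c))"
  unfolding ouvar_def sq using prodint[OF t0 order_refl] prodint[OF st(1) order_refl] prodint[OF st] by simp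
 moreover have "exp (- (t + t) * c) = exp (- t * c) * exp (- t * c)" "exp (- (s + s) * c) = exp (- s * c) * exp (- s * c)" "exp (- (s + t) * c) = exp (- s * c) * exp (- t * c)"
  by (simp_all add: exp_add[symmetric] algebra_simps)
 ultimately show ?thesis using c by (simp only:) (simp add: field_simps power2_eq_square)
qed

lemma ouvar_bounds:
 assumes st: "0 <= s" "0 <= t" and c: "c > 0"
 shows "0 <= ouvar c s t" "ouvar c s t <= abs (t - s)" "ouvar c s t <= 1 / c"
proof -
 show "0 <= ouvar c s t" unfolding ouvar_def by simp
 have *: "ouvar c s t <= t - s & ouvar c s t <= 1 / c" if "0 <= s" "s <= t" for s t
 proof -
  have "ouvar c s t <= 2 * (1 - exp (- (t - s) * c)) / (2 * c)" unfolding ouvar_formula[OF that c] using c by (intro divide_right_mono) auto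
  then have 1: "ouvar c s t <= (1 - exp (- (t - s) * c)) / c" by (subst (asm) mult_divide_mult_cancel_left) simp
  have "1 - exp (- (t - s) * c) <= (t - s) * c" using exp_ge_add_one_self[of "- (t - s) * c"] by linarith
  then have "(1 - exp (- (t - s) * c)) / c <= (t - s) * c / c" using c by (intro divide_right_mono) auto
  moreover have "(1 - exp (- (t - s) * c)) / c <= 1 / c" using c by (intro divide_right_mono) auto
  ultimately show ?thesis using 1 c by auto
 qed
 have sym: "ouvar c s t = ouvar c t s" by (simp add: ouvar_def power2_commute)
 show "ouvar c s t <= abs (t - s)" "ouvar c s t <= 1 / c" using *[of s t] *[of t s] st sym by (cases "s <= t"; simp)+
qed

lemma ouvar_0: "t >= 0 ==> c > 0 ==> ouvar c 0 t = (1 - exp (- 2 * t * c)) / (2 * c)"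
proof -
 assume t: "t >= 0" "c > 0"
 have "exp (- 2 * t * c) = exp (- t * c) * exp (- t * c)" by (simp add: exp_add[symmetric] algebra_simps)
 then show ?thesis using ouvar_formula[of 0 t c] t by (simp add: power2_eq_square algebra_simps)
qed

end

section \<open>Majorants and chaining\<close>

lemma ennreal_power_le_cancel:
 fixes x :: ennreal
 assumes "x ^ p <= ennreal (r ^ p)" "r >= 0" "p > 0"
 shows "x <= ennreal r"
proof (cases x)
 case (real y)
 then have "ennreal (y ^ p) <= ennreal (r ^ p)" using assms by (simp add: ennreal_power)
 then have "y ^ p <= r ^ p" using assms by (simp add: ennreal_le_iff)
 then have "y <= r" using assms real by (simp add: power_mono_iff)
 then show ?thesis using real by (simp add: ennreal_leI)
next
 case top
 then show ?thesis using assms by (simp add: top_unique power_eq_top_ennreal)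
qed

text \<open>Each term is at most its weight times the supremum of the rescaled terms, and the supremum is at most the sum of powers.\<close>

lemma weighted_sum_power:
 fixes a :: "nat => ennreal" and w :: "nat => real"
 assumes w: "!!n. w n > 0" "(\<Sum>n. ennreal (w n)) <= 1" and p: "p > 0"
 shows "(\<Sum>n. a n) ^ p <= (\<Sum>n. (ennreal (1 / w n) * a n) ^ p)"
proof (cases "\<Sum>n. (ennreal (1 / w n) * a n) ^ p")
 case (real s)
 define r where "r = root p s"
 have r: "r >= 0" "r ^ p = s" using real p by (auto simp: r_def)
 have "a n <= ennreal (w n) * ennreal r" for n
 proof -
  have "(ennreal (1 / w n) * a n) ^ p <= (\<Sum>n. (ennreal (1 / w n) * a n) ^ p)" using sum_le_suminf[of "%n. (ennreal (1 / w n) * a n) ^ p" "{n}"] by simp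
  then have "(ennreal (1 / w n) * a n) ^ p <= ennreal (r ^ p)" unfolding r(2) real(2) .
  then have "ennreal (1 / w n) * a n <= ennreal r" using r(1) p by (rule ennreal_power_le_cancel)
  then have "ennreal (w n) * (ennreal (1 / w n) * a n) <= ennreal (w n) * ennreal r" by (rule mult_left_mono) simp
  moreover have "ennreal (w n) * (ennreal (1 / w n) * a n) = a n" using w(1)[of n] by (simp add: mult.assoc[symmetric] ennreal_mult[symmetric] less_imp_neq[symmetric])
  ultimately show ?thesis by simp
 qed
 then have "(\<Sum>n. a n) <= (\<Sum>n. ennreal (w n) * ennreal r)" by (intro suminf_le) auto
 also have "... = (\<Sum>n. ennreal (w n)) * ennreal r" by (rule ennreal_suminf_multc)
 also have "... <= 1 * ennreal r" by (intro mult_right_mono w) auto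
 finally have "(\<Sum>n. a n) ^ p <= ennreal r ^ p" by (intro power_mono) auto
 then show ?thesis using r real by (simp add: ennreal_power)
qed (simp add: top_greatest)

lemma ennreal_add_power: "(x + y :: ennreal) ^ p <= 2 ^ p * (x ^ p + y ^ p)"
proof -
 have *: "(x + y) ^ p <= 2 ^ p * (x ^ p + y ^ p)" if "x <= y" for x y :: ennreal
 proof -
  have "(x + y) ^ p <= (2 * y) ^ p" using that by (intro power_mono) (auto simp: mult_2)
  also have "... = 2 ^ p * y ^ p" by (rule power_mult_distrib)
  also have "... <= 2 ^ p * (x ^ p + y ^ p)" by (intro mult_left_mono) auto
  finally show ?thesis .
 qed
 show ?thesis using *[of x y] *[of y x] by (cases "x <= y") (auto simp: add.commute)
qed

lemma ennreal_sum_power: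
 fixes S :: "'i => ennreal"
 assumes "finite I" "p > 0"
 shows "(SUM i:I. S i) ^ p <= of_nat (card I) ^ p * (SUM i:I. (S i) ^ p)"
proof (cases "I = {}")
 case True then show ?thesis using assms by simp
next
 case False
 define m where "m = Max (S ` I)"
 have "m : S ` I" using assms False by (auto simp: m_def)
 then obtain i where i: "i : I" "m = S i" by auto
 have "(SUM i:I. S i) <= of_nat (card I) * m" using assms by (intro sum_bounded_above) (auto simp: m_def)
 then have "(SUM i:I. S i) ^ p <= (of_nat (card I) * m) ^ p" by (intro power_mono) auto
 also have "... = of_nat (card I) ^ p * (S i) ^ p" by (simp add: i power_mult_distrib)
 also have "... <= of_nat (card I) ^ p * (SUM i:I. (S i) ^ p)" using assms i by (intro mult_left_mono member_le_sum) auto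
 finally show ?thesis .
qed

lemma ennreal_Max_power:
 fixes S :: "'i => ennreal"
 assumes "finite I" "I ~= {}"
 shows "(Max (S ` I)) ^ p <= (SUM i:I. (S i) ^ p)"
proof -
 have "Max (S ` I) : S ` I" using assms by auto
 then obtain i where i: "i : I" "Max (S ` I) = S i" by auto
 then show ?thesis using assms by (auto intro!: member_le_sum)
qed

definition chain_const :: "nat => real" where "chain_const p = 3 * (4 * real p) ^ p"

context prob_space begin

definition majorant :: "real => nat => real => (real => 'a => real) => ('a => ennreal) => bool" where
 "majorant T p K Y S \<longleftrightarrow> S : borel_measurable M &
   (ALL w:space M. ALL t. 0 <= t --> t <= T --> ennreal (abs (Y t w)) <= S w) &
   (\<integral>\<^sup>+w. (S w) ^ p \<partial>M) <= ennreal K"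

lemma majorantD:
 assumes "majorant T p K Y S"
 shows "S : borel_measurable M" "!!w t. w : space M ==> 0 <= t ==> t <= T ==> ennreal (abs (Y t w)) <= S w"
  "(\<integral>\<^sup>+w. (S w) ^ p \<partial>M) <= ennreal K" using assms by (simp_all add: majorant_def)

lemma majorantI:
 assumes "S : borel_measurable M" "!!w t. w : space M ==> 0 <= t ==> t <= T ==> ennreal (abs (Y t w)) <= S w"
  "(\<integral>\<^sup>+w. (S w) ^ p \<partial>M) <= ennreal K"
 shows "majorant T p K Y S" using assms by (simp add: majorant_def)

text \<open>Kolmogorov--Chentsov: a dyadic time is reached by one step on each level. The weights decay so slowly that their reciprocals cost less than the halving of the moments gains.\<close>

lemma chaining:
 fixes Y :: "real => 'a => real"
 assumes Ym: "!!t. 0 <= t ==> t <= T ==> Y t : borel_measurable M"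
  and cont: "!!z. z : space M ==> continuous_on {0..T} (%t. Y t z)" and Y0: "!!z. z : space M ==> Y 0 z = 0"
  and T: "T > 0" and m: "m >= 1" and K: "K >= 0"
  and mom: "!!s t. 0 <= s ==> s <= T ==> 0 <= t ==> t <= T ==> (\<integral>\<^sup>+z. ennreal ((Y t z - Y s z) ^ (2 * m)) \<partial>M) <= ennreal (K * (t - s)^2)"
 shows "EX S. majorant T (2 * m) (chain_const (2 * m) * (K * T^2)) Y S"
proof -
 define p where "p = 2 * m"
 have p: "p > 0" "even p" using m by (auto simp: p_def)
 define tt where "tt n i = T * real i / 2 ^ n" for n i
 have tt: "0 <= tt n i" "tt n i <= T" if "i <= 2 ^ n" for n i
 proof -
  have "real i <= 2 ^ n" using that by (metis of_nat_le_iff of_nat_numeral of_nat_power)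
  then show "0 <= tt n i" "tt n i <= T" using T by (auto simp: tt_def divide_le_eq)
 qed
 define Mx where "Mx n z = root p (SUM i<2 ^ n. (Y (tt n (Suc i)) z - Y (tt n i) z) ^ p)" for n z
 have Yt [measurable]: "i <= 2 ^ n ==> Y (tt n i) : borel_measurable M" for n i using tt Ym by auto
 have Mxm [measurable]: "Mx n : borel_measurable M" for n
 proof -
  have "(%z. SUM i<2 ^ n. (Y (tt n (Suc i)) z - Y (tt n i) z) ^ p) : borel_measurable M"
   by (intro borel_measurable_sum borel_measurable_power borel_measurable_diff Yt) auto
  moreover have "root p : borel_measurable borel" by (intro borel_measurable_continuous_onI continuous_intros)
  ultimately show ?thesis unfolding Mx_def[abs_def] by measurable
 qed
 have nn: "0 <= (SUM i<2 ^ n. (Y (tt n (Suc i)) z - Y (tt n i) z) ^ p)" for n z using p by (intro sum_nonneg) (auto simp: zero_le_even_power)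
 have Mx0: "0 <= Mx n z" for n z using nn p by (simp add: Mx_def)
 have Mxp: "Mx n z ^ p = (SUM i<2 ^ n. (Y (tt n (Suc i)) z - Y (tt n i) z) ^ p)" for n z using nn p by (simp add: Mx_def)
 have inc: "abs (Y (tt n (Suc i)) z - Y (tt n i) z) <= Mx n z" if "i < 2 ^ n" for n i z
 proof -
  have "abs (Y (tt n (Suc i)) z - Y (tt n i) z) ^ p = (Y (tt n (Suc i)) z - Y (tt n i) z) ^ p" using p by (simp add: power_even_abs)
  also have "... <= Mx n z ^ p" unfolding Mxp using that p by (intro member_le_sum) (auto simp: zero_le_even_power)
  finally show ?thesis using Mx0 p by (simp add: power_mono_iff)
 qed
 have EM: "(\<integral>\<^sup>+z. ennreal (Mx n z ^ p) \<partial>M) <= ennreal (K * T^2 / 2 ^ n)" for n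
 proof -
  have "(\<integral>\<^sup>+z. ennreal (Mx n z ^ p) \<partial>M) = (\<integral>\<^sup>+z. (SUM i<2 ^ n. ennreal ((Y (tt n (Suc i)) z - Y (tt n i) z) ^ p)) \<partial>M)"
   unfolding Mxp using p by (subst sum_ennreal) (auto simp: zero_le_even_power)
  also have "... = (SUM i<2 ^ n. \<integral>\<^sup>+z. ennreal ((Y (tt n (Suc i)) z - Y (tt n i) z) ^ p) \<partial>M)"
   by (rule nn_integral_sum) (intro measurable_compose[OF _ measurable_ennreal] borel_measurable_power borel_measurable_diff Yt; auto)
  also have "... <= (SUM i<(2::nat) ^ n. ennreal (K * (T / 2 ^ n)^2))"
  proof (rule sum_mono)
   fix i :: nat assume i: "i : {..<2 ^ n}"
   have "tt n (Suc i) - tt n i = T / 2 ^ n" by (simp add: tt_def diff_divide_distrib[symmetric] algebra_simps)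
   then show "(\<integral>\<^sup>+z. ennreal ((Y (tt n (Suc i)) z - Y (tt n i) z) ^ p) \<partial>M) <= ennreal (K * (T / 2 ^ n)^2)"
    using mom[of "tt n i" "tt n (Suc i)"] tt[of i n] tt[of "Suc i" n] i by (simp add: p_def)
  qed
  also have "... = ennreal (2 ^ n * (K * (T / 2 ^ n)^2))" using K by (simp add: ennreal_mult ennreal_of_nat_eq_real_of_nat flip: ennreal_power ennreal_numeral)
  also have "2 ^ n * (K * (T / 2 ^ n)^2) = K * T^2 / 2 ^ n" by (simp add: power_divide power2_eq_square)
  finally show ?thesis .
 qed
 have dy: "abs (Y (tt n i) z) <= (\<Sum>j\<le>n. Mx j z)" if "i <= 2 ^ n" "z : space M" for n i z using that
 proof (induction n arbitrary: i)
  case 0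
  then consider "i = 0" | "i = 1" by fastforce
  then show ?case
  proof cases
   case 1 then show ?thesis using Mx0 Y0 0 by (simp add: tt_def)
  next
   case 2 then show ?thesis using inc[of 0 0 z] Y0 0 by (simp add: tt_def)
  qed
 next
  case (Suc n)
  have half: "tt (Suc n) (2 * j) = tt n j" for j by (simp add: tt_def)
  show ?case
  proof (cases "even i")
   case True
   then obtain j where j: "i = 2 * j" by auto
   then have "abs (Y (tt n j) z) <= (\<Sum>j\<le>n. Mx j z)" using Suc by auto
   then show ?thesis unfolding j half using Mx0[of "Suc n" z] by simp
  next
   case False
   then obtain j where j: "i = Suc (2 * j)" by (metis oddE add.commute plus_1_eq_Suc)
   then have jn: "j <= 2 ^ n" "2 * j < 2 ^ Suc n" using Suc.prems(1) by auto
   have "abs (Y (tt n j) z) <= (\<Sum>j\<le>n. Mx j z)" using Suc jn by auto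
   moreover have "abs (Y (tt (Suc n) (Suc (2 * j))) z - Y (tt n j) z) <= Mx (Suc n) z" using inc[OF jn(2), of z] unfolding half .
   ultimately show ?thesis unfolding j by simp
  qed
 qed
 define S where "S z = (\<Sum>n. ennreal (Mx n z))" for z
 have Sm: "S : borel_measurable M" unfolding S_def by measurable
 have dS: "ennreal (abs (Y (tt n i) z)) <= S z" if "i <= 2 ^ n" "z : space M" for n i z
 proof -
  have "ennreal (abs (Y (tt n i) z)) <= ennreal (\<Sum>j\<le>n. Mx j z)" using dy[OF that] by (rule ennreal_leI)
  also have "... = (\<Sum>j\<le>n. ennreal (Mx j z))" using Mx0 by (intro sum_ennreal[symmetric]) auto
  also have "... <= S z" unfolding S_def by (intro sum_le_suminf) auto
  finally show ?thesis .
 qed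
 have bound: "ennreal (abs (Y t z)) <= S z" if t: "z : space M" "0 <= t" "t <= T" for z t
 proof -
  define i where "i n = nat \<lfloor>t * 2 ^ n / T\<rfloor>" for n :: nat
  have i1: "real (i n) <= t * 2 ^ n / T" "t * 2 ^ n / T < real (i n) + 1" for n using t T unfolding i_def by (simp_all add: of_nat_nat)
  have i2: "i n <= 2 ^ n" for n
  proof -
   have "t * 2 ^ n / T <= 2 ^ n" using t T by (simp add: divide_le_eq)
   then have "real (i n) <= 2 ^ n" using i1(1)[of n] by linarith
   then show ?thesis by (metis of_nat_le_iff of_nat_numeral of_nat_power)
  qed
  have lim: "(%n. tt n (i n)) ----> t"
  proof (rule tendsto_sandwich[of "%n. t - T * (1/2) ^ n" _ _ "%n. t"])
   have b: "t - T * (1/2) ^ n <= tt n (i n) & tt n (i n) <= t" for n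
   proof -
    have "T * (t * 2 ^ n / T) < T * (real (i n) + 1)" using i1(2)[of n] T by (intro mult_strict_left_mono)
    then have "t * 2 ^ n < T * real (i n) + T" using T by (simp add: algebra_simps)
    then have "t < T * real (i n) / 2 ^ n + T / 2 ^ n" by (simp add: field_simps)
    moreover have "T * real (i n) <= T * (t * 2 ^ n / T)" using i1(1)[of n] T by (intro mult_left_mono) auto
    then have "T * real (i n) / 2 ^ n <= t" using T by (simp add: field_simps)
    ultimately show ?thesis by (simp add: tt_def power_one_over)
   qed
   then show "eventually (%n. t - T * (1/2) ^ n <= tt n (i n)) sequentially" "eventually (%n. tt n (i n) <= t) sequentially" by auto
   have "(%n. t - T * (1/2) ^ n) ----> t - T * 0" by (intro tendsto_intros LIMSEQ_power_zero) auto
   then show "(%n. t - T * (1/2) ^ n) ----> t" by simp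
  qed simp
  have "(%n. Y (tt n (i n)) z) ----> Y t z" by (rule continuous_on_tendsto_compose[OF cont[OF t(1)] lim]) (use t tt i2 in auto)
  then have "(%n. ennreal (abs (Y (tt n (i n)) z))) ----> ennreal (abs (Y t z))" by (intro tendsto_intros tendsto_ennrealI)
  then show ?thesis by (rule LIMSEQ_le_const2) (use dS i2 t in blast)
 qed
 (* Geometric weights with a ratio so close to one that the reciprocal to the power p is at most 4 / 3. *)
 define r where "r = 1 - 1 / (4 * real p)"
 have r: "0 < r" "r < 1" "1 - r = 1 / (4 * real p)" using p by (auto simp: r_def field_simps)
 have rp: "3 / 4 <= r ^ p"
 proof -
  have "1 + real p * (- 1 / (4 * real p)) <= (1 + (- 1 / (4 * real p))) ^ p" by (rule Bernoulli_inequality) (use p in \<open>simp add: field_simps\<close>)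
  then show ?thesis using p by (simp add: r_def)
 qed
 define w where "w n = (1 - r) * r ^ n" for n :: nat
 have w0: "w n > 0" for n using r(1,2) unfolding w_def by (intro mult_pos_pos) auto
 have "w sums ((1 - r) * (1 / (1 - r)))" unfolding w_def using r by (intro sums_mult geometric_sums) auto
 then have "(%n. ennreal (w n)) sums ennreal 1" using r(2) p w0 by (subst sums_ennreal) (auto intro: less_imp_le)
 then have w1: "(\<Sum>n. ennreal (w n)) <= 1" by (simp add: sums_iff)
 have "(\<integral>\<^sup>+z. (S z) ^ p \<partial>M) <= (\<integral>\<^sup>+z. (\<Sum>n. (ennreal (1 / w n) * ennreal (Mx n z)) ^ p) \<partial>M)"
  unfolding S_def by (intro nn_integral_mono weighted_sum_power w0 w1 p)
 also have "... = (\<Sum>n. \<integral>\<^sup>+z. (ennreal (1 / w n) * ennreal (Mx n z)) ^ p \<partial>M)" by (rule nn_integral_suminf) measurable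
 also have "... <= (\<Sum>n. ennreal ((4 * real p) ^ p * (K * T^2) * (2 / 3) ^ n))"
 proof (intro suminf_le allI)
  fix n
  have "(\<integral>\<^sup>+z. (ennreal (1 / w n) * ennreal (Mx n z)) ^ p \<partial>M) = (\<integral>\<^sup>+z. ennreal ((1 / w n) ^ p) * ennreal (Mx n z ^ p) \<partial>M)" (is "?l = _")
   using w0[of n] Mx0 by (intro nn_integral_cong) (simp add: power_mult_distrib ennreal_power)
  also have "... = ennreal ((1 / w n) ^ p) * (\<integral>\<^sup>+z. ennreal (Mx n z ^ p) \<partial>M)" by (rule nn_integral_cmult) measurable
  also have "... <= ennreal ((1 / w n) ^ p) * ennreal (K * T^2 / 2 ^ n)" by (intro mult_left_mono EM) auto
  also have "... = ennreal ((1 / w n) ^ p * (K * T^2 / 2 ^ n))" using K w0[of n] by (subst ennreal_mult) auto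
  also have "... <= ennreal ((4 * real p) ^ p * (K * T^2) * (2 / 3) ^ n)"
  proof (rule ennreal_leI)
   have "1 / w n = 4 * real p * (1 / r) ^ n" unfolding w_def r(3) by (simp add: power_one_over)
   then have "(1 / w n) ^ p = (4 * real p) ^ p * ((1 / r) ^ p) ^ n" by (simp add: power_mult_distrib power_mult[symmetric] mult.commute)
   also have "... <= (4 * real p) ^ p * (4 / 3) ^ n"
   proof (intro mult_left_mono power_mono)
    have "1 / r ^ p <= 1 / (3 / 4)" using rp r by (intro divide_left_mono) auto
    then show "(1 / r) ^ p <= 4 / 3" by (simp add: power_one_over)
   qed (use r in auto)
   finally have "(1 / w n) ^ p * (K * T^2 / 2 ^ n) <= (4 * real p) ^ p * (4 / 3) ^ n * (K * T^2 / 2 ^ n)" using K by (intro mult_right_mono) auto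
   also have "... = (4 * real p) ^ p * (K * T^2) * (2 / 3) ^ n"
   proof -
    have "(4 / 3 :: real) ^ n / 2 ^ n = (2 / 3) ^ n" unfolding power_divide[symmetric] by simp
    then show ?thesis by (simp add: field_simps)
   qed
   finally show "(1 / w n) ^ p * (K * T^2 / 2 ^ n) <= (4 * real p) ^ p * (K * T^2) * (2 / 3) ^ n" .
  qed
  finally show "?l <= ennreal ((4 * real p) ^ p * (K * T^2) * (2 / 3) ^ n)" .
 qed auto
 also have "... = ennreal (chain_const p * (K * T^2))"
 proof -
  have "(%n. (4 * real p) ^ p * (K * T^2) * (2 / 3) ^ n) sums ((4 * real p) ^ p * (K * T^2) * (1 / (1 - 2 / 3)))" by (intro sums_mult geometric_sums) auto
  then have "(%n. ennreal ((4 * real p) ^ p * (K * T^2) * (2 / 3) ^ n)) sums ennreal ((4 * real p) ^ p * (K * T^2) * (1 / (1 - 2 / 3)))"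
   using K by (subst sums_ennreal) auto
  then show ?thesis by (simp add: sums_iff chain_const_def mult_ac)
 qed
 finally have "(\<integral>\<^sup>+z. (S z) ^ (2 * m) \<partial>M) <= ennreal (chain_const (2 * m) * (K * T^2))" by (simp only: p_def)
 with Sm bound have "majorant T (2 * m) (chain_const (2 * m) * (K * T^2)) Y S" by (intro majorantI)
 then show ?thesis by (rule exI[of _ S])
qed

end

section \<open>The stochastic convolution, shell by shell\<close>

locale ou_family = prob_space M + flat_torus L for M :: "'w measure" and L :: real +
 fixes X :: "idx => real => 'w => real"
 assumes X_measurable: "!!k t. k : modes ==> t >= 0 ==> X k t : borel_measurable M"
  and X_continuous: "!!k \<omega>. k : modes ==> continuous_on {0..} (%t. X k t \<omega>)"
  and X_0: "!!k \<omega>. k : modes ==> X k 0 \<omega> = 0"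
  and X_gauss: "!!F s t \<alpha>. finite F ==> F <= modes ==> 0 <= s ==> 0 <= t ==>
   gauss M (%\<omega>. SUM k:F. \<alpha> k * (X k t \<omega> - X k s \<omega>)) (SUM k:F. (\<alpha> k)^2 * ouvar ((eigval L k)^2) s t)"
begin

lemma eigval_sq_pos: "k : modes ==> (eigval L k)^2 > 0" using eigval_pos[of k] by simp

definition shellsum :: "series => nat => real => plane => 'w => real" where
 "shellsum a n t x w = (SUM k:shell n. a k * X k t w * bf k x)"

lemma linear_moment:
 assumes F: "finite F" "F <= modes" and st: "0 <= s" "s <= T" "0 <= t" "t <= T"
  and V: "!!k. k : F ==> ouvar ((eigval L k)^2) s t <= V" and b: "(SUM k:F. (b k)^2) * V <= v"
 shows "(\<integral>\<^sup>+w. ennreal (((SUM k:F. b k * X k t w) - (SUM k:F. b k * X k s w)) ^ (2 * m)) \<partial>M) <= ennreal (mom m * v ^ m)"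
proof -
 have g: "gauss M (%w. SUM k:F. b k * (X k t w - X k s w)) (SUM k:F. (b k)^2 * ouvar ((eigval L k)^2) s t)" using F st by (intro X_gauss) auto
 have "(SUM k:F. (b k)^2 * ouvar ((eigval L k)^2) s t) <= (SUM k:F. (b k)^2 * V)" using V by (intro sum_mono mult_left_mono) auto
 also have "... <= v" using b by (simp add: sum_distrib_right)
 finally have "mom m * (SUM k:F. (b k)^2 * ouvar ((eigval L k)^2) s t) ^ m <= mom m * v ^ m"
  using mom_pos[of m] gauss_nonneg[OF g] by (intro mult_left_mono power_mono) auto
 moreover have "(SUM k:F. b k * X k t w) - (SUM k:F. b k * X k s w) = (SUM k:F. b k * (X k t w - X k s w))" for w by (simp add: sum_subtractf right_diff_distrib)
 ultimately show ?thesis using gauss_moment[OF g, of m] by (simp add: ennreal_leI)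
qed

text \<open>Of the \<open>m\<close> powers of the variance two are spent on the time increment, as chaining requires; the others keep the decay in the wave number.\<close>

lemma linear_majorant:
 assumes F: "finite F" "F <= modes" and T: "T > 0" and m: "m >= 2" and c: "c >= 0" "d >= 0"
  and V: "!!s t k. 0 <= s ==> s <= T ==> 0 <= t ==> t <= T ==> k : F ==> ouvar ((eigval L k)^2) s t <= d"
  and b: "(SUM k:F. (b k)^2) <= c"
 shows "EX S. majorant T (2 * m) (chain_const (2 * m) * (mom m * c ^ m * d ^ (m - 2) * T^2)) (%t w. SUM k:F. b k * X k t w) S"
proof -
 have sub: "{0..T} <= {0..}" by auto
 show ?thesis
 proof (rule chaining[where Y="%t w. SUM k:F. b k * X k t w" and T=T and m=m and K="mom m * c ^ m * d ^ (m - 2)"])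
  show "(%w. SUM k:F. b k * X k t w) : borel_measurable M" if "0 <= t" "t <= T" for t
   using F that X_measurable by (intro borel_measurable_sum borel_measurable_times borel_measurable_const) auto
  show "continuous_on {0..T} (%t. SUM k:F. b k * X k t w)" for w using F by (intro continuous_intros continuous_on_subset[OF X_continuous sub]) auto
  show "(SUM k:F. b k * X k 0 w) = 0" for w using F X_0 by (intro sum.neutral) auto
  show "mom m * c ^ m * d ^ (m - 2) >= 0" using c mom_pos[of m] by simp
  fix s t assume st: "0 <= s" "s <= T" "0 <= t" "t <= T"
  define V' where "V' = min d (abs (t - s))"
  have V': "0 <= V'" "V' <= d" "V' <= abs (t - s)" using c by (auto simp: V'_def)
  have "(\<integral>\<^sup>+w. ennreal (((SUM k:F. b k * X k t w) - (SUM k:F. b k * X k s w)) ^ (2 * m)) \<partial>M) <= ennreal (mom m * (c * V') ^ m)" (is "?l <= _")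
  proof (rule linear_moment[OF F st])
   show "ouvar ((eigval L k)^2) s t <= V'" if "k : F" for k using V[OF st that] ouvar_bounds(2)[OF st(1,3) eigval_sq_pos, of k] that F by (auto simp: V'_def)
   show "(SUM k:F. (b k)^2) * V' <= c * V'" using b V' by (intro mult_right_mono) auto
  qed
  also have "... <= ennreal (mom m * c ^ m * d ^ (m - 2) * (t - s)^2)"
  proof (rule ennreal_leI)
   have "m = m - 2 + 2" using m by simp
   then have "V' ^ m = V' ^ (m - 2) * V' ^ 2" by (metis power_add)
   also have "... <= d ^ (m - 2) * abs (t - s) ^ 2" using V' by (intro mult_mono power_mono) auto
   finally have "(mom m * c ^ m) * V' ^ m <= (mom m * c ^ m) * (d ^ (m - 2) * abs (t - s) ^ 2)" using c mom_pos[of m] by (intro mult_left_mono) auto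
   then show "mom m * (c * V') ^ m <= mom m * c ^ m * d ^ (m - 2) * (t - s)^2" by (simp add: power_mult_distrib mult_ac)
  qed
  finally show "?l <= ennreal (mom m * c ^ m * d ^ (m - 2) * (t - s)^2)" .
 qed (use T m in auto)
qed

lemma mode_majorant:
 assumes k: "k : modes" and T: "T > 0" and m: "m >= 2"
 shows "EX S. majorant T (2 * m) (chain_const (2 * m) * (mom m * T ^ (m - 2) * T^2)) (X k) S"
proof -
 have V: "ouvar ((eigval L l)^2) s t <= T" if "0 <= s" "s <= T" "0 <= t" "t <= T" "l : {k}" for s t l
  using ouvar_bounds(2)[of s t "(eigval L l)^2"] eigval_sq_pos[OF k] that by auto
 have "EX S. majorant T (2 * m) (chain_const (2 * m) * (mom m * 1 ^ m * T ^ (m - 2) * T^2)) (%t w. SUM k:{k}. 1 * X k t w) S"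
  by (rule linear_majorant) (use k T m V in auto)
 then show ?thesis by simp
qed

lemma e_lipschitz: "abs (bf k x - bf k y) <= (2 * kp / L * cnorm k) * (abs (fst x - fst y) + abs (snd x - snd y))"
proof (rule lipschitz_of_partials[OF e_gderiv])
 have c: "abs (real_of_int (fst k)) <= cnorm k" "abs (real_of_int (snd k)) <= cnorm k" using cnorm_le_iff[of k "cnorm k"] by linarith+
 have "abs (d1 k x) <= kp * cnorm k * (2 / L)" "abs (d2 k x) <= kp * cnorm k * (2 / L)" for x
  unfolding d1_def d2_def abs_mult using kp_pos c by (intro mult_mono e_bound; simp)+
 then show "abs (fst (d1 k x, d2 k x)) <= 2 * kp / L * cnorm k" "abs (snd (d1 k x, d2 k x)) <= 2 * kp / L * cnorm k" for x by (simp_all add: mult_ac)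
qed

definition shell_const :: "real => nat => real" where
 "shell_const T m = 2 ^ (2 * m) * (chain_const (2 * m) * (mom m * (48 / L^2) ^ m * (1 / kp ^ 4) ^ (m - 2) * T^2)
   + (4 * kp) ^ (2 * m) * (12 ^ (2 * m) * (12 * (chain_const (2 * m) * (mom m * T ^ (m - 2) * T^2)))))"

lemma chain_const_nonneg: "chain_const p >= 0" by (simp add: chain_const_def)

lemma shell_const_nonneg: "T >= 0 ==> shell_const T m >= 0" unfolding shell_const_def using kp_pos less_imp_le[OF mom_pos]
 by (intro mult_nonneg_nonneg add_nonneg_nonneg chain_const_nonneg zero_le_power) simp_all

text \<open>The supremum over the torus is taken over a grid of \<open>n ^ 8\<close> points; between grid points a crude Lipschitz estimate suffices. The powers of \<open>n\<close> lost to the grid do not depend on the moment, while the gain grows with the moment.\<close>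

lemma shell_majorant:
 assumes T: "T > 0" and m: "m >= 2" and n: "n >= 1" and A: "A >= 0" and a: "!!k. k : shell n ==> abs (a k) <= A"
 shows "EX S. ALL x. majorant T (2 * m) (shell_const T m * A ^ (2 * m) * (real n ^ 16 / real n ^ (3 * m))) (%t. shellsum a n t x) S"
proof -
 have n0: "real n > 0" "real n >= 1" using n by auto
 define G where "G = n ^ 4"
 have G: "G >= 1" using n by (simp add: G_def)
 define P where "P = {..G} \<times> {..G}"
 define pt :: "nat \<times> nat => plane" where "pt ij = (L * real (fst ij) / G, L * real (snd ij) / G)" for ij
 define I where "I = {..<G} \<times> {..<G}"
 have I: "finite I" "I ~= {}" "card I = G^2" using G by (auto simp: I_def card_cartesian_product power2_eq_square lessThan_empty_iff)
 define d where "d = 1 / (kp ^ 4 * real n ^ 4)"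
 have d: "d >= 0" using kp_pos by (simp add: d_def)
 have V: "ouvar ((eigval L k)^2) s t <= d" if "0 <= s" "0 <= t" "k : shell n" for s t k
 proof -
  have k: "k : modes" "cnorm k = n" using that by (auto simp: shell_def)
  have "ouvar ((eigval L k)^2) s t <= 1 / (eigval L k)^2" using that k by (intro ouvar_bounds eigval_sq_pos)
  also have "... <= d" unfolding d_def using eigval_sq_ge[of k] k n0 kp_pos eigval_sq_pos[OF k(1)] by (intro divide_left_mono) auto
  finally show ?thesis .
 qed
 define c where "c = 48 / L^2 * A^2 * n"
 have c: "c >= 0" by (simp add: c_def)
 have b: "(SUM k:shell n. (a k * bf k x)^2) <= c" for x
 proof -
  have "(SUM k:shell n. (a k * bf k x)^2) <= (SUM k:shell n. (A * (2 / L))^2)"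
  proof (rule sum_mono)
   fix k assume k: "k : shell n"
   have "abs (a k * bf k x) <= A * (2 / L)" unfolding abs_mult using a[OF k] A by (intro mult_mono e_bound) auto
   then show "(a k * bf k x)^2 <= (A * (2 / L))^2" using A L_pos by (intro power2_le_iff_abs_le[THEN iffD2]) auto
  qed
  also have "... = real (card (shell n)) * (A * (2 / L))^2" by simp
  also have "... <= 12 * real n * (A * (2 / L))^2" by (intro mult_right_mono card_shell) auto
  also have "... = c" by (simp add: c_def power_mult_distrib power_divide)
  finally show ?thesis .
 qed
 define K1 where "K1 = chain_const (2 * m) * (mom m * c ^ m * d ^ (m - 2) * T^2)"
 define K2 where "K2 = chain_const (2 * m) * (mom m * T ^ (m - 2) * T^2)"
 have K: "K1 >= 0" "K2 >= 0" using c d T chain_const_nonneg[of "2 * m"] mom_pos[of m] by (auto simp: K1_def K2_def)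
 have "EX S. majorant T (2 * m) K1 (%t. shellsum a n t (pt ij)) S" for ij
 proof -
  have e: "(%t w. SUM k:shell n. a k * bf k (pt ij) * X k t w) = (%t. shellsum a n t (pt ij))" unfolding shellsum_def by (intro ext sum.cong) auto
  have "EX S. majorant T (2 * m) K1 (%t w. SUM k:shell n. a k * bf k (pt ij) * X k t w) S"
   unfolding K1_def by (rule linear_majorant[OF finite_shell shell_modes T m c d V b])
  then show ?thesis unfolding e .
 qed
 then obtain S1 where "!!ij. majorant T (2 * m) K1 (%t. shellsum a n t (pt ij)) (S1 ij)" by metis
 note S1 = majorantD[OF this]
 have "ALL k:modes. EX S. majorant T (2 * m) K2 (X k) S" using mode_majorant[OF _ T m] unfolding K2_def by blast
 then obtain S2 where S2': "!!k. k : modes ==> majorant T (2 * m) K2 (X k) (S2 k)" by metis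
 note S2 = majorantD[OF S2']
 define \<rho> where "\<rho> = A * (4 * kp * n / G)"
 have \<rho>: "\<rho> >= 0" using A kp_pos by (simp add: \<rho>_def)
 define H where "H w = Max ((%ij. S1 ij w) ` I)" for w
 define R where "R w = ennreal \<rho> * (SUM k:shell n. S2 k w)" for w
 define S where "S w = H w + R w" for w
 have Hm [measurable]: "H : borel_measurable M" unfolding H_def[abs_def] using I S1(1) by (intro borel_measurable_Max) auto
 have Rm [measurable]: "R : borel_measurable M" unfolding R_def[abs_def] using shell_modes[of n]
  by (intro borel_measurable_times_ennreal borel_measurable_const borel_measurable_sum S2(1)) auto
 have bound: "ennreal (abs (shellsum a n t x w)) <= S w" if w: "w : space M" and t: "0 <= t" "t <= T" for w t x
 proof -
  obtain y where y: "y : torus L" "!!g :: plane => real. periodic L g ==> g x = g y" by (rule periodic_reduce[of x]) blast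
  have "periodic L (%x. shellsum a n t x w)" using e_periodic by (simp add: periodic_def shellsum_def)
  then have xy: "shellsum a n t x w = shellsum a n t y w" by (rule y(2))
  have near: "EX i<G. abs (s - L * real i / G) <= L / G" if s: "0 <= s" "s <= L" for s
  proof -
   define j where "j = nat \<lfloor>s * G / L\<rfloor>"
   define i where "i = min (G - 1) j"
   have f: "real j <= s * G / L" "s * G / L < real j + 1" using s L_pos by (simp_all add: j_def of_nat_nat)
   have "s * G / L <= G" using s L_pos mult_right_mono[of s L "real G"] by (simp add: divide_le_eq mult.commute)
   then have "abs (s * G / L - real i) <= 1"  using f G by (cases "j <= G - 1") (simp_all add: i_def of_nat_diff)
   then have "L / G * abs (s * G / L - real i) <= L / G * 1" using L_pos by (intro mult_left_mono) auto
   moreover have "L / G * abs (s * G / L - real i) = abs (L / G * (s * G / L - real i))" using L_pos by (simp add: abs_mult)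
   moreover have "L / G * (s * G / L - real i) = s - L * real i / G" using L_pos G by (simp add: field_simps)
   moreover have "i < G" using G by (simp add: i_def)
   ultimately show ?thesis by (metis mult.right_neutral)
  qed
  obtain i j where ij: "i < G" "j < G" "abs (fst y - L * real i / G) <= L / G" "abs (snd y - L * real j / G) <= L / G"
   using near[of "fst y"] near[of "snd y"] y(1) by (auto simp: torus_Times)
  define z where "z = pt (i, j)"
  have dist: "abs (fst y - fst z) + abs (snd y - snd z) <= 2 * L / G" using ij by (simp add: z_def pt_def)
  have "abs (shellsum a n t y w - shellsum a n t z w) <= (SUM k:shell n. \<rho> * abs (X k t w))"
  proof -
   have "abs (shellsum a n t y w - shellsum a n t z w) = abs (SUM k:shell n. a k * X k t w * (bf k y - bf k z))"
    by (simp add: shellsum_def sum_subtractf right_diff_distrib)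
   also have "... <= (SUM k:shell n. abs (a k * X k t w * (bf k y - bf k z)))" by (rule sum_abs)
   also have "... <= (SUM k:shell n. \<rho> * abs (X k t w))"
   proof (rule sum_mono)
    fix k assume k: "k : shell n"
    then have kn: "cnorm k = n" by (simp add: shell_def)
    have "abs (bf k y - bf k z) <= (2 * kp / L * n) * (abs (fst y - fst z) + abs (snd y - snd z))" using e_lipschitz[of k y z] kn by simp
    also have "... <= (2 * kp / L * n) * (2 * L / G)" using dist kp_pos L_pos by (intro mult_left_mono) auto
    also have "... = 4 * kp * n / G" using L_pos by simp
    finally have "abs (a k) * abs (bf k y - bf k z) <= \<rho>" unfolding \<rho>_def using a[OF k] A by (intro mult_mono) auto
    then have "abs (a k) * abs (bf k y - bf k z) * abs (X k t w) <= \<rho> * abs (X k t w)" by (rule mult_right_mono) simp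
    then show "abs (a k * X k t w * (bf k y - bf k z)) <= \<rho> * abs (X k t w)" by (simp add: abs_mult mult_ac)
   qed
   finally show ?thesis .
  qed
  then have "abs (shellsum a n t y w) <= abs (shellsum a n t z w) + (SUM k:shell n. \<rho> * abs (X k t w))" by linarith
  then have "ennreal (abs (shellsum a n t y w)) <= ennreal (abs (shellsum a n t z w) + (SUM k:shell n. \<rho> * abs (X k t w)))" by (rule ennreal_leI)
  also have "... = ennreal (abs (shellsum a n t z w)) + (SUM k:shell n. ennreal \<rho> * ennreal (abs (X k t w)))"
   using \<rho> by (simp add: ennreal_plus sum_nonneg sum_ennreal[symmetric] ennreal_mult)
  also have "... <= H w + R w"
  proof (rule add_mono)
   have "S1 (i, j) w <= H w" unfolding H_def using I ij by (intro Max_ge) (auto simp: I_def)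
   then show "ennreal (abs (shellsum a n t z w)) <= H w" using S1(2)[OF w t, of "(i, j)"] unfolding z_def by (rule order_trans[rotated])
   show "(SUM k:shell n. ennreal \<rho> * ennreal (abs (X k t w))) <= R w"
    unfolding R_def sum_distrib_left using S2(2)[OF _ w t] shell_modes by (intro sum_mono mult_left_mono) auto
  qed
  finally show ?thesis unfolding xy S_def .
 qed
 have EH: "(\<integral>\<^sup>+w. H w ^ (2 * m) \<partial>M) <= ennreal (real (G^2) * K1)"
 proof -
  have "(\<integral>\<^sup>+w. H w ^ (2 * m) \<partial>M) <= (\<integral>\<^sup>+w. (SUM ij:I. S1 ij w ^ (2 * m)) \<partial>M)"
   unfolding H_def by (intro nn_integral_mono ennreal_Max_power I)
  also have "... = (SUM ij:I. \<integral>\<^sup>+w. S1 ij w ^ (2 * m) \<partial>M)" using S1(1) by (intro nn_integral_sum) auto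
  also have "... <= (SUM ij:I. ennreal K1)" by (intro sum_mono S1)
  also have "... = ennreal (real (G^2) * K1)" using K I(3) by (simp add: ennreal_mult ennreal_of_nat_eq_real_of_nat)
  finally show ?thesis .
 qed
 have ER: "(\<integral>\<^sup>+w. R w ^ (2 * m) \<partial>M) <= ennreal (\<rho> ^ (2 * m) * ((12 * real n) ^ (2 * m) * (12 * real n * K2)))"
 proof -
  have "(\<integral>\<^sup>+w. R w ^ (2 * m) \<partial>M) <= (\<integral>\<^sup>+w. ennreal (\<rho> ^ (2 * m)) * (of_nat (card (shell n)) ^ (2 * m) * (SUM k:shell n. S2 k w ^ (2 * m))) \<partial>M)"
   unfolding R_def power_mult_distrib using \<rho> m by (intro nn_integral_mono mult_mono ennreal_sum_power) (auto simp: ennreal_power)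
  also have "... = ennreal (\<rho> ^ (2 * m)) * (of_nat (card (shell n)) ^ (2 * m) * (SUM k:shell n. \<integral>\<^sup>+w. S2 k w ^ (2 * m) \<partial>M))"
  proof -
   have m2: "S2 k : borel_measurable M" if "k : shell n" for k using that shell_modes[of n] by (intro S2(1)) auto
   have m3: "(%w. SUM k:shell n. S2 k w ^ (2 * m)) \<in> borel_measurable M" by (intro borel_measurable_sum borel_measurable_power_ennreal m2)
   have "(\<integral>\<^sup>+w. (SUM k:shell n. S2 k w ^ (2 * m)) \<partial>M) = (SUM k:shell n. \<integral>\<^sup>+w. S2 k w ^ (2 * m) \<partial>M)"
    by (intro nn_integral_sum borel_measurable_power_ennreal m2)
   then show ?thesis using m3 by (simp add: nn_integral_cmult)
  qed
  also have "... <= ennreal (\<rho> ^ (2 * m)) * (ennreal ((12 * real n) ^ (2 * m)) * ennreal (12 * real n * K2))"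
  proof (intro mult_left_mono mult_mono)
   have cs: "of_nat (card (shell n)) <= ennreal (12 * real n)" using card_shell[of n] by (simp add: ennreal_of_nat_eq_real_of_nat ennreal_leI)
   then show "of_nat (card (shell n)) ^ (2 * m) <= ennreal ((12 * real n) ^ (2 * m))" by (subst ennreal_power[symmetric]) (auto intro: power_mono)
   have "(SUM k:shell n. \<integral>\<^sup>+w. S2 k w ^ (2 * m) \<partial>M) <= (SUM k:shell n. ennreal K2)" (is "?l <= _") using S2(3) shell_modes by (intro sum_mono) auto
   also have "... = of_nat (card (shell n)) * ennreal K2" by simp
   also have "... <= ennreal (12 * real n) * ennreal K2" by (intro mult_right_mono cs) auto
   finally show "?l <= ennreal (12 * real n * K2)" using K by (simp add: ennreal_mult)
  qed auto
  finally show ?thesis using \<rho> K by (simp add: ennreal_mult)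
 qed
 have "(\<integral>\<^sup>+w. S w ^ (2 * m) \<partial>M) <= (\<integral>\<^sup>+w. 2 ^ (2 * m) * (H w ^ (2 * m) + R w ^ (2 * m)) \<partial>M)" (is "?l <= _")
  unfolding S_def by (intro nn_integral_mono ennreal_add_power)
 also have "... = 2 ^ (2 * m) * ((\<integral>\<^sup>+w. H w ^ (2 * m) \<partial>M) + (\<integral>\<^sup>+w. R w ^ (2 * m) \<partial>M))"
  by (simp add: nn_integral_cmult nn_integral_add)
 also have "... <= 2 ^ (2 * m) * (ennreal (real (G^2) * K1) + ennreal (\<rho> ^ (2 * m) * ((12 * real n) ^ (2 * m) * (12 * real n * K2))))"
  by (intro mult_left_mono add_mono EH ER) auto
 also have "... = ennreal (2 ^ (2 * m) * (real (G^2) * K1 + \<rho> ^ (2 * m) * ((12 * real n) ^ (2 * m) * (12 * real n * K2))))"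
 proof -
  have "(2::ennreal) ^ (2 * m) = ennreal (2 ^ (2 * m))" by (simp flip: ennreal_power)
  then show ?thesis using K \<rho> by (simp only:) (simp add: ennreal_mult ennreal_plus)
 qed
 also have "... <= ennreal (shell_const T m * A ^ (2 * m) * (real n ^ 16 / real n ^ (3 * m)))"
 proof (rule ennreal_leI)
  define N where "N = real n"
  have N: "N >= 1" "N > 0" using n0 by (auto simp: N_def)
  have GN: "real G = N ^ 4" by (simp add: G_def N_def)
  have p1: "real (G^2) * K1 = chain_const (2 * m) * (mom m * (48 / L^2) ^ m * (1 / kp ^ 4) ^ (m - 2) * T^2) * (A ^ (2 * m) * (N ^ 16 / N ^ (3 * m)))"
  proof -
   have dm: "d ^ (m - 2) = (1 / kp ^ 4) ^ (m - 2) * (1 / N ^ (4 * (m - 2)))" by (simp add: d_def N_def power_divide power_mult_distrib power_mult)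
   have cm: "c ^ m = (48 / L^2) ^ m * A ^ (2 * m) * N ^ m" by (simp only: c_def N_def power_mult_distrib power_mult)
   have e: "N ^ 8 * (N ^ m * (1 / N ^ (4 * (m - 2)))) = N ^ 16 / N ^ (3 * m)"
   proof -
    have "N ^ 8 * N ^ m * N ^ (3 * m) = N ^ 16 * N ^ (4 * (m - 2))" unfolding power_add[symmetric]
     using m by (intro arg_cong[where f="power N"]) (simp add: diff_mult_distrib2)
    then show ?thesis using N by (simp add: field_simps)
   qed
   have "real (G^2) = N ^ 8" by (simp add: GN flip: power_mult)
   then have "real (G^2) * K1 = chain_const (2 * m) * (mom m * (48 / L^2) ^ m * (1 / kp ^ 4) ^ (m - 2) * T^2) * (A ^ (2 * m) * (N ^ 8 * (N ^ m * (1 / N ^ (4 * (m - 2))))))"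
    unfolding K1_def dm cm by (simp add: mult_ac)
   then show ?thesis unfolding e .
  qed
  have p2: "\<rho> ^ (2 * m) * ((12 * real n) ^ (2 * m) * (12 * real n * K2)) <= (4 * kp) ^ (2 * m) * (12 ^ (2 * m) * (12 * K2)) * (A ^ (2 * m) * (N ^ 16 / N ^ (3 * m)))"
  proof -
   have \<rho>e: "\<rho> = A * (4 * kp) * (1 / N ^ 3)" using N by (simp add: \<rho>_def GN N_def[symmetric] field_simps power4_eq_xxxx power3_eq_cube)
   have "\<rho> ^ (2 * m) * ((12 * real n) ^ (2 * m) * (12 * real n * K2)) = (4 * kp) ^ (2 * m) * (12 ^ (2 * m) * (12 * K2)) * (A ^ (2 * m) * ((1 / N ^ 3) ^ (2 * m) * (N ^ (2 * m) * N)))"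
    unfolding \<rho>e N_def[symmetric] by (simp only: power_mult_distrib) (simp only: mult_ac)
   also have "... <= (4 * kp) ^ (2 * m) * (12 ^ (2 * m) * (12 * K2)) * (A ^ (2 * m) * (N ^ 16 / N ^ (3 * m)))"
   proof (intro mult_left_mono)
    have "(1 / N ^ 3) ^ (2 * m) * (N ^ (2 * m) * N) = (N ^ (2 * m) * N) / N ^ (6 * m)" (is "?l = _") by (simp add: power_one_over power_mult[symmetric])
    also have "... <= N ^ 16 / N ^ (3 * m)"
    proof -
     have "N ^ (2 * m) * N * N ^ (3 * m) = N ^ (5 * m + 1)" by (simp flip: power_add)
     also have "... <= N ^ (6 * m + 16)" using N by (intro power_increasing) auto
     also have "... = N ^ 16 * N ^ (6 * m)" by (simp add: power_add)
     finally show ?thesis using N by (simp add: divide_simps)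
    qed
    finally show "?l <= N ^ 16 / N ^ (3 * m)" .
   qed (use A K kp_pos in auto)
   finally show ?thesis .
  qed
  have "2 ^ (2 * m) * (real (G^2) * K1 + \<rho> ^ (2 * m) * ((12 * real n) ^ (2 * m) * (12 * real n * K2)))
   <= 2 ^ (2 * m) * (chain_const (2 * m) * (mom m * (48 / L^2) ^ m * (1 / kp ^ 4) ^ (m - 2) * T^2) * (A ^ (2 * m) * (N ^ 16 / N ^ (3 * m)))
    + (4 * kp) ^ (2 * m) * (12 ^ (2 * m) * (12 * K2)) * (A ^ (2 * m) * (N ^ 16 / N ^ (3 * m))))" (is "?l <= _")
   unfolding p1 using p2 by (intro mult_left_mono add_left_mono) auto
  also have "... = shell_const T m * A ^ (2 * m) * (N ^ 16 / N ^ (3 * m))" unfolding shell_const_def K2_def by (simp only: distrib_left distrib_right mult_ac)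
  finally show "?l <= shell_const T m * A ^ (2 * m) * (real n ^ 16 / real n ^ (3 * m))"
   by (simp only: N_def)
 qed
 finally have ES: "?l <= ennreal (shell_const T m * A ^ (2 * m) * (real n ^ 16 / real n ^ (3 * m)))" .
 have "S : borel_measurable M" unfolding S_def[abs_def] by measurable
 then have "ALL x. majorant T (2 * m) (shell_const T m * A ^ (2 * m) * (real n ^ 16 / real n ^ (3 * m))) (%t. shellsum a n t x) S"
  using bound ES by (intro allI majorantI)
 then show ?thesis by (rule exI[of _ S])
qed

definition shell_majorants :: "real => nat => series => ennreal => (nat => 'w => ennreal) => bool" where
 "shell_majorants T q a B s \<longleftrightarrow> (ALL n. s n : borel_measurable M) &
   (ALL n w t x. w : space M --> 0 <= t --> t <= T --> ennreal (abs (shellsum a (Suc n) t x w)) <= s n w) &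
   (\<integral>\<^sup>+w. (\<Sum>n. s n w) ^ q \<partial>M) <= B"

lemma shell_majorantsD:
 assumes "shell_majorants T q a B s"
 shows "!!n. s n : borel_measurable M"
  "!!n w t x. w : space M ==> 0 <= t ==> t <= T ==> ennreal (abs (shellsum a (Suc n) t x w)) <= s n w"
  "(\<integral>\<^sup>+w. (\<Sum>n. s n w) ^ q \<partial>M) <= B" using assms unfolding shell_majorants_def by iprover+

text \<open>The root of the moment of shell \<open>n\<close> is of order \<open>n powr (- 3 / 2)\<close> up to a loss that is small for large \<open>l\<close>; the weights \<open>n powr (- 5 / 4)\<close> are summable and leave a factor \<open>1 / n^2\<close>.\<close>

lemma convolution_majorant:
 assumes T: "T > 0" and l: "l >= 18"
 obtains C where "C >= 0" "!!a A. (!!n. A n >= 0) ==> (!!n k. k : shell n ==> abs (a k) <= A n) ==>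
  EX s. shell_majorants T (4 * l) a (\<Sum>n. ennreal (C * A (Suc n) ^ (4 * l) / real (Suc n) ^ 2)) s"
proof -
 define v where "v n = real (Suc n) powr (- 5 / 4)" for n
 have v0: "v n > 0" for n by (simp add: v_def)
 have "summable (%n. real n powr (- 5 / 4))" by (subst summable_real_powr_iff) simp
 then have sv: "summable v" unfolding v_def by (subst (asm) summable_Suc_iff[symmetric])
 define V where "V = suminf v"
 have V: "V > 0" unfolding V_def by (intro suminf_pos sv v0)
 define w where "w n = v n / V" for n
 have w0: "w n > 0" for n using v0 V by (simp add: w_def)
 have "w sums (V / V)" unfolding w_def V_def using sv by (intro sums_divide summable_sums)
 then have "(%n. ennreal (w n)) sums ennreal 1" using V w0 by (subst sums_ennreal) (auto intro: less_imp_le)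
 then have w1: "(\<Sum>n. ennreal (w n)) <= 1" by (simp add: sums_iff)
 define C where "C = V ^ (4 * l) * shell_const T (2 * l)"
 have C: "C >= 0" using V T shell_const_nonneg[of T "2 * l"] by (simp add: C_def)
 show thesis
 proof (rule that[OF C])
  fix a :: series and A :: "nat => real" assume A: "!!n. A n >= 0" "!!n k. k : shell n ==> abs (a k) <= A n"
  have m2: "2 * l >= 2" using l by simp
  have "EX S. ALL x. majorant T (2 * (2 * l)) (shell_const T (2 * l) * A (Suc n) ^ (2 * (2 * l)) * (real (Suc n) ^ 16 / real (Suc n) ^ (3 * (2 * l)))) (%t. shellsum a (Suc n) t x) S" for n
   by (rule shell_majorant[OF T m2 _ A(1) A(2)]) auto
  then obtain s where s': "!!n x. majorant T (2 * (2 * l)) (shell_const T (2 * l) * A (Suc n) ^ (2 * (2 * l)) * (real (Suc n) ^ 16 / real (Suc n) ^ (3 * (2 * l)))) (%t. shellsum a (Suc n) t x) (s n)" by metis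
  note s = majorantD(1)[OF s'] majorantD(2)[OF s'] majorantD(3)[OF s']
  note [measurable] = s(1)
  have l4: "2 * (2 * l) = 4 * l" by simp
  have "(\<integral>\<^sup>+z. (\<Sum>n. s n z) ^ (4 * l) \<partial>M) <= (\<integral>\<^sup>+z. (\<Sum>n. (ennreal (1 / w n) * s n z) ^ (4 * l)) \<partial>M)"
   using l by (intro nn_integral_mono weighted_sum_power w0 w1) auto
  also have "... = (\<Sum>n. \<integral>\<^sup>+z. (ennreal (1 / w n) * s n z) ^ (4 * l) \<partial>M)" by (rule nn_integral_suminf) measurable
  also have "... <= (\<Sum>n. ennreal (C * A (Suc n) ^ (4 * l) / real (Suc n) ^ 2))"
  proof (intro suminf_le allI)
   fix n
   define N where "N = real (Suc n)"
   have N: "N >= 1" "N > 0" by (auto simp: N_def)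
   have "(\<integral>\<^sup>+z. (ennreal (1 / w n) * s n z) ^ (4 * l) \<partial>M) = (\<integral>\<^sup>+z. ennreal ((1 / w n) ^ (4 * l)) * (s n z) ^ (4 * l) \<partial>M)" (is "?l = _")
    using w0[of n] by (intro nn_integral_cong) (simp add: power_mult_distrib ennreal_power)
   also have "... = ennreal ((1 / w n) ^ (4 * l)) * (\<integral>\<^sup>+z. (s n z) ^ (4 * l) \<partial>M)" by (rule nn_integral_cmult) measurable
   also have "... <= ennreal ((1 / w n) ^ (4 * l)) * ennreal (shell_const T (2 * l) * A (Suc n) ^ (4 * l) * (N ^ 16 / N ^ (6 * l)))"
    using s(3)[of n] by (intro mult_left_mono) (auto simp: N_def l4)
   also have "... = ennreal ((1 / w n) ^ (4 * l) * (shell_const T (2 * l) * A (Suc n) ^ (4 * l) * (N ^ 16 / N ^ (6 * l))))"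
    using w0[of n] T A N shell_const_nonneg[of T "2 * l"] by (subst ennreal_mult) auto
   also have "... <= ennreal (C * A (Suc n) ^ (4 * l) / real (Suc n) ^ 2)"
   proof (rule ennreal_leI)
    have "1 / w n = V * N powr (5 / 4)" using V N by (simp add: w_def v_def N_def powr_minus divide_simps)
    then have "(1 / w n) ^ (4 * l) = V ^ (4 * l) * (N powr (5 / 4)) ^ (4 * l)" by (simp add: power_mult_distrib)
    also have "(N powr (5 / 4)) ^ (4 * l) = N ^ (5 * l)"
    proof -
     have "(N powr (5 / 4)) ^ (4 * l) = N powr (5 / 4 * real (4 * l))" using N by (simp add: powr_powr flip: powr_realpow)
     also have "5 / 4 * real (4 * l) = real (5 * l)" by simp
     finally show ?thesis using N powr_realpow[of N "5 * l"] by simp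
    qed
    finally have e: "(1 / w n) ^ (4 * l) = V ^ (4 * l) * N ^ (5 * l)" .
    have "N ^ (5 * l) * (N ^ 16 / N ^ (6 * l)) <= 1 / N ^ 2"
    proof -
     have "N ^ (5 * l) * N ^ 16 * N ^ 2 = N ^ (5 * l + 18)" by (simp add: power_add)
     also have "... <= N ^ (6 * l)" using N l by (intro power_increasing) auto
     finally show ?thesis using N by (simp add: divide_simps)
    qed
    then have "C * A (Suc n) ^ (4 * l) * (N ^ (5 * l) * (N ^ 16 / N ^ (6 * l))) <= C * A (Suc n) ^ (4 * l) * (1 / N ^ 2)" using C A by (intro mult_left_mono) auto
    then show "(1 / w n) ^ (4 * l) * (shell_const T (2 * l) * A (Suc n) ^ (4 * l) * (N ^ 16 / N ^ (6 * l))) <= C * A (Suc n) ^ (4 * l) / real (Suc n) ^ 2"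
     unfolding e C_def N_def[symmetric] by (simp add: mult_ac)
   qed
   finally show "?l <= ennreal (C * A (Suc n) ^ (4 * l) / real (Suc n) ^ 2)" .
  qed auto
  finally show "EX s. shell_majorants T (4 * l) a (\<Sum>n. ennreal (C * A (Suc n) ^ (4 * l) / real (Suc n) ^ 2)) s"
   using s(1,2) unfolding shell_majorants_def by (intro exI[of _ s] conjI allI impI) auto
 qed
qed

end

section \<open>Continuous fields with rapidly decreasing shells\<close>

lemma suminf_tail_tendsto:
 fixes b :: "nat => real"
 assumes "summable b" shows "(%N. \<Sum>n. b (n + N)) ----> 0"
proof -
 have "(%N. suminf b - (SUM i<N. b i)) ----> suminf b - suminf b" by (intro tendsto_diff tendsto_const summable_LIMSEQ assms)
 then show ?thesis using suminf_minus_initial_segment[OF assms] by simp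
qed

context flat_torus begin

text \<open>The limit along squares exists for all coefficient families used below and is a junk value otherwise.\<close>

definition fld :: "series => plane => real" where "fld c x = lim (%N. PS (square N) c x)"

definition shell_bounded :: "series => (nat => real) => bool" where
 "shell_bounded c b \<longleftrightarrow> summable b & (ALL n x. abs (PS (shell (Suc n)) c x) <= b n)"

definition bounded_field :: "real => (real => series) => ennreal => bool" where
 "bounded_field T y B \<longleftrightarrow> (EX b. (ALL t:{0..T}. shell_bounded (y t) b) & ennreal (suminf b) <= B)"

lemma fld_sum:
 assumes "shell_bounded c b"
 shows "(%N. PS (square N) c x) ----> fld c x"
  and "abs (fld c x - PS (square N) c x) <= (\<Sum>n. b (n + N))" and "abs (fld c x) <= suminf b"
proof -
 have b: "summable b" "!!n. abs (PS (shell (Suc n)) c x) <= b n" using assms unfolding shell_bounded_def by iprover+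
 have s: "summable (%n. PS (shell (Suc n)) c x)"  by (rule summable_comparison_test'[OF b(1)]) (use b(2) in simp)
 have sq: "PS (square N) c x = (SUM n<N. PS (shell (Suc n)) c x)" for N by (rule sum_square)
 have lim: "(%N. PS (square N) c x) ----> (\<Sum>n. PS (shell (Suc n)) c x)" unfolding sq by (rule summable_LIMSEQ[OF s])
 then have f: "fld c x = (\<Sum>n. PS (shell (Suc n)) c x)" unfolding fld_def by (rule limI)
 show "(%N. PS (square N) c x) ----> fld c x" unfolding f by (rule lim)
 have "fld c x - PS (square N) c x = (\<Sum>n. PS (shell (Suc (n + N))) c x)" for N unfolding f sq using suminf_minus_initial_segment[OF s, of N] by simp
 moreover have "norm (\<Sum>n. PS (shell (Suc (n + N))) c x) <= (\<Sum>n. b (n + N))" for N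
  by (rule norm_suminf_le) (use b(2) summable_ignore_initial_segment[OF b(1)] in simp_all)
 ultimately show t: "abs (fld c x - PS (square N) c x) <= (\<Sum>n. b (n + N))" for N by simp
 show "abs (fld c x) <= suminf b" 
 proof -
  have "square 0 = {}" by (auto simp: square_def cnorm_def modes_def prod_eq_iff)
  then show ?thesis using t[of 0] by simp
 qed
qed

lemma fld_periodic: "periodic L (fld c)" using PS_periodic by (simp add: periodic_def fld_def)

lemma fld_continuous:
 fixes y :: "real => series"
 assumes b: "!!t. t : A ==> shell_bounded (y t) b" and y: "!!k. k : modes ==> continuous_on A (%t. y t k)"
 shows "continuous_on (A \<times> UNIV) (%(t, x). fld (y t) x)"
proof (cases "A = {}")
 case False
 then have sb: "summable b" using b unfolding shell_bounded_def by blast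
 show ?thesis
 proof (rule uniform_limit_theorem[where f="%N (t, x). PS (square N) (y t) x" and F=sequentially])
  have "continuous_on (A \<times> UNIV) (%p. PS (square N) (y (fst p)) (snd p))" for N
  proof (intro continuous_on_sum continuous_on_mult)
   fix k assume "k : square N"
   then have k: "k : modes" using square_modes by blast
   show "continuous_on (A \<times> UNIV) (%p. y (fst p) k)" by (rule continuous_on_compose2[OF y[OF k] continuous_on_fst[OF continuous_on_id]]) auto
   show "continuous_on (A \<times> UNIV) (%p. bf k (snd p))" by (intro continuous_intros)
  qed
  then show "\<forall>\<^sub>F N in sequentially. continuous_on (A \<times> UNIV) (%(t, x). PS (square N) (y t) x)" by (simp add: case_prod_beta)
  show "uniform_limit (A \<times> UNIV) (%N (t, x). PS (square N) (y t) x) (%(t, x). fld (y t) x) sequentially"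
  proof (rule uniform_limitI)
   fix e :: real assume "e > 0"
   then have "\<forall>\<^sub>F N in sequentially. (\<Sum>n. b (n + N)) < e" using suminf_tail_tendsto[OF sb] by (intro order_tendstoD(2)) auto
   then show "\<forall>\<^sub>F N in sequentially. ALL p:A \<times> UNIV. dist (case p of (t, x) => PS (square N) (y t) x) (case p of (t, x) => fld (y t) x) < e"
   proof eventually_elim
    fix N assume e: "(\<Sum>n. b (n + N)) < e"
    show "ALL p:A \<times> UNIV. dist (case p of (t, x) => PS (square N) (y t) x) (case p of (t, x) => fld (y t) x) < e"
    proof
     fix p :: "real \<times> plane" assume "p : A \<times> UNIV"
     then obtain t x where p: "p = (t, x)" "t : A" by (cases p) auto
     have "abs (PS (square N) (y t) x - fld (y t) x) < e" using fld_sum(2)[OF b[OF p(2)], of x N] e by (simp only: abs_minus_commute)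
     then show "dist (case p of (t, x) => PS (square N) (y t) x) (case p of (t, x) => fld (y t) x) < e" unfolding p(1) prod.case dist_real_def .
    qed
   qed
  qed
 qed simp
qed simp

text \<open>Uniform convergence bounds the square partial sums in mean square, so the coefficients are square summable.\<close>

lemma fld_represents:
 assumes c: "shell_bounded c b"
 shows "represents L c (fld c)"
proof (rule represents_subseqI)
 have [measurable]: "PS (square N) c : borel_measurable tor" for N by (simp add: tor_def borel_measurable_sum measurable_restrict_space1)
 show "fld c : borel_measurable tor" by (rule borel_measurable_LIMSEQ_real[OF fld_sum(1)[OF c]]) measurable
 have sb: "summable b" and b0: "b n >= 0" for n using c unfolding shell_bounded_def by (blast, meson abs_ge_zero order_trans)
 show "(%k. (c k)^2) summable_on modes"
 proof (rule nonneg_bounded_partial_sums_imp_summable_on)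
  show "\<forall>\<^sub>F F in finite_subsets_at_top modes. (SUM k:F. (c k)^2) <= (suminf b + suminf b)^2 * L^2"
  proof (rule eventually_finite_subsets_at_top_weakI)
   fix F assume F: "finite F" "F <= modes"
   obtain N where N: "F <= square N" by (rule finite_in_square[OF F])
   have "ennreal (SUM k:square N. (c k)^2) = (\<integral>\<^sup>+x. ennreal ((PS (square N) c x)^2) \<partial>tor)" by (rule e_sum_sq_nn[symmetric]) simp
   also have "... <= (\<integral>\<^sup>+x. ennreal ((suminf b + suminf b)^2) \<partial>tor)"
   proof (intro nn_integral_mono ennreal_leI)
    fix x
    have "(\<Sum>n. b (n + N)) <= suminf b" using suminf_minus_initial_segment[OF sb, of N] sum_nonneg[of "{..<N}" b] b0 by simp
    then have "abs (PS (square N) c x) <= suminf b + suminf b" using fld_sum(2)[OF c, of x N] fld_sum(3)[OF c, of x] by linarith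
    then show "(PS (square N) c x)^2 <= (suminf b + suminf b)^2" by (intro abs_le_square_iff[THEN iffD1]) linarith
   qed
   also have "... = ennreal ((suminf b + suminf b)^2 * L^2)" by (simp add: emeasure_tor ennreal_mult)
   finally have "(SUM k:square N. (c k)^2) <= (suminf b + suminf b)^2 * L^2" by (subst (asm) ennreal_le_iff) auto
   moreover have "(SUM k:F. (c k)^2) <= (SUM k:square N. (c k)^2)" using N by (intro sum_mono2) auto
   ultimately show "(SUM k:F. (c k)^2) <= (suminf b + suminf b)^2 * L^2" by simp
  qed
 qed simp
 fix d :: real and m :: nat assume d: "d > 0"
 have "(%N. (\<Sum>n. b (n + N))^2 * L^2) ----> 0^2 * L^2" by (intro tendsto_intros suminf_tail_tendsto sb)
 then have "\<forall>\<^sub>F N in sequentially. (\<Sum>n. b (n + N))^2 * L^2 < d" using d by (intro order_tendstoD(2)) auto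
 then obtain N0 where N0: "!!N. N >= N0 ==> (\<Sum>n. b (n + N))^2 * L^2 < d" unfolding eventually_sequentially by blast
 define N where "N = max m N0"
 have "dist2 (fld c) (PS (square N) c) <= (\<integral>\<^sup>+x. ennreal ((\<Sum>n. b (n + N))^2) \<partial>tor)" unfolding dist2_def
 proof (intro nn_integral_mono ennreal_leI)
  fix x show "(fld c x - PS (square N) c x)^2 <= (\<Sum>n. b (n + N))^2" using fld_sum(2)[OF c, of x N] by (intro abs_le_square_iff[THEN iffD1]) linarith
 qed
 also have "... = ennreal ((\<Sum>n. b (n + N))^2 * L^2)" by (simp add: emeasure_tor ennreal_mult)
 also have "... <= ennreal d" using N0[of N] by (intro ennreal_leI) (simp add: N_def)
 finally show "EX n>=m. dist2 (fld c) (PS (square n) c) <= ennreal d" by (intro exI[of _ N]) (simp add: N_def)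
qed

end

text \<open>If the sum is large its flux is small; otherwise, unless the first summand is large, the second is not.\<close>

lemma flux_split:
 fixes y z :: plane
 assumes K: "K >= 1"
 shows "norm (flux (y + z)) <= 1 / K + (norm y)^2 / K^2 + (if abs (fst z) < 2 * K then 1 else 0)"
proof -
 have nn: "0 <= 1 / K" "0 <= (norm y)^2 / K^2" "0 <= (if abs (fst z) < 2 * K then 1 else 0 :: real)" using K by auto
 consider "norm (y + z) >= K" | "norm (y + z) < K" "norm y >= K" | "norm (y + z) < K" "norm y < K" by linarith
 then show ?thesis
 proof cases
  case 1
  then have p: "norm (y + z) > 0" using K by linarith
  have "norm (flux (y + z)) <= norm (y + z) / (norm (y + z))^2" unfolding norm_flux using p by (intro divide_left_mono) (auto intro!: mult_pos_pos add_pos_nonneg)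
  also have "... = 1 / norm (y + z)" using p by (simp add: power2_eq_square)
  also have "... <= 1 / K" using 1 K by (intro frac_le) auto
  finally show ?thesis using nn by linarith
 next
  case 2
  have "K^2 <= (norm y)^2" using 2 K by (intro power_mono) auto
  then have "1 <= (norm y)^2 / K^2" using K by (simp add: le_divide_eq)
  then show ?thesis using norm_flux_le_half[of "y + z"] nn by linarith
 next
  case 3
  have "norm z <= norm (y + z) + norm y" using norm_triangle_ineq4[of "y + z" y] by simp
  then have "abs (fst z) < 2 * K" using norm_fst_le[of "fst z" "snd z"] 3 by simp
  then have "(if abs (fst z) < 2 * K then 1 else 0 :: real) = 1" by simp
  then show ?thesis using norm_flux_le_half[of "y + z"] nn by linarith
 qed
qed

section \<open>The gradient of the stochastic convolution is typically large\<close>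

context ou_family begin

text \<open>The sum is logarithmically divergent in dimension two: averaging over the four sign changes turns the squared basis functions into a constant, and the wave numbers in a sector contribute the harmonic sum.\<close>

lemma gradient_variance:
 assumes s: "r <= s" "0 < r" and n: "m <= n" and a: "!!k. k : square m ==> 1 / 2 <= abs (a k)"
 shows "(1 - exp (- 2 * r * kp ^ 4)) / (32 * kp^2 * L^2) * harm m
   <= (SUM k:square n. (a k * d1 k x)^2 * ouvar ((eigval L k)^2) 0 s)"
proof -
 define e0 where "e0 = 1 - exp (- 2 * r * kp ^ 4)"
 have e0: "e0 >= 0" using s by (simp add: e0_def)
 define w where "w k = e0 / (32 * kp ^ 4 * real (cnorm k) ^ 4)" for k
 have w0: "w k >= 0" for k using e0 by (simp add: w_def)
 define g where "g k = w k * (kp^2 * (real_of_int (fst k))^2 * (bf k x)^2)" for k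
 have g0: "g k >= 0" for k using w0 by (simp add: g_def)
 have wf: "w (flip1 k) = w k" "w (flip2 k) = w k" for k by (auto simp: w_def cnorm_def flip1_def flip2_def)
 have term_ge: "g (flip1 k) <= (a k * d1 k x)^2 * ouvar ((eigval L k)^2) 0 s" if k: "k : square m" for k
 proof -
  have km: "k : modes" using k square_modes by blast
  have c1: "real (cnorm k) >= 1" using cnorm_pos[OF km] by simp
  have ev: "(eigval L k)^2 > 0" using eigval_pos[OF km] by simp
  have k4: "kp ^ 4 <= (eigval L k)^2"
  proof -
   have "kp ^ 4 * 1 <= kp ^ 4 * real (cnorm k) ^ 4" using c1 kp_pos by (intro mult_left_mono one_le_power) auto
   then show ?thesis using eigval_sq_ge[of k] by simp
  qed
  have "r * kp ^ 4 <= s * (eigval L k)^2" using s k4 kp_pos by (intro mult_mono) auto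
  then have "e0 <= 1 - exp (- 2 * s * (eigval L k)^2)" by (simp add: e0_def mult.assoc)
  then have "e0 / (8 * kp ^ 4 * real (cnorm k) ^ 4) <= (1 - exp (- 2 * s * (eigval L k)^2)) / (2 * (eigval L k)^2)" (is "?l <= _")
   using e0 ev eigval_sq_le[of k] s by (intro frac_le) (auto intro!: mult_nonneg_nonneg)
  also have "... = ouvar ((eigval L k)^2) 0 s" using s ev by (intro ouvar_0[symmetric]) auto
  finally have o: "?l <= ouvar ((eigval L k)^2) 0 s" .
  have "(1 / 2)^2 <= (a k)^2" using a[OF k] by (intro abs_le_square_iff[THEN iffD1]) simp
  then have a4: "1 / 4 <= (a k)^2" by (simp add: power2_eq_square)
  have "g (flip1 k) = (1 / 4) * (d1 k x)^2 * (e0 / (8 * kp ^ 4 * real (cnorm k) ^ 4))"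
   by (simp add: g_def wf) (simp add: w_def d1_flip flip1_def power_mult_distrib mult_ac)
  also have "... <= ((a k)^2 * (d1 k x)^2) * ouvar ((eigval L k)^2) 0 s" using o a4 e0 by (intro mult_mono mult_right_mono) auto
  finally show ?thesis by (simp add: power_mult_distrib)
 qed
 define P where "P = (SIGMA i:{1..m}. {1..i})"
 (* Only modes with 1 <= j <= i are kept: there the first component is the shell index. *)
 define \<phi> where "\<phi> = (%(i::nat, j::nat). (int i, int j))"
 have inj: "inj_on \<phi> P" by (auto simp: \<phi>_def inj_on_def)
 have sub: "\<phi> ` P <= square m" by (auto simp: \<phi>_def P_def square_def modes_def cnorm_def)
 have four: "g k + g (flip1 k) + (g (flip2 k) + g (flip1 (flip2 k))) >= 0" for k using g0 by (simp add: add_nonneg_nonneg)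
 have "e0 / (32 * kp^2 * L^2) * harm m = (1 / 4) * (\<Sum>i=1..m. \<Sum>j=1..i. e0 / (32 * kp ^ 4 * real i ^ 4) * (kp^2 * (real i)^2 * (2 / L)^2))"
 proof -
  have "(\<Sum>j=1..i. e0 / (32 * kp ^ 4 * real i ^ 4) * (kp^2 * (real i)^2 * (2 / L)^2)) = e0 / (32 * kp^2 * L^2) * 4 * inverse (real i)" if "i : {1..m}" for i
   using that kp_pos L_pos by (simp add: field_simps power2_eq_square power4_eq_xxxx)
  then have "(\<Sum>i=1..m. \<Sum>j=1..i. e0 / (32 * kp ^ 4 * real i ^ 4) * (kp^2 * (real i)^2 * (2 / L)^2)) = (\<Sum>i=1..m. e0 / (32 * kp^2 * L^2) * 4 * inverse (real i))"
   by (rule sum.cong[OF refl])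
  also have "... = e0 / (32 * kp^2 * L^2) * 4 * harm m" unfolding harm_def by (rule sum_distrib_left[symmetric])
  finally show ?thesis by simp
 qed
 also have "(\<Sum>i=1..m. \<Sum>j=1..i. e0 / (32 * kp ^ 4 * real i ^ 4) * (kp^2 * (real i)^2 * (2 / L)^2))
   = (SUM p:P. (%k. g k + g (flip1 k) + (g (flip2 k) + g (flip1 (flip2 k)))) (\<phi> p))"
  unfolding P_def
 proof (subst sum.Sigma; (simp; fail)?)
  show "(\<Sum>(i, j)\<in>(SIGMA i:{1..m}. {1..i}). e0 / (32 * kp ^ 4 * real i ^ 4) * (kp^2 * (real i)^2 * (2 / L)^2))
   = (SUM p:(SIGMA i:{1..m}. {1..i}). g (\<phi> p) + g (flip1 (\<phi> p)) + (g (flip2 (\<phi> p)) + g (flip1 (flip2 (\<phi> p)))))"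
  proof (rule sum.cong[OF refl])
   fix p assume p: "p : (SIGMA i:{1..m}. {1..i})"
   obtain i j where ij: "p = (i, j)" "1 <= i" "1 <= j" "j <= i" using p by auto
   have ne: "int i ~= 0" "int j ~= 0" using ij by auto
   have "(trig L (int i) (fst x))^2 + (trig L (- int i) (fst x))^2 = 2 / L" "(trig L (int j) (snd x))^2 + (trig L (- int j) (snd x))^2 = 2 / L" by (intro trig_sq_sum ne)+
   then have "(2 / L)^2 = ((trig L (int i) (fst x))^2 + (trig L (- int i) (fst x))^2) * ((trig L (int j) (snd x))^2 + (trig L (- int j) (snd x))^2)"
    by (simp only: power2_eq_square)
   moreover have "cnorm (int i, int j) = i" "cnorm (- int i, int j) = i" "cnorm (int i, - int j) = i" "cnorm (- int i, - int j) = i" using ij by (simp_all add: cnorm_def)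
   ultimately have "e0 / (32 * kp ^ 4 * real i ^ 4) * (kp^2 * (real i)^2 * (2 / L)^2) = g (\<phi> p) + g (flip1 (\<phi> p)) + (g (flip2 (\<phi> p)) + g (flip1 (flip2 (\<phi> p))))"
    unfolding g_def wf w_def by (simp add: ij(1) \<phi>_def flip1_def flip2_def basis_fun_def power_mult_distrib) (simp add: algebra_simps add_divide_distrib)
   then show "(case p of (i, j) => e0 / (32 * kp ^ 4 * real i ^ 4) * (kp^2 * (real i)^2 * (2 / L)^2)) = g (\<phi> p) + g (flip1 (\<phi> p)) + (g (flip2 (\<phi> p)) + g (flip1 (flip2 (\<phi> p))))"
    by (simp add: ij(1))
  qed
 qed
 also have "... = (SUM k:\<phi> ` P. g k + g (flip1 k) + (g (flip2 k) + g (flip1 (flip2 k))))" by (subst sum.reindex[OF inj]) simp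
 also have "... <= (SUM k:square m. g k + g (flip1 k) + (g (flip2 k) + g (flip1 (flip2 k))))" using sub four by (intro sum_mono2) auto
 also have "... = 4 * (SUM k:square m. g (flip1 k))"
 proof -
  have f1: "(SUM k:square m. h (flip1 k)) = (SUM k:square m. h k)" for h :: "idx => real" by (rule sum.reindex_bij_betw[OF flip_bij(3)])
  have f2: "(SUM k:square m. h (flip2 k)) = (SUM k:square m. h k)" for h :: "idx => real" by (rule sum.reindex_bij_betw[OF flip_bij(4)])
  show ?thesis unfolding sum.distrib using f1[of g] f2[of g] f2[of "%k. g (flip1 k)"] by simp
 qed
 finally have "e0 / (32 * kp^2 * L^2) * harm m <= (SUM k:square m. g (flip1 k))" by simp
 also have "... <= (SUM k:square m. (a k * d1 k x)^2 * ouvar ((eigval L k)^2) 0 s)" by (intro sum_mono term_ge)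
 also have "... <= (SUM k:square n. (a k * d1 k x)^2 * ouvar ((eigval L k)^2) 0 s)"
 proof (intro sum_mono2 mult_nonneg_nonneg)
  fix k assume "k : square n - square m"
  then have "k : modes" using square_modes by blast
  then show "0 <= ouvar ((eigval L k)^2) 0 s" using s eigval_pos[of k] by (intro ouvar_bounds(1)) auto
 qed (use square_mono[OF n] in auto)
 finally show ?thesis unfolding e0_def .
qed

text \<open>A process that is continuous in time is the limit of its values at grid times.\<close>

lemma X_joint_measurable:
 assumes k: "k : modes" shows "(%p. X k (max 0 (snd p)) (fst p)) \<in> borel_measurable (M \<Otimes>\<^sub>M lborel)"
proof (rule borel_measurable_LIMSEQ_real)
 define q where "q n s = \<lfloor>s * real (Suc n)\<rfloor>" for n :: nat and s :: real
 define r where "r n i = max 0 (real_of_int i / real (Suc n))" for n :: nat and i :: int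
 show "(%p. X k (r n (q n (snd p))) (fst p)) \<in> borel_measurable (M \<Otimes>\<^sub>M lborel)" for n
 proof (rule measurable_compose_countable[where f="%i p. X k (r n i) (fst p)" and g="%p. q n (snd p)"])
  fix i show "(%p. X k (r n i) (fst p)) \<in> borel_measurable (M \<Otimes>\<^sub>M lborel)"
   by (rule measurable_compose[OF measurable_fst X_measurable[OF k]]) (simp add: r_def)
 next
  show "(%p. q n (snd p)) \<in> M \<Otimes>\<^sub>M lborel \<rightarrow>\<^sub>M count_space UNIV" unfolding q_def by measurable
 qed
 fix p :: "'w \<times> real"
 have "(%n. real_of_int (q n (snd p)) / real (Suc n)) ----> snd p"
 proof (rule tendsto_sandwich[of "%n. snd p - 1 / real (Suc n)" _ _ "%n. snd p"])
  have "snd p - 1 / real (Suc n) <= real_of_int (q n (snd p)) / real (Suc n) & real_of_int (q n (snd p)) / real (Suc n) <= snd p" for n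
  proof -
   have "real_of_int (q n (snd p)) <= snd p * real (Suc n)" "snd p * real (Suc n) - 1 <= real_of_int (q n (snd p))" unfolding q_def by linarith+
   then have "snd p - 1 / real (Suc n) <= real_of_int (q n (snd p)) / real (Suc n)" "real_of_int (q n (snd p)) / real (Suc n) <= snd p"
    using divide_right_mono[of "snd p * real (Suc n) - 1" "real_of_int (q n (snd p))" "real (Suc n)"] by (simp_all add: diff_divide_distrib divide_le_eq del: of_nat_Suc)
   then show ?thesis by simp
  qed
  then show "\<forall>\<^sub>F n in sequentially. snd p - 1 / real (Suc n) <= real_of_int (q n (snd p)) / real (Suc n)"
   "\<forall>\<^sub>F n in sequentially. real_of_int (q n (snd p)) / real (Suc n) <= snd p" by auto
  have "(%n. snd p - 1 / real (Suc n)) ----> snd p - 0" by (intro tendsto_intros LIMSEQ_Suc lim_1_over_n)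
  then show "(%n. snd p - 1 / real (Suc n)) ----> snd p" by simp
 qed simp
 then have "(%n. r n (q n (snd p))) ----> max 0 (snd p)" unfolding r_def by (intro tendsto_intros)
 then show "(%n. X k (r n (q n (snd p))) (fst p)) ----> X k (max 0 (snd p)) (fst p)" by (rule continuous_on_tendsto_compose[OF X_continuous[OF k]]) (auto simp: r_def)
qed

text \<open>The part of the torus where the first partial derivative is not large.\<close>

definition slow :: "series => nat => real => real => 'w => ennreal" where
 "slow a n K s w = (\<integral>\<^sup>+x. indicator {y. abs y < 2 * K} (SUM k:square n. a k * X k (max 0 s) w * d1 k x) \<partial>tor)"

lemma d1_measurable [measurable]: "d1 k : borel_measurable tor" unfolding d1_def[abs_def] by (auto simp: tor_def intro!: measurable_restrict_space1)

lemma slow_integrand_measurable: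
 "(%p. indicator {y :: real. abs y < 2 * K} (SUM k:square n. a k * X k (max 0 (snd (fst p))) (fst (fst p)) * d1 k (snd p)) :: ennreal)
   \<in> borel_measurable ((M \<Otimes>\<^sub>M lborel) \<Otimes>\<^sub>M tor)"
proof -
 have "(%p. SUM k:square n. a k * X k (max 0 (snd (fst p))) (fst (fst p)) * d1 k (snd p)) \<in> borel_measurable ((M \<Otimes>\<^sub>M lborel) \<Otimes>\<^sub>M tor)"
 proof (intro borel_measurable_sum borel_measurable_times borel_measurable_const)
  fix k assume "k : square n"
  then have "k : modes" using square_modes by blast
  then show "(%p. X k (max 0 (snd (fst p))) (fst (fst p))) \<in> borel_measurable ((M \<Otimes>\<^sub>M lborel) \<Otimes>\<^sub>M tor)"
   by (rule measurable_compose[OF measurable_fst X_joint_measurable])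
  show "(%p. d1 k (snd p)) \<in> borel_measurable ((M \<Otimes>\<^sub>M lborel) \<Otimes>\<^sub>M tor)" by (rule measurable_compose[OF measurable_snd d1_measurable])
 qed
 moreover have "(indicator {y :: real. abs y < 2 * K} :: real => ennreal) : borel_measurable borel" by measurable
 ultimately show ?thesis by (rule measurable_compose)
qed

lemma slow_measurable: "(%p. slow a n K (snd p) (fst p)) \<in> borel_measurable (M \<Otimes>\<^sub>M lborel)"
proof -
 have "(%p. \<integral>\<^sup>+x. indicator {y :: real. abs y < 2 * K} (SUM k:square n. a k * X k (max 0 (snd p)) (fst p) * d1 k x) \<partial>tor) : borel_measurable (M \<Otimes>\<^sub>M lborel)"
  by (rule finT.borel_measurable_nn_integral) (use slow_integrand_measurable[where K=K and n=n and a=a] in \<open>simp add: case_prod_beta\<close>)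
 then show ?thesis by (simp add: slow_def)
qed

text \<open>By Fubini it is enough to bound the small-ball probability of a Gaussian variable at each point.\<close>

lemma slow_expectation:
 assumes s: "s >= 0" and K: "K >= 1"
 shows "(\<integral>\<^sup>+w. slow a n K s w \<partial>M) <= ennreal (L^2)"
  and "v > 0 ==> (!!x. v <= (SUM k:square n. (a k * d1 k x)^2 * ouvar ((eigval L k)^2) 0 s)) ==>
   (\<integral>\<^sup>+w. slow a n K s w \<partial>M) <= ennreal (L^2 * (2 * K / sqrt v))"
proof -
 have "slow a n K s w <= ennreal (L^2)" for w
 proof -
  have "slow a n K s w <= (\<integral>\<^sup>+x. 1 \<partial>tor)" unfolding slow_def by (intro nn_integral_mono) (simp add: indicator_def)
  then show ?thesis by (simp add: emeasure_tor)
 qed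
 then have "(\<integral>\<^sup>+w. slow a n K s w \<partial>M) <= (\<integral>\<^sup>+w. ennreal (L^2) \<partial>M)" by (intro nn_integral_mono)
 then show "(\<integral>\<^sup>+w. slow a n K s w \<partial>M) <= ennreal (L^2)" by (simp add: emeasure_space_1)
 assume v: "v > 0" "!!x. v <= (SUM k:square n. (a k * d1 k x)^2 * ouvar ((eigval L k)^2) 0 s)"
 interpret P: pair_sigma_finite M tor by unfold_locales
 define f where "f = (%(w, x). indicator {y :: real. abs y < 2 * K} (SUM k:square n. a k * X k (max 0 s) w * d1 k x) :: ennreal)"
 have fm: "f : borel_measurable (M \<Otimes>\<^sub>M tor)"
 proof -
  have "(%p. ((fst p, s), snd p)) \<in> (M \<Otimes>\<^sub>M tor) \<rightarrow>\<^sub>M ((M \<Otimes>\<^sub>M lborel) \<Otimes>\<^sub>M tor)" by measurable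
  from measurable_compose[OF this slow_integrand_measurable[where K=K and n=n and a=a]] show ?thesis by (simp add: f_def case_prod_beta)
 qed
 have "(\<integral>\<^sup>+w. slow a n K s w \<partial>M) = (\<integral>\<^sup>+w. \<integral>\<^sup>+x. f (w, x) \<partial>tor \<partial>M)" (is "?l = _") by (simp add: slow_def f_def)
 also have "... = (\<integral>\<^sup>+x. \<integral>\<^sup>+w. f (w, x) \<partial>M \<partial>tor)" by (rule P.Fubini[OF fm, symmetric])
 also have "... <= (\<integral>\<^sup>+x. ennreal (2 * K / sqrt v) \<partial>tor)"
 proof (rule nn_integral_mono)
  fix x
  define V where "V = (SUM k:square n. (a k * d1 k x)^2 * ouvar ((eigval L k)^2) 0 s)"
  have V: "v <= V" using v(2)[of x] by (simp add: V_def)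
  have "gauss M (%w. SUM k:square n. (a k * d1 k x) * (X k s w - X k 0 w)) V" unfolding V_def by (rule X_gauss) (use s square_modes in auto)
  moreover have "(SUM k:square n. (a k * d1 k x) * (X k s w - X k 0 w)) = (SUM k:square n. a k * X k (max 0 s) w * d1 k x)" for w
  proof (rule sum.cong[OF refl])
   fix k assume "k : square n"
   then have "X k 0 w = 0" using square_modes by (intro X_0) blast
   then show "(a k * d1 k x) * (X k s w - X k 0 w) = a k * X k (max 0 s) w * d1 k x" using s by (simp add: max_def)
  qed
  ultimately have g: "gauss M (%w. SUM k:square n. a k * X k (max 0 s) w * d1 k x) V" by simp
  have "(\<integral>\<^sup>+w. f (w, x) \<partial>M) <= ennreal (2 * K / sqrt V)" (is "?l <= _") unfolding f_def prod.case using V v K by (intro gauss_small_ball[OF g]) auto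
  also have "... <= ennreal (2 * K / sqrt v)" using V v K by (intro ennreal_leI divide_left_mono) auto
  finally show "?l <= ennreal (2 * K / sqrt v)" .
 qed
 also have "... = ennreal (2 * K / sqrt v) * ennreal (L^2)" by (simp add: emeasure_tor)
 also have "... = ennreal (L^2 * (2 * K / sqrt v))" using v K by (subst ennreal_mult[symmetric]) (auto simp: mult_ac)
 finally show "?l <= ennreal (L^2 * (2 * K / sqrt v))" .
qed

text \<open>The limes inferior of the flux bounds over the spectral cut-offs, integrated in time; it bounds the total nonlinear forcing.\<close>

definition mass :: "series => real => real => real => 'w => ennreal" where
 "mass a K c T w = (\<integral>\<^sup>+s. indicator {0..T} s * liminf (%n. ennreal c + slow a n K s w) \<partial>lborel)"

lemma mass_joint_measurable: "(%p. indicator {0..T} (snd p) * liminf (%n. ennreal c + slow a n K (snd p) (fst p))) \<in> borel_measurable (M \<Otimes>\<^sub>M lborel)"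
 using slow_measurable by measurable

lemma mass_measurable: "mass a K c T : borel_measurable M"
proof -
 have "(%w. \<integral>\<^sup>+s. indicator {0..T} (snd (w, s)) * liminf (%n. ennreal c + slow a n K (snd (w, s)) (fst (w, s))) \<partial>lborel) : borel_measurable M"
  by (rule lborel.borel_measurable_nn_integral) (use mass_joint_measurable in \<open>simp add: case_prod_beta\<close>)
 then show ?thesis by (simp add: mass_def[abs_def])
qed

text \<open>Fatou in the cut-off and Fubini in time; only the initial times, where the variance has not built up, are estimated trivially.\<close>

lemma mass_expectation:
 assumes T: "T > 0" and K: "K >= 1" and c: "c >= 0" and r: "r > 0" and a: "!!k. k : square m ==> 1 / 2 <= abs (a k)"
  and v: "v > 0" "v <= (1 - exp (- 2 * r * kp ^ 4)) / (32 * kp^2 * L^2) * harm m"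
 shows "(\<integral>\<^sup>+w. mass a K c T w \<partial>M) <= ennreal (T * (c + L^2 * (2 * K / sqrt v)) + L^2 * r)"
proof -
 interpret P: pair_sigma_finite M lborel by unfold_locales
 define q where "q = c + L^2 * (2 * K / sqrt v)"
 have q: "q >= 0" using c K v by (simp add: q_def)
 have inner: "(\<integral>\<^sup>+w. liminf (%n. ennreal c + slow a n K s w) \<partial>M) <= ennreal q + ennreal (L^2) * indicator {0..r} s" if s: "s : {0..T}" for s
 proof -
  have sm [measurable]: "slow a n K s : borel_measurable M" for n
  proof -
   have "(%w. (w, s)) \<in> M \<rightarrow>\<^sub>M M \<Otimes>\<^sub>M lborel" by measurable
   from measurable_compose[OF this slow_measurable] show ?thesis by simp
  qed
  have "(\<integral>\<^sup>+w. liminf (%n. ennreal c + slow a n K s w) \<partial>M) <= liminf (%n. \<integral>\<^sup>+w. ennreal c + slow a n K s w \<partial>M)"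
   by (rule nn_integral_liminf) measurable
  also have "... <= liminf (%n::nat. ennreal q + ennreal (L^2) * indicator {0..r} s)"
  proof (rule Liminf_mono, rule eventually_sequentiallyI[of m])
   fix n assume n: "m <= n"
   have e: "(\<integral>\<^sup>+w. ennreal c + slow a n K s w \<partial>M) = ennreal c + (\<integral>\<^sup>+w. slow a n K s w \<partial>M)"
    by (simp add: nn_integral_add emeasure_space_1)
   show "(\<integral>\<^sup>+w. ennreal c + slow a n K s w \<partial>M) <= ennreal q + ennreal (L^2) * indicator {0..r} s"
   proof (cases "s <= r")
    case True
    have "ennreal c + (\<integral>\<^sup>+w. slow a n K s w \<partial>M) <= ennreal q + ennreal (L^2)"
     using s K v c by (intro add_mono slow_expectation ennreal_leI) (auto simp: q_def)
    then show ?thesis unfolding e using True s by simp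
   next
    case False
    have "(\<integral>\<^sup>+w. slow a n K s w \<partial>M) <= ennreal (L^2 * (2 * K / sqrt v))"
    proof (rule slow_expectation(2)[OF _ K v(1)])
     fix x show "v <= (SUM k:square n. (a k * d1 k x)^2 * ouvar ((eigval L k)^2) 0 s)" using False by (intro order_trans[OF v(2)] gradient_variance r n a) auto
    qed (use s in auto)
    then have "ennreal c + (\<integral>\<^sup>+w. slow a n K s w \<partial>M) <= ennreal c + ennreal (L^2 * (2 * K / sqrt v))" by (rule add_left_mono)
    also have "... = ennreal q" using c K v by (simp add: q_def ennreal_plus)
    finally show ?thesis unfolding e by (simp add: add_increasing2)
   qed
  qed
  also have "... = ennreal q + ennreal (L^2) * indicator {0..r} s" by (rule Liminf_const) simp
  finally show ?thesis .
 qed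
 have "(\<integral>\<^sup>+w. mass a K c T w \<partial>M) = (\<integral>\<^sup>+s. \<integral>\<^sup>+w. indicator {0..T} s * liminf (%n. ennreal c + slow a n K s w) \<partial>M \<partial>lborel)"
  unfolding mass_def using P.Fubini[OF mass_joint_measurable[of T c a K]] by simp
 also have "... <= (\<integral>\<^sup>+s. ennreal q * indicator {0..T} s + ennreal (L^2) * indicator {0..r} s \<partial>lborel)"
 proof (rule nn_integral_mono)
  fix s :: real
  show "(\<integral>\<^sup>+w. indicator {0..T} s * liminf (%n. ennreal c + slow a n K s w) \<partial>M) <= ennreal q * indicator {0..T} s + ennreal (L^2) * indicator {0..r} s"
  proof (cases "s : {0..T}")
   case True then show ?thesis using inner[OF True] by simp
  qed simp
 qed
 also have "... = ennreal q * ennreal T + ennreal (L^2) * ennreal r" using T r by (simp add: nn_integral_add nn_integral_cmult_indicator)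
 also have "... = ennreal (T * q + L^2 * r)" using T r q by (simp add: ennreal_mult ennreal_plus mult.commute)
 finally show ?thesis unfolding q_def .
qed

end

section \<open>Bounds for the nonlinear remainder of a mild solution\<close>

lemma set_lint_le:
 fixes f :: "real => real"
 shows "ennreal (abs (LINT s:S|lborel. f s)) <= (\<integral>\<^sup>+s. ennreal (abs (f s)) * indicator S s \<partial>lborel)"
proof (cases "set_integrable lborel S f")
 case True
 have "ennreal (norm (\<integral>s. indicator S s *\<^sub>R f s \<partial>lborel)) <= (\<integral>\<^sup>+s. ennreal (norm (indicator S s *\<^sub>R f s)) \<partial>lborel)"
  using True unfolding set_integrable_def by (rule integral_norm_bound_ennreal)
 also have "... = (\<integral>\<^sup>+s. ennreal (abs (f s)) * indicator S s \<partial>lborel)" by (intro nn_integral_cong) (simp add: indicator_def)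
 finally show ?thesis by (simp add: set_lebesgue_integral_def)
next
 case False
 then show ?thesis by (simp add: set_integrable_def set_lebesgue_integral_def not_integrable_integral_eq)
qed

lemma exp_kernel_integral:
 assumes "c > 0" "t >= 0"
 shows "(\<integral>\<^sup>+s. ennreal (exp (- (t - s) * c)) * indicator {0..t} s \<partial>lborel) <= ennreal (1 / c)"
proof -
 have "(\<integral>\<^sup>+s. ennreal (exp (- (t - s) * c)) * indicator {0..t} s \<partial>lborel)
   = ennreal (exp (- (t - t) * c) / c - exp (- (t - 0) * c) / c)"
  by (rule nn_integral_FTC_Icc) (use assms in \<open>auto intro!: derivative_eq_intros\<close>)
 also have "... <= ennreal (1 / c)" using assms by (intro ennreal_leI) simp
 finally show ?thesis .
qed

context flat_torus begin

lemma Hspace_1_diff: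
 assumes "u : Hspace L 1" "v : Hspace L 1"
 shows "(%k. eigval L k * (u k - v k)^2) summable_on modes"
proof (rule summable_on_comparison_test)
 show "(%k. 2 * (eigval L k * (u k)^2) + 2 * (eigval L k * (v k)^2)) summable_on modes"
  using assms by (intro summable_on_add summable_on_cmult_right) (simp_all add: Hspace_1)
 fix k
 have "(u k - v k)^2 <= 2 * (u k)^2 + 2 * (v k)^2" using sum_squares_bound[of "u k" "- v k"] by (simp add: power2_diff)
 then have "eigval L k * (u k - v k)^2 <= eigval L k * (2 * (u k)^2 + 2 * (v k)^2)" using eigval_nonneg by (rule mult_left_mono)
 then show "eigval L k * (u k - v k)^2 <= 2 * (eigval L k * (u k)^2) + 2 * (eigval L k * (v k)^2)" by (simp add: algebra_simps)
qed (simp add: eigval_nonneg)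

lemma continuous_path_coeff:
 assumes w: "continuous_path_H L 1 T w" and k: "k : modes"
 shows "continuous_on {0..T} (%t. w t k)" unfolding continuous_on_def
proof
 fix t assume t: "t : {0..T}"
 have ev: "eigval L k > 0" by (rule eigval_pos[OF k])
 have H: "w s : Hspace L 1" if "s : {0..T}" for s using w that unfolding continuous_path_H_def by blast
 have lim: "((%s. Hnorm L 1 (%k. w s k - w t k)) ---> 0) (at t within {0..T})" using w t unfolding continuous_path_H_def by blast
 have le: "abs (w s k - w t k) <= Hnorm L 1 (%k. w s k - w t k) / sqrt (eigval L k)" if s: "s : {0..T}" for s
 proof -
  have "(SUM k:{k}. eigval L k * (w s k - w t k)^2) <= (\<Sum>\<^sub>\<infinity>k\<in>modes. eigval L k * (w s k - w t k)^2)"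
   using k by (intro finite_sum_le_infsum Hspace_1_diff H s t) (simp_all add: eigval_nonneg)
  also have "... = (\<Sum>\<^sub>\<infinity>k\<in>modes. eigval L k powr 1 * (w s k - w t k)^2)" using eigval_nonneg by (intro infsum_cong) simp
  finally have "sqrt (eigval L k * (w s k - w t k)^2) <= Hnorm L 1 (%k. w s k - w t k)" unfolding Hnorm_def by (intro real_sqrt_le_mono) simp
  then show ?thesis using ev by (simp add: real_sqrt_mult le_divide_eq mult.commute)
 qed
 have "((%s. w s k - w t k) ---> 0) (at t within {0..T})"
 proof (rule Lim_null_comparison)
  show "\<forall>\<^sub>F s in at t within {0..T}. norm (w s k - w t k) <= Hnorm L 1 (%k. w s k - w t k) / sqrt (eigval L k)"
   unfolding eventually_at_filter using le by (intro always_eventually) simp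
  show "((%s. Hnorm L 1 (%k. w s k - w t k) / sqrt (eigval L k)) ---> 0) (at t within {0..T})"
   using tendsto_divide[OF lim tendsto_const[of "sqrt (eigval L k)"]] ev by simp
 qed
 then show "((%s. w s k) ---> w t k) (at t within {0..T})" by (rule LIM_zero_cancel)
qed

definition rem_const :: real where "rem_const = 2 * L / kp ^ 3"

lemma rem_const_nonneg: "rem_const >= 0" using L_pos kp_pos by (simp add: rem_const_def)

text \<open>Smoothing: the Duhamel coefficient gains four powers of the wave number and the divergence
 loses one.\<close>

lemma duhamel_smoothing:
 assumes k: "k : modes" and t: "t >= 0"
 shows "abs (LINT s:{0..t}|lborel. semigroup_A L (t - s) (nonlinearity L (w s)) k) <= rem_const / real (cnorm k) ^ 3"
proof -
 have c: "real (cnorm k) > 0" using cnorm_pos[OF k] by simp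
 have ev: "(eigval L k)^2 > 0" using eigval_pos[OF k] by simp
 have "ennreal (abs (LINT s:{0..t}|lborel. semigroup_A L (t - s) (nonlinearity L (w s)) k))
   <= (\<integral>\<^sup>+s. ennreal (abs (semigroup_A L (t - s) (nonlinearity L (w s)) k)) * indicator {0..t} s \<partial>lborel)" by (rule set_lint_le)
 also have "... <= (\<integral>\<^sup>+s. ennreal (2 * kp * L * cnorm k) * (ennreal (exp (- (t - s) * (eigval L k)^2)) * indicator {0..t} s) \<partial>lborel)"
 proof (rule nn_integral_mono)
  fix s :: real
  have "abs (semigroup_A L (t - s) (nonlinearity L (w s)) k) <= (2 * kp * L * cnorm k) * exp (- (t - s) * (eigval L k)^2)"
   using mult_left_mono[OF nonlinearity_bound[of "w s" k] exp_ge_zero[of "- (t - s) * (eigval L k)^2"]] by (simp add: semigroup_A_def abs_mult mult_ac)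
  then have "ennreal (abs (semigroup_A L (t - s) (nonlinearity L (w s)) k)) <= ennreal (2 * kp * L * cnorm k) * ennreal (exp (- (t - s) * (eigval L k)^2))"
   using kp_pos L_pos by (subst ennreal_mult[symmetric]) (auto intro!: ennreal_leI)
  then show "ennreal (abs (semigroup_A L (t - s) (nonlinearity L (w s)) k)) * indicator {0..t} s
   <= ennreal (2 * kp * L * cnorm k) * (ennreal (exp (- (t - s) * (eigval L k)^2)) * indicator {0..t} s)"
   unfolding mult.assoc[symmetric] by (rule mult_right_mono) simp
 qed
 also have "... = ennreal (2 * kp * L * cnorm k) * (\<integral>\<^sup>+s. ennreal (exp (- (t - s) * (eigval L k)^2)) * indicator {0..t} s \<partial>lborel)"
  by (rule nn_integral_cmult) measurable
 also have "... <= ennreal (2 * kp * L * cnorm k) * ennreal (1 / (eigval L k)^2)" by (intro mult_left_mono exp_kernel_integral ev t) simp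
 also have "... = ennreal (2 * kp * L * cnorm k * (1 / (eigval L k)^2))" using kp_pos L_pos by (subst ennreal_mult) auto
 finally have "abs (LINT s:{0..t}|lborel. semigroup_A L (t - s) (nonlinearity L (w s)) k) <= 2 * kp * L * cnorm k * (1 / (eigval L k)^2)"
  using kp_pos L_pos by (subst (asm) ennreal_le_iff) auto
 also have "... <= 2 * kp * L * cnorm k * (1 / (kp ^ 4 * real (cnorm k) ^ 4))" using eigval_sq_ge[of k] c kp_pos L_pos ev by (intro mult_left_mono frac_le) auto
 also have "... = rem_const / real (cnorm k) ^ 3" using c kp_pos by (simp add: rem_const_def power4_eq_xxxx power3_eq_cube)
 finally show ?thesis .
qed

text \<open>The exponential factor is dropped: the gain here is in the flux.\<close>

lemma duhamel_flux:
 assumes t: "0 <= t" "t <= T" and w: "!!s. s : {0..T} ==> w s : Hspace L 1"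
  and f [measurable]: "f : borel_measurable lborel"
  and wf: "!!s. s : {0..T} ==> (\<integral>\<^sup>+x. ennreal (norm (flux (series_grad L (w s) x))) \<partial>tor) <= f s"
 shows "ennreal (abs (LINT s:{0..t}|lborel. semigroup_A L (t - s) (nonlinearity L (w s)) k))
   <= ennreal (4 * kp / L * cnorm k) * (\<integral>\<^sup>+s. indicator {0..T} s * f s \<partial>lborel)"
proof -
 have "ennreal (abs (LINT s:{0..t}|lborel. semigroup_A L (t - s) (nonlinearity L (w s)) k))
   <= (\<integral>\<^sup>+s. ennreal (abs (semigroup_A L (t - s) (nonlinearity L (w s)) k)) * indicator {0..t} s \<partial>lborel)" by (rule set_lint_le)
 also have "... <= (\<integral>\<^sup>+s. ennreal (4 * kp / L * cnorm k) * (indicator {0..T} s * f s) \<partial>lborel)"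
 proof (rule nn_integral_mono)
  fix s :: real
  show "ennreal (abs (semigroup_A L (t - s) (nonlinearity L (w s)) k)) * indicator {0..t} s <= ennreal (4 * kp / L * cnorm k) * (indicator {0..T} s * f s)"
  proof (cases "s : {0..t}")
   case True
   then have s: "s : {0..T}" using t by auto
   have "(%k. eigval L k * (w s k)^2) summable_on modes" using w[OF s] by (simp add: Hspace_1)
   then have G: "integrable tor (series_grad L (w s))" by (rule H1_series_grad)
   have "exp (- (t - s) * (eigval L k)^2) <= 1" using True by (simp add: mult_nonpos_nonneg)
   then have "abs (semigroup_A L (t - s) (nonlinearity L (w s)) k) <= abs (nonlinearity L (w s) k)"
    unfolding semigroup_A_def abs_mult abs_exp_cancel by (intro mult_left_le_one_le) auto
   then have "ennreal (abs (semigroup_A L (t - s) (nonlinearity L (w s)) k)) <= ennreal (abs (nonlinearity L (w s) k))" by (rule ennreal_leI)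
   also have "... <= ennreal (4 * kp / L * cnorm k) * (\<integral>\<^sup>+x. ennreal (norm (flux (series_grad L (w s) x))) \<partial>tor)"
    by (rule nonlinearity_le_flux[OF G])
   also have "... <= ennreal (4 * kp / L * cnorm k) * f s" by (intro mult_left_mono wf[OF s]) simp
   finally show ?thesis using True s by simp
  qed simp
 qed
 also have "... = ennreal (4 * kp / L * cnorm k) * (\<integral>\<^sup>+s. indicator {0..T} s * f s \<partial>lborel)" by (rule nn_integral_cmult) measurable
 finally show ?thesis .
qed

lemma gradPS_energy:
 "(\<integral>\<^sup>+x. ennreal ((norm (gradPS n u x))^2) \<partial>tor) = ennreal (SUM k:square n. eigval L k * (u k)^2)"
proof -
 have [measurable]: "PS (square n) v : borel_measurable tor" for v by (simp add: tor_def borel_measurable_sum measurable_restrict_space1)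
 have "(\<integral>\<^sup>+x. ennreal ((norm (gradPS n u x))^2) \<partial>tor) = (\<integral>\<^sup>+x. ennreal ((PS (square n) (dc1 u) x)^2) + ennreal ((PS (square n) (dc2 u) x)^2) \<partial>tor)"
  by (intro nn_integral_cong) (simp add: gradPS_def norm_prod_def ennreal_plus)
 also have "... = ennreal (SUM k:square n. (dc1 u k)^2) + ennreal (SUM k:square n. (dc2 u k)^2)" by (subst nn_integral_add) (simp_all add: e_sum_sq_nn)
 also have "(SUM k:square n. (dc1 u k)^2) = (SUM k:square n. kp^2 * (real_of_int (fst k))^2 * (u k)^2)"
  by (rule sum.reindex_bij_betw[OF flip_bij(3), symmetric, THEN trans])
    (rule sum.cong[OF refl], simp add: dc1_def power_mult_distrib flip1_def)
 also have "(SUM k:square n. (dc2 u k)^2) = (SUM k:square n. kp^2 * (real_of_int (snd k))^2 * (u k)^2)"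
  by (rule sum.reindex_bij_betw[OF flip_bij(4), symmetric, THEN trans])
    (rule sum.cong[OF refl], simp add: dc2_def power_mult_distrib flip2_def)
 also have "ennreal (SUM k:square n. kp^2 * (real_of_int (fst k))^2 * (u k)^2) + ennreal (SUM k:square n. kp^2 * (real_of_int (snd k))^2 * (u k)^2)
   = ennreal ((SUM k:square n. kp^2 * (real_of_int (fst k))^2 * (u k)^2) + (SUM k:square n. kp^2 * (real_of_int (snd k))^2 * (u k)^2))"
  by (rule ennreal_plus[symmetric]) (simp_all add: sum_nonneg)
 also have "(SUM k:square n. kp^2 * (real_of_int (fst k))^2 * (u k)^2) + (SUM k:square n. kp^2 * (real_of_int (snd k))^2 * (u k)^2) = (SUM k:square n. eigval L k * (u k)^2)"
  unfolding sum.distrib[symmetric] by (intro sum.cong) (simp_all add: eigval_eq mode_norm_sq algebra_simps)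
 finally show ?thesis .
qed

text \<open>Bounds the squared gradient norm of everything except the noise, uniformly in time and in the regularization.\<close>

definition energy :: "series => real" where
 "energy u0 = 2 * (\<Sum>\<^sub>\<infinity>k\<in>modes. eigval L k * (u0 k)^2) + 2 * (\<Sum>\<^sub>\<infinity>k\<in>modes. 2 * kp^2 * rem_const^2 / real (cnorm k) ^ 4)"

lemma energy_bound:
 assumes u0: "u0 : Hspace L 1" and s: "s >= 0" and r: "!!k. k : modes ==> abs (r k) <= rem_const / real (cnorm k) ^ 3"
 shows "(SUM k:square n. eigval L k * (semigroup_A L s u0 k + r k)^2) <= energy u0"
proof -
 have "(SUM k:square n. eigval L k * (semigroup_A L s u0 k + r k)^2) <= (SUM k:square n. 2 * (eigval L k * (u0 k)^2) + 2 * (2 * kp^2 * rem_const^2 / real (cnorm k) ^ 4))"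
 proof (rule sum_mono)
  fix k assume "k : square n"
  then have k: "k : modes" using square_modes by blast
  have c: "real (cnorm k) > 0" using cnorm_pos[OF k] by simp
  have "abs (semigroup_A L s u0 k) <= abs (u0 k)" using s mult_right_mono[of "exp (- s * (eigval L k)^2)" 1 "abs (u0 k)"] by (simp add: semigroup_A_def abs_mult)
  then have a: "(semigroup_A L s u0 k)^2 <= (u0 k)^2" by (rule abs_le_square_iff[THEN iffD1])
  have b: "(r k)^2 <= (rem_const / real (cnorm k) ^ 3)^2" using r[OF k] rem_const_nonneg by (intro abs_le_square_iff[THEN iffD1]) simp
  have "(semigroup_A L s u0 k + r k)^2 <= 2 * (semigroup_A L s u0 k)^2 + 2 * (r k)^2" using sum_squares_bound[of "semigroup_A L s u0 k" "r k"] by (simp add: power2_sum)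
  also have "... <= 2 * (u0 k)^2 + 2 * (rem_const / real (cnorm k) ^ 3)^2" using a b by simp
  finally have "eigval L k * (semigroup_A L s u0 k + r k)^2 <= eigval L k * (2 * (u0 k)^2 + 2 * (rem_const / real (cnorm k) ^ 3)^2)"
   using eigval_nonneg by (rule mult_left_mono)
  moreover have "eigval L k * (rem_const / real (cnorm k) ^ 3)^2 <= (2 * kp^2 * (real (cnorm k))^2) * (rem_const / real (cnorm k) ^ 3)^2"
   by (intro mult_right_mono eigval_bounds(2)) simp
  moreover have "(2 * kp^2 * (real (cnorm k))^2) * (rem_const / real (cnorm k) ^ 3)^2 = 2 * kp^2 * rem_const^2 / real (cnorm k) ^ 4"
   using c by (simp add: power2_eq_square power3_eq_cube power4_eq_xxxx)
  ultimately show "eigval L k * (semigroup_A L s u0 k + r k)^2 <= 2 * (eigval L k * (u0 k)^2) + 2 * (2 * kp^2 * rem_const^2 / real (cnorm k) ^ 4)"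
   unfolding distrib_left by linarith
 qed
 also have "... = 2 * (SUM k:square n. eigval L k * (u0 k)^2) + 2 * (SUM k:square n. 2 * kp^2 * rem_const^2 / real (cnorm k) ^ 4)"
  by (simp add: sum.distrib sum_distrib_left)
 also have "... <= energy u0" unfolding energy_def
 proof (intro add_mono mult_left_mono finite_sum_le_infsum)
  show "(%k. eigval L k * (u0 k)^2) summable_on modes" using u0 by (simp add: Hspace_1)
  show "(%k. 2 * kp^2 * rem_const^2 / real (cnorm k) ^ 4) summable_on modes" by (rule cnorm_power_summable) auto
 qed (auto simp: eigval_nonneg square_modes)
 finally show ?thesis .
qed

lemma energy_nonneg: "energy u0 >= 0" unfolding energy_def by (intro add_nonneg_nonneg mult_nonneg_nonneg infsum_nonneg) (auto simp: eigval_nonneg)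

end

context ou_family begin

text \<open>What remains of a path of the equation after the linear evolution of the initial value and the noise are removed.\<close>

definition rest :: "series => series => (real => series) => real => 'w => series" where
 "rest u0 a w t z k = w t k - semigroup_A L t u0 k - a k * X k t z"

definition flux_level :: "series => real => real" where "flux_level u0 K = L^2 / K + energy u0 / K^2"

lemma flux_level_nonneg: "K >= 1 ==> flux_level u0 K >= 0" using energy_nonneg[of u0] by (simp add: flux_level_def)

lemma slow_section_measurable: "w : space M ==> (%s. slow a n K s w) : borel_measurable lborel"
proof -
 assume "w : space M"
 then have "(%s. (w, s)) \<in> lborel \<rightarrow>\<^sub>M M \<Otimes>\<^sub>M lborel" by measurable
 from measurable_compose[OF this slow_measurable] show ?thesis by simp
qed

text \<open>Where the gradient of the noise is large, so is the gradient of the solution, unless the rest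
 of the gradient is large, which its energy forbids on most of the torus; and where the gradient
 of the solution is large, the flux is small.\<close>

lemma flux_le_slow:
 assumes u0: "u0 : Hspace L 1" and s: "s >= 0" and K: "K >= 1" and w: "w s : Hspace L 1"
  and r: "!!k. k : modes ==> abs (rest u0 a w s z k) <= rem_const / real (cnorm k) ^ 3"
 shows "(\<integral>\<^sup>+x. ennreal (norm (flux (series_grad L (w s) x))) \<partial>tor) <= liminf (%n. ennreal (flux_level u0 K) + slow a n K s z)"
proof -
 have "(\<integral>\<^sup>+x. ennreal (norm (flux (series_grad L (w s) x))) \<partial>tor) <= liminf (%n. \<integral>\<^sup>+x. ennreal (norm (flux (gradPS n (w s) x))) \<partial>tor)"
  using w by (intro flux_liminf) (simp add: Hspace_1)
 also have "... <= liminf (%n. ennreal (flux_level u0 K) + slow a n K s z)"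
 proof (rule Liminf_mono, rule always_eventually, rule allI)
  fix n
  have [measurable]: "PS (square n) v : borel_measurable tor" for v by (simp add: tor_def borel_measurable_sum measurable_restrict_space1)
  define A where "A x = gradPS n (%k. semigroup_A L s u0 k + rest u0 a w s z k) x" for x
  define B where "B x = gradPS n (%k. a k * X k s z) x" for x
  have Am [measurable]: "(%x. norm (A x)) \<in> borel_measurable tor" unfolding A_def gradPS_def norm_prod_def fst_conv snd_conv by measurable
  have Bm: "fst (B x) = (SUM k:square n. a k * X k (max 0 s) z * d1 k x)" for x using s unfolding B_def gradPS_def fst_conv PS_dc1[symmetric] by (simp add: max_def)
  have bm [measurable]: "(%x. fst (B x)) \<in> borel_measurable tor" unfolding B_def gradPS_def fst_conv by measurable
  have AB: "gradPS n (w s) x = A x + B x" for x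
  proof -
   have "w s k = (semigroup_A L s u0 k + rest u0 a w s z k) + a k * X k s z" for k by (simp add: rest_def)
   then have "dc1 (w s) k = dc1 (%k. semigroup_A L s u0 k + rest u0 a w s z k) k + dc1 (%k. a k * X k s z) k"
    "dc2 (w s) k = dc2 (%k. semigroup_A L s u0 k + rest u0 a w s z k) k + dc2 (%k. a k * X k s z) k" for k unfolding dc1_def dc2_def by (metis distrib_left)+
   then show ?thesis by (simp add: A_def B_def gradPS_def distrib_right sum.distrib)
  qed
  have "(\<integral>\<^sup>+x. ennreal (norm (flux (gradPS n (w s) x))) \<partial>tor)
    <= (\<integral>\<^sup>+x. ennreal (1 / K) + (ennreal (1 / K^2) * ennreal ((norm (A x))^2) + indicator {y. abs y < 2 * K} (fst (B x))) \<partial>tor)" (is "?l <= _")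
  proof (rule nn_integral_mono)
   fix x
   have "ennreal (norm (flux (gradPS n (w s) x))) <= ennreal (1 / K + (norm (A x))^2 / K^2 + (if abs (fst (B x)) < 2 * K then 1 else 0))" (is "?l <= _")
    unfolding AB by (intro ennreal_leI flux_split K)
   also have "... = ennreal (1 / K) + (ennreal (1 / K^2) * ennreal ((norm (A x))^2) + indicator {y. abs y < 2 * K} (fst (B x)))"
    using K by (simp add: ennreal_plus add.assoc flip: ennreal_mult)
   finally show "?l <= ennreal (1 / K) + (ennreal (1 / K^2) * ennreal ((norm (A x))^2) + indicator {y. abs y < 2 * K} (fst (B x)))" .
  qed
  also have "... = ennreal (1 / K) * ennreal (L^2) + (ennreal (1 / K^2) * (\<integral>\<^sup>+x. ennreal ((norm (A x))^2) \<partial>tor) + slow a n K s z)"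
  proof -
   have i [measurable]: "(%x. indicator {y :: real. abs y < 2 * K} (fst (B x)) :: ennreal) : borel_measurable tor" by (rule measurable_compose[OF bm]) measurable
   show ?thesis by (simp add: nn_integral_add nn_integral_cmult emeasure_tor slow_def Bm)
  qed
  also have "... <= ennreal (1 / K) * ennreal (L^2) + (ennreal (1 / K^2) * ennreal (energy u0) + slow a n K s z)"
   unfolding A_def gradPS_energy by (intro add_left_mono add_right_mono mult_left_mono ennreal_leI energy_bound u0 s r) simp_all
  also have "... = ennreal (flux_level u0 K) + slow a n K s z"
   using K energy_nonneg[of u0] by (simp add: flux_level_def add.assoc[symmetric] flip: ennreal_mult ennreal_plus)
  finally show "?l <= ennreal (flux_level u0 K) + slow a n K s z" .
 qed
 finally show ?thesis .
qed

lemma mass_le: assumes "c >= 0" "T > 0" shows "mass a K c T w <= ennreal (T * (c + L^2))"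
proof -
 have sl: "slow a n K s w <= ennreal (L^2)" for n s
 proof -
  have "slow a n K s w <= (\<integral>\<^sup>+x. 1 \<partial>tor)" unfolding slow_def by (intro nn_integral_mono) (simp add: indicator_def)
  then show ?thesis by (simp add: emeasure_tor)
 qed
 have "liminf (%n. ennreal c + slow a n K s w) <= ennreal (c + L^2)" for s
 proof -
  have "liminf (%n. ennreal c + slow a n K s w) <= liminf (%n::nat. ennreal (c + L^2))"
   using assms sl by (intro Liminf_mono always_eventually allI) (simp add: ennreal_plus add_left_mono)
  then show ?thesis by (simp add: Liminf_const)
 qed
 then have "mass a K c T w <= (\<integral>\<^sup>+s. ennreal (c + L^2) * indicator {0..T} s \<partial>lborel)"
  unfolding mass_def by (intro nn_integral_mono) (simp add: indicator_def)
 also have "... = ennreal (c + L^2) * ennreal T" using assms by (subst nn_integral_cmult_indicator) auto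
 also have "... = ennreal (T * (c + L^2))" using assms by (subst ennreal_mult[symmetric]) (auto simp: mult.commute)
 finally show ?thesis .
qed

definition rbound :: "real => nat => real" where
 "rbound m n = min (rem_const / real n ^ 3) (4 * kp / L * real n * m)"

text \<open>The Duhamel formula is available only at countably many times outside a common null set; continuity of the coefficients extends the estimates to all times.\<close>

lemma rest_bounds:
 assumes T: "T > 0" and u0: "u0 : Hspace L 1" and w: "continuous_path_H L 1 T w" and K: "K >= 1" and z: "z : space M"
  and D: "D <= {0..T}" "{0..T} <= closure D"
  and E: "!!t k. t : D ==> k : modes ==>
   w t k = semigroup_A L t u0 k + (LINT s:{0..t}|lborel. semigroup_A L (t - s) (nonlinearity L (w s)) k) + a k * X k t z"
  and t: "t : {0..T}" and k: "k : modes"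
 shows "abs (rest u0 a w t z k) <= rbound (enn2real (mass a K (flux_level u0 K) T z)) (cnorm k)"
proof -
 have H: "w s : Hspace L 1" if "s : {0..T}" for s using w that unfolding continuous_path_H_def by blast
 have clD: "closure D = {0..T}" using D by (intro antisym closure_minimal) auto
 have cont: "continuous_on (closure D) (%t. abs (rest u0 a w t z k))" if k: "k : modes" for k unfolding clD rest_def semigroup_A_def
  by (intro continuous_intros continuous_path_coeff[OF w k] continuous_on_subset[OF X_continuous[OF k]]) auto
 have e: "rest u0 a w t z k = (LINT s:{0..t}|lborel. semigroup_A L (t - s) (nonlinearity L (w s)) k)" if "t : D" "k : modes" for t k
  using E[OF that] by (simp add: rest_def)
 have ext: "abs (rest u0 a w t z k) <= C" if "!!t. t : D ==> abs (rest u0 a w t z k) <= C" "k : modes" "t : {0..T}" for C k t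
  by (rule continuous_le_on_closure[OF cont[OF that(2)]]) (use that clD in auto)
 have b1: "abs (rest u0 a w t z k) <= rem_const / real (cnorm k) ^ 3" if "k : modes" "t : {0..T}" for k t
  by (rule ext[OF _ that]) (use e that D(1) in \<open>auto intro!: duhamel_smoothing\<close>)
 have lm: "(%s. liminf (%n. ennreal (flux_level u0 K) + slow a n K s z)) \<in> borel_measurable lborel" using slow_section_measurable[OF z] by measurable
 define m where "m = enn2real (mass a K (flux_level u0 K) T z)"
 have m: "m >= 0" "mass a K (flux_level u0 K) T z = ennreal m"
 proof -
  have "mass a K (flux_level u0 K) T z < top" using mass_le[OF flux_level_nonneg[OF K] T] by (rule le_less_trans) simp
  then show "m >= 0" "mass a K (flux_level u0 K) T z = ennreal m" by (simp_all add: m_def)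
 qed
 have "abs (rest u0 a w t z k) <= 4 * kp / L * real (cnorm k) * m"
 proof (rule ext[OF _ k t])
  fix t assume t: "t : D"
  have "ennreal (abs (rest u0 a w t z k)) <= ennreal (4 * kp / L * cnorm k) * (\<integral>\<^sup>+s. indicator {0..T} s * liminf (%n. ennreal (flux_level u0 K) + slow a n K s z) \<partial>lborel)"
   unfolding e[OF t k]
  proof (rule duhamel_flux[OF _ _ H lm])
   show "0 <= t" "t <= T" using t D by auto
   fix s assume s: "s : {0..T}"
   show "(\<integral>\<^sup>+x. ennreal (norm (flux (series_grad L (w s) x))) \<partial>tor) <= liminf (%n. ennreal (flux_level u0 K) + slow a n K s z)"
    by (rule flux_le_slow[OF u0 _ K H[OF s] b1[OF _ s]]) (use s in auto)
  qed
  also have "... = ennreal (4 * kp / L * cnorm k) * ennreal m" unfolding mass_def[symmetric] m(2) ..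
  also have "... = ennreal (4 * kp / L * cnorm k * m)" using m kp_pos L_pos by (subst ennreal_mult) auto
  finally show "abs (rest u0 a w t z k) <= 4 * kp / L * real (cnorm k) * m" using m kp_pos L_pos by (subst (asm) ennreal_le_iff) auto
 qed
 then show ?thesis using b1[OF k t] by (simp add: rbound_def m_def)
qed

end

section \<open>Random continuous functions\<close>

lemma powr_le_scaled:
 fixes x d p :: real
 assumes "x >= 0" "d > 0" "p <= real q" "p >= 0"
 shows "x powr p <= d powr p + d powr (p - real q) * x ^ q"
proof (cases "x <= d")
 case True
 then have "x powr p <= d powr p" using assms by (intro powr_mono2) auto
 then show ?thesis using assms by (simp add: add_increasing2)
next
 case False
 then have x: "x > 0" using assms by simp
 have "x powr p = x powr (p - real q) * x powr real q" using x by (simp flip: powr_add)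
 also have "... <= d powr (p - real q) * x powr real q" using False assms by (intro mult_right_mono powr_mono2') auto
 also have "x powr real q = x ^ q" using x by (rule powr_realpow)
 finally show ?thesis by (simp add: add_increasing)
qed

lemma C0_norm_ge:
 assumes "v : C0 L T" "t : {0..T}" "x : torus L"
 shows "abs (v t x) <= C0_norm L T v"
proof -
 have c: "continuous_on ({0..T} \<times> torus L) (%p. abs (v (fst p) (snd p)))"
  using assms(1) by (auto simp: C0_def case_prod_beta intro!: continuous_intros elim: continuous_on_subset)
 have "compact ({0..T} \<times> torus L)" unfolding torus_def by (intro compact_Times) auto
 then have "bdd_above ((%p. abs (v (fst p) (snd p))) ` ({0..T} \<times> torus L))"
  using compact_continuous_image[OF c] by (intro bounded_imp_bdd_above compact_imp_bounded) auto
 then have "abs (v (fst (t, x)) (snd (t, x))) <= (SUP p\<in>{0..T} \<times> torus L. abs (v (fst p) (snd p)))" by (rule cSUP_upper[rotated]) (use assms in simp)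
 then show ?thesis by (simp add: C0_norm_def case_prod_beta)
qed

context flat_torus begin

lemma torus_nonempty: "(0, 0) : torus L" using L_pos by (simp add: torus_Times)

lemma C0_norm_le:
 assumes "T >= 0" "!!t x. t : {0..T} ==> x : torus L ==> abs (v t x) <= c"
 shows "C0_norm L T v <= c" unfolding C0_norm_def
proof (rule cSUP_least)
 show "{0..T} \<times> torus L ~= {}" using assms(1) torus_nonempty by auto
 fix p assume "p : {0..T} \<times> torus L"
 then show "(case p of (t, x) => abs (v t x)) <= c" using assms(2)[of "fst p" "snd p"] by (simp add: case_prod_beta mem_Times_iff)
qed

lemma C0_norm_nonneg: "v : C0 L T ==> T >= 0 ==> 0 <= C0_norm L T v" using C0_norm_ge[of v L T 0 "(0, 0)"] torus_nonempty by (simp add: order_trans[OF abs_ge_zero])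

text \<open>By continuity the supremum is over a countable dense set.\<close>

lemma C0_norm_measurable:
 assumes T: "T >= 0" and v: "!!w. w : space M ==> v w : C0 L T" and m: "!!t x. t : {0..T} ==> (%w. v w t x) : borel_measurable M"
 shows "(%w. C0_norm L T (v w)) \<in> borel_measurable M" unfolding borel_measurable_iff_le
proof
 fix c
 define S where "S = {0..T} \<times> torus L"
 obtain D where D: "countable D" "D <= S" "S <= closure D" by (rule separable[of S])
 have "closed S" unfolding S_def torus_def by (intro closed_Times) auto
 then have cl: "closure D = S" using D by (intro antisym closure_minimal) auto
 have "C0_norm L T (v w) <= c \<longleftrightarrow> (ALL p:D. abs (v w (fst p) (snd p)) <= c)" if w: "w : space M" for w
 proof
  assume le: "C0_norm L T (v w) <= c"
  show "ALL p:D. abs (v w (fst p) (snd p)) <= c"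
  proof
   fix p assume "p : D"
   then have "p : S" using D(2) by blast
   then show "abs (v w (fst p) (snd p)) <= c" using C0_norm_ge[OF v[OF w], of "fst p" "snd p"] le by (simp add: S_def mem_Times_iff)
  qed
 next
  assume le: "ALL p:D. abs (v w (fst p) (snd p)) <= c"
  have "continuous_on ({0..T} \<times> UNIV) (%p. v w (fst p) (snd p))" using v[OF w] by (simp add: C0_def case_prod_beta)
  then have c: "continuous_on (closure D) (%p. abs (v w (fst p) (snd p)))" unfolding cl S_def by (intro continuous_on_rabs) (auto elim: continuous_on_subset)
  show "C0_norm L T (v w) <= c"
  proof (rule C0_norm_le[OF T])
   fix t x assume "t : {0..T}" "x : torus L"
   then have "(t, x) : closure D" by (simp add: cl S_def)
   from continuous_le_on_closure[OF c this] show "abs (v w t x) <= c" using le by simp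
  qed
 qed
 then have "{w \<in> space M. C0_norm L T (v w) <= c} = {w \<in> space M. ALL p:D. abs (v w (fst p) (snd p)) <= c}" by blast
 also have "... = space M - (\<Union>p\<in>D. {w \<in> space M. \<not> (abs (v w (fst p) (snd p))) <= c})" by blast
 also have "... \<in> sets M"
 proof (intro sets.compl_sets sets.countable_UN'' D(1))
  fix p assume "p : D"
  then have "fst p : {0..T}" using D(2) by (auto simp: S_def)
  from m[OF this, of "snd p"] have [measurable]: "(%w. v w (fst p) (snd p)) \<in> borel_measurable M" .
  show "{w \<in> space M. \<not> (abs (v w (fst p) (snd p))) <= c} \<in> sets M" by measurable
 qed
 finally show "{w \<in> space M. C0_norm L T (v w) <= c} \<in> sets M" .
qed

lemma shell_PS_bound:
 assumes "!!k. k : shell n ==> abs (c k) <= r" "r >= 0"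
 shows "abs (PS (shell n) c x) <= 24 / L * real n * r"
proof -
 have "abs (PS (shell n) c x) <= 2 / L * (SUM k:shell n. abs (c k))" by (rule PS_abs_le)
 also have "... <= 2 / L * (SUM k:shell n. r)" using L_pos assms by (intro mult_left_mono sum_mono) auto
 also have "... <= 2 / L * (12 * real n * r)" using L_pos assms card_shell[of n] by (intro mult_left_mono) (auto intro!: mult_right_mono)
 finally show ?thesis by simp
qed

end

context prob_space begin

text \<open>A random upper bound with small high moments is enough, so the supremum norm itself enters only through it.\<close>

lemma Lp_norm_tendsto_0:
 fixes f :: "real => 'a => real"
 assumes p: "p >= 1" "p <= real q"
  and ev: "\<forall>\<^sub>F y in F. ALL w:space M. 0 <= f y w"
  and lim: "!!\<eta>. \<eta> > 0 ==> \<forall>\<^sub>F y in F. EX Q. Q : borel_measurable M & (AE w in M. ennreal (f y w) <= Q w) & (\<integral>\<^sup>+w. Q w ^ q \<partial>M) <= ennreal \<eta>"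
 shows "((%y. (LINT w|M. f y w powr p) powr (1 / p)) ---> 0) F"
proof -
 have "((%y. LINT w|M. f y w powr p) ---> 0) F"
 proof (rule tendstoI)
  fix e :: real assume e: "e > 0"
  define \<delta> where "\<delta> = (e / 3) powr (1 / p)"
  have \<delta>: "\<delta> > 0" "\<delta> powr p = e / 3" using e p by (auto simp: \<delta>_def powr_powr)
  define \<eta> where "\<eta> = (e / 3) / \<delta> powr (p - real q)"
  have \<eta>: "\<eta> > 0" using e \<delta> by (simp add: \<eta>_def)
  show "\<forall>\<^sub>F y in F. dist (LINT w|M. f y w powr p) 0 < e" using lim[OF \<eta>] ev
  proof eventually_elim
   fix y assume "EX Q. Q : borel_measurable M & (AE w in M. ennreal (f y w) <= Q w) & (\<integral>\<^sup>+w. Q w ^ q \<partial>M) <= ennreal \<eta>"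
    and f0: "ALL w:space M. 0 <= f y w"
   then obtain Q where Q [measurable]: "Q : borel_measurable M" and Qf: "AE w in M. ennreal (f y w) <= Q w"
    and Qe: "(\<integral>\<^sup>+w. Q w ^ q \<partial>M) <= ennreal \<eta>" by blast
   have I0: "(LINT w|M. f y w powr p) >= 0" by (intro integral_nonneg_AE) simp
   have "(LINT w|M. f y w powr p) <= e / 3 + e / 3"
   proof (cases "integrable M (%w. f y w powr p)")
    case True
    then have "ennreal (LINT w|M. f y w powr p) = (\<integral>\<^sup>+w. ennreal (f y w powr p) \<partial>M)" by (intro nn_integral_eq_integral[symmetric]) auto
    also have "... <= (\<integral>\<^sup>+w. ennreal (e / 3) + ennreal (\<delta> powr (p - real q)) * Q w ^ q \<partial>M)"
    proof (rule nn_integral_mono_AE)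
     show "AE w in M. ennreal (f y w powr p) <= ennreal (e / 3) + ennreal (\<delta> powr (p - real q)) * Q w ^ q" using Qf AE_space
     proof eventually_elim
      fix w assume q: "ennreal (f y w) <= Q w" and w: "w : space M"
      have x: "f y w >= 0" using f0 w by blast
      have "ennreal (f y w powr p) <= ennreal (e / 3 + \<delta> powr (p - real q) * f y w ^ q)"
       using powr_le_scaled[OF x \<delta>(1) p(2)] p(1) \<delta>(2) by (intro ennreal_leI) simp
      also have "... = ennreal (e / 3) + ennreal (\<delta> powr (p - real q)) * ennreal (f y w) ^ q" using x e by (simp add: ennreal_plus ennreal_mult ennreal_power)
      also have "... <= ennreal (e / 3) + ennreal (\<delta> powr (p - real q)) * Q w ^ q" by (intro add_left_mono mult_left_mono power_mono q) auto
      finally show "ennreal (f y w powr p) <= ennreal (e / 3) + ennreal (\<delta> powr (p - real q)) * Q w ^ q" .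
     qed
    qed
    also have "... = ennreal (e / 3) + ennreal (\<delta> powr (p - real q)) * (\<integral>\<^sup>+w. Q w ^ q \<partial>M)"
     by (simp add: nn_integral_add nn_integral_cmult emeasure_space_1)
    also have "... <= ennreal (e / 3) + ennreal (\<delta> powr (p - real q)) * ennreal \<eta>" by (intro add_left_mono mult_left_mono Qe) auto
    also have "... = ennreal (e / 3 + \<delta> powr (p - real q) * \<eta>)" using e \<eta> by (simp add: ennreal_plus ennreal_mult)
    also have "\<delta> powr (p - real q) * \<eta> = e / 3" using \<delta> by (simp add: \<eta>_def)
    finally show ?thesis using e by (subst (asm) ennreal_le_iff) auto
   next
    case False
    then show ?thesis using e by (simp add: not_integrable_integral_eq)
   qed
   then show "dist (LINT w|M. f y w powr p) 0 < e" using I0 e by simp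
  qed
 qed
 then have "((%y. (LINT w|M. f y w powr p) powr (1 / p)) ---> 0 powr (1 / p)) F" using p by (intro tendsto_powr') (auto intro!: always_eventually integral_nonneg_AE)
 then show ?thesis by simp
qed

end

context ou_family begin

lemma Lp_C0I:
 assumes T: "T >= 0" and v: "!!w. w : space M ==> v w : C0 L T" and m: "!!t x. t : {0..T} ==> (%w. v w t x) : borel_measurable M"
  and S [measurable]: "S : borel_measurable M" and le: "AE w in M. ennreal (C0_norm L T (v w)) <= ennreal c + S w"
  and fin: "(\<integral>\<^sup>+w. S w ^ q \<partial>M) < top" and p: "p >= 1" "p <= real q"
 shows "v : Lp_C0 M L T p"
proof -
 have nm [measurable]: "(%w. C0_norm L T (v w)) \<in> borel_measurable M" by (rule C0_norm_measurable[OF T v m])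
 have "integrable M (%w. C0_norm L T (v w) powr p)"
 proof (rule integrableI_bounded)
  have "(\<integral>\<^sup>+w. ennreal (norm (C0_norm L T (v w) powr p)) \<partial>M) <= (\<integral>\<^sup>+w. 1 + 2 ^ q * (ennreal c ^ q + S w ^ q) \<partial>M)" (is "?l <= _")
  proof (rule nn_integral_mono_AE)
   show "AE w in M. ennreal (norm (C0_norm L T (v w) powr p)) <= 1 + 2 ^ q * (ennreal c ^ q + S w ^ q)" using le AE_space
   proof eventually_elim
    fix w assume l: "ennreal (C0_norm L T (v w)) <= ennreal c + S w" and w: "w : space M"
    have x: "C0_norm L T (v w) >= 0" by (rule C0_norm_nonneg[OF v[OF w] T])
    have "ennreal (norm (C0_norm L T (v w) powr p)) <= ennreal (1 + C0_norm L T (v w) ^ q)" (is "?l <= _") using powr_le_scaled[OF x, of 1 p q] p by (intro ennreal_leI) simp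
    also have "... = 1 + ennreal (C0_norm L T (v w)) ^ q" using x by (simp add: ennreal_plus ennreal_power)
    also have "... <= 1 + (ennreal c + S w) ^ q" using l by (intro add_left_mono power_mono) auto
    also have "... <= 1 + 2 ^ q * (ennreal c ^ q + S w ^ q)" by (intro add_left_mono ennreal_add_power)
    finally show "?l <= 1 + 2 ^ q * (ennreal c ^ q + S w ^ q)" .
   qed
  qed
  also have "... = 1 + 2 ^ q * (ennreal c ^ q + (\<integral>\<^sup>+w. S w ^ q \<partial>M))" by (simp add: nn_integral_add nn_integral_cmult emeasure_space_1)
  also have "... < \<infinity>" using fin by (simp add: ennreal_mult_less_top power_less_top_ennreal)
  finally show "?l < \<infinity>" .
 qed measurable
 then show ?thesis using v m by (simp add: Lp_C0_def)
qed

text \<open>The shells of the rest are bounded in two ways: by smoothing, with a summable bound, and by the mass, which is small. The minimum is summable uniformly and small when the mass is.\<close>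

definition rb :: "real => nat => real" where "rb m n = 24 / L * real (Suc n) * rbound m (Suc n)"
definition rb_max :: "nat => real" where "rb_max n = 24 / L * real (Suc n) * (rem_const / real (Suc n) ^ 3)"

lemma rbound_nonneg: "m >= 0 ==> rbound m n >= 0" using rem_const_nonneg kp_pos L_pos by (simp add: rbound_def)

lemma rb_bounds:
 assumes "m >= 0" shows "0 <= rb m n" "rb m n <= rb_max n" "rb m n <= 24 / L * real (Suc n) * (4 * kp / L * real (Suc n) * m)"
proof -
 show "0 <= rb m n" using rbound_nonneg[OF assms] L_pos by (simp add: rb_def)
 show "rb m n <= rb_max n" "rb m n <= 24 / L * real (Suc n) * (4 * kp / L * real (Suc n) * m)"
  unfolding rb_def rb_max_def rbound_def using L_pos by (intro mult_left_mono; simp)+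
qed

lemma summable_inverse_square: "summable (%n. 1 / real (Suc n) ^ 2)"
proof -
 have "summable (%n. inverse (real (Suc n) ^ 2))" using inverse_power_summable[of 2, where 'a=real] by (subst summable_Suc_iff) simp
 then show ?thesis by (simp add: inverse_eq_divide)
qed

lemma summable_rb_max: "summable rb_max"
proof -
 have "rb_max n = 24 / L * rem_const * (1 / real (Suc n) ^ 2)" for n by (simp add: rb_max_def power3_eq_cube power2_eq_square del: of_nat_Suc)
 then show ?thesis using summable_mult[OF summable_inverse_square, of "24 / L * rem_const"] by presburger
qed

lemma summable_rb: "m >= 0 ==> summable (rb m)" by (rule summable_comparison_test'[OF summable_rb_max]) (use rb_bounds in simp)

lemma suminf_rb_le_max: "m >= 0 ==> suminf (rb m) <= suminf rb_max" by (intro suminf_le summable_rb summable_rb_max rb_bounds)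

text \<open>Only finitely many shells need the mass; the others are small by smoothing.\<close>

lemma suminf_rb_small:
 assumes d: "d > 0" obtains c where "c >= 0" "!!m. m >= 0 ==> suminf (rb m) <= d + c * m"
proof -
 have "\<forall>\<^sub>F N in sequentially. (\<Sum>n. rb_max (n + N)) < d" using suminf_tail_tendsto[OF summable_rb_max] d by (rule order_tendstoD(2))
 then obtain r where r: "(\<Sum>n. rb_max (n + r)) < d" by (auto simp: eventually_sequentially)
 define c where "c = (SUM n<r. 24 / L * real (Suc n) * (4 * kp / L * real (Suc n)))"
 have c: "c >= 0" using L_pos kp_pos unfolding c_def by (intro sum_nonneg) simp
 show thesis
 proof (rule that[OF c])
  fix m :: real assume m: "m >= 0"
  have "suminf (rb m) = (\<Sum>n. rb m (n + r)) + (SUM n<r. rb m n)" by (rule suminf_split_initial_segment[OF summable_rb[OF m]])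
  moreover have "(\<Sum>n. rb m (n + r)) <= (\<Sum>n. rb_max (n + r))"
   using rb_bounds(2)[OF m] by (intro suminf_le summable_ignore_initial_segment summable_rb[OF m] summable_rb_max)
  moreover have "(SUM n<r. rb m n) <= (SUM n<r. 24 / L * real (Suc n) * (4 * kp / L * real (Suc n)) * m)"
   using rb_bounds(3)[OF m] by (intro sum_mono) (simp only: mult.assoc)
  moreover have "... = c * m" by (simp only: c_def sum_distrib_right)
  ultimately show "suminf (rb m) <= d + c * m" using r by linarith
 qed
qed

text \<open>The noise is bounded shell by shell by the majorants and the rest by \<open>rb\<close>.\<close>

lemma field_estimate:
 assumes maj: "shell_majorants T q a B s" and B: "B < top" and q: "q >= 1"
  and r: "AE w in M. ALL t:{0..T}. ALL k:modes. abs (Y t w k - a k * X k t w) <= rbound (\<theta> w) (cnorm k)"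
  and \<theta>: "!!w. \<theta> w >= 0"
 shows "AE w in M. bounded_field T (%t. Y t w) ((\<Sum>n. s n w) + ennreal (suminf (rb (\<theta> w))))"
proof -
 note [measurable] = shell_majorantsD(1)[OF maj] and sb = shell_majorantsD(2)[OF maj]
 have fin: "(\<integral>\<^sup>+w. (\<Sum>n. s n w) ^ q \<partial>M) < top" using shell_majorantsD(3)[OF maj] B by (rule le_less_trans)
 have "AE w in M. (\<Sum>n. s n w) ^ q ~= \<infinity>" by (rule nn_integral_noteq_infinite) (use fin in auto)
 then show ?thesis using r AE_space
 proof eventually_elim
  fix w assume f: "(\<Sum>n. s n w) ^ q ~= \<infinity>" and r: "ALL t:{0..T}. ALL k:modes. abs (Y t w k - a k * X k t w) <= rbound (\<theta> w) (cnorm k)"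
   and w: "w : space M"
  have f: "(\<Sum>n. s n w) ~= top" using f q by (auto simp: power_eq_top_ennreal)
  have sn: "s n w < top" for n
  proof -
   have "s n w <= (\<Sum>n. s n w)" using sum_le_suminf[of "%n. s n w" "{n}"] by simp
   then show ?thesis using f by (metis top.not_eq_extremum order_le_less_trans)
  qed
  define e where "e n = enn2real (s n w)" for n
  have e: "e n >= 0" "ennreal (e n) = s n w" for n using sn[of n] by (simp_all add: e_def)
  have se: "summable e" using e f by (intro summable_suminf_not_top) auto
  define b where "b n = e n + rb (\<theta> w) n" for n
  have sbm: "summable b" unfolding b_def by (intro summable_add se summable_rb \<theta>)
  have "shell_bounded (Y t w) b" if t: "t : {0..T}" for t unfolding shell_bounded_def
  proof (intro conjI allI sbm)
   fix n x
   have "PS (shell (Suc n)) (Y t w) x = shellsum a (Suc n) t x w + PS (shell (Suc n)) (%k. Y t w k - a k * X k t w) x"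
    unfolding shellsum_def sum.distrib[symmetric] by (intro sum.cong) (simp_all add: algebra_simps)
   moreover have "abs (shellsum a (Suc n) t x w) <= e n" using sb[OF w, of t n x] t e(1)[of n] unfolding e(2)[symmetric] by simp
   moreover have "abs (PS (shell (Suc n)) (%k. Y t w k - a k * X k t w) x) <= rb (\<theta> w) n" unfolding rb_def
   proof (rule shell_PS_bound[OF _ rbound_nonneg[OF \<theta>]])
    fix k assume "k : shell (Suc n)"
    then have "k : modes" "cnorm k = Suc n" unfolding shell_def by blast+
    then show "abs (Y t w k - a k * X k t w) <= rbound (\<theta> w) (Suc n)" using r t by metis
   qed
   ultimately show "abs (PS (shell (Suc n)) (Y t w) x) <= b n" unfolding b_def by linarith
  qed
  moreover have "ennreal (suminf b) = (\<Sum>n. s n w) + ennreal (suminf (rb (\<theta> w)))"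
  proof -
   have "suminf b = suminf e + suminf (rb (\<theta> w))" unfolding b_def by (intro suminf_add[symmetric] se summable_rb \<theta>)
   then have "ennreal (suminf b) = ennreal (suminf e) + ennreal (suminf (rb (\<theta> w)))"
    using suminf_nonneg[OF se e(1)] suminf_nonneg[OF summable_rb[OF \<theta>] rb_bounds(1)[OF \<theta>]] by (simp add: ennreal_plus)
   moreover have "ennreal (suminf e) = (\<Sum>n. s n w)" using suminf_ennreal2[OF e(1) se] e(2) by simp
   ultimately show ?thesis by simp
  qed
  ultimately show "bounded_field T (%t. Y t w) ((\<Sum>n. s n w) + ennreal (suminf (rb (\<theta> w))))" unfolding bounded_field_def by (intro exI[of _ b]) auto
 qed
qed

text \<open>Almost sure properties hold outside a measurable null set, on which the field is set to zero.\<close>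

lemma realization:
 assumes T: "T > 0"
  and g: "continuous_on ({0..} \<times> UNIV) (%(t, x). g t x)" "!!t. periodic L (g t)" "!!t. t >= 0 ==> represents L (semigroup_A L t u0) (g t)"
  and U: "series_process M T U"
  and ae1: "AE w in M. (ALL k:modes. continuous_on {0..T} (%t. U t w k)) & (ALL t:{0..T}. U t w (0, 0) = 0)"
  and ae2: "AE w in M. bounded_field T (%t k. U t w k - semigroup_A L t u0 k) (S w)"
  and S: "S : borel_measurable M" "(\<integral>\<^sup>+w. S w ^ q \<partial>M) < top" and p: "p >= 1" "p <= real q"
 shows "EX v. realizes M L T U v & v : Lp_C0 M L T p &
  (AE w in M. ALL t:{0..T}. ALL x. (%N. PS (square N) (%k. U t w k - semigroup_A L t u0 k) x) ----> v w t x - g t x)"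
proof -
 define Y where "Y t w k = U t w k - semigroup_A L t u0 k" for t w k
 define good where "good w \<longleftrightarrow> (ALL k:modes. continuous_on {0..T} (%t. U t w k)) & (ALL t:{0..T}. U t w (0, 0) = 0) &
  (bounded_field T (%t. Y t w) (S w))" for w
 have "AE w in M. good w" using ae1 ae2 unfolding good_def Y_def[abs_def] by eventually_elim blast
 then obtain N0 where N0: "!!w. w : space M - N0 ==> good w" "N0 : null_sets M" by (rule AE_E3) blast
 define G where "G = space M - N0"
 have [measurable]: "G : sets M" using N0 by (auto simp: G_def)
 have G: "good w" if "w : G" for w using that N0 by (auto simp: G_def)
 have aeG: "AE w in M. w : G" using AE_not_in[OF N0(2)] AE_space by eventually_elim (simp add: G_def)
 define v where "v w t x = (if w : G then g t x + fld (Y t w) x else 0)" for w t x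
 have gc: "continuous_on ({0..T} \<times> UNIV) (%p. g (fst p) (snd p))"
  by (rule continuous_on_subset[of "{0..} \<times> UNIV"]) (use g(1) in \<open>auto simp: case_prod_beta\<close>)
 have gC0: "g : C0 L T" using gc g(2) by (simp add: C0_def case_prod_beta)
 have vC0: "v w : C0 L T" for w
 proof (cases "w : G")
  case True
  then obtain b where b: "!!t. t : {0..T} ==> shell_bounded (Y t w) b" using G unfolding good_def bounded_field_def by blast
  have "continuous_on {0..T} (%t. Y t w k)" if "k : modes" for k
  proof -
   have "continuous_on {0..T} (%t. U t w k)" using G[OF True] that unfolding good_def by blast
   then show ?thesis unfolding Y_def semigroup_A_def by (intro continuous_intros)
  qed
  then have "continuous_on ({0..T} \<times> UNIV) (%(t, x). fld (Y t w) x)" by (intro fld_continuous[of _ _ b] b)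
  then have "continuous_on ({0..T} \<times> UNIV) (%p. g (fst p) (snd p) + fld (Y (fst p) w) (snd p))" by (intro continuous_on_add gc) (simp add: case_prod_beta)
  moreover have "periodic L (%x. g t x + fld (Y t w) x)" for t using g(2)[of t] fld_periodic[of "Y t w"] by (simp add: periodic_def)
  ultimately show ?thesis using True by (simp add: C0_def v_def[abs_def] case_prod_beta)
 qed (simp add: C0_def v_def periodic_def case_prod_beta)
 have vm: "(%w. v w t x) : borel_measurable M" if t: "t : {0..T}" for t x
 proof (rule borel_measurable_LIMSEQ_real)
  have [measurable]: "(%w. U t w k) : borel_measurable M" for k using U t unfolding series_process_def by blast
  show "(%w. indicator G w * (g t x + PS (square N) (Y t w) x)) \<in> borel_measurable M" for N unfolding Y_def by measurable
  show "(%N. indicator G w * (g t x + PS (square N) (Y t w) x)) ----> v w t x" for w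
  proof (cases "w : G")
   case True
   then obtain b where "shell_bounded (Y t w) b" using G t unfolding good_def bounded_field_def by blast
   then have "(%N. PS (square N) (Y t w) x) ----> fld (Y t w) x" by (rule fld_sum)
   then have "(%N. g t x + PS (square N) (Y t w) x) ----> g t x + fld (Y t w) x" by (intro tendsto_intros)
   then show ?thesis using True by (simp add: v_def)
  qed (simp add: v_def)
 qed
 have "realizes M L T U v" unfolding realizes_def
 proof (intro conjI ballI vC0)
  show "AE w in M. ALL t:{0..T}. U t w (0, 0) = 0 & represents L (U t w) (v w t)" using aeG
  proof eventually_elim
   fix w assume w: "w : G"
   then obtain b where b: "!!t. t : {0..T} ==> shell_bounded (Y t w) b" using G unfolding good_def bounded_field_def by blast
   show "ALL t:{0..T}. U t w (0, 0) = 0 & represents L (U t w) (v w t)"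
   proof
    fix t assume t: "t : {0..T}"
    have "represents L (%k. semigroup_A L t u0 k + Y t w k) (%x. g t x + fld (Y t w) x)" using t by (intro represents_add g(3) fld_represents[OF b]) auto
    then have "represents L (U t w) (v w t)" using w by (simp add: Y_def v_def[abs_def])
    then show "U t w (0, 0) = 0 & represents L (U t w) (v w t)" using G[OF w] t unfolding good_def by blast
   qed
  qed
 qed
 moreover have "v : Lp_C0 M L T p"
 proof (rule Lp_C0I[OF _ vC0 vm S(1) _ S(2) p])
  show "AE w in M. ennreal (C0_norm L T (v w)) <= ennreal (C0_norm L T g) + S w" using aeG
  proof eventually_elim
   fix w assume w: "w : G"
   then obtain b where b: "!!t. t : {0..T} ==> shell_bounded (Y t w) b" "ennreal (suminf b) <= S w" using G unfolding good_def bounded_field_def by blast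
   have sb0: "0 <= suminf b" using fld_sum(3)[OF b(1)[of 0], of "(0, 0)"] T by (simp add: order_trans[OF abs_ge_zero])
   have "C0_norm L T (v w) <= C0_norm L T g + suminf b"
   proof (rule C0_norm_le)
    fix t x assume tx: "t : {0..T}" "x : torus L"
    show "abs (v w t x) <= C0_norm L T g + suminf b" using C0_norm_ge[OF gC0 tx] fld_sum(3)[OF b(1)[OF tx(1)], of x] w by (simp add: v_def)
   qed (use T in simp)
   then have "ennreal (C0_norm L T (v w)) <= ennreal (C0_norm L T g + suminf b)" by (rule ennreal_leI)
   also have "... = ennreal (C0_norm L T g) + ennreal (suminf b)" using sb0 C0_norm_nonneg[OF gC0] T by (intro ennreal_plus) auto
   also have "... <= ennreal (C0_norm L T g) + S w" by (intro add_left_mono b)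
   finally show "ennreal (C0_norm L T (v w)) <= ennreal (C0_norm L T g) + S w" .
  qed
 qed (use T in auto)
 moreover have "AE w in M. ALL t:{0..T}. ALL x. (%N. PS (square N) (%k. U t w k - semigroup_A L t u0 k) x) ----> v w t x - g t x" using aeG
 proof eventually_elim
  fix w assume w: "w : G"
  then obtain b where b: "!!t. t : {0..T} ==> shell_bounded (Y t w) b" using G unfolding good_def bounded_field_def by blast
  show "ALL t:{0..T}. ALL x. (%N. PS (square N) (%k. U t w k - semigroup_A L t u0 k) x) ----> v w t x - g t x"
   using fld_sum(1)[OF b] w by (simp add: v_def Y_def[abs_def])
 qed
 ultimately show ?thesis by blast
qed

text \<open>The mild formulation with the stochastic convolution replaced by its continuous version.\<close>

definition driven_mild :: "series => real => series => (real => 'w => series) => bool" where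
 "driven_mild a T u0 U \<longleftrightarrow> series_process M T U & (AE w in M. continuous_path_H L 1 T (%t. U t w)) &
   (ALL t:{0..T}. AE w in M. ALL k:modes. U t w k = semigroup_A L t u0 k
    + (LINT s:{0..t}|lborel. semigroup_A L (t - s) (nonlinearity L (U s w)) k) + a k * X k t w)"

lemma driven_mild_rest:
 assumes U: "driven_mild a T u0 U" and T: "T > 0" and u0: "u0 : Hspace L 1" and K: "K >= 1"
 shows "AE z in M. ALL t:{0..T}. ALL k:modes. abs ((U t z k - semigroup_A L t u0 k) - a k * X k t z)
  <= rbound (enn2real (mass a K (flux_level u0 K) T z)) (cnorm k)"
proof -
 obtain D where D: "countable D" "D <= {0..T}" "{0..T} <= closure D" by (rule separable[of "{0..T}"])
 have "AE z in M. ALL t:D. ALL k:modes. U t z k = semigroup_A L t u0 k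
    + (LINT s:{0..t}|lborel. semigroup_A L (t - s) (nonlinearity L (U s z)) k) + a k * X k t z"
  by (subst AE_ball_countable[OF D(1)]) (use U D(2) in \<open>unfold driven_mild_def, blast\<close>)
 moreover have "AE z in M. continuous_path_H L 1 T (%t. U t z)" using U unfolding driven_mild_def by blast
 ultimately show ?thesis using AE_space
 proof eventually_elim
  fix z assume E: "ALL t:D. ALL k:modes. U t z k = semigroup_A L t u0 k
    + (LINT s:{0..t}|lborel. semigroup_A L (t - s) (nonlinearity L (U s z)) k) + a k * X k t z"
   and w: "continuous_path_H L 1 T (%t. U t z)" and z: "z : space M"
  show "ALL t:{0..T}. ALL k:modes. abs ((U t z k - semigroup_A L t u0 k) - a k * X k t z)
   <= rbound (enn2real (mass a K (flux_level u0 K) T z)) (cnorm k)"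
  proof (intro ballI)
   fix t k assume tk: "t : {0..T}" "k : modes"
   have "abs (rest u0 a (%t. U t z) t z k) <= rbound (enn2real (mass a K (flux_level u0 K) T z)) (cnorm k)"
    by (rule rest_bounds[OF T u0 w K z D(2,3) _ tk]) (use E in blast)
   then show "abs ((U t z k - semigroup_A L t u0 k) - a k * X k t z) <= rbound (enn2real (mass a K (flux_level u0 K) T z)) (cnorm k)" by (simp add: rest_def)
  qed
 qed
qed

end

section \<open>Convergence\<close>

context ou_family begin

text \<open>The parameters are chosen in order: the flux level fixes \<open>K\<close>, then the initial times, then the number of modes that make the variance large. Only a lower bound on these modes is required of the coefficients.\<close>

lemma small_mass:
 assumes T: "T > 0" and h: "h > 0"
 obtains K m where "K >= 1"
  "!!a. (!!k. k : square m ==> 1 / 2 <= abs (a k)) ==> (\<integral>\<^sup>+w. mass a K (flux_level u0 K) T w \<partial>M) <= ennreal h"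
proof -
 define e where "e = L^2 + energy u0"
 have e: "e > 0" using L_pos energy_nonneg[of u0] unfolding e_def by (intro add_pos_nonneg) auto
 define K where "K = max 1 (4 * T * e / h)"
 have K: "K >= 1" by (simp add: K_def)
 have fl: "flux_level u0 K <= e / K"
 proof -
  have "energy u0 / K^2 <= energy u0 / K" using K energy_nonneg[of u0] by (intro divide_left_mono) (auto simp: power2_eq_square)
  then show ?thesis by (simp add: flux_level_def e_def add_divide_distrib)
 qed
 have Te: "T * (e / K) <= h / 4"
 proof -
  have "4 * T * e / h <= K" by (simp add: K_def)
  then show ?thesis using K h by (simp add: field_simps)
 qed
 define \<tau> where "\<tau> = h / (4 * L^2)"
 have \<tau>: "\<tau> > 0" "L^2 * \<tau> = h / 4" using h L_pos by (simp_all add: \<tau>_def)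
 define y where "y = 8 * T * L^2 * K / h"
 have y: "y > 0" using T L_pos K h by (simp add: y_def)
 define v where "v = y^2"
 have v: "v > 0" "sqrt v = y" using y by (simp_all add: v_def)
 define e1 where "e1 = (1 - exp (- 2 * \<tau> * kp ^ 4)) / (32 * kp^2 * L^2)"
 have e1: "e1 > 0" using \<tau> kp_pos L_pos by (simp add: e1_def)
 define m where "m = nat \<lceil>exp (v / e1)\<rceil>"
 have "exp (v / e1) <= real m + 1" unfolding m_def by linarith
 then have "v / e1 <= ln (real m + 1)" by (subst ln_ge_iff) auto
 also have "... <= harm m" by (rule ln_le_harm)
 finally have vm: "v <= e1 * harm m" using e1 by (simp add: divide_le_eq mult.commute)
 show thesis
 proof (rule that[OF K])
  fix a :: series assume a: "!!k. k : square m ==> 1 / 2 <= abs (a k)"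
  have "(\<integral>\<^sup>+w. mass a K (flux_level u0 K) T w \<partial>M) <= ennreal (T * (flux_level u0 K + L^2 * (2 * K / sqrt v)) + L^2 * \<tau>)" (is "?l <= _")
   using vm unfolding e1_def by (intro mass_expectation T K flux_level_nonneg \<tau> a v)
  also have "... <= ennreal h"
  proof (rule ennreal_leI)
   have a1: "T * (L^2 * (2 * K / sqrt v)) = h / 4" unfolding v(2) y_def using T L_pos K h by (simp add: field_simps)
   have "T * flux_level u0 K <= h / 4" using mult_left_mono[OF fl, of T] T Te by linarith
   then show "T * (flux_level u0 K + L^2 * (2 * K / sqrt v)) + L^2 * \<tau> <= h" using h unfolding distrib_left \<tau>(2) a1 by simp
  qed
  finally show "?l <= ennreal h" .
 qed
qed

lemma constant_series_finite:
 assumes "C >= 0" "B >= 0" shows "(\<Sum>n. ennreal (C * B ^ q / real (Suc n) ^ 2)) < top"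
proof -
 have "summable (%n. C * B ^ q * (1 / real (Suc n) ^ 2))" by (rule summable_mult[OF summable_inverse_square])
 then have "(\<Sum>n. ennreal (C * B ^ q * (1 / real (Suc n) ^ 2))) = ennreal (\<Sum>n. C * B ^ q * (1 / real (Suc n) ^ 2))" using assms by (intro suminf_ennreal2) auto
 then show ?thesis by simp
qed

text \<open>Finitely many coefficients are small and the tail of the series is small because the coefficients are bounded.\<close>

lemma tapered_series_small:
 assumes C: "C >= 0" and B: "B >= 0" and h: "h > 0" and q: "q >= 1"
 obtains r \<delta> where "\<delta> > 0" "(\<Sum>n. ennreal (C * (if Suc n <= r then \<delta> else B) ^ q / real (Suc n) ^ 2)) <= ennreal h"
proof -
 define z where "z n = 1 / real (Suc n) ^ 2" for n
 have sz: "summable z" unfolding z_def by (rule summable_inverse_square)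
 have z0: "z n >= 0" for n by (simp add: z_def)
 have Z: "suminf z >= 0" using sz z0 by (rule suminf_nonneg)
 have "(%N. C * B ^ q * (\<Sum>n. z (n + N))) ----> C * B ^ q * 0" by (intro tendsto_intros suminf_tail_tendsto sz)
 then have "\<forall>\<^sub>F N in sequentially. C * B ^ q * (\<Sum>n. z (n + N)) < h / 2" using h by (intro order_tendstoD(2)) auto
 then obtain r where r: "C * B ^ q * (\<Sum>n. z (n + r)) < h / 2" by (auto simp: eventually_sequentially)
 define \<delta> where "\<delta> = min 1 (h / (2 * (C * suminf z + 1)))"
 have CZ: "C * suminf z + 1 > 0" using C Z by (simp add: add_nonneg_pos)
 have \<delta>: "\<delta> > 0" "\<delta> <= 1" "\<delta> <= h / (2 * (C * suminf z + 1))" using h CZ by (auto simp: \<delta>_def)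
 have "\<delta> ^ q <= \<delta> ^ 1" using \<delta> q by (intro power_decreasing) auto
 then have "C * suminf z * \<delta> ^ q <= C * suminf z * \<delta>" using C Z by (intro mult_left_mono) auto
 then have "C * \<delta> ^ q * suminf z <= C * suminf z * \<delta>" by (simp only: mult_ac)
 also have "... <= (C * suminf z + 1) * \<delta>" using \<delta> by (intro mult_right_mono) auto
 also have "... <= h / 2" using \<delta>(3) CZ by (simp add: field_simps)
 finally have d: "C * \<delta> ^ q * suminf z <= h / 2" .
 define f where "f n = C * (if Suc n <= r then \<delta> else B) ^ q * z n" for n
 have f0: "f n >= 0" for n using C B \<delta> z0 by (simp add: f_def)
 have sf: "summable f"
 proof (rule summable_comparison_test'[OF summable_mult[OF sz, of "C * (\<delta> ^ q + B ^ q)"]])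
  fix n
  have "(if Suc n <= r then \<delta> else B) ^ q <= \<delta> ^ q + B ^ q" using \<delta> B by auto
  then show "norm (f n) <= C * (\<delta> ^ q + B ^ q) * z n" using f0[of n] C z0 by (simp add: f_def mult_left_mono mult_right_mono)
 qed
 have "suminf f = (\<Sum>n. f (n + r)) + (SUM n<r. f n)" by (rule suminf_split_initial_segment[OF sf])
 also have "(\<Sum>n. f (n + r)) = C * B ^ q * (\<Sum>n. z (n + r))" unfolding f_def by (subst suminf_mult[symmetric]) (auto intro: summable_ignore_initial_segment sz)
 also have "(SUM n<r. f n) = C * \<delta> ^ q * (SUM n<r. z n)" unfolding sum_distrib_left by (intro sum.cong) (auto simp: f_def)
 also have "... <= C * \<delta> ^ q * suminf z" using C \<delta> z0 by (intro mult_left_mono sum_le_suminf sz) auto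
 finally have "suminf f <= h" using r d by linarith
 moreover have "(\<Sum>n. ennreal (f n)) = ennreal (suminf f)" by (rule suminf_ennreal2[OF f0 sf])
 ultimately have "(\<Sum>n. ennreal (f n)) <= ennreal h" by (simp add: ennreal_leI)
 then show thesis using \<delta>(1) by (intro that[of \<delta> r]) (simp_all add: f_def z_def)
qed

lemma version:
 assumes T: "T > 0" and l: "l >= 18" and p: "p >= 1" "p <= real (4 * l)"
  and g: "continuous_on ({0..} \<times> UNIV) (%(t, x). g t x)" "!!t. periodic L (g t)" "!!t. t >= 0 ==> represents L (semigroup_A L t u0) (g t)"
  and U: "series_process M T U"
  and ae1: "AE w in M. (ALL k:modes. continuous_on {0..T} (%t. U t w k)) & (ALL t:{0..T}. U t w (0, 0) = 0)"
  and a: "!!k. k : modes ==> abs (a k) <= B" "B >= 0" and \<theta>: "!!w. \<theta> w >= 0"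
  and r: "AE w in M. ALL t:{0..T}. ALL k:modes. abs ((U t w k - semigroup_A L t u0 k) - a k * X k t w) <= rbound (\<theta> w) (cnorm k)"
 shows "EX v. realizes M L T U v & v : Lp_C0 M L T p &
  (AE w in M. ALL t:{0..T}. ALL x. (%N. PS (square N) (%k. U t w k - semigroup_A L t u0 k) x) ----> v w t x - g t x)"
proof -
 obtain C where C: "C >= 0" "!!a A. (!!n. A n >= 0) ==> (!!n k. k : shell n ==> abs (a k) <= A n) ==>
  EX s. shell_majorants T (4 * l) a (\<Sum>n. ennreal (C * A (Suc n) ^ (4 * l) / real (Suc n) ^ 2)) s"
  using convolution_majorant[OF T l] by blast
 have ab: "abs (a k) <= B" if "k : shell n" for n k using a(1) that shell_modes by blast
 obtain s where sm: "shell_majorants T (4 * l) a (\<Sum>n. ennreal (C * B ^ (4 * l) / real (Suc n) ^ 2)) s" using C(2)[of "%_. B" a] a(2) ab by blast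
 note s = shell_majorantsD[OF sm]
 note [measurable] = s(1)
 have fin: "(\<integral>\<^sup>+w. (\<Sum>n. s n w) ^ (4 * l) \<partial>M) < top" by (rule le_less_trans[OF s(3) constant_series_finite[OF C(1) a(2)]])
 define S where "S w = (\<Sum>n. s n w) + ennreal (suminf rb_max)" for w
 have Sm: "S : borel_measurable M" unfolding S_def by measurable
 have "(\<integral>\<^sup>+w. S w ^ (4 * l) \<partial>M) <= (\<integral>\<^sup>+w. 2 ^ (4 * l) * ((\<Sum>n. s n w) ^ (4 * l) + ennreal (suminf rb_max) ^ (4 * l)) \<partial>M)" (is "?l <= _")
  unfolding S_def by (intro nn_integral_mono ennreal_add_power)
 also have "... = 2 ^ (4 * l) * ((\<integral>\<^sup>+w. (\<Sum>n. s n w) ^ (4 * l) \<partial>M) + ennreal (suminf rb_max) ^ (4 * l))"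
  by (simp add: nn_integral_cmult nn_integral_add emeasure_space_1)
 also have "... < top" using fin by (simp add: ennreal_mult_less_top power_less_top_ennreal)
 finally have Sf: "?l < top" .
 have "AE w in M. bounded_field T (%t k. U t w k - semigroup_A L t u0 k) ((\<Sum>n. s n w) + ennreal (suminf (rb (\<theta> w))))"
  by (rule field_estimate[OF sm constant_series_finite[OF C(1) a(2)] _ r \<theta>]) (use l in auto)
 then have "AE w in M. bounded_field T (%t k. U t w k - semigroup_A L t u0 k) (S w)"
 proof eventually_elim
  fix w assume "bounded_field T (%t k. U t w k - semigroup_A L t u0 k) ((\<Sum>n. s n w) + ennreal (suminf (rb (\<theta> w))))"
  moreover have "(\<Sum>n. s n w) + ennreal (suminf (rb (\<theta> w))) <= S w" unfolding S_def by (intro add_left_mono ennreal_leI suminf_rb_le_max \<theta>)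
  ultimately show "bounded_field T (%t k. U t w k - semigroup_A L t u0 k) (S w)" unfolding bounded_field_def using order_trans by blast
 qed
 from realization[OF T g U ae1 this Sm Sf p] show ?thesis .
qed

text \<open>The difference of the two fields consists of the noise with coefficients reduced by one, which are small on the first shells and bounded on the others, and of the nonlinear rest.\<close>

theorem convergence:
 fixes \<alpha> :: "real => series" and U :: "real => real => 'w => series"
 assumes T: "T > 0" and \<alpha>: "admissible_regularization \<alpha>" and u0: "u0 : Hspace L 1" "series_in_W1inf L u0"
  and U: "!!\<epsilon>. \<epsilon> > 0 ==> driven_mild (\<alpha> \<epsilon>) T u0 (U \<epsilon>)" and p: "p >= 1"
  and u: "!!t w k. u t w k = semigroup_A L t u0 k + (if k : modes then X k t w else 0)"
 shows "converges_Lp_C0 M L T p U u"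
proof -
 obtain g where g: "continuous_on ({0..} \<times> UNIV) (%(t, x). g t x)" "!!t. periodic L (g t)" "!!t. t >= 0 ==> represents L (semigroup_A L t u0) (g t)"
  using semigroup_version[OF u0] by blast
 (* From 18 on the moments outweigh the powers lost to the spatial grid. *)
 define l where "l = max 18 (nat \<lceil>p\<rceil>)"
 have l: "l >= 18" by (simp add: l_def)
 have pl: "p <= real (4 * l)"
 proof -
  have "p <= real (nat \<lceil>p\<rceil>)" by linarith
  also have "... <= real (4 * l)" by (simp add: l_def)
  finally show ?thesis .
 qed
 have "EX C. ALL \<epsilon>>0. ALL k:modes. abs (\<alpha> \<epsilon> k) <= C" and \<alpha>1: "ALL k:modes. ((%\<epsilon>. \<alpha> \<epsilon> k) ---> 1) (at_right 0)"
  using \<alpha> unfolding admissible_regularization_def by iprover+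
 then obtain B0 where "ALL \<epsilon>>0. ALL k:modes. abs (\<alpha> \<epsilon> k) <= B0" by iprover
 note B0 = this[rule_format]
 define B where "B = max 0 B0"
 have B: "B >= 0" "!!\<epsilon> k. \<epsilon> > 0 ==> k : modes ==> abs (\<alpha> \<epsilon> k) <= B" using B0 unfolding B_def by fastforce+
 have u00: "u0 (0, 0) = 0" using u0(1) by (simp add: Hspace_def)
 have zero_mode: "(0, 0) \<notin> modes" by (simp add: modes_def)
 define conv where "conv W v \<longleftrightarrow> (AE w in M. ALL t:{0..T}. ALL x. (%N. PS (square N) (%k. W t w k - semigroup_A L t u0 k) x) ----> v w t x - g t x)"
  for W :: "real => 'w => series" and v
 have "EX v. realizes M L T u v & v : Lp_C0 M L T p & conv u v" unfolding conv_def
 proof (rule version[where a="%_. 1" and B=1 and \<theta>="%_. 0", OF T l p pl g])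
  show "series_process M T u" unfolding series_process_def
  proof (intro ballI allI)
   fix t k assume t: "t : {0..T}"
   show "(%w. u t w k) : borel_measurable M"
   proof (cases "k : modes")
    case True
    have [measurable]: "X k t : borel_measurable M" using X_measurable[OF True] t by simp
    show ?thesis unfolding u using True by simp
   qed (simp add: u)
  qed
  have sub: "{0..T} <= {0..}" by auto
  have "continuous_on {0..T} (%t. u t w k)" if "k : modes" for k w
   using that unfolding u semigroup_A_def by (simp, intro continuous_intros continuous_on_subset[OF X_continuous[OF that] sub])
  then show "AE w in M. (ALL k:modes. continuous_on {0..T} (%t. u t w k)) & (ALL t:{0..T}. u t w (0, 0) = 0)"
   by (intro AE_I2 conjI ballI) (simp_all add: u u00 zero_mode semigroup_A_def)
  show "AE w in M. ALL t:{0..T}. ALL k:modes. abs (u t w k - semigroup_A L t u0 k - 1 * X k t w) <= rbound 0 (cnorm k)"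
  proof (intro AE_I2 ballI)
   fix w t k assume "k : modes"
   then show "abs (u t w k - semigroup_A L t u0 k - 1 * X k t w) <= rbound 0 (cnorm k)" using rbound_nonneg[of 0] by (simp add: u)
  qed
 qed auto
 then obtain v where v: "realizes M L T u v" "v : Lp_C0 M L T p" "conv u v" by blast
 have "EX v. \<epsilon> > 0 --> (realizes M L T (U \<epsilon>) v & v : Lp_C0 M L T p & conv (U \<epsilon>) v)" for \<epsilon>
 proof (cases "\<epsilon> > 0")
  case True
  note D = U[OF True]
  have cp: "AE w in M. continuous_path_H L 1 T (%t. U \<epsilon> t w)" using D unfolding driven_mild_def by blast
  have "EX v. realizes M L T (U \<epsilon>) v & v : Lp_C0 M L T p & conv (U \<epsilon>) v" unfolding conv_def
  proof (rule version[OF T l p pl g _ _ B(2)[OF True] B(1) _ driven_mild_rest[OF D T u0(1) order_refl]])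
   show "series_process M T (U \<epsilon>)" using D unfolding driven_mild_def by blast
   show "AE w in M. (ALL k:modes. continuous_on {0..T} (%t. U \<epsilon> t w k)) & (ALL t:{0..T}. U \<epsilon> t w (0, 0) = 0)" using cp
   proof eventually_elim
    fix w assume c: "continuous_path_H L 1 T (%t. U \<epsilon> t w)"
    then have "ALL t:{0..T}. U \<epsilon> t w (0, 0) = 0" unfolding continuous_path_H_def Hspace_def by blast
    then show "(ALL k:modes. continuous_on {0..T} (%t. U \<epsilon> t w k)) & (ALL t:{0..T}. U \<epsilon> t w (0, 0) = 0)" using continuous_path_coeff[OF c] by blast
   qed
  qed auto
  then show ?thesis by blast
 qed simp
 then obtain v\<epsilon> where v\<epsilon>: "!!\<epsilon>. \<epsilon> > 0 ==> realizes M L T (U \<epsilon>) (v\<epsilon> \<epsilon>) & v\<epsilon> \<epsilon> \<in> Lp_C0 M L T p & conv (U \<epsilon>) (v\<epsilon> \<epsilon>)" by metis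
 define f where "f \<epsilon> w = C0_norm L T (%t x. v\<epsilon> \<epsilon> w t x - v w t x)" for \<epsilon> w
 have pos: "\<forall>\<^sub>F \<epsilon> in at_right (0::real). \<epsilon> > 0" by (simp add: eventually_at_filter)
 have "((%\<epsilon>. (LINT w|M. f \<epsilon> w powr p) powr (1 / p)) ---> 0) (at_right 0)"
 proof (rule Lp_norm_tendsto_0[OF p pl])
  show "\<forall>\<^sub>F \<epsilon> in at_right 0. ALL w:space M. 0 <= f \<epsilon> w" using pos
  proof eventually_elim
   fix \<epsilon> :: real assume \<epsilon>: "\<epsilon> > 0"
   show "ALL w:space M. 0 <= f \<epsilon> w"
   proof
    fix w assume w: "w : space M"
    have "v\<epsilon> \<epsilon> w : C0 L T" "v w : C0 L T" using v\<epsilon>[OF \<epsilon>] v(1) w unfolding realizes_def by blast+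
    then have "(%t x. v\<epsilon> \<epsilon> w t x - v w t x) : C0 L T" by (auto simp: C0_def periodic_def case_prod_beta intro!: continuous_on_diff)
    then show "0 <= f \<epsilon> w" unfolding f_def using T by (intro C0_norm_nonneg) auto
   qed
  qed
 next
  fix \<eta> :: real assume \<eta>: "\<eta> > 0"
  define q where "q = 4 * l"
  have q: "q >= 1" using l by (simp add: q_def)
  define \<eta>1 where "\<eta>1 = \<eta> / (2 * 2 ^ q)"
  have \<eta>1: "\<eta>1 > 0" "2 ^ q * (\<eta>1 + \<eta>1) = \<eta>" using \<eta> by (simp_all add: \<eta>1_def)
  define Z where "Z = suminf rb_max ^ (q - 1) + 1"
  have rm0: "suminf rb_max >= 0" using rb_bounds[of 0] by (intro suminf_nonneg summable_rb_max) (meson order_refl order_trans)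
  have Z: "Z > 0" using rm0 by (simp add: Z_def add_nonneg_pos)
  define \<delta>' where "\<delta>' = \<eta>1 / (2 * Z)"
  have \<delta>': "\<delta>' > 0" using \<eta>1 Z by (simp add: \<delta>'_def)
  obtain c where c: "c >= 0" "!!m. m >= 0 ==> suminf (rb m) <= \<delta>' + c * m" using suminf_rb_small[OF \<delta>'] by blast
  define \<eta>2 where "\<eta>2 = \<eta>1 / (2 * Z * (c + 1))"
  have \<eta>2: "\<eta>2 > 0" using \<eta>1 Z c by (simp add: \<eta>2_def)
  have small: "Z * (\<delta>' + c * \<eta>2) <= \<eta>1"
  proof -
   have "c * \<eta>2 <= (c + 1) * \<eta>2" using \<eta>2 by (intro mult_right_mono) auto
   also have "... = \<delta>'" using c Z by (simp add: \<eta>2_def \<delta>'_def)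
   finally have "Z * (\<delta>' + c * \<eta>2) <= Z * (\<delta>' + \<delta>')" using Z by (intro mult_left_mono) auto
   also have "... = \<eta>1" using Z by (simp add: \<delta>'_def)
   finally show ?thesis .
  qed
  obtain K m where K: "K >= 1"
   and Km: "!!a. (!!k. k : square m ==> 1 / 2 <= abs (a k)) ==> (\<integral>\<^sup>+w. mass a K (flux_level u0 K) T w \<partial>M) <= ennreal \<eta>2"
   using small_mass[OF T \<eta>2, of u0] by blast
  obtain C where C: "C >= 0" "!!a A. (!!n. A n >= 0) ==> (!!n k. k : shell n ==> abs (a k) <= A n) ==>
   EX s. shell_majorants T q a (\<Sum>n. ennreal (C * A (Suc n) ^ q / real (Suc n) ^ 2)) s"
   using convolution_majorant[OF T l] unfolding q_def by blast
  have B1: "B + 1 >= 0" using B(1) by simp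
  obtain r \<delta> where \<delta>: "\<delta> > 0" and r\<delta>: "(\<Sum>n. ennreal (C * (if Suc n <= r then \<delta> else B + 1) ^ q / real (Suc n) ^ 2)) <= ennreal \<eta>1"
   by (rule tapered_series_small[OF C(1) B1 \<eta>1(1) q])
  have "\<forall>\<^sub>F \<epsilon> in at_right 0. ALL k:square (max r m). abs (\<alpha> \<epsilon> k - 1) < min \<delta> (1 / 2)"
  proof (rule eventually_ball_finite[OF finite_square], rule ballI)
   fix k assume "k : square (max r m)"
   then have "k : modes" using square_modes by blast
   then have "((%\<epsilon>. \<alpha> \<epsilon> k) ---> 1) (at_right 0)" using \<alpha>1 by blast
   from tendstoD[OF this, of "min \<delta> (1 / 2)"] show "\<forall>\<^sub>F \<epsilon> in at_right 0. abs (\<alpha> \<epsilon> k - 1) < min \<delta> (1 / 2)"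
    using \<delta> by (simp add: dist_real_def)
  qed
  then show "\<forall>\<^sub>F \<epsilon> in at_right 0. EX Q. Q : borel_measurable M & (AE w in M. ennreal (f \<epsilon> w) <= Q w) & (\<integral>\<^sup>+w. Q w ^ (4 * l) \<partial>M) <= ennreal \<eta>"
   using pos unfolding q_def[symmetric]
  proof eventually_elim
   fix \<epsilon> :: real assume close: "ALL k:square (max r m). abs (\<alpha> \<epsilon> k - 1) < min \<delta> (1 / 2)" and \<epsilon>: "\<epsilon> > 0"
   note D = U[OF \<epsilon>]
   define A where "A n = (if n <= r then \<delta> else B + 1)" for n
   define a where "a k = \<alpha> \<epsilon> k - 1" for k
   have A0: "A n >= 0" for n using \<delta> B by (simp add: A_def)
   have aA: "abs (a k) <= A n" if k: "k : shell n" for n k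
   proof (cases "n <= r")
    case True
    then have "k : square (max r m)" using k unfolding shell_def square_def by auto
    then show ?thesis using close True unfolding A_def a_def by force
   next
    case False
    then show ?thesis using B(2)[OF \<epsilon>, of k] k shell_modes[of n] unfolding A_def a_def by fastforce
   qed
   obtain s where sm: "shell_majorants T q a (\<Sum>n. ennreal (C * A (Suc n) ^ q / real (Suc n) ^ 2)) s" using C(2)[of A a, OF A0 aA] by blast
   note [measurable] = shell_majorantsD(1)[OF sm]
   note A\<eta> = r\<delta>[folded A_def]
   have s3: "(\<integral>\<^sup>+w. (\<Sum>n. s n w) ^ q \<partial>M) <= ennreal \<eta>1" using shell_majorantsD(3)[OF sm] A\<eta> by (rule order_trans)
   define \<theta> where "\<theta> w = enn2real (mass (\<alpha> \<epsilon>) K (flux_level u0 K) T w)" for w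
   have \<theta>0: "\<theta> w >= 0" for w by (simp add: \<theta>_def)
   have mm [measurable]: "mass (\<alpha> \<epsilon>) K (flux_level u0 K) T : borel_measurable M" by (rule mass_measurable)
   have \<theta>m [measurable]: "\<theta> \<in> borel_measurable M" unfolding \<theta>_def by measurable
   have \<theta>int: "(\<integral>\<^sup>+w. ennreal (\<theta> w) \<partial>M) <= ennreal \<eta>2"
   proof -
    have "ennreal (\<theta> w) <= mass (\<alpha> \<epsilon>) K (flux_level u0 K) T w" for w
     unfolding \<theta>_def by (cases "mass (\<alpha> \<epsilon>) K (flux_level u0 K) T w") auto
    then have "(\<integral>\<^sup>+w. ennreal (\<theta> w) \<partial>M) <= (\<integral>\<^sup>+w. mass (\<alpha> \<epsilon>) K (flux_level u0 K) T w \<partial>M)" by (intro nn_integral_mono)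
    also have "... <= ennreal \<eta>2"
    proof (rule Km)
     fix k assume "k : square m"
     then have "k : square (max r m)" using square_mono[of m "max r m"] by auto
     then have "abs (\<alpha> \<epsilon> k - 1) < 1 / 2" using close by force
     then show "1 / 2 <= abs (\<alpha> \<epsilon> k)" by linarith
    qed
    finally show ?thesis .
   qed
   define Q where "Q w = (\<Sum>n. s n w) + ennreal (suminf (rb (\<theta> w)))" for w
   have rbm [measurable]: "(%w. suminf (rb (\<theta> w))) \<in> borel_measurable M" unfolding rb_def rbound_def by measurable
   have Qm: "Q : borel_measurable M" unfolding Q_def by measurable
   have rb0: "0 <= suminf (rb (\<theta> w))" for w by (intro suminf_nonneg summable_rb rb_bounds(1) \<theta>0)
   have "(\<integral>\<^sup>+w. ennreal (suminf (rb (\<theta> w))) ^ q \<partial>M) <= (\<integral>\<^sup>+w. ennreal (Z * \<delta>') + ennreal (Z * c) * ennreal (\<theta> w) \<partial>M)" (is "?l <= _")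
   proof (rule nn_integral_mono)
    fix w
    have "suminf (rb (\<theta> w)) ^ q = suminf (rb (\<theta> w)) ^ (q - 1) * suminf (rb (\<theta> w))" using q by (simp flip: power_Suc2)
    also have "... <= Z * (\<delta>' + c * \<theta> w)"
    proof (rule mult_mono)
     have "suminf (rb (\<theta> w)) ^ (q - 1) <= suminf rb_max ^ (q - 1)" by (intro power_mono suminf_rb_le_max \<theta>0 rb0)
     then show "suminf (rb (\<theta> w)) ^ (q - 1) <= Z" by (simp add: Z_def)
    qed (use c(2)[OF \<theta>0] rb0 Z in auto)
    finally have "ennreal (suminf (rb (\<theta> w)) ^ q) <= ennreal (Z * \<delta>' + (Z * c) * \<theta> w)" by (intro ennreal_leI) (simp add: algebra_simps)
    also have "... = ennreal (Z * \<delta>') + ennreal ((Z * c) * \<theta> w)" using Z \<delta>' c \<theta>0 by (intro ennreal_plus) auto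
    also have "ennreal ((Z * c) * \<theta> w) = ennreal (Z * c) * ennreal (\<theta> w)" using Z c \<theta>0 by (intro ennreal_mult) auto
    finally show "ennreal (suminf (rb (\<theta> w))) ^ q <= ennreal (Z * \<delta>') + ennreal (Z * c) * ennreal (\<theta> w)" using rb0 by (simp add: ennreal_power)
   qed
   also have "... = ennreal (Z * \<delta>') + ennreal (Z * c) * (\<integral>\<^sup>+w. ennreal (\<theta> w) \<partial>M)"
    by (subst nn_integral_add) (simp_all add: nn_integral_cmult emeasure_space_1)
   also have "... <= ennreal (Z * \<delta>') + ennreal (Z * c) * ennreal \<eta>2" by (intro add_left_mono mult_left_mono \<theta>int) simp
   also have "... = ennreal (Z * \<delta>' + Z * c * \<eta>2)" using Z \<delta>' c \<eta>2 by (subst ennreal_mult[symmetric], simp_all)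
   also have "... <= ennreal \<eta>1" using small by (intro ennreal_leI) (simp add: algebra_simps)
   finally have rq: "?l <= ennreal \<eta>1" .
   have "(\<integral>\<^sup>+w. Q w ^ q \<partial>M) <= (\<integral>\<^sup>+w. 2 ^ q * ((\<Sum>n. s n w) ^ q + ennreal (suminf (rb (\<theta> w))) ^ q) \<partial>M)" (is "?l <= _")
    unfolding Q_def by (intro nn_integral_mono ennreal_add_power)
   also have "... = 2 ^ q * ((\<integral>\<^sup>+w. (\<Sum>n. s n w) ^ q \<partial>M) + (\<integral>\<^sup>+w. ennreal (suminf (rb (\<theta> w))) ^ q \<partial>M))"
    by (simp add: nn_integral_cmult nn_integral_add)
   also have "... <= 2 ^ q * (ennreal \<eta>1 + ennreal \<eta>1)" by (intro mult_left_mono add_mono s3 rq) simp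
   also have "... = ennreal (2 ^ q * (\<eta>1 + \<eta>1))"
   proof -
    have "(2::ennreal) ^ q = ennreal (2 ^ q)" by (simp flip: ennreal_power)
    then show ?thesis using \<eta>1(1) by (simp only: ennreal_mult ennreal_plus less_imp_le zero_le_power zero_le_numeral add_nonneg_nonneg)
   qed
   finally have Qq: "?l <= ennreal \<eta>" unfolding \<eta>1(2) .
   have rest: "AE w in M. ALL t:{0..T}. ALL k:modes. abs ((U \<epsilon> t w k - u t w k) - a k * X k t w) <= rbound (\<theta> w) (cnorm k)"
    using driven_mild_rest[OF D T u0(1) K]
   proof eventually_elim
    fix w assume b: "ALL t:{0..T}. ALL k:modes. abs ((U \<epsilon> t w k - semigroup_A L t u0 k) - \<alpha> \<epsilon> k * X k t w)
     <= rbound (enn2real (mass (\<alpha> \<epsilon>) K (flux_level u0 K) T w)) (cnorm k)"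
    show "ALL t:{0..T}. ALL k:modes. abs ((U \<epsilon> t w k - u t w k) - a k * X k t w) <= rbound (\<theta> w) (cnorm k)"
    proof (intro ballI)
     fix t k assume tk: "t : {0..T}" "k : modes"
     have "(U \<epsilon> t w k - u t w k) - a k * X k t w = (U \<epsilon> t w k - semigroup_A L t u0 k) - \<alpha> \<epsilon> k * X k t w"
      using tk by (simp add: u a_def algebra_simps)
     then show "abs ((U \<epsilon> t w k - u t w k) - a k * X k t w) <= rbound (\<theta> w) (cnorm k)" using b tk unfolding \<theta>_def by metis
    qed
   qed
   have "AE w in M. bounded_field T (%t k. U \<epsilon> t w k - u t w k) (Q w)"
    unfolding Q_def by (rule field_estimate[OF sm le_less_trans[OF A\<eta> ennreal_less_top] q rest \<theta>0])
   moreover have "conv (U \<epsilon>) (v\<epsilon> \<epsilon>)" using v\<epsilon>[OF \<epsilon>] by blast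
   ultimately have "AE w in M. ennreal (f \<epsilon> w) <= Q w" using v(3) unfolding conv_def
   proof eventually_elim
    fix w assume "bounded_field T (%t k. U \<epsilon> t w k - u t w k) (Q w)"
     and l1: "ALL t:{0..T}. ALL x. (%N. PS (square N) (%k. U \<epsilon> t w k - semigroup_A L t u0 k) x) ----> v\<epsilon> \<epsilon> w t x - g t x"
     and l2: "ALL t:{0..T}. ALL x. (%N. PS (square N) (%k. u t w k - semigroup_A L t u0 k) x) ----> v w t x - g t x"
    then obtain b where b: "!!t. t : {0..T} ==> shell_bounded (%k. U \<epsilon> t w k - u t w k) b" "ennreal (suminf b) <= Q w" unfolding bounded_field_def by blast
    have "f \<epsilon> w <= suminf b" unfolding f_def
    proof (rule C0_norm_le)
     fix t x assume t: "t : {0..T}"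
     have "(%N. PS (square N) (%k. U \<epsilon> t w k - semigroup_A L t u0 k) x - PS (square N) (%k. u t w k - semigroup_A L t u0 k) x) ----> (v\<epsilon> \<epsilon> w t x - g t x) - (v w t x - g t x)"
      using l1[rule_format, OF t, of x] l2[rule_format, OF t, of x] by (rule tendsto_diff)
     moreover have "PS (square N) (%k. U \<epsilon> t w k - semigroup_A L t u0 k) x - PS (square N) (%k. u t w k - semigroup_A L t u0 k) x = PS (square N) (%k. U \<epsilon> t w k - u t w k) x" for N
      unfolding sum_subtractf[symmetric] by (intro sum.cong) (simp_all add: algebra_simps)
     ultimately have "(%N. PS (square N) (%k. U \<epsilon> t w k - u t w k) x) ----> v\<epsilon> \<epsilon> w t x - v w t x" by simp
     then have "v\<epsilon> \<epsilon> w t x - v w t x = fld (%k. U \<epsilon> t w k - u t w k) x" by (rule LIMSEQ_unique[OF _ fld_sum(1)[OF b(1)[OF t]]])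
     then show "abs (v\<epsilon> \<epsilon> w t x - v w t x) <= suminf b" using fld_sum(3)[OF b(1)[OF t], of x] by simp
    qed (use T in simp)
    then show "ennreal (f \<epsilon> w) <= Q w" using b(2) by (meson ennreal_leI order_trans)
   qed
   then show "EX Q. Q : borel_measurable M & (AE w in M. ennreal (f \<epsilon> w) <= Q w) & (\<integral>\<^sup>+w. Q w ^ q \<partial>M) <= ennreal \<eta>"
    using Qm Qq by blast
  qed
 qed
 then have "((%\<epsilon>. Lp_C0_norm M L T p (%w t x. v\<epsilon> \<epsilon> w t x - v w t x)) ---> 0) (at_right 0)" by (simp add: Lp_C0_norm_def f_def)
 then show ?thesis unfolding converges_Lp_C0_def using v(1,2) v\<epsilon> by blast
qed

end

theorem theorem1:
  fixes M :: "'w measure"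
    and L T :: real
    and \<beta> :: "idx \<Rightarrow> real \<Rightarrow> 'w \<Rightarrow> real"
    and \<alpha> :: "real \<Rightarrow> series"
    and u0 :: series
    and u\<epsilon> :: "real \<Rightarrow> real \<Rightarrow> 'w \<Rightarrow> series"
  assumes "prob_space M"
    and "L > 0" and "T > 0"
    and "iid_wiener M \<beta>"
    and "admissible_regularization \<alpha>"
    and "u0 \<in> Hspace L 1" and "series_in_W1inf L u0"
    and "\<And>\<epsilon>. \<epsilon> > 0 \<Longrightarrow> mild_solution M L \<beta> (\<alpha> \<epsilon>) T u0 (u\<epsilon> \<epsilon>)"
  shows "\<exists>u. linear_mild_solution M L \<beta> T u0 u \<and>
           (\<forall>p\<ge>1. converges_Lp_C0 M L T p u\<epsilon> u)"
proof -
 interpret prob_space M by fact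
 interpret flat_torus L by unfold_locales fact
 define P where "P k Y \<longleftrightarrow> (ALL t>=0. Y t : borel_measurable M) & (ALL \<omega>. continuous_on {0..} (%t. Y t \<omega>)) & (ALL \<omega>. Y 0 \<omega> = 0) &
   (ALL t>=0. ALL N. (\<integral>\<^sup>+\<omega>. ennreal ((Y t \<omega> - oustep ((eigval L k)^2) t N (%t. \<beta> k t \<omega>))^2) \<partial>M) <= ennreal (4 * (((eigval L k)^2 * t / real (Suc N))^2 * t))) &
   (ALL t>=0. AE \<omega> in M. wiener_integral M (\<beta> k) (%s. exp (- (t - s) * (eigval L k)^2)) 0 t \<omega> = Y t \<omega>)"
  for k and Y :: "real => 'w => real"
 have "EX Y. P k Y" if k: "k : modes" for k
 proof -
  have W: "wiener_process M (\<beta> k)" using assms(4) k unfolding iid_wiener_def by blast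
  show ?thesis
  proof (rule ou_version[OF W zero_le_power2[of "eigval L k"]])
   fix Y assume Y: "!!t. t >= 0 ==> Y t : borel_measurable M" "!!\<omega>. continuous_on {0..} (%t. Y t \<omega>)" "!!\<omega>. Y 0 \<omega> = 0"
    "!!t N. t >= 0 ==> (\<integral>\<^sup>+\<omega>. ennreal ((Y t \<omega> - oustep ((eigval L k)^2) t N (%t. \<beta> k t \<omega>))^2) \<partial>M) <= ennreal (4 * (((eigval L k)^2 * t / real (Suc N))^2 * t))"
    "!!t. t >= 0 ==> AE \<omega> in M. wiener_integral M (\<beta> k) (%s. exp (- (t - s) * (eigval L k)^2)) 0 t \<omega> = Y t \<omega>"
   have "P k Y" unfolding P_def by (intro conjI allI impI) (erule Y | rule Y)+
   then show ?thesis by (rule exI[of _ Y])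
  qed
 qed
 then obtain X where X0: "!!k. k : modes ==> P k (X k)" by metis
 have X: "k : modes ==> t >= 0 ==> X k t : borel_measurable M"
  "k : modes ==> continuous_on {0..} (%t. X k t \<omega>)" "k : modes ==> X k 0 \<omega> = 0"
  "k : modes ==> t >= 0 ==> (\<integral>\<^sup>+\<omega>. ennreal ((X k t \<omega> - oustep ((eigval L k)^2) t N (%t. \<beta> k t \<omega>))^2) \<partial>M) <= ennreal (4 * (((eigval L k)^2 * t / real (Suc N))^2 * t))"
  "k : modes ==> t >= 0 ==> AE \<omega> in M. wiener_integral M (\<beta> k) (%s. exp (- (t - s) * (eigval L k)^2)) 0 t \<omega> = X k t \<omega>" for k t N \<omega>
  using X0[of k, unfolded P_def] by iprover+
 interpret ou_family M L X
 proof unfold_locales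
  show "gauss M (%\<omega>. SUM k:F. \<alpha> k * (X k t \<omega> - X k s \<omega>)) (SUM k:F. (\<alpha> k)^2 * ouvar ((eigval L k)^2) s t)"
   if "finite F" "F <= modes" "0 <= s" "0 <= t" for F s t and \<alpha> :: series by (rule ou_gauss[OF assms(4) _ X(1) X(4) that]) auto
 qed (fact X(1), fact X(2), fact X(3))
 have conv: "AE \<omega> in M. ALL k:modes. wiener_integral M (\<beta> k) (%s. exp (- (t - s) * (eigval L k)^2)) 0 t \<omega> = X k t \<omega>" if "t >= 0" for t
  by (subst AE_ball_countable) (use X(5) that in auto)
 define u where "u t \<omega> k = semigroup_A L t u0 k + (if k : modes then X k t \<omega> else 0)" for t \<omega> k
 have "linear_mild_solution M L \<beta> T u0 u" unfolding linear_mild_solution_def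
 proof (intro conjI ballI)
  show "series_process M T u" unfolding series_process_def
  proof (intro ballI allI)
   fix t k assume t: "t : {0..T}"
   show "(%\<omega>. u t \<omega> k) : borel_measurable M"
   proof (cases "k : modes")
    case True
    have [measurable]: "X k t : borel_measurable M" using X(1)[OF True] t by simp
    show ?thesis unfolding u_def using True by simp
   qed (simp add: u_def)
  qed
  fix t assume "t : {0..T}"
  then have "AE \<omega> in M. ALL k:modes. wiener_integral M (\<beta> k) (%s. exp (- (t - s) * (eigval L k)^2)) 0 t \<omega> = X k t \<omega>" by (intro conv) simp
  then show "AE \<omega> in M. ALL k. u t \<omega> k = semigroup_A L t u0 k + stoch_conv M L \<beta> (%_. 1) t \<omega> k"
  proof eventually_elim
   fix \<omega> assume e: "ALL k:modes. wiener_integral M (\<beta> k) (%s. exp (- (t - s) * (eigval L k)^2)) 0 t \<omega> = X k t \<omega>"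
   show "ALL k. u t \<omega> k = semigroup_A L t u0 k + stoch_conv M L \<beta> (%_. 1) t \<omega> k"
   proof
    fix k show "u t \<omega> k = semigroup_A L t u0 k + stoch_conv M L \<beta> (%_. 1) t \<omega> k"
     using bspec[OF e, of k] by (cases "k : modes") (simp_all add: u_def stoch_conv_def)
   qed
  qed
 qed
 moreover have "driven_mild (\<alpha> \<epsilon>) T u0 (u\<epsilon> \<epsilon>)" if \<epsilon>: "\<epsilon> > 0" for \<epsilon> unfolding driven_mild_def
 proof (intro conjI ballI)
  note m = assms(8)[OF \<epsilon>, unfolded mild_solution_def]
  show "series_process M T (u\<epsilon> \<epsilon>)" "AE \<omega> in M. continuous_path_H L 1 T (%t. u\<epsilon> \<epsilon> t \<omega>)" using m by blast+
  fix t assume t: "t : {0..T}"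
  then have "AE \<omega> in M. ALL k. u\<epsilon> \<epsilon> t \<omega> k = semigroup_A L t u0 k
   + (LINT s:{0..t}|lborel. semigroup_A L (t - s) (nonlinearity L (u\<epsilon> \<epsilon> s \<omega>)) k) + stoch_conv M L \<beta> (\<alpha> \<epsilon>) t \<omega> k" using m by blast
  moreover have "AE \<omega> in M. ALL k:modes. wiener_integral M (\<beta> k) (%s. exp (- (t - s) * (eigval L k)^2)) 0 t \<omega> = X k t \<omega>" using t by (intro conv) simp
  ultimately show "AE \<omega> in M. ALL k:modes. u\<epsilon> \<epsilon> t \<omega> k = semigroup_A L t u0 k
   + (LINT s:{0..t}|lborel. semigroup_A L (t - s) (nonlinearity L (u\<epsilon> \<epsilon> s \<omega>)) k) + \<alpha> \<epsilon> k * X k t \<omega>"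
  proof eventually_elim
   fix \<omega> assume a: "ALL k. u\<epsilon> \<epsilon> t \<omega> k = semigroup_A L t u0 k
    + (LINT s:{0..t}|lborel. semigroup_A L (t - s) (nonlinearity L (u\<epsilon> \<epsilon> s \<omega>)) k) + stoch_conv M L \<beta> (\<alpha> \<epsilon>) t \<omega> k"
    and b: "ALL k:modes. wiener_integral M (\<beta> k) (%s. exp (- (t - s) * (eigval L k)^2)) 0 t \<omega> = X k t \<omega>"
   show "ALL k:modes. u\<epsilon> \<epsilon> t \<omega> k = semigroup_A L t u0 k
    + (LINT s:{0..t}|lborel. semigroup_A L (t - s) (nonlinearity L (u\<epsilon> \<epsilon> s \<omega>)) k) + \<alpha> \<epsilon> k * X k t \<omega>"
   proof
    fix k assume k: "k : modes"
    have "stoch_conv M L \<beta> (\<alpha> \<epsilon>) t \<omega> k = \<alpha> \<epsilon> k * X k t \<omega>" using k bspec[OF b k] by (simp add: stoch_conv_def)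
    then show "u\<epsilon> \<epsilon> t \<omega> k = semigroup_A L t u0 k
     + (LINT s:{0..t}|lborel. semigroup_A L (t - s) (nonlinearity L (u\<epsilon> \<epsilon> s \<omega>)) k) + \<alpha> \<epsilon> k * X k t \<omega>" using spec[OF a, of k] by metis
   qed
  qed
 qed
 then have "ALL p>=1. converges_Lp_C0 M L T p u\<epsilon> u" using convergence[OF assms(3,5,6,7) _ _ u_def] by blast
 ultimately show ?thesis by blast
qed

end
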